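(* Let $\mathcal{C}$ be the set of points $[z_0:z_1]\in\mathbb{P}^1(\mathbb{Q})$ with $(z_0,z_1)\in\mathbb{Z}^2$ primitive such that $z_0,z_1,z_0+z_1$ are nonzero and squareful, and let $H(z)=\max(|z_0|,|z_1|,|z_0+z_1|)$ for a primitive integral representative $(z_0,z_1)$ of $z$. Define $$c_{\mathrm{BV}}=\frac{1}{\pi}\sum_{\mathbf{y}=(y_0,y_1,y_2)\in\mathbb{N}^3}\frac{\mu^2(y_0y_1y_2)\gamma(y_0y_1y_2)}{(y_0y_1y_2)^{3/2}}\sigma_{2,\mathbf{y}}\rho(\mathbf{y}).$$ Suppose that $\#\{z\in\mathcal{C}: H(z)\le B\}\sim 3c_{\mathrm{BV}}B^{1/2}$ as $B\to\infty$. Then for any real number $\lambda\in(0,3c_{\mathrm{BV}}]$ there is a Campana thin subset $\mathcal{T}\subseteq\mathcal{C}$ such that $$\#\{z\in\mathcal{C}\setminus\mathcal{T}: H(z)\le B\}\sim\lambda B^{1/2}\quad (B\to\infty).$$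
   Context: A nonzero integer $z$ is squareful if $p\mid z$ implies $p^2\mid z$ for every prime $p$. $\mu$ is the Möbius function. For a positive integer $d$, $\gamma(d)=\prod_{p\mid d,\,p>2}(1+1/p)^{-1}$. For $\mathbf{y}\in\mathbb{N}^3$, $\rho(\mathbf{y})=\prod_{p\mid y_0,\,p>2}\bigl(1+\bigl(\tfrac{y_1y_2}{p}\bigr)\bigr)\prod_{p\mid y_1,\,p>2}\bigl(1+\bigl(\tfrac{y_0y_2}{p}\bigr)\bigr)\prod_{p\mid y_2,\,p>2}\bigl(1+\bigl(\tfrac{-y_0y_1}{p}\bigr)\bigr)$ (Legendre symbols), and $\sigma_{2,\mathbf{y}}=\lim_{r\to\infty}2^{-2r}\#\{\mathbf{x}\in(\mathbb{Z}/2^r\mathbb{Z})^3: y_0^3x_0^2+y_1^3x_1^2\equiv y_2^3x_2^2 \pmod{2^r},\ \min_{0\le i\le2}\nu_2(x_iy_i)=0\}$. A subset of $\mathbb{P}^1(\mathbb{Q})$ is thin if it is contained in a finite union of sets of the form $Z(\mathbb{Q})$ for a proper closed subvariety $Z\subset\mathbb{P}^1$ and sets $\varphi(V(\mathbb{Q}))$ for $V$ an integral projective curve and $\varphi:V\to\mathbb{P}^1$ a dominant morphism of degree at least $2$. A Campana thin subset of $\mathcal{C}$ is a set of the form $T\cap\mathcal{C}$ with $T\subseteq\mathbb{P}^1(\mathbb{Q})$ thin. *)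

theory Defs
  imports
    "HOL-Analysis.Infinite_Sum"
    "HOL-Library.Poly_Mapping"
    "HOL-Library.Landau_Symbols"
    "HOL-Library.Extended_Nat"
    "HOL-Computational_Algebra.Squarefree"
    "HOL-Number_Theory.Number_Theory"
    "HOL-Algebra.Embedded_Algebras"
begin

section \<open>Polynomial rings over the rationals\<close>

text \<open>
  A polynomial is a finitely supported map from monomials to coefficients, and a monomial is a
  finitely supported exponent vector.
\<close>

type_synonym 'a mpoly = "(nat \<Rightarrow>\<^sub>0 nat) \<Rightarrow>\<^sub>0 'a"

definition Var :: "nat \<Rightarrow> rat mpoly" where
  "Var i = Poly_Mapping.single (Poly_Mapping.single i 1) 1"

definition Const :: "rat \<Rightarrow> rat mpoly" where
  "Const c = Poly_Mapping.single 0 c"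

text \<open>Evaluation at \<open>v\<close>, the coefficients being mapped by \<open>c\<close>.\<close>

definition eval_with :: "(rat \<Rightarrow> 'b) \<Rightarrow> (nat \<Rightarrow> 'b) \<Rightarrow> rat mpoly \<Rightarrow> 'b::comm_ring_1" where
  "eval_with c v f = (\<Sum>m\<in>Poly_Mapping.keys f.
     c (Poly_Mapping.lookup f m) * (\<Prod>i\<in>Poly_Mapping.keys m. v i ^ Poly_Mapping.lookup m i))"

definition eval_at :: "(nat \<Rightarrow> rat) \<Rightarrow> rat mpoly \<Rightarrow> rat" where
  "eval_at = eval_with (\<lambda>c. c)"

definition subst2 :: "rat mpoly \<Rightarrow> rat mpoly \<Rightarrow> rat mpoly \<Rightarrow> rat mpoly" where
  "subst2 h F G = eval_with Const (\<lambda>i. if i = 0 then F else G) h"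

text \<open>The homogeneous coordinate ring \<open>\<rat>[x\<^sub>0,\<dots>,x\<^sub>n]\<close> of projective \<open>n\<close>-space.\<close>

definition coord_ring :: "nat \<Rightarrow> rat mpoly ring" where
  "coord_ring n =
     \<lparr>carrier = {f. \<forall>m\<in>Poly_Mapping.keys f. Poly_Mapping.keys m \<subseteq> {..n}},
      mult = (*), one = 1, zero = 0, add = (+)\<rparr>"

text \<open>The zero polynomial is homogeneous of every degree.\<close>

definition homogeneous :: "nat \<Rightarrow> nat \<Rightarrow> rat mpoly \<Rightarrow> bool" where
  "homogeneous n d f \<longleftrightarrow> f \<in> carrier (coord_ring n) \<and>
     (\<forall>m\<in>Poly_Mapping.keys f. (\<Sum>i\<in>Poly_Mapping.keys m. Poly_Mapping.lookup m i) = d)"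

definition homogeneous_ideal :: "nat \<Rightarrow> rat mpoly set \<Rightarrow> bool" where
  "homogeneous_ideal n I \<longleftrightarrow> ideal I (coord_ring n) \<and>
     I = Idl\<^bsub>coord_ring n\<^esub> {f \<in> I. \<exists>d. homogeneous n d f}"

section \<open>Projective varieties over the rationals\<close>

text \<open>
  Rational points of projective \<open>n\<close>-space are classes of nonzero vectors up to scaling; a vector is
  a function on the natural numbers that vanishes outside \<open>{..n}\<close>.
\<close>

definition coord_vectors :: "nat \<Rightarrow> (nat \<Rightarrow> rat) set" where
  "coord_vectors n = {a. (\<forall>i>n. a i = 0) \<and> (\<exists>i\<le>n. a i \<noteq> 0)}"

definition proj_class :: "(nat \<Rightarrow> rat) \<Rightarrow> (nat \<Rightarrow> rat) set" where
  "proj_class a = {(\<lambda>i. c * a i) |c. c \<noteq> 0}"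

definition proj_space :: "nat \<Rightarrow> (nat \<Rightarrow> rat) set set" where
  "proj_space n = proj_class ` coord_vectors n"

definition P1_point :: "rat \<Rightarrow> rat \<Rightarrow> (nat \<Rightarrow> rat) set" where
  "P1_point a b = proj_class (\<lambda>i. if i = 0 then a else if i = 1 then b else 0)"

definition rational_zeros :: "nat \<Rightarrow> rat mpoly set \<Rightarrow> (nat \<Rightarrow> rat) set" where
  "rational_zeros n I = {a \<in> coord_vectors n. \<forall>f\<in>I. eval_at a f = 0}"

definition rational_points :: "nat \<Rightarrow> rat mpoly set \<Rightarrow> (nat \<Rightarrow> rat) set set" where
  "rational_points n I = proj_class ` rational_zeros n I"

text \<open>
  Closed subvarieties of projective \<open>n\<close>-space are given by radical homogeneous ideals (they may be
  reducible or empty). Integral closed subschemes are given by homogeneous prime ideals that do not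
  contain the irrelevant ideal.
\<close>

definition closed_subvariety :: "nat \<Rightarrow> rat mpoly set \<Rightarrow> bool" where
  "closed_subvariety n J \<longleftrightarrow> homogeneous_ideal n J \<and>
     (\<forall>f\<in>carrier (coord_ring n). \<forall>k. f ^ k \<in> J \<longrightarrow> f \<in> J)"

definition integral_subvariety :: "nat \<Rightarrow> rat mpoly set \<Rightarrow> bool" where
  "integral_subvariety n I \<longleftrightarrow> homogeneous_ideal n I \<and> primeideal I (coord_ring n) \<and>
     \<not> Var ` {..n} \<subseteq> I"

text \<open>The points of the scheme \<open>Proj (\<rat>[x\<^sub>0,\<dots>,x\<^sub>n] / I)\<close>.\<close>

definition scheme_points :: "nat \<Rightarrow> rat mpoly set \<Rightarrow> rat mpoly set set" where
  "scheme_points n I = {P. integral_subvariety n P \<and> I \<subseteq> P}"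

text \<open>Krull dimension: supremum of the lengths of chains of irreducible closed subsets.\<close>

definition variety_dim :: "nat \<Rightarrow> rat mpoly set \<Rightarrow> enat" where
  "variety_dim n I = (SUP Ps\<in>{Ps. Ps \<noteq> [] \<and> sorted_wrt (\<subset>) Ps \<and> set Ps \<subseteq> scheme_points n I}.
     enat (length Ps - 1))"

definition integral_projective_curve :: "nat \<Rightarrow> rat mpoly set \<Rightarrow> bool" where
  "integral_projective_curve n I \<longleftrightarrow> integral_subvariety n I \<and> variety_dim n I = 1"

section \<open>The function field of an integral projective variety\<close>

text \<open>
  Rational functions are classes of fractions \<open>F/G\<close> of forms of equal degree with \<open>G \<notin> I\<close>, where
  \<open>F/G\<close> and \<open>F'/G'\<close> are identified if \<open>F G' - F' G \<in> I\<close>.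
\<close>

definition form_fracs :: "nat \<Rightarrow> rat mpoly set \<Rightarrow> (rat mpoly \<times> rat mpoly) set" where
  "form_fracs n I = {(F, G). \<exists>d. homogeneous n d F \<and> homogeneous n d G \<and> G \<notin> I}"

definition frac_rel ::
    "nat \<Rightarrow> rat mpoly set \<Rightarrow> ((rat mpoly \<times> rat mpoly) \<times> (rat mpoly \<times> rat mpoly)) set" where
  "frac_rel n I = {((F, G), (F', G')).
     (F, G) \<in> form_fracs n I \<and> (F', G') \<in> form_fracs n I \<and> F * G' - F' * G \<in> I}"

definition frac_class ::
    "nat \<Rightarrow> rat mpoly set \<Rightarrow> rat mpoly \<Rightarrow> rat mpoly \<Rightarrow> (rat mpoly \<times> rat mpoly) set" where
  "frac_class n I F G = frac_rel n I `` {(F, G)}"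

definition function_field :: "nat \<Rightarrow> rat mpoly set \<Rightarrow> (rat mpoly \<times> rat mpoly) set ring" where
  "function_field n I =
     \<lparr>carrier = form_fracs n I // frac_rel n I,
      mult = (\<lambda>A B. \<Union>(F, G)\<in>A. \<Union>(F', G')\<in>B. frac_class n I (F * F') (G * G')),
      one = frac_class n I 1 1,
      zero = frac_class n I 0 1,
      add = (\<lambda>A B. \<Union>(F, G)\<in>A. \<Union>(F', G')\<in>B. frac_class n I (F * G' + F' * G) (G * G'))\<rparr>"

section \<open>Morphisms to the projective line\<close>

text \<open>
  A morphism from the integral variety \<open>V\<close> given by \<open>I\<close> to the projective line is represented by a
  set of pairs of forms of equal degree. The pair \<open>(F, G)\<close> describes the morphism as \<open>[F : G]\<close> on
  the open subset of \<open>V\<close> where \<open>F\<close> and \<open>G\<close> do not both vanish; these descriptions agree on overlaps,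
  and the open subsets cover all (scheme) points of \<open>V\<close>.
\<close>

definition morphism_to_P1 ::
    "nat \<Rightarrow> rat mpoly set \<Rightarrow> (rat mpoly \<times> rat mpoly) set \<Rightarrow> bool" where
  "morphism_to_P1 n I \<Phi> \<longleftrightarrow>
     (\<forall>(F, G)\<in>\<Phi>. \<exists>d. homogeneous n d F \<and> homogeneous n d G) \<and>
     (\<forall>(F, G)\<in>\<Phi>. \<forall>(F', G')\<in>\<Phi>. F * G' - F' * G \<in> I) \<and>
     (\<forall>P\<in>scheme_points n I. \<exists>(F, G)\<in>\<Phi>. F \<notin> P \<or> G \<notin> P)"

definition image_rational_points ::
    "nat \<Rightarrow> rat mpoly set \<Rightarrow> (rat mpoly \<times> rat mpoly) set \<Rightarrow> (nat \<Rightarrow> rat) set set" where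
  "image_rational_points n I \<Phi> = {P1_point (eval_at a F) (eval_at a G) |a F G.
     a \<in> rational_zeros n I \<and> (F, G) \<in> \<Phi> \<and> \<not> (eval_at a F = 0 \<and> eval_at a G = 0)}"

text \<open>
  The image is dense: no nonzero form \<open>h\<close> on the projective line vanishes on it, that is, pulls back
  to zero on \<open>V\<close>.
\<close>

definition dominant :: "rat mpoly set \<Rightarrow> (rat mpoly \<times> rat mpoly) set \<Rightarrow> bool" where
  "dominant I \<Phi> \<longleftrightarrow>
     (\<forall>h d. homogeneous 1 d h \<and> h \<noteq> 0 \<longrightarrow> (\<exists>(F, G)\<in>\<Phi>. subst2 h F G \<notin> I))"

text \<open>
  The image of the function field of the projective line in that of \<open>V\<close> under pullback of rational
  functions, \<open>h/k \<mapsto> h(F,G)/k(F,G)\<close>.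
\<close>

definition pullback_field ::
    "nat \<Rightarrow> rat mpoly set \<Rightarrow> (rat mpoly \<times> rat mpoly) set \<Rightarrow> (rat mpoly \<times> rat mpoly) set set" where
  "pullback_field n I \<Phi> = {frac_class n I (subst2 h F G) (subst2 k F G) |h k d F G.
     homogeneous 1 d h \<and> homogeneous 1 d k \<and> (F, G) \<in> \<Phi> \<and> subst2 k F G \<notin> I}"

definition has_degree ::
    "nat \<Rightarrow> rat mpoly set \<Rightarrow> (rat mpoly \<times> rat mpoly) set \<Rightarrow> nat \<Rightarrow> bool" where
  "has_degree n I \<Phi> e \<longleftrightarrow> ring.dimension (function_field n I) e (pullback_field n I \<Phi>)
     (carrier (function_field n I))"

section \<open>Thin sets\<close>

definition basic_thin :: "(nat \<Rightarrow> rat) set set \<Rightarrow> bool" where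
  "basic_thin A \<longleftrightarrow>
     (\<exists>J. closed_subvariety 1 J \<and> J \<noteq> {0} \<and> A = rational_points 1 J) \<or>
     (\<exists>n I \<Phi> e. integral_projective_curve n I \<and> morphism_to_P1 n I \<Phi> \<and> dominant I \<Phi> \<and>
        has_degree n I \<Phi> e \<and> e \<ge> 2 \<and> A = image_rational_points n I \<Phi>)"

definition thin :: "(nat \<Rightarrow> rat) set set \<Rightarrow> bool" where
  "thin T \<longleftrightarrow> T \<subseteq> proj_space 1 \<and> (\<exists>\<A>. finite \<A> \<and> (\<forall>A\<in>\<A>. basic_thin A) \<and> T \<subseteq> \<Union>\<A>)"

section \<open>Campana points\<close>

definition squareful :: "int \<Rightarrow> bool" where
  "squareful z \<longleftrightarrow> z \<noteq> 0 \<and> (\<forall>p. prime p \<and> p dvd z \<longrightarrow> p\<^sup>2 dvd z)"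

definition campana_points :: "(nat \<Rightarrow> rat) set set" where
  "campana_points = {P1_point (of_int z0) (of_int z1) |z0 z1.
     coprime z0 z1 \<and> squareful z0 \<and> squareful z1 \<and> squareful (z0 + z1)}"

text \<open>Well defined: a primitive integral representative is unique up to sign.\<close>

definition height :: "(nat \<Rightarrow> rat) set \<Rightarrow> int" where
  "height z = (THE h. \<exists>z0 z1. coprime z0 z1 \<and> z = P1_point (of_int z0) (of_int z1) \<and>
     h = max \<bar>z0\<bar> (max \<bar>z1\<bar> \<bar>z0 + z1\<bar>))"

definition campana_thin :: "(nat \<Rightarrow> rat) set set \<Rightarrow> bool" where
  "campana_thin T \<longleftrightarrow> (\<exists>S. thin S \<and> T = S \<inter> campana_points)"

definition count_height :: "(nat \<Rightarrow> rat) set set \<Rightarrow> real \<Rightarrow> nat" where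
  "count_height S B = card {z \<in> S. real_of_int (height z) \<le> B}"

section \<open>The constant\<close>

definition moebius :: "nat \<Rightarrow> int" where
  "moebius n = (if squarefree n then (-1) ^ card (prime_factors n) else 0)"

definition gamma_fac :: "nat \<Rightarrow> real" where
  "gamma_fac d = (\<Prod>p\<in>{p. prime p \<and> p dvd d \<and> p > 2}. inverse (1 + 1 / real p))"

definition rho :: "nat \<Rightarrow> nat \<Rightarrow> nat \<Rightarrow> int" where
  "rho y0 y1 y2 =
     (\<Prod>p\<in>{p. prime p \<and> p dvd y0 \<and> p > 2}. 1 + Legendre (int y1 * int y2) (int p)) *
     (\<Prod>p\<in>{p. prime p \<and> p dvd y1 \<and> p > 2}. 1 + Legendre (int y0 * int y2) (int p)) *
     (\<Prod>p\<in>{p. prime p \<and> p dvd y2 \<and> p > 2}. 1 + Legendre (- (int y0 * int y1)) (int p))"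

text \<open>\<^const>\<open>multiplicity\<close> is \<open>0\<close> at \<open>0\<close>, whereas the 2-adic valuation of \<open>0\<close> is infinite.\<close>

definition nu2 :: "nat \<Rightarrow> enat" where
  "nu2 a = (if a = 0 then \<infinity> else enat (multiplicity 2 a))"

text \<open>Residue classes modulo \<open>2 ^ r\<close> are represented by \<open>{..<2 ^ r}\<close>.\<close>

definition sigma2_count :: "nat \<Rightarrow> nat \<Rightarrow> nat \<Rightarrow> nat \<Rightarrow> nat" where
  "sigma2_count y0 y1 y2 r =
     card {(x0, x1, x2). x0 \<in> {..<2 ^ r} \<and> x1 \<in> {..<2 ^ r} \<and> x2 \<in> {..<2 ^ r} \<and>
       [y0 ^ 3 * x0\<^sup>2 + y1 ^ 3 * x1\<^sup>2 = y2 ^ 3 * x2\<^sup>2] (mod 2 ^ r) \<and>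
       min (nu2 (x0 * y0)) (min (nu2 (x1 * y1)) (nu2 (x2 * y2))) = 0}"

definition sigma2 :: "nat \<Rightarrow> nat \<Rightarrow> nat \<Rightarrow> real" where
  "sigma2 y0 y1 y2 = lim (\<lambda>r. real (sigma2_count y0 y1 y2 r) / 2 ^ (2 * r))"

definition c_BV :: real where
  "c_BV = (1 / pi) * (\<Sum>\<^sub>\<infinity>(y0, y1, y2)\<in>{1..} \<times> {1..} \<times> {1..}.
     real_of_int ((moebius (y0 * y1 * y2))\<^sup>2) * gamma_fac (y0 * y1 * y2) /
       real (y0 * y1 * y2) powr (3 / 2) * sigma2 y0 y1 y2 * real_of_int (rho y0 y1 y2))"

end

theory Submission
  imports
    Defs
    "HOL-Analysis.Analysis"
    "HOL-Computational_Algebra.Nth_Powers"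
    "HOL-Computational_Algebra.Polynomial_Factorial"
    "HOL-Computational_Algebra.Field_as_Ring"
begin

text \<open>
  Every Campana point comes from a solution of a conic \<open>y\<^sub>0\<^sup>3 x\<^sub>0\<^sup>2 + y\<^sub>1\<^sup>3 x\<^sub>1\<^sup>2 = y\<^sub>2\<^sup>3 x\<^sub>2\<^sup>2\<close>. Its coprime solutions fall into
  finitely many lattices on which the form becomes, up to a factor, an integral form of half-discriminant
  \<open>-1\<close>; an isotropic such form is equivalent to \<open>Y\<^sup>2 - X Z\<close>, whose zeros are \<open>(u\<^sup>2, u v, v\<^sup>2)\<close>. Counting coprime
  lattice points in ellipses then shows that the conic contributes \<open>c\<^sub>y B\<^sup>1\<^sup>/\<^sup>2\<close> points, \<open>3 c\<^sub>y\<close> over the three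
  choices of signs, and \<open>c\<^sub>y\<close> is the term of \<open>c_BV\<close> at \<open>y\<close>. The points of one conic lie in the image of
  \<open>[s : t] \<mapsto> [a s\<^sup>2 : b t\<^sup>2]\<close>, which is a morphism of degree \<open>2\<close>, so every subset of finitely many conic
  families is thin. Finitely many conics have total density more than \<open>3 c_BV - \<lambda>\<close>, and their points can be
  thinned out to a set of density exactly \<open>3 c_BV - \<lambda>\<close>, which is the set to be removed.
\<close>

section \<open>Isotropic integral ternary forms\<close>

text \<open>Small \<lambda> is what makes exact constants unavoidable: the removed set must have
  density 3 c_BV - \<lambda>, which may be arbitrarily close to the total, so the density of each
  conic has to be computed and recognised as its term of the series, the prime 2 included. Only
  finitely many conics are in play at a time; the total is supplied by the assumed asymptotic.

  The half-discriminant can be -1 only if the product of the coefficients is even. This holds when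
  some y_i is even. When all are odd, exactly one x_i is even, and writing it as twice another
  integer puts a factor 4 on its coefficient, which splits the conic into three. These are the three
  summands of the 2-adic density.

  Solvability of a conic is never tested. Compatible square roots modulo the coefficients define a
  lattice, and reduction theory produces an isotropic vector in it, which is Legendre's theorem. The
  number of such lattices is \<open>rho\<close> times the conditions at 2 that make up
  \<open>sigma2\<close>, so conics without local solutions get density 0 by themselves.\<close>

definition tern_form :: "int \<Rightarrow> int \<Rightarrow> int \<Rightarrow> int \<Rightarrow> int \<Rightarrow> int \<Rightarrow> int \<times> int \<times> int \<Rightarrow> int" where
  "tern_form a b c d e f = (\<lambda>(X, Y, Z). a*X\<^sup>2 + b*Y\<^sup>2 + c*Z\<^sup>2 + d*Y*Z + e*X*Z + f*X*Y)"

text \<open>Half the determinant of the matrix of second derivatives, which is always even in three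
  variables. Its value on Y^2 - X Z is -1.\<close>

definition half_disc :: "int \<Rightarrow> int \<Rightarrow> int \<Rightarrow> int \<Rightarrow> int \<Rightarrow> int \<Rightarrow> int" where
  "half_disc a b c d e f = 4*a*b*c + d*e*f - a*d\<^sup>2 - b*e\<^sup>2 - c*f\<^sup>2"

definition det3 :: "int \<Rightarrow> int \<Rightarrow> int \<Rightarrow> int \<Rightarrow> int \<Rightarrow> int \<Rightarrow> int \<Rightarrow> int \<Rightarrow> int \<Rightarrow> int" where
  "det3 a b c d e f g h i = a*(e*i - f*h) - b*(d*i - f*g) + c*(d*h - e*g)"

definition lin3 :: "int \<Rightarrow> int \<Rightarrow> int \<Rightarrow> int \<Rightarrow> int \<Rightarrow> int \<Rightarrow> int \<Rightarrow> int \<Rightarrow> int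
    \<Rightarrow> int \<times> int \<times> int \<Rightarrow> int \<times> int \<times> int" where
  "lin3 a b c d e f g h i = (\<lambda>(X, Y, Z). (a*X + b*Y + c*Z, d*X + e*Y + f*Z, g*X + h*Y + i*Z))"

definition sl3 :: "(int \<times> int \<times> int \<Rightarrow> int \<times> int \<times> int) \<Rightarrow> bool" where
  "sl3 \<phi> \<longleftrightarrow> (\<exists>a b c d e f g h i. det3 a b c d e f g h i = 1 \<and> \<phi> = lin3 a b c d e f g h i)"

lemma sl3_comp:
  assumes "sl3 \<phi>" "sl3 \<psi>"
  shows "sl3 (\<phi> \<circ> \<psi>)"
proof -
  obtain a b c d e f g h i where 1: "det3 a b c d e f g h i = 1" "\<phi> = lin3 a b c d e f g h i"
    using assms(1) unfolding sl3_def by blast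
  obtain a' b' c' d' e' f' g' h' i' where
    2: "det3 a' b' c' d' e' f' g' h' i' = 1" "\<psi> = lin3 a' b' c' d' e' f' g' h' i'"
    using assms(2) unfolding sl3_def by blast
  have "\<phi> \<circ> \<psi> = lin3 (a*a'+b*d'+c*g') (a*b'+b*e'+c*h') (a*c'+b*f'+c*i')
     (d*a'+e*d'+f*g') (d*b'+e*e'+f*h') (d*c'+e*f'+f*i')
     (g*a'+h*d'+i*g') (g*b'+h*e'+i*h') (g*c'+h*f'+i*i')"
    unfolding 1 2 by (auto simp: lin3_def fun_eq_iff algebra_simps)
  moreover have "det3 (a*a'+b*d'+c*g') (a*b'+b*e'+c*h') (a*c'+b*f'+c*i')
     (d*a'+e*d'+f*g') (d*b'+e*e'+f*h') (d*c'+e*f'+f*i')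
     (g*a'+h*d'+i*g') (g*b'+h*e'+i*h') (g*c'+h*f'+i*i')
     = det3 a b c d e f g h i * det3 a' b' c' d' e' f' g' h' i'"
    unfolding det3_def by (simp add: algebra_simps)
  ultimately show ?thesis unfolding sl3_def using 1(1) 2(1) by (metis mult_1)
qed

section \<open>Reduction of forms of half-discriminant -1\<close>

definition sl3_class :: "(int \<times> int \<times> int \<Rightarrow> int) \<Rightarrow> int \<Rightarrow> int \<Rightarrow> int \<Rightarrow> int \<Rightarrow> int \<Rightarrow> int \<Rightarrow> bool" where
  "sl3_class F a b c d e f \<longleftrightarrow> half_disc a b c d e f = -1 \<and>
     (\<exists>\<phi>. sl3 \<phi> \<and> F \<circ> \<phi> = tern_form a b c d e f)"

lemma sl3_class_subst:
  assumes "sl3_class F a b c d e f" "sl3 \<psi>"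
    and "tern_form a b c d e f \<circ> \<psi> = tern_form a' b' c' d' e' f'"
    and "half_disc a' b' c' d' e' f' = half_disc a b c d e f"
  shows "sl3_class F a' b' c' d' e' f'"
  using assms sl3_comp unfolding sl3_class_def by (metis comp_assoc)

text \<open>The reduction uses two kinds of substitution in a pair of variables: shears, and the
  quarter turn that exchanges the variables up to sign.\<close>

lemma sl3_class_12:
  assumes C: "sl3_class F a b c d e f" and det: "x*w - y*z = 1"
  shows "sl3_class F (a*x\<^sup>2+f*x*z+b*z\<^sup>2) (a*y\<^sup>2+f*y*w+b*w\<^sup>2) c (e*y+d*w) (e*x+d*z)
     (2*a*x*y+f*(x*w+y*z)+2*b*z*w)"
proof (rule sl3_class_subst[OF C])
  show "sl3 (lin3 x y 0 z w 0 0 0 1)"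
    unfolding sl3_def using det by (intro exI conjI) (auto simp: det3_def)
  show "tern_form a b c d e f \<circ> lin3 x y 0 z w 0 0 0 1 =
    tern_form (a*x\<^sup>2+f*x*z+b*z\<^sup>2) (a*y\<^sup>2+f*y*w+b*w\<^sup>2) c (e*y+d*w) (e*x+d*z)
     (2*a*x*y+f*(x*w+y*z)+2*b*z*w)"
    by (auto simp: tern_form_def lin3_def fun_eq_iff power2_eq_square algebra_simps)
  have "half_disc (a*x\<^sup>2+f*x*z+b*z\<^sup>2) (a*y\<^sup>2+f*y*w+b*w\<^sup>2) c (e*y+d*w) (e*x+d*z)
     (2*a*x*y+f*(x*w+y*z)+2*b*z*w) = (x*w - y*z)\<^sup>2 * half_disc a b c d e f"
    unfolding half_disc_def by (simp add: power2_eq_square algebra_simps)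
  then show "half_disc (a*x\<^sup>2+f*x*z+b*z\<^sup>2) (a*y\<^sup>2+f*y*w+b*w\<^sup>2) c (e*y+d*w) (e*x+d*z)
     (2*a*x*y+f*(x*w+y*z)+2*b*z*w) = half_disc a b c d e f"
    using det by simp
qed

lemma sl3_class_23:
  assumes C: "sl3_class F a b c d e f" and det: "x*w - y*z = 1"
  shows "sl3_class F a (b*x\<^sup>2+d*x*z+c*z\<^sup>2) (b*y\<^sup>2+d*y*w+c*w\<^sup>2)
     (2*b*x*y+d*(x*w+y*z)+2*c*z*w) (f*y+e*w) (f*x+e*z)"
proof (rule sl3_class_subst[OF C])
  show "sl3 (lin3 1 0 0 0 x y 0 z w)"
    unfolding sl3_def using det by (intro exI conjI) (auto simp: det3_def)
  show "tern_form a b c d e f \<circ> lin3 1 0 0 0 x y 0 z w =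
    tern_form a (b*x\<^sup>2+d*x*z+c*z\<^sup>2) (b*y\<^sup>2+d*y*w+c*w\<^sup>2)
     (2*b*x*y+d*(x*w+y*z)+2*c*z*w) (f*y+e*w) (f*x+e*z)"
    by (auto simp: tern_form_def lin3_def fun_eq_iff power2_eq_square algebra_simps)
  have "half_disc a (b*x\<^sup>2+d*x*z+c*z\<^sup>2) (b*y\<^sup>2+d*y*w+c*w\<^sup>2)
     (2*b*x*y+d*(x*w+y*z)+2*c*z*w) (f*y+e*w) (f*x+e*z) = (x*w - y*z)\<^sup>2 * half_disc a b c d e f"
    unfolding half_disc_def by (simp add: power2_eq_square algebra_simps)
  then show "half_disc a (b*x\<^sup>2+d*x*z+c*z\<^sup>2) (b*y\<^sup>2+d*y*w+c*w\<^sup>2)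
     (2*b*x*y+d*(x*w+y*z)+2*c*z*w) (f*y+e*w) (f*x+e*z) = half_disc a b c d e f"
    using det by simp
qed

lemma sl3_class_13:
  assumes C: "sl3_class F a b c d e f"
  shows "sl3_class F a b (c+e*t+a*t\<^sup>2) (d+f*t) (e+2*a*t) f"
proof (rule sl3_class_subst[OF C])
  show "sl3 (lin3 1 0 t 0 1 0 0 0 1)"
    unfolding sl3_def by (intro exI conjI) (auto simp: det3_def)
  show "tern_form a b c d e f \<circ> lin3 1 0 t 0 1 0 0 0 1 = tern_form a b (c+e*t+a*t\<^sup>2) (d+f*t) (e+2*a*t) f"
    by (auto simp: tern_form_def lin3_def fun_eq_iff power2_eq_square algebra_simps)
  show "half_disc a b (c+e*t+a*t\<^sup>2) (d+f*t) (e+2*a*t) f = half_disc a b c d e f"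
    unfolding half_disc_def by (simp add: power2_eq_square algebra_simps)
qed

lemma balanced_residue:
  fixes D E :: int
  assumes "D \<noteq> 0"
  obtains x where "\<bar>2 * (E + x * D)\<bar> \<le> \<bar>D\<bar>"
proof -
  define r where "r = E mod \<bar>D\<bar>"
  have r: "0 \<le> r" "r < \<bar>D\<bar>" using assms by (auto simp: r_def)
  have E: "E = r + (E div \<bar>D\<bar>) * (sgn D * D)"
    unfolding r_def by (metis abs_sgn add.commute div_mult_mod_eq mult.commute)
  define q where "q = (E div \<bar>D\<bar>) * sgn D"
  have E': "E = r + q * D" using E by (simp add: q_def mult.assoc)
  show ?thesis
  proof (cases "2 * r \<le> \<bar>D\<bar>")
    case True
    have "E + (-q) * D = r" using E' by simp
    with True r that[of "-q"] show ?thesis by auto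
  next
    case False
    have "E + (-q - sgn D) * D = r - \<bar>D\<bar>" using E' by (simp add: algebra_simps abs_sgn)
    with False r that[of "-q - sgn D"] show ?thesis by auto
  qed
qed

text \<open>Hermite reduction: make |a| minimal in the class, then the absolute value of the minor D
  = 4 a b - f^2. If a is nonzero, a shear of X and Y gives 3 a^2 \<le> |D|, and a shear of Y and Z
  gives 3 D^2 \<le> 16 |a|. Together 27 a^4 \<le> 16 |a|, which no nonzero integer satisfies.
  Isotropy is thus a consequence of the half-discriminant being -1.\<close>

lemma sl3_class_isotropic:
  assumes C0: "sl3_class F a0 b0 c0 d0 e0 f0"
  obtains b c d e f where "sl3_class F 0 b c d e f"
proof -
  let ?C = "sl3_class F"
  define m where "m = (LEAST n. \<exists>a b c d e f. ?C a b c d e f \<and> nat \<bar>a\<bar> = n)"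
  have m_ex: "\<exists>a b c d e f. ?C a b c d e f \<and> nat \<bar>a\<bar> = m"
    unfolding m_def by (rule LeastI_ex) (use C0 in blast)
  have m_le: "m \<le> nat \<bar>a\<bar>" if "?C a b c d e f" for a b c d e f
    unfolding m_def by (rule Least_le) (use that in blast)
  \<comment> \<open>The second minimum is taken over a leading coefficient of the adjoint form,
    among the forms that attain the first minimum.\<close>
  define n where "n = (LEAST n. \<exists>a b c d e f. ?C a b c d e f \<and> nat \<bar>a\<bar> = m \<and> nat \<bar>4*a*b-f\<^sup>2\<bar> = n)"
  have "\<exists>a b c d e f. ?C a b c d e f \<and> nat \<bar>a\<bar> = m \<and> nat \<bar>4*a*b-f\<^sup>2\<bar> = n"
    unfolding n_def by (rule LeastI_ex) (use m_ex in blast)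
  then obtain a b c d e f where C: "?C a b c d e f" and am: "nat \<bar>a\<bar> = m"
    and Dn: "nat \<bar>4*a*b-f\<^sup>2\<bar> = n" by blast
  have n_le: "n \<le> nat \<bar>4*a*b-f\<^sup>2\<bar>" if "?C a b c d e f" "nat \<bar>a\<bar> = m" for a b c d e f
    unfolding n_def by (rule Least_le) (use that in blast)
  define D where "D = 4*a*b-f\<^sup>2"
  have "a = 0"
  proof (rule ccontr)
    assume a: "a \<noteq> 0"
    obtain x where x: "\<bar>2 * (f + x * (2*a))\<bar> \<le> \<bar>2*a\<bar>" using a by (rule_tac balanced_residue[of "2*a" f]) auto
    define f1 where "f1 = f + 2*a*x"
    define b1 where "b1 = a*x\<^sup>2+f*x+b"
    have "?C a b1 c (e*x+d) e f1"
      using sl3_class_12[OF C, of 1 1 x 0] by (simp add: f1_def b1_def algebra_simps)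
    \<comment> \<open>The quarter turn makes b1 the leading coefficient, so minimality of |a| bounds
      it from below.\<close>
    from sl3_class_12[OF this, of 0 0 "-1" 1] have "m \<le> nat \<bar>b1\<bar>" using m_le by fastforce
    then have b1: "\<bar>a\<bar> \<le> \<bar>b1\<bar>" using am by linarith
    have f1: "\<bar>f1\<bar> \<le> \<bar>a\<bar>" using x unfolding f1_def by (simp add: algebra_simps)
    have D1: "D = 4*a*b1 - f1\<^sup>2" unfolding D_def f1_def b1_def by (simp add: power2_eq_square algebra_simps)
    have "f1\<^sup>2 \<le> a\<^sup>2" using f1 by (simp add: abs_le_square_iff)
    moreover have "a\<^sup>2 \<le> \<bar>a*b1\<bar>" using mult_left_mono[OF b1, of "\<bar>a\<bar>"] by (simp add: abs_mult power2_eq_square)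
    moreover have "\<bar>4*a*b1\<bar> - f1\<^sup>2 \<le> \<bar>D\<bar>" "\<bar>4*a*b1\<bar> = 4 * \<bar>a*b1\<bar>"
      unfolding D1 using abs_triangle_ineq2[of "4*a*b1" "f1\<^sup>2"] by (simp_all add: abs_mult)
    ultimately have aD: "3 * a\<^sup>2 \<le> \<bar>D\<bar>" by linarith
    then have D: "D \<noteq> 0" using a by auto
    define E where "E = 2*a*d - e*f"
    obtain x where x: "\<bar>2 * (E + x * D)\<bar> \<le> \<bar>D\<bar>" by (rule balanced_residue[OF D])
    define c1 d1 e1 where "c1 = b*x\<^sup>2+d*x+c" "d1 = d+2*b*x" "e1 = e+f*x"
    have "?C a b c1 d1 e1 f"
      using sl3_class_23[OF C, of 1 1 x 0] by (simp add: c1_d1_e1_def algebra_simps)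
    \<comment> \<open>Exchanging Y and Z replaces the minor in X, Y by the one in X, Z and keeps the
      leading coefficient a, so minimality of n applies.\<close>
    from sl3_class_23[OF this, of 0 0 "-1" 1] have C': "?C a c1 b (-d1) (-f) e1" by simp
    have "n \<le> nat \<bar>4*a*c1-e1\<^sup>2\<bar>" using n_le[OF C'] am by simp
    then have D13: "\<bar>D\<bar> \<le> \<bar>4*a*c1-e1\<^sup>2\<bar>" using Dn D_def by linarith
    define E1 where "E1 = 2*a*d1 - e1*f"
    have E1: "E1 = E + x * D" unfolding E1_def E_def D_def c1_d1_e1_def by (simp add: power2_eq_square algebra_simps)
    have hd: "half_disc a b c1 d1 e1 f = -1"
      using \<open>?C a b c1 d1 e1 f\<close> by (simp add: sl3_class_def)
    \<comment> \<open>Jacobi's identity: a 2x2 minor of the adjoint form is a coefficient of the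
      form times its discriminant.\<close>
    have "D * (4*a*c1-e1\<^sup>2) - E1\<^sup>2 = 4 * a * half_disc a b c1 d1 e1 f"
      unfolding D_def E1_def half_disc_def by (simp add: power2_eq_square algebra_simps)
    then have id: "D * (4*a*c1-e1\<^sup>2) = E1\<^sup>2 - 4*a" using hd by simp
    have "\<bar>2*E1\<bar> \<le> \<bar>D\<bar>" using x E1 by simp
    then have "(2*E1)\<^sup>2 \<le> D\<^sup>2" by (simp add: abs_le_square_iff)
    then have e4: "4 * E1\<^sup>2 \<le> D\<^sup>2" by (simp add: power_mult_distrib)
    have "D\<^sup>2 \<le> \<bar>D * (4*a*c1-e1\<^sup>2)\<bar>"
      using mult_left_mono[OF D13, of "\<bar>D\<bar>"] by (simp add: abs_mult power2_eq_square)
    then have "D\<^sup>2 \<le> E1\<^sup>2 + 4*\<bar>a\<bar>" unfolding id using abs_triangle_ineq4[of "E1\<^sup>2" "4*a"] by (simp add: abs_mult)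
    with e4 have 3: "3 * D\<^sup>2 \<le> 16 * \<bar>a\<bar>" by linarith
    have "(3 * a\<^sup>2)\<^sup>2 \<le> D\<^sup>2" using power_mono[OF aD, of 2] by simp
    then have "27 * (a\<^sup>2)\<^sup>2 \<le> 16 * \<bar>a\<bar>" using 3 by (simp add: power_mult_distrib)
    moreover have "\<bar>a\<bar> \<le> (a\<^sup>2)\<^sup>2"
    proof -
      have "1 \<le> \<bar>a\<bar>" using a by linarith
      then have "\<bar>a\<bar> ^ 1 \<le> \<bar>a\<bar> ^ 4" by (intro power_increasing) auto
      also have "\<bar>a\<bar> ^ 4 = (a\<^sup>2)\<^sup>2" by (simp flip: power_mult)
      finally show ?thesis by simp
    qed
    ultimately show False using a by linarith
  qed
  with C that show thesis by blast
qed

text \<open>Reduction makes the first basis vector isotropic, and half-discriminant -1 forces its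
  pairings f and e with the other two basis vectors to be coprime. A change of those two vectors
  makes the pairings 0 and -1; then the coefficient of Y^2 must be 1, and two shears clear the
  remaining coefficients.\<close>

lemma unimodular_form_standard:
  assumes "half_disc a b c d e f = -1"
  obtains \<phi> where "sl3 \<phi>" "tern_form a b c d e f \<circ> \<phi> = (\<lambda>(X, Y, Z). Y\<^sup>2 - X * Z)"
proof -
  define F where "F = tern_form a b c d e f"
  have "sl3 id" unfolding sl3_def
    by (rule exI[of _ 1], rule exI[of _ 0], rule exI[of _ 0], rule exI[of _ 0], rule exI[of _ 1],
        rule exI[of _ 0], rule exI[of _ 0], rule exI[of _ 0], rule exI[of _ 1])
       (auto simp: det3_def lin3_def fun_eq_iff)
  then have "sl3_class F a b c d e f" unfolding sl3_class_def F_def using assms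
    by (metis comp_id)
  then obtain b1 c1 d1 e1 f1 where C1: "sl3_class F 0 b1 c1 d1 e1 f1" by (rule sl3_class_isotropic)
  then have hd: "d1*e1*f1 - b1*e1\<^sup>2 - c1*f1\<^sup>2 = -1" by (simp add: sl3_class_def half_disc_def)
  have "coprime f1 e1"
  proof (rule coprimeI)
    fix k assume "k dvd f1" "k dvd e1"
    then have "k dvd d1*e1*f1 - b1*e1\<^sup>2 - c1*f1\<^sup>2" by (intro dvd_diff dvd_mult) (auto simp: power2_eq_square)
    then show "is_unit k" unfolding hd by simp
  qed
  then obtain s t where st: "s * f1 + t * e1 = 1" using cong_solve_coprime_int bezout_int
    by (metis coprime_iff_gcd_eq_1)
  \<comment> \<open>the new second basis vector is orthogonal to the isotropic one\<close>
  have "\<exists>b2 c2 d2. sl3_class F 0 b2 c2 d2 (-1) 0"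
  proof -
    have 1: "(-e1) * (-t) - (-s) * f1 = 1" using st by (simp add: algebra_simps)
    have 2: "f1 * (-s) + e1 * (-t) = -1" using st by (simp add: algebra_simps)
    have 3: "f1 * (-e1) + e1 * f1 = 0" by simp
    show ?thesis using sl3_class_23[OF C1 1, unfolded 2 3] by (intro exI)
  qed
  then obtain b2 c2 d2 where C2: "sl3_class F 0 b2 c2 d2 (-1) 0" by blast
  then have b2: "b2 = 1" by (simp add: sl3_class_def half_disc_def)
  from sl3_class_12[OF C2, of 1 1 d2 0] b2 have "sl3_class F 0 1 c2 0 (-1) 0" by simp
  from sl3_class_13[OF this, of c2] have "sl3_class F 0 1 0 0 (-1) 0" by simp
  then obtain \<phi> where "sl3 \<phi>" "F \<circ> \<phi> = tern_form 0 1 0 0 (-1) 0" unfolding sl3_class_def by blast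
  then show thesis using that[of \<phi>] unfolding F_def by (simp add: tern_form_def mult.commute)
qed

section \<open>Coprime lattice points in ellipses\<close>

locale ellipse =
  fixes a b c :: real
  assumes a_pos: "a > 0" and disc_pos: "4*a*c - b\<^sup>2 > 0"
begin

definition qf :: "real^2 \<Rightarrow> real" where
  "qf x = a*(x$1)\<^sup>2 + b*x$1*x$2 + c*(x$2)\<^sup>2"

definition D :: real where "D = 4*a*c - b\<^sup>2"

text \<open>Completing the square: \<open>T\<close> carries \<open>qf\<close> to the squared
  Euclidean norm and \<open>S\<close> is its inverse, so ellipses are linear images of
  discs.\<close>

definition T :: "real^2 \<Rightarrow> real^2" where
  "T x = vector [sqrt a * x$1 + b * x$2 / (2 * sqrt a), sqrt D * x$2 / (2 * sqrt a)]"

definition S :: "real^2 \<Rightarrow> real^2" where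
  "S y = vector [y$1 / sqrt a - b * y$2 / (sqrt a * sqrt D), 2 * sqrt a * y$2 / sqrt D]"

lemma D_pos: "D > 0" using disc_pos by (simp add: D_def)

lemma linear_T: "linear T"
  by (rule linearI) (auto simp: T_def vec_eq_iff forall_2 vector_2 algebra_simps add_divide_distrib)

lemma linear_S: "linear S"
  by (rule linearI) (auto simp: S_def vec_eq_iff forall_2 vector_2 algebra_simps add_divide_distrib diff_divide_distrib)

lemma T_S: "T (S y) = y"
  using a_pos D_pos by (auto simp: T_def S_def vec_eq_iff forall_2 vector_2 field_simps)

lemma S_T: "S (T x) = x"
  using a_pos D_pos by (auto simp: T_def S_def vec_eq_iff forall_2 vector_2 field_simps)

lemma norm_T: "(norm (T x))\<^sup>2 = qf x"
proof -
  have sa: "(sqrt a)\<^sup>2 = a" "(sqrt D)\<^sup>2 = D" using a_pos D_pos by auto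
  have "(norm (T x))\<^sup>2 = (sqrt a * x$1 + b * x$2 / (2 * sqrt a))\<^sup>2 + (sqrt D * x$2 / (2 * sqrt a))\<^sup>2"
    by (simp add: norm_vec_def L2_set_def sum_2 T_def vector_2)
  also have "(sqrt D * x$2 / (2 * sqrt a))\<^sup>2 = D * (x$2)\<^sup>2 / (4 * a)"
    by (simp add: power_divide power_mult_distrib sa)
  also have "(sqrt a * x$1 + b * x$2 / (2 * sqrt a))\<^sup>2 = a*(x$1)\<^sup>2 + b*x$1*x$2 + b\<^sup>2*(x$2)\<^sup>2/(4*a)"
    using a_pos by (simp add: power2_sum power_divide power_mult_distrib sa)
  also have "D * (x$2)\<^sup>2 / (4 * a) = c*(x$2)\<^sup>2 - b\<^sup>2*(x$2)\<^sup>2/(4*a)"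
    using a_pos by (simp add: D_def field_simps)
  finally show ?thesis by (simp add: qf_def)
qed

lemma norm_T_eq: "norm (T x) = sqrt (qf x)"
  using norm_T by (metis norm_ge_zero real_sqrt_unique)

lemma ellipse_eq: "r \<ge> 0 \<Longrightarrow> {x. norm (T x) \<le> r} = S ` cball 0 r"
proof (intro equalityI subsetI)
  fix x assume "x \<in> {x. norm (T x) \<le> r}"
  then show "x \<in> S ` cball 0 r" by (intro image_eqI[of _ _ "T x"]) (auto simp: S_T)
qed (auto simp: T_S)

lemma ellipse_measurable: "r \<ge> 0 \<Longrightarrow> {x. norm (T x) \<le> r} \<in> lmeasurable"
  by (simp add: ellipse_eq measurable_linear_image[OF linear_S])

lemma measure_ellipse:
  assumes "r \<ge> 0"
  shows "measure lebesgue {x. norm (T x) \<le> r} = 2 * pi * r\<^sup>2 / sqrt D"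
proof -
  have "det (matrix S) = 2 / sqrt D"
    using a_pos by (simp add: det_2 matrix_def S_def vector_2 axis_def)
  moreover have "measure lebesgue (cball 0 r :: (real^2) set) = r\<^sup>2 * pi"
    using content_cball_conv_ball[of "0::real^2" r] circle_area[OF assms, of 0] by simp
  ultimately show ?thesis
    using D_pos measure_linear_image[OF linear_S lmeasurable_cball] by (simp add: ellipse_eq[OF assms])
qed

end

text \<open>The density of a residue class is read off from the squares of side \<open>m\<close> with lower left corners
  at its points: they tile the plane.\<close>

lemma (in ellipse) lattice_count_real:
  fixes m i j :: int
  assumes m: "m > 0"
  defines "L \<equiv> \<lambda>X. {(u::int, v::int). [u = i] (mod m) \<and> [v = j] (mod m) \<and>
     a*(real_of_int u)\<^sup>2 + b*real_of_int u*real_of_int v + c*(real_of_int v)\<^sup>2 \<le> X}"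
  shows "\<And>X. finite (L X)"
    and "((\<lambda>X. real (card (L X)) / X) \<longlongrightarrow> 2 * pi / (sqrt D * (of_int m)\<^sup>2)) at_top"
proof -
  define vc :: "int \<times> int \<Rightarrow> real^2" where "vc = (\<lambda>(u, v). vector [real_of_int u, real_of_int v])"
  have vc1: "vc p $ 1 = real_of_int (fst p)" and vc2: "vc p $ 2 = real_of_int (snd p)" for p
    by (auto simp: vc_def split: prod.splits)
  have qf_vc: "qf (vc (u, v)) = a*(real_of_int u)\<^sup>2 + b*real_of_int u*real_of_int v + c*(real_of_int v)\<^sup>2" for u v
    by (simp add: qf_def vc_def)
  have L_iff: "p \<in> L X \<longleftrightarrow> [fst p = i] (mod m) \<and> [snd p = j] (mod m) \<and> norm (T (vc p)) \<le> sqrt X" if "X \<ge> 0" for p X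
    unfolding L_def using that by (cases p) (auto simp: norm_T_eq qf_vc)
  have "bounded_linear S" using linear_S linear_conv_bounded_linear by blast
  then obtain KS where KS: "KS > 0" "\<And>y. norm (S y) \<le> norm y * KS"
    using bounded_linear.pos_bounded by blast
  have "bounded_linear T" using linear_T linear_conv_bounded_linear by blast
  then obtain K where K: "K > 0" "\<And>y. norm (T y) \<le> norm y * K"
    using bounded_linear.pos_bounded by blast
  have qf_nonneg: "qf x \<ge> 0" for x by (metis norm_T zero_le_power2)
  show fin: "finite (L X)" for X
  proof (cases "X \<ge> 0")
    case False
    have "\<not> qf (vc p) \<le> X" for p using qf_nonneg[of "vc p"] False by linarith
    then have "L X = {}" unfolding L_def qf_vc[symmetric] by auto
    then show ?thesis by simp
  next
    case True
    define M where "M = \<lceil>sqrt X * KS\<rceil>"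
    have "L X \<subseteq> {-M..M} \<times> {-M..M}"
    proof
      fix p assume p: "p \<in> L X"
      have "norm (vc p) \<le> norm (T (vc p)) * KS" using KS(2)[of "T (vc p)"] S_T by simp
      also have "\<dots> \<le> sqrt X * KS" using p L_iff[OF True] KS(1) by (simp add: mult_right_mono)
      finally have "norm (vc p) \<le> of_int M" unfolding M_def by linarith
      then have "\<bar>real_of_int (fst p)\<bar> \<le> of_int M" "\<bar>real_of_int (snd p)\<bar> \<le> of_int M"
        using component_le_norm_cart[of "vc p" 1] component_le_norm_cart[of "vc p" 2] vc1 vc2 by auto
      then show "p \<in> {-M..M} \<times> {-M..M}" by (cases p) (auto simp: abs_le_iff)
    qed
    then show ?thesis by (rule finite_subset) auto
  qed
  define mr where "mr = real_of_int m"
  have mr: "mr > 0" using m by (simp add: mr_def)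
  define Q where "Q p = cbox (vc p) (vc p + vector [mr, mr])" for p
  have Qiff: "x \<in> Q p \<longleftrightarrow> of_int (fst p) \<le> x$1 \<and> x$1 \<le> of_int (fst p) + mr \<and>
      of_int (snd p) \<le> x$2 \<and> x$2 \<le> of_int (snd p) + mr" for x p
    by (auto simp: Q_def mem_box_cart forall_2 vc1 vc2)
  have mQ: "measure lebesgue (Q p) = mr\<^sup>2" for p
  proof -
    have "Q p \<noteq> {}" using mr unfolding Q_def by (auto simp: interval_ne_empty_cart forall_2)
    then show ?thesis unfolding Q_def by (simp add: content_cbox_cart UNIV_2 power2_eq_square)
  qed
  have Qm: "Q p \<in> lmeasurable" for p by (simp add: Q_def)
  \<comment> \<open>Bound for the variation of norm (T x) over one square of side m; by this margin
    the ellipse is enlarged and shrunk in the two area comparisons.\<close>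
  define C where "C = 2 * mr * K"
  have C: "C > 0" using mr K by (simp add: C_def)
  have near: "\<bar>norm (T x) - norm (T (vc p))\<bar> \<le> C" if "x \<in> Q p" for x p
  proof -
    have "\<bar>(x - vc p)$1\<bar> \<le> mr" "\<bar>(x - vc p)$2\<bar> \<le> mr" using that Qiff vc1 vc2 by auto
    then have "norm (x - vc p) \<le> 2 * mr" using norm_le_l1_cart[of "x - vc p"] by (simp add: sum_2)
    then have "norm (T (x - vc p)) \<le> C" using K(2)[of "x - vc p"] K(1) unfolding C_def
      by (meson mult_right_mono order_trans less_imp_le)
    then show ?thesis using norm_triangle_ineq3[of "T x" "T (vc p)"] by (simp add: linear_diff[OF linear_T])
  qed
  \<comment> \<open>Distinct points of one residue class differ by at least m in some coordinate, so
    their closed squares meet inside a line.\<close>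
  have overlap: "negligible (Q p \<inter> Q q)" if pq: "p \<in> L X" "q \<in> L X" "p \<noteq> q" for p q X
  proof -
    have cg: "m dvd fst p - fst q" "m dvd snd p - snd q"
      using pq unfolding L_def by (auto simp: cong_iff_dvd_diff) (metis cong_iff_dvd_diff cong_sym cong_trans)+
    have hyp: "negligible {x::real^2. x$k = t}" for k t
    proof -
      have "negligible {x::real^2. x \<bullet> axis k 1 = t}" by (rule negligible_standard_hyperplane) (auto simp: Basis_vec_def)
      then show ?thesis by (simp add: inner_axis)
    qed
    have far: "s + m \<le> t \<or> t + m \<le> s" if "m dvd s - t" "s \<noteq> t" for s t :: int
      using that zdvd_imp_le[of m "s - t"] zdvd_imp_le[of m "t - s"] by (smt (verit) dvd_diff_commute)
    have *: "x$k = of_int (max s t)" if "s + m \<le> t \<or> t + m \<le> s" "of_int s \<le> x$k" "x$k \<le> of_int s + mr"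
        "of_int t \<le> x$k" "x$k \<le> of_int t + mr" for x :: "real^2" and k and s t :: int
      using that unfolding mr_def by (smt (verit) of_int_add of_int_le_iff)
    show ?thesis
    proof (cases "fst p = fst q")
      case False
      have "Q p \<inter> Q q \<subseteq> {x. x$1 = of_int (max (fst p) (fst q))}"
        using *[OF far[OF cg(1) False]] by (auto simp: Qiff)
      then show ?thesis using hyp negligible_subset by blast
    next
      case True
      then have False': "snd p \<noteq> snd q" using pq(3) by (simp add: prod_eq_iff)
      have "Q p \<inter> Q q \<subseteq> {x. x$2 = of_int (max (snd p) (snd q))}"
        using *[OF far[OF cg(2) False']] by (auto simp: Qiff)
      then show ?thesis using hyp negligible_subset by blast
    qed
  qed
  have meas_eq: "measure lebesgue (\<Union>(Q ` L X)) = mr\<^sup>2 * card (L X)" for X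
    using measure_negligible_finite_Union_image[OF fin[of X], of Q] Qm overlap
    by (simp add: pairwise_def mQ mult.commute)
  have Um: "\<Union>(Q ` L X) \<in> lmeasurable" for X using Qm fin by (intro fmeasurable.finite_Union) auto
  have upper: "mr\<^sup>2 * card (L X) \<le> 2 * pi * (sqrt X + C)\<^sup>2 / sqrt D" if X: "X \<ge> 0" for X
  proof -
    have nn: "0 \<le> sqrt X + C" using X C by (simp add: add_nonneg_nonneg)
    have "\<Union>(Q ` L X) \<subseteq> {x. norm (T x) \<le> sqrt X + C}" using near L_iff[OF X] by fastforce
    then have "measure lebesgue (\<Union>(Q ` L X)) \<le> measure lebesgue {x. norm (T x) \<le> sqrt X + C}"
      by (intro measure_mono_fmeasurable ellipse_measurable nn) (use Um in auto)
    then show ?thesis using meas_eq measure_ellipse[OF nn] by simp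
  qed
  have lower: "2 * pi * (sqrt X - C)\<^sup>2 / sqrt D \<le> mr\<^sup>2 * card (L X)" if X: "sqrt X \<ge> C" for X
  proof -
    have X0: "X \<ge> 0" using X C by (metis less_le_trans less_imp_le real_sqrt_gt_0_iff)
    have nn: "0 \<le> sqrt X - C" using X by simp
    have "{x. norm (T x) \<le> sqrt X - C} \<subseteq> \<Union>(Q ` L X)"
    proof
      fix x assume "x \<in> {x. norm (T x) \<le> sqrt X - C}"
      then have x: "norm (T x) \<le> sqrt X - C" by simp
      \<comment> \<open>The largest member of the class of t modulo m that does not exceed s. In
        both coordinates this finds a square containing x.\<close>
      define fl where "fl s t = t + m * \<lfloor>(s - of_int t) / mr\<rfloor>" for s :: real and t :: int
      have fl: "of_int (fl s t) \<le> s" "s \<le> of_int (fl s t) + mr" "[fl s t = t] (mod m)" for s t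
      proof -
        define f where "f = \<lfloor>(s - of_int t) / mr\<rfloor>"
        have "of_int f \<le> (s - of_int t) / mr" "(s - of_int t) / mr \<le> of_int f + 1"
          unfolding f_def by linarith+
        then have "of_int f * mr \<le> s - of_int t" "s - of_int t \<le> (of_int f + 1) * mr"
          using mr by (auto simp: field_simps)
        moreover have "fl s t = t + m * f" unfolding fl_def f_def ..
        ultimately show "of_int (fl s t) \<le> s" "s \<le> of_int (fl s t) + mr"
          by (auto simp: mr_def algebra_simps)
        show "[fl s t = t] (mod m)" unfolding fl_def by (simp add: cong_iff_dvd_diff)
      qed
      define p where "p = (fl (x$1) i, fl (x$2) j)"
      have xQ: "x \<in> Q p" using fl unfolding Qiff p_def by auto
      then have "norm (T (vc p)) \<le> sqrt X" using near x by fastforce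
      then have "p \<in> L X" using L_iff[OF X0] fl unfolding p_def by auto
      then show "x \<in> \<Union>(Q ` L X)" using xQ by blast
    qed
    then have "measure lebesgue {x. norm (T x) \<le> sqrt X - C} \<le> measure lebesgue (\<Union>(Q ` L X))"
      using ellipse_measurable[OF nn] Um by (intro measure_mono_fmeasurable) (auto simp: fmeasurableD)
    then show ?thesis using meas_eq measure_ellipse[OF nn] by simp
  qed
  define A where "A = 2 * pi / (sqrt D * mr\<^sup>2)"
  show "((\<lambda>X. real (card (L X)) / X) \<longlongrightarrow> 2 * pi / (sqrt D * (of_int m)\<^sup>2)) at_top"
    unfolding mr_def[symmetric] A_def[symmetric]
  proof (rule tendsto_sandwich)
    have ev: "eventually (\<lambda>X. X \<ge> 1 \<and> sqrt X \<ge> C) at_top"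
    proof (rule eventually_at_top_linorderI[of "max 1 (C\<^sup>2)"])
      fix X :: real assume "X \<ge> max 1 (C\<^sup>2)"
      then show "X \<ge> 1 \<and> sqrt X \<ge> C" using real_le_rsqrt by auto
    qed
    show "eventually (\<lambda>X. A * (1 - C / sqrt X)\<^sup>2 \<le> real (card (L X)) / X) at_top"
      using ev
    proof eventually_elim
      case (elim X)
      then have "X > 0" "sqrt X > 0" by auto
      then have "A * (1 - C / sqrt X)\<^sup>2 = 2 * pi * (sqrt X - C)\<^sup>2 / sqrt D / mr\<^sup>2 / X"
        unfolding A_def by (simp add: field_simps power2_diff)
      also have "\<dots> \<le> mr\<^sup>2 * card (L X) / mr\<^sup>2 / X"
        using lower[of X] elim \<open>X > 0\<close> by (intro divide_right_mono) auto
      finally show ?case using mr by simp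
    qed
    show "eventually (\<lambda>X. real (card (L X)) / X \<le> A * (1 + C / sqrt X)\<^sup>2) at_top"
      using ev
    proof eventually_elim
      case (elim X)
      then have "X > 0" "sqrt X > 0" by auto
      then have "A * (1 + C / sqrt X)\<^sup>2 = 2 * pi * (sqrt X + C)\<^sup>2 / sqrt D / mr\<^sup>2 / X"
        unfolding A_def by (simp add: field_simps power2_sum)
      also have "\<dots> \<ge> mr\<^sup>2 * card (L X) / mr\<^sup>2 / X"
        using upper[of X] elim \<open>X > 0\<close> by (intro divide_right_mono) auto
      finally show ?case using mr by simp
    qed
    have lim0: "((\<lambda>X. C / sqrt X) \<longlongrightarrow> 0) at_top"
      by (intro tendsto_divide_0[OF tendsto_const] filterlim_at_top_imp_at_infinity sqrt_at_top)
    show "((\<lambda>X. A * (1 - C / sqrt X)\<^sup>2) \<longlongrightarrow> A) at_top"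
      using tendsto_mult[OF tendsto_const[of A] tendsto_power[OF tendsto_diff[OF tendsto_const[of 1] lim0], of 2]] by simp
    show "((\<lambda>X. A * (1 + C / sqrt X)\<^sup>2) \<longlongrightarrow> A) at_top"
      using tendsto_mult[OF tendsto_const[of A] tendsto_power[OF tendsto_add[OF tendsto_const[of 1] lim0], of 2]] by simp
  qed
qed

section \<open>Residues outside lines modulo primes\<close>

lemma card_periodic_prod:
  fixes m n :: int
  assumes mn: "coprime m n" "m > 0" "n > 0"
    and P: "\<And>u v u' v'. [u = u'] (mod m) \<Longrightarrow> [v = v'] (mod m) \<Longrightarrow> P u v = P u' v'"
    and Q: "\<And>u v u' v'. [u = u'] (mod n) \<Longrightarrow> [v = v'] (mod n) \<Longrightarrow> Q u v = Q u' v'"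
  shows "card {(u, v) \<in> {0..<m*n} \<times> {0..<m*n}. P u v \<and> Q u v} =
    card {(u, v) \<in> {0..<m} \<times> {0..<m}. P u v} * card {(u, v) \<in> {0..<n} \<times> {0..<n}. Q u v}"
proof -
  let ?f = "\<lambda>(u, v). ((u mod m, v mod m), (u mod n, v mod n))"
  have "bij_betw ?f {(u, v) \<in> {0..<m*n} \<times> {0..<m*n}. P u v \<and> Q u v}
    ({(u, v) \<in> {0..<m} \<times> {0..<m}. P u v} \<times> {(u, v) \<in> {0..<n} \<times> {0..<n}. Q u v})"
  proof (rule bij_betwI')
    fix p q assume pq: "p \<in> {(u, v) \<in> {0..<m*n} \<times> {0..<m*n}. P u v \<and> Q u v}"
      "q \<in> {(u, v) \<in> {0..<m*n} \<times> {0..<m*n}. P u v \<and> Q u v}"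
    have inj: "u = u'" if "u mod m = u' mod m" "u mod n = u' mod n" "u \<in> {0..<m*n}" "u' \<in> {0..<m*n}" for u u'
    proof -
      have "[u = u'] (mod m * n)" using that mn(1) by (intro coprime_cong_mult) (auto simp: unique_euclidean_semiring_class.cong_def)
      then show ?thesis using that cong_less_imp_eq_int[of u "m * n" u'] by simp
    qed
    obtain u v u' v' where "p = (u, v)" "q = (u', v')" by (metis prod.exhaust)
    then show "(?f p = ?f q) = (p = q)"
      using pq inj[of u u'] inj[of v v'] by auto
  next
    fix p assume "p \<in> {(u, v) \<in> {0..<m*n} \<times> {0..<m*n}. P u v \<and> Q u v}"
    then show "?f p \<in> {(u, v) \<in> {0..<m} \<times> {0..<m}. P u v} \<times> {(u, v) \<in> {0..<n} \<times> {0..<n}. Q u v}"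
      using mn P[of "fst p mod m" "fst p" "snd p mod m" "snd p"] Q[of "fst p mod n" "fst p" "snd p mod n" "snd p"]
      by (auto simp: unique_euclidean_semiring_class.cong_def)
  next
    fix y assume y: "y \<in> {(u, v) \<in> {0..<m} \<times> {0..<m}. P u v} \<times> {(u, v) \<in> {0..<n} \<times> {0..<n}. Q u v}"
    obtain u v u' v' where yy: "y = ((u, v), (u', v'))" by (metis prod.exhaust)
    have ex: "\<exists>x\<in>{0..<m*n}. [x = s] (mod m) \<and> [x = t] (mod n)" for s t
    proof -
      obtain x where x: "[x = s] (mod m)" "[x = t] (mod n)"
        using binary_chinese_remainder_int[OF mn(1)] by blast
      have "[x mod (m*n) = s] (mod m)" "[x mod (m*n) = t] (mod n)"
        using x by (auto simp: unique_euclidean_semiring_class.cong_def mod_mod_cancel)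
      then show ?thesis using mn by (intro bexI[of _ "x mod (m*n)"]) auto
    qed
    obtain x where x: "x \<in> {0..<m*n}" "[x = u] (mod m)" "[x = u'] (mod n)" using ex by blast
    obtain z where z: "z \<in> {0..<m*n}" "[z = v] (mod m)" "[z = v'] (mod n)" using ex by blast
    have "P x z" "Q x z" using P[OF x(2) z(2)] Q[OF x(3) z(3)] y yy by auto
    moreover have "?f (x, z) = y" using y yy x z by (auto simp: unique_euclidean_semiring_class.cong_def)
    ultimately show "\<exists>x\<in>{(u, v) \<in> {0..<m*n} \<times> {0..<m*n}. P u v \<and> Q u v}. y = ?f x"
      using x(1) z(1) by (intro bexI[of _ "(x, z)"]) auto
  qed
  from bij_betw_same_card[OF this] show ?thesis by (simp add: card_cartesian_product)
qed

text \<open>A nonzero linear form over the field with p elements has a one-dimensional kernel; solve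
  for a variable whose coefficient is invertible.\<close>

lemma card_linear_form_zeros:
  fixes a b :: int
  assumes p: "prime p" and ab: "\<not> (int p dvd a \<and> int p dvd b)"
  shows "card {(u, v) \<in> {0..<int p} \<times> {0..<int p}. int p dvd a * u + b * v} = p"
proof -
  have p0: "int p > 0" using p prime_gt_0_nat by simp
  have pp: "prime (int p)" using p by simp
  show ?thesis
  proof (cases "int p dvd a")
    case True
    then have b: "\<not> int p dvd b" using ab by simp
    have "int p dvd a * u + b * v \<longleftrightarrow> int p dvd v" for u v
      using True b pp by (simp add: dvd_add_right_iff prime_dvd_mult_iff)
    moreover have "int p dvd v \<longleftrightarrow> v = 0" if "v \<in> {0..<int p}" for v
      using that zdvd_imp_le by force
    ultimately have "{(u, v) \<in> {0..<int p} \<times> {0..<int p}. int p dvd a * u + b * v} = {0..<int p} \<times> {0}"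
      using p0 by auto
    then show ?thesis by (simp add: card_cartesian_product)
  next
    case False
    then have "coprime a (int p)" using prime_imp_coprime[OF pp, of a] by (simp add: coprime_commute)
    then obtain a' where a': "[a * a' = 1] (mod int p)" using cong_solve_coprime_int by blast
    have eq: "int p dvd a * u + b * v \<longleftrightarrow> [u = - a' * b * v] (mod int p)" for u v
    proof
      assume "int p dvd a * u + b * v"
      then have "[a * u + b * v = 0] (mod int p)" by (simp add: cong_0_iff)
      then have "[a' * (a * u + b * v) = 0] (mod int p)" using cong_scalar_left[of _ 0 _ a'] by fastforce
      then have 1: "[a * a' * u + a' * b * v = 0] (mod int p)" by (simp add: algebra_simps)
      have "[a * a' * u + a' * b * v = 1 * u + a' * b * v] (mod int p)"
        using a' by (intro cong_add cong_mult) auto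
      from cong_trans[OF cong_sym[OF this] 1] have "[u + a' * b * v = 0] (mod int p)" by simp
      then show "[u = - a' * b * v] (mod int p)" by (simp add: cong_iff_dvd_diff algebra_simps)
    next
      assume "[u = - a' * b * v] (mod int p)"
      then have "[a * u = a * (- a' * b * v)] (mod int p)" by (rule cong_scalar_left)
      moreover have "[(a * a') * (- b * v) = 1 * (- b * v)] (mod int p)"
        using a' by (rule cong_scalar_right)
      ultimately have "[a * u = - b * v] (mod int p)" by (auto simp: algebra_simps intro: cong_trans)
      then show "int p dvd a * u + b * v" by (simp add: cong_iff_dvd_diff)
    qed
    have "{(u, v) \<in> {0..<int p} \<times> {0..<int p}. int p dvd a * u + b * v} =
        (\<lambda>v. ((- a' * b * v) mod int p, v)) ` {0..<int p}"
      unfolding eq using p0 by (auto simp: unique_euclidean_semiring_class.cong_def)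
    moreover have "inj_on (\<lambda>v. ((- a' * b * v) mod int p, v)) {0..<int p}" by (auto simp: inj_on_def)
    ultimately show ?thesis by (simp add: card_image)
  qed
qed

text \<open>The shape that the coprimality conditions on a conic take in the parameters (u, v):
  modulo each prime concerned, a single linear form must not vanish.\<close>

definition avoids :: "nat set \<Rightarrow> (nat \<Rightarrow> int) \<Rightarrow> (nat \<Rightarrow> int) \<Rightarrow> int \<Rightarrow> int \<Rightarrow> bool" where
  "avoids A \<alpha> \<beta> u v \<longleftrightarrow> (\<forall>p\<in>A. \<not> int p dvd \<alpha> p * u + \<beta> p * v)"

lemma avoids_periodic:
  assumes "\<And>p. p \<in> A \<Longrightarrow> int p dvd m" "[u = u'] (mod m)" "[v = v'] (mod m)"
  shows "avoids A \<alpha> \<beta> u v = avoids A \<alpha> \<beta> u' v'"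
proof -
  have "int p dvd \<alpha> p * u + \<beta> p * v \<longleftrightarrow> int p dvd \<alpha> p * u' + \<beta> p * v'" if "p \<in> A" for p
  proof -
    have "[u = u'] (mod int p)" "[v = v'] (mod int p)" using assms that cong_dvd_modulus by blast+
    then have "[\<alpha> p * u + \<beta> p * v = \<alpha> p * u' + \<beta> p * v'] (mod int p)"
      by (intro cong_add cong_mult) auto
    then show ?thesis by (rule cong_dvd_iff)
  qed
  then show ?thesis unfolding avoids_def by blast
qed

text \<open>The primes are independent by the Chinese remainder theorem, and each removes a line,
  that is a proportion 1/p of all pairs.\<close>

lemma card_avoids:
  assumes "finite A" "\<And>p. p \<in> A \<Longrightarrow> prime p" "\<And>p. p \<in> A \<Longrightarrow> \<not> (int p dvd \<alpha> p \<and> int p dvd \<beta> p)"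
  shows "real (card {(u, v) \<in> {0..<int (\<Prod>A)} \<times> {0..<int (\<Prod>A)}. avoids A \<alpha> \<beta> u v}) =
    (real (\<Prod>A))\<^sup>2 * (\<Prod>p\<in>A. 1 - 1 / real p)"
  using assms
proof (induction A rule: finite_induct)
  case empty
  have "{(u, v). 0 \<le> u \<and> u < 1 \<and> 0 \<le> v \<and> v < 1} = {(0::int, 0::int)}" by auto
  then show ?case by (simp add: avoids_def) 
next
  case (insert p A)
  have p: "prime p" "\<And>q. q \<in> A \<Longrightarrow> prime q" using insert by auto
  have cop: "coprime (int p) (int (\<Prod>A))"
  proof -
    have "coprime p (\<Prod>A)"
      using insert.hyps p by (intro prod_coprime_right) (metis primes_coprime)
    then show ?thesis by (simp only: coprime_int_iff)
  qed
  have pos: "int p > 0" "int (\<Prod>A) > 0" using p prime_gt_0_nat by (auto simp flip: of_nat_prod intro!: prod_pos)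
  let ?P = "\<lambda>u v. avoids {p} \<alpha> \<beta> u v" and ?Q = "\<lambda>u v. avoids A \<alpha> \<beta> u v"
  have "card {(u, v) \<in> {0..<int p * int (\<Prod>A)} \<times> {0..<int p * int (\<Prod>A)}. ?P u v \<and> ?Q u v} =
    card {(u, v) \<in> {0..<int p} \<times> {0..<int p}. ?P u v} *
    card {(u, v) \<in> {0..<int (\<Prod>A)} \<times> {0..<int (\<Prod>A)}. ?Q u v}"
  proof (rule card_periodic_prod[OF cop pos])
    show "?P u v = ?P u' v'" if "[u = u'] (mod int p)" "[v = v'] (mod int p)" for u v u' v'
      using that by (intro avoids_periodic[of _ "int p"]) auto
    show "?Q u v = ?Q u' v'" if "[u = u'] (mod int (\<Prod>A))" "[v = v'] (mod int (\<Prod>A))" for u v u' v'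
      using that by (intro avoids_periodic[of _ "int (\<Prod>A)"]) (use insert.hyps dvd_prodI[of A _ "\<lambda>x. x"] in auto)
  qed
  also have "{(u, v) \<in> {0..<int p} \<times> {0..<int p}. ?P u v} = {0..<int p} \<times> {0..<int p} -
      {(u, v) \<in> {0..<int p} \<times> {0..<int p}. int p dvd \<alpha> p * u + \<beta> p * v}"
    by (auto simp: avoids_def)
  also have "card \<dots> = p * p - p"
    using card_linear_form_zeros[OF p(1), of "\<alpha> p" "\<beta> p"] insert.prems(2)[of p]
    by (subst card_Diff_subset) (auto simp: card_cartesian_product intro: finite_subset[of _ "{0..<int p} \<times> {0..<int p}"])
  finally have eq: "card {(u, v) \<in> {0..<int p * int (\<Prod>A)} \<times> {0..<int p * int (\<Prod>A)}. ?P u v \<and> ?Q u v} =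
    (p * p - p) * card {(u, v) \<in> {0..<int (\<Prod>A)} \<times> {0..<int (\<Prod>A)}. ?Q u v}" .
  have av: "avoids (insert p A) \<alpha> \<beta> u v \<longleftrightarrow> ?P u v \<and> ?Q u v" for u v
    by (auto simp: avoids_def)
  have "real (p * p - p) = real p ^ 2 * (1 - 1 / real p)"
    using pos by (simp add: of_nat_diff power2_eq_square field_simps)
  then have "real (card {(u, v) \<in> {0..<int p * int (\<Prod>A)} \<times> {0..<int p * int (\<Prod>A)}. ?P u v \<and> ?Q u v}) =
    (real p)\<^sup>2 * (1 - 1 / real p) * ((real (\<Prod>A))\<^sup>2 * (\<Prod>p\<in>A. 1 - 1 / real p))"
    using eq insert.IH insert.prems by simp
  then show ?case using insert.hyps av by (simp add: power_mult_distrib mult_ac)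
qed

section \<open>From all lattice points to coprime ones\<close>

lemma coprime_zeta_two:
  fixes A :: "nat set"
  assumes "finite A" "\<And>p. p \<in> A \<Longrightarrow> prime p"
  shows "(\<lambda>n. if n \<ge> 1 \<and> (\<forall>p\<in>A. \<not> p dvd n) then 1 / (real n)\<^sup>2 else 0) sums
    (pi\<^sup>2 / 6 * (\<Prod>p\<in>A. 1 - 1 / (real p)\<^sup>2))"
  using assms
proof (induction A rule: finite_induct)
  case empty
  have "(\<lambda>n. if n \<ge> 1 then 1 / (real n)\<^sup>2 else 0) sums (pi\<^sup>2 / 6)"
    using inverse_squares_sums sums_Suc_iff[of "\<lambda>n. if n \<ge> 1 then 1 / (real n)\<^sup>2 else 0" "pi\<^sup>2/6"]
    by (simp add: add.commute)
  then show ?case by simp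
next
  case (insert p A)
  let ?w = "\<lambda>A n. if n \<ge> 1 \<and> (\<forall>p\<in>A. \<not> p dvd n) then 1 / (real n)\<^sup>2 else 0"
  let ?z = "pi\<^sup>2 / 6 * (\<Prod>p\<in>A. 1 - 1 / (real p)\<^sup>2)"
  have p: "prime p" "p > 0" using insert prime_gt_0_nat by auto
  have IH: "?w A sums ?z" using insert by simp
  have "(\<lambda>n. ?w A n / (real p)\<^sup>2) sums (?z / (real p)\<^sup>2)" by (rule sums_divide[OF IH])
  moreover have "?w A n / (real p)\<^sup>2 = (\<lambda>n. if p dvd n then ?w A n else 0) (p * n)" for n
  proof -
    have "q dvd p * n \<longleftrightarrow> q dvd n" if "q \<in> A" for q
      using that insert p by (metis primes_dvd_imp_eq prime_dvd_mult_iff insertI1 insertI2)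
    then show ?thesis using p by (auto simp: power_mult_distrib)
  qed
  \<comment> \<open>The terms with p dividing n form the whole series scaled by 1/p^2, because the
    other primes of A divide p n exactly when they divide n. Subtracting them removes the Euler
    factor at p.\<close>
  ultimately have "(\<lambda>n. (\<lambda>n. if p dvd n then ?w A n else 0) (p * n)) sums (?z / (real p)\<^sup>2)" by simp
  then have "(\<lambda>n. if p dvd n then ?w A n else 0) sums (?z / (real p)\<^sup>2)"
    using p by (subst (asm) sums_mono_reindex) (auto simp: strict_mono_def elim!: dvdE)
  from sums_diff[OF IH this] have "(\<lambda>n. ?w A n - (if p dvd n then ?w A n else 0)) sums (?z - ?z / (real p)\<^sup>2)" .
  moreover have "(\<lambda>n. ?w A n - (if p dvd n then ?w A n else 0)) = ?w (insert p A)" by auto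
  ultimately show ?case using insert.hyps by (simp add: algebra_simps)
qed

text \<open>Inverting \<open>A(X) = \<Sum>w(n) \<phi>(X/n\<^sup>2)\<close>: if the deviation of \<open>\<phi>\<close> from its expected limit is eventually at
  most \<open>M\<close>, it is eventually at most \<open>s M\<close> for some \<open>s < 1\<close>.\<close>

lemma convolution_inversion_limit:
  fixes w :: "nat \<Rightarrow> real" and \<phi> :: "real \<Rightarrow> real"
  assumes w: "w sums W" "\<And>n. w n \<ge> 0" "w 0 = 0" "w 1 = 1" "W < 2"
    and bound: "\<And>X. \<bar>\<phi> X\<bar> \<le> C"
    and lim: "((\<lambda>X. suminf (\<lambda>n. w n * \<phi> (X / (real n)\<^sup>2))) \<longlongrightarrow> L) at_top"
  shows "(\<phi> \<longlongrightarrow> L / W) at_top"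
proof -
  \<comment> \<open>The term n = 1 is the unknown itself. The remaining weights have total s = W - 1
    < 1, which makes the inversion a contraction.\<close>
  define w' where "w' n = (if n = 1 then 0 else w n)" for n
  define s where "s = W - 1"
  have "(\<lambda>n. w n - (if n = 1 then 1 else 0)) sums (W - 1)"
    by (rule sums_diff[OF w(1)]) (use sums_single[of 1 "\<lambda>_. 1::real"] in simp)
  moreover have "(\<lambda>n. w n - (if n = 1 then 1 else 0)) = w'" using w(4) by (auto simp: w'_def)
  ultimately have w': "w' sums s" by (simp add: s_def)
  have w'_nn: "w' n \<ge> 0" for n using w(2) by (simp add: w'_def)
  have s0: "s \<ge> 0" using sums_le[OF w'_nn sums_zero w'] by simp
  have W: "W > 0" using s0 by (simp add: s_def)
  define l where "l = L / W"
  have C0: "C \<ge> 0" using bound[of 0] by linarith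
  have sumw: "summable (\<lambda>n. w' n * f n)" if "\<And>n. \<bar>f n\<bar> \<le> K" for f K
  proof (rule summable_comparison_test')
    show "summable (\<lambda>n. w' n * K)" using w' by (intro summable_mult2) (auto simp: sums_iff)
    show "norm (w' n * f n) \<le> w' n * K" if "n \<ge> 0" for n
      using \<open>\<And>n. \<bar>f n\<bar> \<le> K\<close> w'_nn by (simp add: abs_mult mult_left_mono)
  qed
  have expand: "\<phi> X - l = ((suminf (\<lambda>n. w n * \<phi> (X / (real n)\<^sup>2))) - L) - (suminf (\<lambda>n. w' n * (\<phi> (X / (real n)\<^sup>2) - l)))" for X
  proof -
    have "summable (\<lambda>n. w' n * \<phi> (X / (real n)\<^sup>2))" using sumw[of "\<lambda>n. \<phi> (X / (real n)\<^sup>2)" C] bound by simp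
    then have 1: "(\<lambda>n. w' n * \<phi> (X / (real n)\<^sup>2)) sums (suminf (\<lambda>n. w' n * \<phi> (X / (real n)\<^sup>2)))" (is "_ sums ?S")
      by (rule summable_sums)
    have 2: "(\<lambda>n. w' n * l) sums (s * l)" by (rule sums_mult2[OF w'])
    have "(\<lambda>n. w' n * (\<phi> (X / (real n)\<^sup>2) - l)) sums (?S - s * l)"
      using sums_diff[OF 1 2] by (simp add: algebra_simps)
    then have 3: "(suminf (\<lambda>n. w' n * (\<phi> (X / (real n)\<^sup>2) - l))) = ?S - s * l" by (rule sums_unique[symmetric])
    have "(\<lambda>n. w' n * \<phi> (X / (real n)\<^sup>2) + (if n = 1 then \<phi> X else 0)) sums (?S + \<phi> X)"
      by (rule sums_add[OF 1]) (use sums_single[of 1 "\<lambda>_. \<phi> X"] in simp)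
    moreover have "(\<lambda>n. w' n * \<phi> (X / (real n)\<^sup>2) + (if n = 1 then \<phi> X else 0)) = (\<lambda>n. w n * \<phi> (X / (real n)\<^sup>2))"
      using w(4) by (auto simp: w'_def)
    ultimately have "(\<lambda>n. w n * \<phi> (X / (real n)\<^sup>2)) sums (?S + \<phi> X)" by simp
    then have "(suminf (\<lambda>n. w n * \<phi> (X / (real n)\<^sup>2))) = ?S + \<phi> X" by (rule sums_unique[symmetric])
    moreover have "L = l + s * l" using W by (simp add: l_def s_def field_simps)
    ultimately show ?thesis using 3 by simp
  qed
  \<comment> \<open>A ratio strictly between s and 1; the gap q - s pays for the two errors e
    below.\<close>
  define q where "q = (1 + s) / 2"
  have q: "s < q" "q < 1" "q > 0" using w(5) s0 by (auto simp: q_def s_def)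
  have step: "eventually (\<lambda>X. \<bar>\<phi> X - l\<bar> \<le> q * M) at_top"
    if M: "M > 0" and ev: "eventually (\<lambda>X. \<bar>\<phi> X - l\<bar> \<le> M) at_top" for M
  proof -
    define K where "K = max (C + \<bar>l\<bar>) M"
    \<comment> \<open>With the maximum, the summands dominate the deviations and each is eventually
      equal to \<open>w' n * M\<close>, so Tannery's theorem exchanges the limit and the
      sum.\<close>
    define g where "g n X = w' n * max \<bar>\<phi> (X / (real n)\<^sup>2) - l\<bar> M" for n X
    have gb: "max \<bar>\<phi> Y - l\<bar> M \<le> K" for Y using bound[of Y] unfolding K_def by linarith
    have "eventually (\<lambda>X. summable (\<lambda>n. norm (g n X))) at_top \<and> summable (\<lambda>n. norm (w' n * M)) \<and>
       ((\<lambda>X. suminf (\<lambda>n. g n X)) \<longlongrightarrow> suminf (\<lambda>n. w' n * M)) at_top"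
    proof (rule tannerys_theorem)
      show "((\<lambda>X. g n X) \<longlongrightarrow> w' n * M) at_top" for n
      proof (cases "n = 0")
        case True
        then show ?thesis using w(3) by (simp add: g_def w'_def)
      next
        case False
        have "filterlim (\<lambda>X. X / (real n)\<^sup>2) at_top at_top"
          using False filterlim_tendsto_pos_mult_at_top[OF tendsto_const, of "1 / (real n)\<^sup>2" "\<lambda>x. x" at_top]
          by (simp add: filterlim_ident)
        then have "eventually (\<lambda>X. \<bar>\<phi> (X / (real n)\<^sup>2) - l\<bar> \<le> M) at_top"
          using ev by (rule eventually_compose_filterlim[rotated])
        then have "eventually (\<lambda>X. g n X = w' n * M) at_top"
          by eventually_elim (auto simp: g_def max_def)
        then show ?thesis by (rule tendsto_eventually)
      qed
      have "norm (g n X) \<le> w' n * K" for n X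
        using gb M w'_nn by (simp add: g_def abs_mult mult_left_mono)
      then show "eventually (\<lambda>(n, X). norm (g n X) \<le> w' n * K) (at_top \<times>\<^sub>F at_top)"
        by (intro always_eventually) auto
      show "summable (\<lambda>n. w' n * K)" using w' by (intro summable_mult2) (auto simp: sums_iff)
    qed simp
    then have "((\<lambda>X. suminf (\<lambda>n. g n X)) \<longlongrightarrow> s * M) at_top"
      using sums_unique[OF sums_mult2[OF w', of M]] by simp
    moreover define e where "e = (q - s) * M / 2"
    have "e > 0" using q M by (simp add: e_def)
    ultimately have "eventually (\<lambda>X. suminf (\<lambda>n. g n X) < s * M + e) at_top"
      using order_tendstoD(2)[of _ "s * M" at_top "s * M + e"] by simp
    moreover have "eventually (\<lambda>X. \<bar>(suminf (\<lambda>n. w n * \<phi> (X / (real n)\<^sup>2))) - L\<bar> < e) at_top"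
      using lim \<open>e > 0\<close> by (auto simp: tendsto_iff dist_real_def)
    ultimately show ?thesis
    proof eventually_elim
      case (elim X)
      have "summable (\<lambda>n. g n X)" unfolding g_def
        by (rule sumw[of _ K]) (use gb M in auto)
      moreover have "norm (w' n * (\<phi> (X / (real n)\<^sup>2) - l)) \<le> g n X" for n
        using w'_nn by (simp add: g_def abs_mult mult_left_mono)
      ultimately have "\<bar>suminf (\<lambda>n. w' n * (\<phi> (X / (real n)\<^sup>2) - l))\<bar> \<le> (suminf (\<lambda>n. g n X))"
        using norm_suminf_le[of "\<lambda>n. w' n * (\<phi> (X / (real n)\<^sup>2) - l)" "\<lambda>n. g n X"] by simp
      then have "\<bar>\<phi> X - l\<bar> \<le> s * M + 2 * e" using expand[of X] elim by linarith
      also have "s * M + 2 * e = q * M" by (simp add: e_def field_simps)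
      finally show ?case .
    qed
  qed
  have it: "eventually (\<lambda>X. \<bar>\<phi> X - l\<bar> \<le> q ^ k * (C + \<bar>l\<bar> + 1)) at_top" for k
  proof (induction k)
    case 0
    have "\<bar>\<phi> X - l\<bar> \<le> C + \<bar>l\<bar> + 1" for X using bound[of X] by linarith
    then show ?case by simp
  next
    case (Suc k)
    have "q ^ k * (C + \<bar>l\<bar> + 1) > 0" using q C0 by (intro mult_pos_pos) auto
    from step[OF this Suc] show ?case by (simp add: mult.assoc)
  qed
  have "(\<lambda>k. q ^ k * (C + \<bar>l\<bar> + 1)) \<longlonglongrightarrow> 0"
    using q by (intro tendsto_mult_left_zero LIMSEQ_power_zero) auto
  show ?thesis unfolding l_def[symmetric]
  proof (rule tendstoI)
    fix e :: real assume "e > 0"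
    then have "eventually (\<lambda>k. q ^ k * (C + \<bar>l\<bar> + 1) < e) sequentially"
      using order_tendstoD(2)[OF \<open>(\<lambda>k. q ^ k * (C + \<bar>l\<bar> + 1)) \<longlonglongrightarrow> 0\<close>] by simp
    then obtain k where "q ^ k * (C + \<bar>l\<bar> + 1) < e" by (auto simp: eventually_sequentially)
    then show "eventually (\<lambda>X. dist (\<phi> X) l < e) at_top"
      using it[of k] by (auto simp: dist_real_def elim: eventually_mono)
  qed
qed

text \<open>Every vector that avoids the lines is n times a coprime one with n prime to A, and the
  form scales by n^2. So the count of all such vectors is a convolution of the coprime counts with
  the weights 1/n^2, which can be inverted. With d the square root of 4 a c - b^2, the constant is
  (2 pi / d) times the product of 1 - 1/p, divided by pi^2/6 times the product of 1 - 1/p^2.\<close>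

lemma coprime_lattice_count:
  fixes a b c :: int and A :: "nat set"
  assumes a: "a > 0" and D: "4*a*c - b\<^sup>2 > 0"
    and A: "finite A" "\<And>p. p \<in> A \<Longrightarrow> prime p" "2 \<in> A"
    and \<alpha>\<beta>: "\<And>p. p \<in> A \<Longrightarrow> \<not> (int p dvd \<alpha> p \<and> int p dvd \<beta> p)"
  defines "P \<equiv> \<lambda>X::real. {(u, v). coprime u v \<and> avoids A \<alpha> \<beta> u v \<and> real_of_int (a*u\<^sup>2 + b*u * v + c * v\<^sup>2) \<le> X}"
  shows "finite (P X)"
    and "((\<lambda>X. real (card (P X)) / X) \<longlongrightarrow>
      12 / (pi * sqrt (real_of_int (4*a*c - b\<^sup>2))) * (\<Prod>p\<in>A. inverse (1 + 1 / real p))) at_top"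
proof -
  define g where "g u v = a*u\<^sup>2 + b*u * v + c * v\<^sup>2" for u v
  define d where "d = sqrt (real_of_int (4*a*c - b\<^sup>2))"
  have d: "d > 0" using D unfolding d_def by (metis of_int_0_less_iff real_sqrt_gt_zero)
  interpret E: ellipse "real_of_int a" "real_of_int b" "real_of_int c"
  proof
    show "0 < real_of_int a" using a by simp
    have "0 < real_of_int (4*a*c - b\<^sup>2)" using D by (simp only: of_int_0_less_iff)
    then show "0 < 4 * real_of_int a * real_of_int c - (real_of_int b)\<^sup>2" by simp
  qed
  have Dd: "sqrt E.D = d" unfolding E.D_def d_def by simp
  define All where "All X = {(u, v). avoids A \<alpha> \<beta> u v \<and> real_of_int (g u v) \<le> X}" for X
  define Lc where "Lc i j X = {(u, v). [u = i] (mod int (\<Prod>A)) \<and> [v = j] (mod int (\<Prod>A)) \<and> real_of_int (g u v) \<le> X}" for i j X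
  define m where "m = int (\<Prod>A)"
  have m: "m > 0" using A prime_gt_0_nat unfolding m_def by (simp del: of_nat_prod add: prod_pos)
  have Lc_eq: "Lc i j X = {(u, v). [u = i] (mod m) \<and> [v = j] (mod m) \<and>
     real_of_int a*(real_of_int u)\<^sup>2 + real_of_int b*real_of_int u*real_of_int v + real_of_int c*(real_of_int v)\<^sup>2 \<le> X}" for i j X
    unfolding Lc_def m_def g_def by simp
  have finLc: "finite (Lc i j X)" for i j X
    unfolding Lc_eq using E.lattice_count_real(1)[OF m] by blast
  have limLc: "((\<lambda>X. real (card (Lc i j X)) / X) \<longlongrightarrow> 2 * pi / (d * (of_int m)\<^sup>2)) at_top" for i j
    unfolding Lc_eq using E.lattice_count_real(2)[OF m] Dd by simp
  define G where "G = {(u, v) \<in> {0..<m} \<times> {0..<m}. avoids A \<alpha> \<beta> u v}"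
  have finG: "finite G" unfolding G_def by (rule finite_subset[of _ "{0..<m} \<times> {0..<m}"]) auto
  have cardG: "real (card G) = (of_int m)\<^sup>2 * (\<Prod>p\<in>A. 1 - 1 / real p)"
    using card_avoids[OF A(1,2) \<alpha>\<beta>] unfolding G_def m_def by simp
  have per: "avoids A \<alpha> \<beta> u v = avoids A \<alpha> \<beta> u' v'" if "[u = u'] (mod m)" "[v = v'] (mod m)" for u v u' v'
  proof (rule avoids_periodic[OF _ that])
    show "int p dvd m" if "p \<in> A" for p
      unfolding m_def of_nat_dvd_iff using dvd_prodI[OF A(1) that, of "\<lambda>x. x"] by simp
  qed
  have All_eq: "All X = (\<Union>(i, j)\<in>G. Lc i j X)" for X
  proof (intro equalityI subsetI)
    fix x assume x: "x \<in> All X"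
    obtain u v where uv: "x = (u, v)" by fastforce
    have "avoids A \<alpha> \<beta> (u mod m) (v mod m)"
      using x uv per[of "u mod m" u "v mod m" v] by (simp add: All_def unique_euclidean_semiring_class.cong_def)
    then have "(u mod m, v mod m) \<in> G" using m by (simp add: G_def)
    moreover have "x \<in> Lc (u mod m) (v mod m) X"
      using x uv by (simp add: Lc_def All_def m_def[symmetric] unique_euclidean_semiring_class.cong_def del: of_nat_prod)
    ultimately show "x \<in> (\<Union>(i, j)\<in>G. Lc i j X)" by blast
  next
    fix x assume "x \<in> (\<Union>(i, j)\<in>G. Lc i j X)"
    then show "x \<in> All X" using per by (auto simp: G_def Lc_def All_def m_def[symmetric] simp del: of_nat_prod)
  qed
  have finAll: "finite (All X)" for X unfolding All_eq using finG finLc by auto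
  have cardAll: "card (All X) = (\<Sum>(i, j)\<in>G. card (Lc i j X))" for X
    unfolding All_eq split_def
  proof (subst card_UN_disjoint)
    show "\<forall>p\<in>G. \<forall>q\<in>G. p \<noteq> q \<longrightarrow> Lc (fst p) (snd p) X \<inter> Lc (fst q) (snd q) X = {}"
    proof (intro ballI impI)
      fix p q assume pq: "p \<in> G" "q \<in> G" "p \<noteq> q"
      have "fst p = fst q \<and> snd p = snd q" if "x \<in> Lc (fst p) (snd p) X" "x \<in> Lc (fst q) (snd q) X" for x
      proof -
        have "[fst p = fst q] (mod m)" "[snd p = snd q] (mod m)"
          using that by (auto simp: Lc_eq intro: cong_trans[OF cong_sym])
        then show ?thesis using pq cong_less_imp_eq_int unfolding G_def by auto
      qed
      then show "Lc (fst p) (snd p) X \<inter> Lc (fst q) (snd q) X = {}" using pq(3) by (auto simp: prod_eq_iff)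
    qed
  qed (use finG finLc in auto)
  define L where "L = 2 * pi / d * (\<Prod>p\<in>A. 1 - 1 / real p)"
  have limAll: "((\<lambda>X. real (card (All X)) / X) \<longlongrightarrow> L) at_top"
  proof -
    have "((\<lambda>X. \<Sum>(i, j)\<in>G. real (card (Lc i j X)) / X) \<longlongrightarrow> (\<Sum>(i, j)\<in>G. 2 * pi / (d * (of_int m)\<^sup>2))) at_top"
      unfolding split_def by (intro tendsto_sum limLc)
    moreover have "(\<Sum>(i, j)\<in>G. real (card (Lc i j X)) / X) = real (card (All X)) / X" for X
      by (simp add: cardAll split_def sum_divide_distrib)
    moreover have "(\<Sum>(i, j)\<in>G. 2 * pi / (d * (of_int m)\<^sup>2)) = L"
      using m d by (simp add: cardG L_def)
    ultimately show ?thesis by simp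
  qed
  have P_eq: "P X = {(u, v). coprime u v \<and> avoids A \<alpha> \<beta> u v \<and> real_of_int (g u v) \<le> X}" for X
    unfolding P_def g_def ..
  have P_sub: "P X \<subseteq> All X" for X unfolding P_eq All_def by auto
  then show finP: "finite (P X)" for X using finAll finite_subset by blast
  have g_pos: "g u v \<ge> 1" if "(u, v) \<noteq> (0, 0)" for u v
  proof -
    have "4 * a * g u v = (2*a*u + b * v)\<^sup>2 + (4*a*c - b\<^sup>2) * v\<^sup>2"
      unfolding g_def by (simp add: power2_eq_square algebra_simps)
    moreover have "(2*a*u + b * v)\<^sup>2 + (4*a*c - b\<^sup>2) * v\<^sup>2 > 0"
    proof (cases "v = 0")
      case True
      then show ?thesis using that a by simp
    next
      case False
      then show ?thesis using D by (intro add_nonneg_pos mult_pos_pos) auto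
    qed
    ultimately have "0 < 4 * a * g u v" by simp
    then show ?thesis using a by (simp add: zero_less_mult_iff)
  qed
  \<comment> \<open>Membership of 2 in A excludes the zero vector from every count.\<close>
  have not00: "\<not> avoids A \<alpha> \<beta> 0 0" using A(3) by (auto simp: avoids_def)
  have P_empty: "P X = {}" if "X < 1" for X
  proof -
    have "\<not> real_of_int (g u v) \<le> X" if "avoids A \<alpha> \<beta> u v" for u v
    proof -
      have "(u, v) \<noteq> (0, 0)" using that not00 by auto
      from g_pos[OF this] have "real_of_int (g u v) \<ge> 1" by simp
      then show ?thesis using \<open>X < 1\<close> by linarith
    qed
    then show ?thesis by (auto simp: P_eq)
  qed
  define w where "w n = (if n \<ge> 1 \<and> (\<forall>p\<in>A. \<not> p dvd n) then 1 / (real n)\<^sup>2 else 0)" for n :: nat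
  define W where "W = pi\<^sup>2 / 6 * (\<Prod>p\<in>A. 1 - 1 / (real p)\<^sup>2)"
  have w: "w sums W" unfolding w_def W_def by (rule coprime_zeta_two[OF A(1,2)])
  define \<phi> where "\<phi> X = real (card (P X)) / X" for X
  have \<phi>_small: "\<phi> X = 0" if "X < 1" for X using P_empty[OF that] by (simp add: \<phi>_def)
  have scale_avoids: "avoids A \<alpha> \<beta> (int n * u) (int n * v) \<longleftrightarrow> (\<forall>p\<in>A. \<not> p dvd n) \<and> avoids A \<alpha> \<beta> u v" for n u v
  proof -
    have "int p dvd \<alpha> p * (int n * u) + \<beta> p * (int n * v) \<longleftrightarrow> p dvd n \<or> int p dvd \<alpha> p * u + \<beta> p * v"
      if "p \<in> A" for p
    proof -
      have "\<alpha> p * (int n * u) + \<beta> p * (int n * v) = int n * (\<alpha> p * u + \<beta> p * v)" by (simp add: algebra_simps)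
      then show ?thesis using A(2)[OF that] by (simp add: prime_dvd_mult_iff)
    qed
    then show ?thesis unfolding avoids_def by blast
  qed
  have decomp: "real (card (All X)) / X = suminf (\<lambda>n. w n * \<phi> (X / (real n)\<^sup>2))" if X: "X \<ge> 1" for X
  proof -
    \<comment> \<open>The form is at least 1 on nonzero integral vectors, so only multiples n with
      n^2 \<le> X occur and N is a safe cutoff.\<close>
    define N where "N = nat \<lceil>X\<rceil>"
    define I where "I = {n\<in>{1..N}. \<forall>p\<in>A. \<not> p dvd n}"
    define sc where "sc n = (\<lambda>(u, v). (int n * u, int n * v))" for n
    have All_dec: "All X = (\<Union>n\<in>I. sc n ` P (X / (real n)\<^sup>2))"
    proof (intro equalityI subsetI)
      fix x assume x: "x \<in> All X"
      obtain u v where uv: "x = (u, v)" by fastforce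
      have av: "avoids A \<alpha> \<beta> u v" "real_of_int (g u v) \<le> X" using x uv by (auto simp: All_def)
      then have nz: "(u, v) \<noteq> (0, 0)" using not00 by auto
      define n where "n = nat (gcd u v)"
      have n: "int n = gcd u v" unfolding n_def by simp
      have n1: "n \<ge> 1" using nz n by (metis One_nat_def Suc_leI gcd_eq_0_iff gr0I of_nat_0)
      define u' v' where "u' = u div int n" "v' = v div int n"
      have u'v': "u = int n * u'" "v = int n * v'" unfolding u'_v'_def n by auto
      have "coprime u' v'" unfolding u'_v'_def n by (rule div_gcd_coprime) (use nz in auto)
      moreover have "(\<forall>p\<in>A. \<not> p dvd n) \<and> avoids A \<alpha> \<beta> u' v'" using av(1) u'v' scale_avoids by simp
      moreover have gn: "g u v = (int n)\<^sup>2 * g u' v'" unfolding u'v' g_def by (simp add: power2_eq_square algebra_simps)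
      moreover have "real_of_int (g u' v') \<le> X / (real n)\<^sup>2"
        using av(2) n1 gn by (simp add: field_simps)
      moreover have "n \<le> N"
      proof -
        have "g u' v' \<ge> 1" using nz u'v' by (intro g_pos) auto
        then have "(int n)\<^sup>2 \<le> g u v" unfolding gn by (metis mult.commute mult_1 mult_right_mono zero_le_power2)
        moreover have "int n \<le> (int n)\<^sup>2" using n1 by (simp add: power2_eq_square)
        ultimately have "int n \<le> g u v" by linarith
        then have "real n \<le> real_of_int (g u v)" by (metis of_int_le_iff of_int_of_nat_eq)
        then have "real n \<le> X" using av(2) by linarith
        then show ?thesis unfolding N_def by linarith
      qed
      ultimately have "n \<in> I" "(u', v') \<in> P (X / (real n)\<^sup>2)" using n1 by (auto simp: I_def P_eq)
      moreover have "x = sc n (u', v')" using uv u'v' by (simp add: sc_def)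
      ultimately show "x \<in> (\<Union>n\<in>I. sc n ` P (X / (real n)\<^sup>2))" by blast
    next
      fix x assume "x \<in> (\<Union>n\<in>I. sc n ` P (X / (real n)\<^sup>2))"
      then obtain n u v where n: "n \<in> I" "(u, v) \<in> P (X / (real n)\<^sup>2)" "x = (int n * u, int n * v)"
        by (auto simp: sc_def)
      have "g (int n * u) (int n * v) = (int n)\<^sup>2 * g u v" unfolding g_def by (simp add: power2_eq_square algebra_simps)
      then show "x \<in> All X" using n scale_avoids by (auto simp: All_def P_eq I_def field_simps)
    qed
    have disj: "sc n ` P Y \<inter> sc k ` P Z = {}" if "n \<noteq> k" for n k Y Z
    proof -
      have False if "coprime u v" "coprime u' v'" "int n * u = int k * u'" "int n * v = int k * v'" for u v u' v'
      proof -
        have "gcd (int n * u) (int n * v) = int n" using that(1) by (simp add: gcd_mult_left)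
        moreover have "gcd (int k * u') (int k * v') = int k" using that(2) by (simp add: gcd_mult_left)
        ultimately show False using that(3,4) \<open>n \<noteq> k\<close> by simp
      qed
      then show ?thesis by (fastforce simp: sc_def P_eq)
    qed
    have "card (All X) = (\<Sum>n\<in>I. card (sc n ` P (X / (real n)\<^sup>2)))"
      unfolding All_dec by (rule card_UN_disjoint) (use finP disj in \<open>auto simp: I_def\<close>)
    also have "\<dots> = (\<Sum>n\<in>I. card (P (X / (real n)\<^sup>2)))"
      by (intro sum.cong refl card_image) (auto simp: I_def sc_def inj_on_def)
    finally have "real (card (All X)) / X = (\<Sum>n\<in>I. real (card (P (X / (real n)\<^sup>2))) / X)"
      by (simp add: sum_divide_distrib)
    also have "\<dots> = (\<Sum>n\<in>I. w n * \<phi> (X / (real n)\<^sup>2))"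
      using X by (intro sum.cong refl) (auto simp: I_def w_def \<phi>_def)
    also have "\<dots> = suminf (\<lambda>n. w n * \<phi> (X / (real n)\<^sup>2))"
    proof (rule suminf_finite[symmetric])
      show "w n * \<phi> (X / (real n)\<^sup>2) = 0" if "n \<notin> I" for n
      proof (cases "n \<ge> 1 \<and> (\<forall>p\<in>A. \<not> p dvd n)")
        case True
        then have "n > N" using that by (auto simp: I_def)
        then have n: "X < real n" unfolding N_def by linarith
        moreover have "real n * 1 \<le> real n * real n" using True by (intro mult_left_mono) auto
        ultimately have "X < (real n)\<^sup>2" by (simp add: power2_eq_square)
        then have "X / (real n)\<^sup>2 < 1" using True by (simp add: field_simps)
        then show ?thesis using \<phi>_small by simp
      qed (auto simp: w_def)
    qed (auto simp: I_def)
    finally show ?thesis .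
  qed
  have "(\<phi> \<longlongrightarrow> L / W) at_top"
  proof -
    obtain X0 where X0: "X0 \<ge> 1" "\<And>X. X \<ge> X0 \<Longrightarrow> real (card (All X)) / X < L + 1"
      using order_tendstoD(2)[OF limAll, of "L + 1"] unfolding eventually_at_top_linorder
      by (metis less_add_one linorder_le_cases order_trans)
    \<comment> \<open>A uniform bound for \<open>\<phi>\<close>: up to X0 the finite count at X0
      serves, because X \<ge> 1 there; beyond X0 the limit for all vectors takes over.\<close>
    define C where "C = max \<bar>L + 1\<bar> (real (card (All X0)))"
    show ?thesis
    proof (rule convolution_inversion_limit[OF w])
      show "w n \<ge> 0" for n by (simp add: w_def)
      show "w 0 = 0" by (simp add: w_def)
      show "w 1 = 1" using A(2) by (auto simp: w_def prime_nat_iff)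
      show "W < 2"
      proof -
        \<comment> \<open>The factor at 2 is 3/4, and then the crude bound pi < 4 suffices, since
          16/6 times 3/4 is 2.\<close>
        have "(\<Prod>p\<in>A. 1 - 1 / (real p)\<^sup>2) = (1 - 1 / 2\<^sup>2) * (\<Prod>p\<in>A - {2}. 1 - 1 / (real p)\<^sup>2)"
          using prod.remove[OF A(1,3), of "\<lambda>p. 1 - 1 / (real p)\<^sup>2"] by simp
        also have "(\<Prod>p\<in>A - {2}. 1 - 1 / (real p)\<^sup>2) \<le> 1"
        proof (intro prod_le_1 conjI)
          fix p assume "p \<in> A - {2}"
          then have "1 \<le> real p" using A(2) prime_ge_1_nat by fastforce
          then have "1 \<le> (real p)\<^sup>2" by (rule one_le_power)
          then show "0 \<le> 1 - 1 / (real p)\<^sup>2" by (auto simp: divide_le_eq_1)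
        qed simp
        finally have "(\<Prod>p\<in>A. 1 - 1 / (real p)\<^sup>2) \<le> 3 / 4" by simp
        then have "W \<le> pi\<^sup>2 / 6 * (3 / 4)" unfolding W_def by (intro mult_left_mono) auto
        also have "pi\<^sup>2 < 4\<^sup>2" using pi_less_4 pi_gt_zero by (intro power_strict_mono) auto
        then have "pi\<^sup>2 / 6 * (3 / 4) < 2" by simp
        finally show ?thesis .
      qed
      show "\<bar>\<phi> X\<bar> \<le> C" for X
      proof -
        consider "X < 1" | "1 \<le> X" "X \<le> X0" | "X \<ge> X0" by linarith
        then show ?thesis
        proof cases
          case 1
          then show ?thesis using \<phi>_small by (simp add: C_def)
        next
          case 2
          have "P X \<subseteq> All X0" using P_sub[of X] 2 by (auto simp: All_def)
          then have "card (P X) \<le> card (All X0)" using finAll card_mono by blast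
          moreover have "\<phi> X \<le> real (card (P X))" using 2 by (auto simp: \<phi>_def field_simps)
             (metis mult_left_mono mult_1 of_nat_0_le_iff mult.commute)
          moreover have "\<phi> X \<ge> 0" using 2 by (simp add: \<phi>_def)
          ultimately show ?thesis by (simp add: C_def)
        next
          case 3
          have "real (card (P X)) / X \<le> real (card (All X)) / X"
            using 3 X0 card_mono[OF finAll P_sub] by (intro divide_right_mono) auto
          then have "\<phi> X \<le> C" using X0(2)[OF 3] by (simp add: \<phi>_def C_def)
          moreover have "\<phi> X \<ge> 0" using 3 X0 by (simp add: \<phi>_def)
          ultimately show ?thesis by simp
        qed
      qed
      have "eventually (\<lambda>X. real (card (All X)) / X = suminf (\<lambda>n. w n * \<phi> (X / (real n)\<^sup>2))) at_top"
        using decomp by (auto simp: eventually_at_top_linorder)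
      then show "((\<lambda>X. suminf (\<lambda>n. w n * \<phi> (X / (real n)\<^sup>2))) \<longlongrightarrow> L) at_top"
        by (rule Lim_transform_eventually[OF limAll])
    qed
  qed
  moreover have "L / W = 12 / (pi * d) * (\<Prod>p\<in>A. inverse (1 + 1 / real p))"
  proof -
    have "(1 - 1 / real p) / (1 - 1 / (real p)\<^sup>2) = inverse (1 + 1 / real p)" if "p \<in> A" for p
    proof -
      have p: "real p > 1" using A(2)[OF that] prime_gt_1_nat by simp
      have "1 - 1 / (real p)\<^sup>2 = (1 - 1 / real p) * (1 + 1 / real p)"
        by (simp add: power2_eq_square algebra_simps)
      moreover have "1 - 1 / real p \<noteq> 0" using p by simp
      ultimately show ?thesis by (simp add: divide_inverse)
    qed
    then have "(\<Prod>p\<in>A. 1 - 1 / real p) / (\<Prod>p\<in>A. 1 - 1 / (real p)\<^sup>2) = (\<Prod>p\<in>A. inverse (1 + 1 / real p))"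
      by (simp flip: prod_dividef)
    moreover have "L / W = 12 / (pi * d) * ((\<Prod>p\<in>A. 1 - 1 / real p) / (\<Prod>p\<in>A. 1 - 1 / (real p)\<^sup>2))"
      using d unfolding L_def W_def by (simp add: power2_eq_square)
    ultimately show ?thesis by simp
  qed
  ultimately show "((\<lambda>X. real (card (P X)) / X) \<longlongrightarrow>
      12 / (pi * sqrt (real_of_int (4*a*c - b\<^sup>2))) * (\<Prod>p\<in>A. inverse (1 + 1 / real p))) at_top"
    unfolding \<phi>_def d_def by simp
qed

section \<open>Points on diagonal conics\<close>

text \<open>A linear functional l evaluated on the parametrized conic is a binary form in (u, v).
  Its discriminant is that of F on the plane l = 0, since both describe how the line l = 0 meets the
  conic. The functional is the cross product of two vectors p, q of the plane, and matrices of
  determinant 1 transport cross products.\<close>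

lemma sl3_row_disc:
  assumes det: "det3 a b c d e f g h i = 1"
    and F: "F \<circ> lin3 a b c d e f g h i = (\<lambda>(X, Y, Z). Y\<^sup>2 - X * Z)"
    and l: "l1 = p2 * q3 - p3 * q2" "l2 = p3 * q1 - p1 * q3" "l3 = p1 * q2 - p2 * q1"
  shows "(l1 * b + l2 * e + l3 * h)\<^sup>2 - 4 * (l1 * a + l2 * d + l3 * g) * (l1 * c + l2 * f + l3 * i) =
    (F (p1+q1, p2+q2, p3+q3) - F (p1, p2, p3) - F (q1, q2, q3))\<^sup>2 - 4 * F (p1, p2, p3) * F (q1, q2, q3)"
proof -
  have ex: "\<exists>x y z. s = a * x+b * y+c * z \<and> t = d * x+e * y+f * z \<and> u = g * x+h * y+i * z" for s t u :: int
  proof (intro exI conjI)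
    let ?x = "(e * i-f * h) * s + (c * h-b * i) * t + (b * f-c * e) * u"
    let ?y = "(f * g-d * i) * s + (a * i-c * g) * t + (c * d-a * f) * u"
    let ?z = "(d * h-e * g) * s + (b * g-a * h) * t + (a * e-b * d) * u"
    have "a * ?x+b * ?y+c * ?z = det3 a b c d e f g h i * s" "d * ?x+e * ?y+f * ?z = det3 a b c d e f g h i * t"
      "g * ?x+h * ?y+i * ?z = det3 a b c d e f g h i * u"
      unfolding det3_def by (simp_all add: algebra_simps)
    then show "s = a * ?x+b * ?y+c * ?z" "t = d * ?x+e * ?y+f * ?z" "u = g * ?x+h * ?y+i * ?z" using det by simp_all
  qed
  obtain x y z where P: "p1 = a * x+b * y+c * z" "p2 = d * x+e * y+f * z" "p3 = g * x+h * y+i * z" using ex by blast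
  obtain x' y' z' where Q: "q1 = a * x'+b * y'+c * z'" "q2 = d * x'+e * y'+f * z'" "q3 = g * x'+h * y'+i * z'" using ex by blast
  have FJ: "F (a * x+b * y+c * z, d * x+e * y+f * z, g * x+h * y+i * z) = y\<^sup>2 - x * z" for x y z
    using fun_cong[OF F, of "(x, y, z)"] by (simp add: lin3_def)
  have FP: "F (p1, p2, p3) = y\<^sup>2 - x * z" and FQ: "F (q1, q2, q3) = y'\<^sup>2 - x' * z'"
    unfolding P Q by (rule FJ)+
  have FPQ: "F (p1+q1, p2+q2, p3+q3) = (y+y')\<^sup>2 - (x+x') * (z+z')"
    using FJ[of "x+x'" "y+y'" "z+z'"] unfolding P Q by (simp add: algebra_simps)
  \<comment> \<open>Up to the determinant, l composed with the matrix is the cross product of the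
    preimages of p and q.\<close>
  have 1: "l1 * a + l2 * d + l3 * g = det3 a b c d e f g h i * (y * z'-z * y')"
    unfolding l P Q det3_def by (simp add: algebra_simps)
  have 2: "l1 * b + l2 * e + l3 * h = det3 a b c d e f g h i * (z * x'-x * z')"
    unfolding l P Q det3_def by (simp add: algebra_simps)
  have 3: "l1 * c + l2 * f + l3 * i = det3 a b c d e f g h i * (x * y'-y * x')"
    unfolding l P Q det3_def by (simp add: algebra_simps)
  show ?thesis unfolding 1 2 3 FP FQ FPQ det by (simp add: power2_eq_square algebra_simps)
qed

text \<open>Cramer's rule: the inverse matrix is integral.\<close>

lemma sl3_inj_dvd:
  assumes det: "det3 a b c d e f g h i = 1"
    and "k dvd a * x+b * y+c * z" "k dvd d * x+e * y+f * z" "k dvd g * x+h * y+i * z"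
  shows "k dvd x" "k dvd y" "k dvd z"
proof -
  let ?s = "a * x+b * y+c * z" and ?t = "d * x+e * y+f * z" and ?u = "g * x+h * y+i * z"
  have "(e * i-f * h) * ?s + (c * h-b * i) * ?t + (b * f-c * e) * ?u = det3 a b c d e f g h i * x"
    "(f * g-d * i) * ?s + (a * i-c * g) * ?t + (c * d-a * f) * ?u = det3 a b c d e f g h i * y"
    "(d * h-e * g) * ?s + (b * g-a * h) * ?t + (a * e-b * d) * ?u = det3 a b c d e f g h i * z"
    unfolding det3_def by (simp_all add: algebra_simps)
  then have "x = (e * i-f * h) * ?s + (c * h-b * i) * ?t + (b * f-c * e) * ?u"
    "y = (f * g-d * i) * ?s + (a * i-c * g) * ?t + (c * d-a * f) * ?u"
    "z = (d * h-e * g) * ?s + (b * g-a * h) * ?t + (a * e-b * d) * ?u" using det by simp_all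
  then show "k dvd x" "k dvd y" "k dvd z" using assms(2-4) by (metis dvd_add dvd_mult)+
qed

text \<open>A binary form of vanishing discriminant modulo p is a nonzero multiple of the square of
  a linear form. For p = 2 every residue is its own square; for odd p complete the square, unless
  \<alpha> vanishes, in which case \<beta> does too.\<close>

lemma degenerate_form_mod_prime:
  fixes \<alpha> \<beta> \<gamma> :: int
  assumes p: "prime p" and disc: "int p dvd \<beta>\<^sup>2 - 4 * \<alpha> * \<gamma>"
    and nz: "\<not> (int p dvd \<alpha> \<and> int p dvd \<beta> \<and> int p dvd \<gamma>)"
  shows "\<exists>s t. \<not> (int p dvd s \<and> int p dvd t) \<and>
    (\<forall>u v. int p dvd \<alpha> * u\<^sup>2 + \<beta> * u * v + \<gamma> * v\<^sup>2 \<longleftrightarrow> int p dvd s * u + t * v)"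
proof -
  have pp: "prime (int p)" using p by simp
  consider "p = 2" | "p \<noteq> 2" "int p dvd \<alpha>" | "p \<noteq> 2" "\<not> int p dvd \<alpha>" by blast
  then show ?thesis
  proof cases
    case 1
    then have "even \<beta>" using disc by (simp add: even_diff_iff)
    then have "even (\<alpha> * u\<^sup>2 + \<beta> * u * v + \<gamma> * v\<^sup>2) \<longleftrightarrow> even (\<alpha> * u + \<gamma> * v)" for u v by simp
    then show ?thesis using 1 nz \<open>even \<beta>\<close> by (intro exI[of _ \<alpha>] exI[of _ \<gamma>]) auto
  next
    case 2
    then have "int p dvd \<beta>\<^sup>2" using disc by (metis dvd_diff_left_iff dvd_mult dvd_mult2 mult.commute)
    then have b: "int p dvd \<beta>" using pp prime_dvd_power by blast
    then have g: "\<not> int p dvd \<gamma>" using 2 nz by blast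
    have "int p dvd \<alpha> * u\<^sup>2 + \<beta> * u * v + \<gamma> * v\<^sup>2 \<longleftrightarrow> int p dvd \<gamma> * v\<^sup>2" for u v
      using 2 b by (simp add: dvd_add_right_iff)
    also have "int p dvd \<gamma> * v\<^sup>2 \<longleftrightarrow> int p dvd 0 * u + 1 * v" for u v
      using pp g by (simp add: prime_dvd_mult_iff prime_dvd_power_iff)
    finally show ?thesis using pp by (intro exI[of _ 0] exI[of _ 1]) auto
  next
    case 3
    have two: "\<not> int p dvd 2" using p 3 by (metis primes_dvd_imp_eq two_is_prime_nat of_nat_dvd_iff of_nat_numeral)
    have four: "\<not> int p dvd 4 * \<alpha>"
      using pp two 3 by (metis mult_2_right numeral_Bit0 prime_dvd_mult_iff)
    have "int p dvd \<alpha> * u\<^sup>2 + \<beta> * u * v + \<gamma> * v\<^sup>2 \<longleftrightarrow> int p dvd (2 * \<alpha>) * u + \<beta> * v" for u v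
    proof -
      have "4 * \<alpha> * (\<alpha> * u\<^sup>2 + \<beta> * u * v + \<gamma> * v\<^sup>2) + (\<beta>\<^sup>2 - 4 * \<alpha> * \<gamma>) * v\<^sup>2 = ((2 * \<alpha>) * u + \<beta> * v)\<^sup>2"
        by (simp add: power2_eq_square algebra_simps)
      then have "int p dvd 4 * \<alpha> * (\<alpha> * u\<^sup>2 + \<beta> * u * v + \<gamma> * v\<^sup>2) \<longleftrightarrow> int p dvd ((2 * \<alpha>) * u + \<beta> * v)\<^sup>2"
        using disc by (metis dvd_add_left_iff dvd_mult2)
      then show ?thesis using pp four by (simp add: prime_dvd_mult_iff prime_dvd_power_iff)
    qed
    moreover have "\<not> int p dvd 2 * \<alpha>" using pp two 3 by (simp add: prime_dvd_mult_iff)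
    ultimately show ?thesis by (intro exI[of _ "2 * \<alpha>"] exI[of _ \<beta>]) auto
  qed
qed

lemma primitive_square_product:
  fixes X Y Z :: int
  assumes eq: "Y\<^sup>2 = X * Z" and prim: "\<And>p. prime p \<Longrightarrow> \<not> (p dvd X \<and> p dvd Y \<and> p dvd Z)"
  obtains u v s where "s = 1 \<or> s = -1" "coprime u v" "X = s * u\<^sup>2" "Y = s * (u * v)" "Z = s * v\<^sup>2"
proof -
  have cop: "coprime X Z"
  proof (rule ccontr)
    assume "\<not> coprime X Z"
    then have nu: "\<not> is_unit (gcd X Z)" by (simp add: coprime_iff_gcd_eq_1)
    have "\<exists>p. prime p \<and> p dvd gcd X Z"
    proof (cases "gcd X Z = 0")
      case True
      then show ?thesis by (intro exI[of _ 2]) simp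
    next
      case False
      then show ?thesis using prime_divisor_exists nu by blast
    qed
    then obtain p where p: "prime p" "p dvd X" "p dvd Z" by auto
    then have "p dvd Y\<^sup>2" unfolding eq by simp
    then have "p dvd Y" using p prime_dvd_power by blast
    then show False using prim p by blast
  qed
  have sq: "\<exists>r. \<bar>x\<bar> = r\<^sup>2" if "coprime x z" "\<bar>x\<bar> * \<bar>z\<bar> = (y::int)\<^sup>2" for x z y :: int
  proof -
    have "coprime (nat \<bar>x\<bar>) (nat \<bar>z\<bar>)" using that(1) by (simp add: coprime_nat_abs_left_iff coprime_nat_abs_right_iff)
    moreover have "nat \<bar>x\<bar> * nat \<bar>z\<bar> = (nat \<bar>y\<bar>)\<^sup>2"
      using that(2) by (metis abs_ge_zero nat_mult_distrib nat_power_eq power2_abs)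
    then have "is_nth_power 2 (nat \<bar>x\<bar> * nat \<bar>z\<bar>)" by (auto simp: is_nth_power_def)
    ultimately have "is_nth_power 2 (nat \<bar>x\<bar>)" using is_nth_power_mult_coprime_nat_iff by blast
    then obtain r where "nat \<bar>x\<bar> = r\<^sup>2" by (auto simp: is_nth_power_def)
    then have "\<bar>x\<bar> = (int r)\<^sup>2" by (metis abs_ge_zero int_nat_eq of_nat_power)
    then show ?thesis by blast
  qed
  have XZ: "X * Z \<ge> 0" using eq by (metis zero_le_power2)
  have aXZ: "\<bar>X\<bar> * \<bar>Z\<bar> = Y\<^sup>2" using XZ eq by (simp add: abs_mult[symmetric])
  obtain u where u: "\<bar>X\<bar> = u\<^sup>2" using sq[OF cop aXZ] by blast
  obtain v where v: "\<bar>Z\<bar> = v\<^sup>2" using sq[of Z X Y] cop aXZ by (auto simp: coprime_commute mult.commute)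
  define s where "s = (if X > 0 \<or> Z > 0 then 1 else - 1 :: int)"
  have Xs: "X = s * u\<^sup>2" and Zs: "Z = s * v\<^sup>2"
    using u v XZ by (auto simp: s_def zero_le_mult_iff split: if_splits)
  have s: "s = 1 \<or> s = -1" by (simp add: s_def)
  have "Y\<^sup>2 = (u * v)\<^sup>2" using aXZ u v by (simp add: power_mult_distrib)
  then have Y: "Y = u * v \<or> Y = - (u * v)" by (simp add: power2_eq_iff)
  have c: "coprime u v" using cop unfolding Xs Zs by auto
  show thesis
  proof (cases "Y = s * (u * v)")
    case True
    then show thesis using that[OF s c Xs _ Zs] by blast
  next
    case False
    then have "Y = s * (u * (-v))" using Y s by auto
    then show thesis using that[of s u "-v"] s c Xs Zs by simp
  qed
qed

section \<open>Lattices that contain the solutions of a conic\<close>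

lemma sq_cong:
  assumes "[s = t] (mod n)" "n dvd a" "a dvd n\<^sup>2" "a dvd 2 * n"
  shows "[s\<^sup>2 = t\<^sup>2] (mod (a::int))"
proof -
  obtain q where q: "s = t + n * q" using assms(1) by (metis cong_iff_lin cong_sym mult.commute)
  have "s\<^sup>2 - t\<^sup>2 = (2 * n) * (t * q) + n\<^sup>2 * q\<^sup>2" unfolding q by (simp add: power2_eq_square algebra_simps)
  moreover have "a dvd (2 * n) * (t * q) + n\<^sup>2 * q\<^sup>2" using dvd_add[OF dvd_mult2[OF assms(4)] dvd_mult2[OF assms(3)]] .
  ultimately show ?thesis by (simp add: cong_iff_dvd_diff)
qed

text \<open>Each n_i is a_i or a_i/2. By \<open>n_prod\<close> exactly one coefficient is halved,
  and \<open>n_sq\<close> makes that one divisible by 4. Divisibilities are arranged for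
  \<open>sq_cong\<close>: a residue modulo n_i determines its square modulo a_i. The halving gives
  the lattices below index a0 a1 a2 / 2, which is what produces half-discriminant -1.\<close>

locale conic =
  fixes a0 a1 a2 n0 n1 n2 :: int
  assumes pos: "a0 > 0" "a1 > 0" "a2 > 0"
    and cop: "coprime a0 a1" "coprime a0 a2" "coprime a1 a2"
    and n_pos: "n0 > 0" "n1 > 0" "n2 > 0"
    and n_dvd: "n0 dvd a0" "n1 dvd a1" "n2 dvd a2"
    and n_sq: "a0 dvd n0\<^sup>2" "a1 dvd n1\<^sup>2" "a2 dvd n2\<^sup>2"
    and n_dbl: "a0 dvd 2 * n0" "a1 dvd 2 * n1" "a2 dvd 2 * n2"
    and n_prod: "2 * n0 * n1 * n2 = a0 * a1 * a2"
begin

definition sols :: "(int \<times> int \<times> int) set" where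
  "sols = {(x0, x1, x2). a0 * x0\<^sup>2 + a1 * x1\<^sup>2 = a2 * x2\<^sup>2 \<and> x2 > 0 \<and> coprime (a0 * x0) (a1 * x1)}"

definition C0 :: "int set" where "C0 = {c \<in> {0..<n0}. [a1 * c\<^sup>2 = a2] (mod a0)}"
definition C1 :: "int set" where "C1 = {c \<in> {0..<n1}. [a0 * c\<^sup>2 = a2] (mod a1)}"
definition C2 :: "int set" where "C2 = {c \<in> {0..<n2}. [a0 * c\<^sup>2 = - a1] (mod a2)}"

text \<open>The ratio of two coordinates is prescribed modulo each n_i. For a solution these ratios
  are square roots of a2/a1, a2/a0 and -a1/a0, which is what \<open>C0\<close>, \<open>C1\<close>
  and \<open>C2\<close> collect.\<close>

definition lattice :: "int \<Rightarrow> int \<Rightarrow> int \<Rightarrow> (int \<times> int \<times> int) set" where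
  "lattice c0 c1 c2 = {(x0, x1, x2). [x1 = c0 * x2] (mod n0) \<and> [x0 = c1 * x2] (mod n1) \<and> [x0 = c2 * x1] (mod n2)}"

lemma cop_n: "coprime n0 n1" "coprime n0 n2" "coprime n1 n2"
  using cop n_dvd by (meson coprime_divisors)+

lemmas sq_cong1 = sq_cong[OF _ n_dvd(2) n_sq(2) n_dbl(2)]
  and sq_cong2 = sq_cong[OF _ n_dvd(3) n_sq(3) n_dbl(3)]

text \<open>A prime dividing a coordinate and one of these coefficients divides two terms of the
  equation, hence the third, against the coprimality of a0 x0 and a1 x1.\<close>

lemma sols_coprime:
  assumes "(x0, x1, x2) \<in> sols"
  shows "coprime x2 a0" "coprime x2 a1" "coprime x1 a2" "coprime x0 a2"
proof -
  have eq: "a0 * x0\<^sup>2 + a1 * x1\<^sup>2 = a2 * x2\<^sup>2" and c: "coprime (a0 * x0) (a1 * x1)"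
    using assms by (auto simp: sols_def)
  have 0: False if "prime p" "p dvd a0 * x0" "p dvd a1 * x1" for p
    using that c by (meson coprime_common_divisor not_prime_unit)
  show "coprime x2 a0"
  proof (rule ccontr)
    assume "\<not> coprime x2 a0"
    then obtain p where p: "prime p" "p dvd x2" "p dvd a0"
      using pos prime_divisor_exists[of "gcd x2 a0"] by (auto simp: coprime_iff_gcd_eq_1)
    then have "p dvd a2 * x2\<^sup>2 - a0 * x0\<^sup>2" by (simp add: power2_eq_square)
    moreover have "a2 * x2\<^sup>2 - a0 * x0\<^sup>2 = a1 * x1 * x1" using eq by (simp add: power2_eq_square)
    ultimately have "p dvd a1 * x1" using p by (metis dvd_mult prime_dvd_mult_iff)
    then show False using 0[OF p(1)] p(2,3) by simp
  qed
  show "coprime x2 a1"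
  proof (rule ccontr)
    assume "\<not> coprime x2 a1"
    then obtain p where p: "prime p" "p dvd x2" "p dvd a1"
      using pos prime_divisor_exists[of "gcd x2 a1"] by (auto simp: coprime_iff_gcd_eq_1)
    then have "p dvd a2 * x2\<^sup>2 - a1 * x1\<^sup>2" by (simp add: power2_eq_square)
    moreover have "a2 * x2\<^sup>2 - a1 * x1\<^sup>2 = a0 * x0 * x0" using eq by (simp add: power2_eq_square)
    ultimately have "p dvd a0 * x0" using p by (metis dvd_mult prime_dvd_mult_iff)
    then show False using 0[OF p(1)] p(2,3) by simp
  qed
  show "coprime x1 a2"
  proof (rule ccontr)
    assume "\<not> coprime x1 a2"
    then obtain p where p: "prime p" "p dvd x1" "p dvd a2"
      using pos prime_divisor_exists[of "gcd x1 a2"] by (auto simp: coprime_iff_gcd_eq_1)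
    then have "p dvd a2 * x2\<^sup>2 - a1 * x1\<^sup>2" by (simp add: power2_eq_square)
    moreover have "a2 * x2\<^sup>2 - a1 * x1\<^sup>2 = a0 * x0 * x0" using eq by (simp add: power2_eq_square)
    ultimately have "p dvd a0 * x0" using p by (metis dvd_mult prime_dvd_mult_iff)
    then show False using 0[OF p(1)] p(2,3) by simp
  qed
  show "coprime x0 a2"
  proof (rule ccontr)
    assume "\<not> coprime x0 a2"
    then obtain p where p: "prime p" "p dvd x0" "p dvd a2"
      using pos prime_divisor_exists[of "gcd x0 a2"] by (auto simp: coprime_iff_gcd_eq_1)
    then have "p dvd a2 * x2\<^sup>2 - a0 * x0\<^sup>2" by (simp add: power2_eq_square)
    moreover have "a2 * x2\<^sup>2 - a0 * x0\<^sup>2 = a1 * x1 * x1" using eq by (simp add: power2_eq_square)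
    ultimately have "p dvd a1 * x1" using p by (metis dvd_mult prime_dvd_mult_iff)
    then show False using 0[OF p(1)] p(2,3) by simp
  qed
qed

text \<open>The root is x/y modulo n. It satisfies a congruence modulo the larger m because squares
  modulo m depend only on residues modulo n.\<close>

lemma root_exists:
  fixes x y a b n m :: int
  assumes eq: "[a * x\<^sup>2 = b * y\<^sup>2] (mod m)" and y: "coprime y m" and n: "n > 0" "n dvd m" "m dvd n\<^sup>2" "m dvd 2 * n"
  shows "\<exists>!c. c \<in> {c \<in> {0..<n}. [a * c\<^sup>2 = b] (mod m)} \<and> [x = c * y] (mod n)"
proof (rule ex_ex1I)
  obtain u where u: "[y * u = 1] (mod m)" using cong_solve_coprime_int[OF y] by blast
  define c where "c = (x * u) mod n"
  have cn: "[c = x * u] (mod n)" unfolding c_def by simp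
  have "[a * c\<^sup>2 = a * (x * u)\<^sup>2] (mod m)" using sq_cong[OF cn n(2-4)] by (intro cong_mult) auto
  also have "a * (x * u)\<^sup>2 = (a * x\<^sup>2) * u\<^sup>2" by (simp add: power_mult_distrib)
  also have "[(a * x\<^sup>2) * u\<^sup>2 = (b * y\<^sup>2) * u\<^sup>2] (mod m)" using eq by (rule cong_scalar_right)
  also have "(b * y\<^sup>2) * u\<^sup>2 = b * (y * u)\<^sup>2" by (simp add: power_mult_distrib)
  also have "[b * (y * u)\<^sup>2 = b * 1\<^sup>2] (mod m)" using u by (intro cong_mult cong_pow) auto
  finally have r: "[a * c\<^sup>2 = b] (mod m)" by simp
  have "[y * u = 1] (mod n)" using u n(2) cong_dvd_modulus by blast
  then have "[x * (y * u) = x * 1] (mod n)" by (intro cong_mult) auto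
  moreover have "[c * y = x * u * y] (mod n)" using cn by (intro cong_mult) auto
  ultimately have "[x = c * y] (mod n)" by (metis cong_sym cong_trans mult.assoc mult.commute mult_1)
  then show "\<exists>c. c \<in> {c \<in> {0..<n}. [a * c\<^sup>2 = b] (mod m)} \<and> [x = c * y] (mod n)"
    using r n(1) by (intro exI[of _ c]) (auto simp: c_def)
next
  fix c d assume c: "c \<in> {c \<in> {0..<n}. [a * c\<^sup>2 = b] (mod m)} \<and> [x = c * y] (mod n)"
    and d: "d \<in> {c \<in> {0..<n}. [a * c\<^sup>2 = b] (mod m)} \<and> [x = d * y] (mod n)"
  have "[c * y = d * y] (mod n)" using c d cong_sym cong_trans by blast
  moreover have "coprime y n" using y n(2) by (meson coprime_divisors dvd_refl)
  ultimately have "[c = d] (mod n)" by (simp add: cong_mult_rcancel)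
  then show "c = d" using c d cong_less_imp_eq_int by auto
qed

lemma sols_lattice:
  assumes x: "(x0, x1, x2) \<in> sols"
  shows "\<exists>!(c0, c1, c2). (c0, c1, c2) \<in> C0 \<times> C1 \<times> C2 \<and> (x0, x1, x2) \<in> lattice c0 c1 c2"
proof -
  have eq: "a0 * x0\<^sup>2 + a1 * x1\<^sup>2 = a2 * x2\<^sup>2" using x by (auto simp: sols_def)
  have e0: "[a1 * x1\<^sup>2 = a2 * x2\<^sup>2] (mod a0)" using eq by (simp add: cong_iff_dvd_diff flip: eq)
  have e1: "[a0 * x0\<^sup>2 = a2 * x2\<^sup>2] (mod a1)" using eq by (simp add: cong_iff_dvd_diff flip: eq)
  have "a0 * x0\<^sup>2 - (- a1) * x1\<^sup>2 = a2 * x2\<^sup>2" using eq by simp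
  then have e2: "[a0 * x0\<^sup>2 = (- a1) * x1\<^sup>2] (mod a2)" by (simp add: cong_iff_dvd_diff)
  have "\<exists>!c. c \<in> C0 \<and> [x1 = c * x2] (mod n0)" unfolding C0_def
    using root_exists[OF e0 sols_coprime(1)[OF x] n_pos(1) n_dvd(1) n_sq(1) n_dbl(1)] .
  moreover have "\<exists>!c. c \<in> C1 \<and> [x0 = c * x2] (mod n1)" unfolding C1_def
    using root_exists[OF e1 sols_coprime(2)[OF x] n_pos(2) n_dvd(2) n_sq(2) n_dbl(2)] .
  moreover have "\<exists>!c. c \<in> C2 \<and> [x0 = c * x1] (mod n2)" unfolding C2_def
    using root_exists[OF e2 sols_coprime(3)[OF x] n_pos(3) n_dvd(3) n_sq(3) n_dbl(3)] .
  ultimately show ?thesis unfolding lattice_def by auto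
qed

text \<open>On each lattice the form is \<open>a0 * a1 * a2\<close> times an integral form of half-discriminant \<open>-1\<close>.\<close>

lemma lattice_basis:
  assumes c: "c0 \<in> C0" "c1 \<in> C1" "c2 \<in> C2"
  obtains \<alpha> \<beta> where
    "\<And>X T W. (\<alpha> * X + \<beta> * T + n1 * n2 * W, c0 * X + n0 * T, X) \<in> lattice c0 c1 c2"
    "\<And>x. x \<in> lattice c0 c1 c2 \<Longrightarrow> \<exists>X T W. x = (\<alpha> * X + \<beta> * T + n1 * n2 * W, c0 * X + n0 * T, X)"
    "a0 * a1 * a2 dvd a0 * \<alpha>\<^sup>2 + a1 * c0\<^sup>2 - a2" "a0 * a1 * a2 dvd a0 * \<beta>\<^sup>2 + a1 * n0\<^sup>2"
    "a0 * a1 * a2 dvd a0 * (n1 * n2)\<^sup>2" "a0 * a1 * a2 dvd 2 * a0 * \<beta> * (n1 * n2)"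
    "a0 * a1 * a2 dvd 2 * a0 * \<alpha> * (n1 * n2)" "a0 * a1 * a2 dvd 2 * (a0 * \<alpha> * \<beta> + a1 * c0 * n0)"
proof -
  \<comment> \<open>The basis is triangular with diagonal entries 1, n0 and n1 n2: x2 is free, then
    x1 is fixed modulo n0, then x0 modulo n1 n2. The numbers \<alpha> and \<beta> are values of x0
    on the first two basis vectors.\<close>
  obtain \<alpha> where \<alpha>: "[\<alpha> = c1] (mod n1)" "[\<alpha> = c2 * c0] (mod n2)"
    using binary_chinese_remainder_int[OF cop_n(3)] by blast
  obtain \<beta> where \<beta>: "[\<beta> = 0] (mod n1)" "[\<beta> = c2 * n0] (mod n2)"
    using binary_chinese_remainder_int[OF cop_n(3)] by blast
  have r0: "[a1 * c0\<^sup>2 = a2] (mod a0)" and r1: "[a0 * c1\<^sup>2 = a2] (mod a1)" and r2: "[a0 * c2\<^sup>2 = - a1] (mod a2)"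
    using c by (auto simp: C0_def C1_def C2_def)
  have dvdI: "a0 * a1 * a2 dvd z" if "a0 dvd z" "a1 dvd z" "a2 dvd z" for z
    using that cop by (simp add: divides_mult coprime_commute)
  have in_lat: "(\<alpha> * X + \<beta> * T + n1 * n2 * W, c0 * X + n0 * T, X) \<in> lattice c0 c1 c2" for X T W
  proof -
    have "[c0 * X + n0 * T = c0 * X] (mod n0)" by (simp add: cong_iff_dvd_diff)
    moreover have "[\<alpha> * X + \<beta> * T + n1 * n2 * W = c1 * X + 0 * T + 0] (mod n1)"
      using \<alpha> \<beta> by (intro cong_add cong_mult) (auto simp: cong_0_iff)
    moreover have "[\<alpha> * X + \<beta> * T + n1 * n2 * W = c2 * c0 * X + c2 * n0 * T + 0] (mod n2)"
      using \<alpha> \<beta> by (intro cong_add cong_mult) (auto simp: cong_0_iff)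
    ultimately show ?thesis by (simp add: lattice_def algebra_simps)
  qed
  have lat_in: "\<exists>X T W. x = (\<alpha> * X + \<beta> * T + n1 * n2 * W, c0 * X + n0 * T, X)" if x: "x \<in> lattice c0 c1 c2" for x
  proof -
    obtain x0 x1 x2 where xx: "x = (x0, x1, x2)" by (metis prod.exhaust)
    obtain T where T: "x1 = c0 * x2 + n0 * T" using x xx
      by (auto simp: lattice_def cong_iff_dvd_diff dvd_def algebra_simps)
    have "(\<alpha> * x2 + \<beta> * T, c0 * x2 + n0 * T, x2) \<in> lattice c0 c1 c2" using in_lat[of x2 T 0] by simp
    then have "[x0 = \<alpha> * x2 + \<beta> * T] (mod n1)" "[x0 = \<alpha> * x2 + \<beta> * T] (mod n2)"
      using x xx T by (auto simp: lattice_def intro: cong_trans cong_sym)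
    then have "[x0 = \<alpha> * x2 + \<beta> * T] (mod n1 * n2)" using cop_n(3) by (intro coprime_cong_mult)
    then obtain W where "x0 = \<alpha> * x2 + \<beta> * T + n1 * n2 * W"
      by (auto simp: cong_iff_dvd_diff dvd_def algebra_simps)
    then show ?thesis using xx T by blast
  qed
  have sqm: "[\<alpha>\<^sup>2 = c1\<^sup>2] (mod a1)" "[\<alpha>\<^sup>2 = (c2 * c0)\<^sup>2] (mod a2)" "[\<beta>\<^sup>2 = 0\<^sup>2] (mod a1)" "[\<beta>\<^sup>2 = (c2 * n0)\<^sup>2] (mod a2)"
    using sq_cong1 sq_cong2 \<alpha> \<beta> by blast+
  have d1: "a0 * a1 * a2 dvd a0 * \<alpha>\<^sup>2 + a1 * c0\<^sup>2 - a2"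
  proof (rule dvdI)
    have "a0 dvd a1 * c0\<^sup>2 - a2" using r0 by (simp add: cong_iff_dvd_diff)
    then have "a0 dvd a0 * \<alpha>\<^sup>2 + (a1 * c0\<^sup>2 - a2)" by (intro dvd_add) auto
    then show "a0 dvd a0 * \<alpha>\<^sup>2 + a1 * c0\<^sup>2 - a2" by (simp add: algebra_simps)
    have "[a0 * \<alpha>\<^sup>2 + a1 * c0\<^sup>2 - a2 = a0 * c1\<^sup>2 + 0 - a2] (mod a1)"
      using sqm by (intro cong_diff cong_add cong_mult) (auto simp: cong_0_iff)
    moreover have "a1 dvd a0 * c1\<^sup>2 - a2" using r1 by (simp add: cong_iff_dvd_diff)
    ultimately show "a1 dvd a0 * \<alpha>\<^sup>2 + a1 * c0\<^sup>2 - a2" by (simp add: cong_dvd_iff)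
    have "[a0 * \<alpha>\<^sup>2 + a1 * c0\<^sup>2 - a2 = a0 * (c2 * c0)\<^sup>2 + a1 * c0\<^sup>2 - 0] (mod a2)"
      using sqm by (intro cong_diff cong_add cong_mult) (auto simp: cong_0_iff)
    moreover have "a0 * (c2 * c0)\<^sup>2 + a1 * c0\<^sup>2 - 0 = (a0 * c2\<^sup>2 - - a1) * c0\<^sup>2"
      by (simp add: power_mult_distrib algebra_simps)
    moreover have "a2 dvd a0 * c2\<^sup>2 - - a1" using r2 by (simp only: cong_iff_dvd_diff)
    ultimately show "a2 dvd a0 * \<alpha>\<^sup>2 + a1 * c0\<^sup>2 - a2" by (metis cong_dvd_iff dvd_mult2)
  qed
  have d2: "a0 * a1 * a2 dvd a0 * \<beta>\<^sup>2 + a1 * n0\<^sup>2"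
  proof (rule dvdI)
    show "a0 dvd a0 * \<beta>\<^sup>2 + a1 * n0\<^sup>2" using n_sq by (intro dvd_add) auto
    have "a1 dvd \<beta>\<^sup>2" using sqm(3) by (simp add: cong_0_iff)
    then show "a1 dvd a0 * \<beta>\<^sup>2 + a1 * n0\<^sup>2" by (intro dvd_add) auto
    have "[a0 * \<beta>\<^sup>2 + a1 * n0\<^sup>2 = a0 * (c2 * n0)\<^sup>2 + a1 * n0\<^sup>2] (mod a2)"
      using sqm by (intro cong_add cong_mult) auto
    moreover have "a0 * (c2 * n0)\<^sup>2 + a1 * n0\<^sup>2 = (a0 * c2\<^sup>2 - - a1) * n0\<^sup>2"
      by (simp add: power_mult_distrib algebra_simps)
    moreover have "a2 dvd a0 * c2\<^sup>2 - - a1" using r2 by (simp only: cong_iff_dvd_diff)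
    ultimately show "a2 dvd a0 * \<beta>\<^sup>2 + a1 * n0\<^sup>2" by (metis cong_dvd_iff dvd_mult2)
  qed
  have d3: "a0 * a1 * a2 dvd a0 * (n1 * n2)\<^sup>2"
    using n_sq by (intro dvdI) (auto simp: power_mult_distrib)
  \<comment> \<open>The cross terms carry the factor 2 n_i, which a_i divides even when n_i is
    a_i/2.\<close>
  have n12: "a1 dvd 2 * n1 * n2" "a2 dvd 2 * n1 * n2"
    using n_dbl(2,3) dvd_mult2[of a1 "2 * n1" n2] dvd_mult2[of a2 "2 * n2" n1] by (simp_all add: mult_ac)
  have d45: "a0 * a1 * a2 dvd 2 * a0 * z * (n1 * n2)" for z
  proof -
    have "2 * a0 * z * (n1 * n2) = (2 * n1 * n2) * (a0 * z)" by simp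
    then show ?thesis using n12 by (intro dvdI) (metis dvd_mult2 dvd_mult dvd_triv_left mult.assoc mult.commute)+
  qed
  have d6: "a0 * a1 * a2 dvd 2 * (a0 * \<alpha> * \<beta> + a1 * c0 * n0)"
  proof (rule dvdI)
    have "2 * (a0 * \<alpha> * \<beta> + a1 * c0 * n0) = a0 * (2 * \<alpha> * \<beta>) + (2 * n0) * (a1 * c0)" by (simp add: algebra_simps)
    then show "a0 dvd 2 * (a0 * \<alpha> * \<beta> + a1 * c0 * n0)"
      using dvd_add[OF dvd_triv_left dvd_mult2[OF n_dbl(1)]] by metis
    have "n1 dvd \<beta>" using \<beta>(1) by (simp add: cong_0_iff)
    then have "a1 dvd 2 * \<beta>" using n_dbl(2) by (meson dvd_trans mult_dvd_mono dvd_refl)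
    moreover have "2 * (a0 * \<alpha> * \<beta> + a1 * c0 * n0) = (2 * \<beta>) * (a0 * \<alpha>) + a1 * (2 * c0 * n0)" by (simp add: algebra_simps)
    ultimately show "a1 dvd 2 * (a0 * \<alpha> * \<beta> + a1 * c0 * n0)" by (metis dvd_add dvd_mult2 dvd_triv_left)
    have "[a0 * \<alpha> * \<beta> + a1 * c0 * n0 = a0 * (c2 * c0) * (c2 * n0) + a1 * c0 * n0] (mod n2)"
      using \<alpha> \<beta> by (intro cong_add cong_mult) auto
    moreover have "a0 * (c2 * c0) * (c2 * n0) + a1 * c0 * n0 = (a0 * c2\<^sup>2 - - a1) * (c0 * n0)"
      by (simp add: power2_eq_square algebra_simps)
    moreover have "n2 dvd a0 * c2\<^sup>2 - - a1" using r2 n_dvd(3) by (metis cong_iff_dvd_diff dvd_trans)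
    ultimately have "n2 dvd a0 * \<alpha> * \<beta> + a1 * c0 * n0" by (metis cong_dvd_iff dvd_mult2)
    then show "a2 dvd 2 * (a0 * \<alpha> * \<beta> + a1 * c0 * n0)" using n_dbl(3) by (meson dvd_trans mult_dvd_mono dvd_refl)
  qed
  show thesis by (rule that[of \<alpha> \<beta>]) (use in_lat lat_in d1 d2 d3 d45 d6 in auto)
qed

end

section \<open>Parametrization of the solutions in one lattice\<close>

context conic
begin

abbreviation k :: int where "k \<equiv> a0 * a1 * a2"

text \<open>In suitable coordinates of the lattice the conic is Y^2 = X Z. The last two conclusions
  are the discriminants of the binary forms that give x2 and x1. The first is negative, so x2 is a
  definite form; and each vanishes modulo the primes at which the corresponding coordinate has to be
  prime to the coefficients.\<close>

lemma lattice_parametrization: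
  assumes c: "c0 \<in> C0" "c1 \<in> C1" "c2 \<in> C2"
  obtains \<alpha> \<beta> a b c d e f g h i where
    "det3 a b c d e f g h i = 1"
    "\<And>X T W. (\<alpha> * X + \<beta> * T + n1 * n2 * W, c0 * X + n0 * T, X) \<in> lattice c0 c1 c2"
    "\<And>x. x \<in> lattice c0 c1 c2 \<Longrightarrow> \<exists>X T W. x = (\<alpha> * X + \<beta> * T + n1 * n2 * W, c0 * X + n0 * T, X)"
    "\<And>X Y Z X' T' W'. (X', T', W') = lin3 a b c d e f g h i (X, Y, Z) \<Longrightarrow>
      a0 * (\<alpha> * X' + \<beta> * T' + n1 * n2 * W')\<^sup>2 + a1 * (c0 * X' + n0 * T')\<^sup>2 - a2 * X'\<^sup>2 = k * (Y\<^sup>2 - X * Z)"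
    "b\<^sup>2 - 4 * a * c = - (a0 * a1)"
    "(c0 * b + n0 * e)\<^sup>2 - 4 * (c0 * a + n0 * d) * (c0 * c + n0 * f) = a0 * a2"
proof -
  obtain \<alpha> \<beta> where lat: "\<And>X T W. (\<alpha> * X + \<beta> * T + n1 * n2 * W, c0 * X + n0 * T, X) \<in> lattice c0 c1 c2"
    "\<And>x. x \<in> lattice c0 c1 c2 \<Longrightarrow> \<exists>X T W. x = (\<alpha> * X + \<beta> * T + n1 * n2 * W, c0 * X + n0 * T, X)"
    and dv: "k dvd a0 * \<alpha>\<^sup>2 + a1 * c0\<^sup>2 - a2" "k dvd a0 * \<beta>\<^sup>2 + a1 * n0\<^sup>2"
    "k dvd a0 * (n1 * n2)\<^sup>2" "k dvd 2 * a0 * \<beta> * (n1 * n2)"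
    "k dvd 2 * a0 * \<alpha> * (n1 * n2)" "k dvd 2 * (a0 * \<alpha> * \<beta> + a1 * c0 * n0)"
    by (rule lattice_basis[OF c], rule that)
  obtain A where A: "a0 * \<alpha>\<^sup>2 + a1 * c0\<^sup>2 - a2 = k * A" using dv(1) by (auto simp: dvd_def)
  obtain B where B: "a0 * \<beta>\<^sup>2 + a1 * n0\<^sup>2 = k * B" using dv(2) by (auto simp: dvd_def)
  obtain C where C: "a0 * (n1 * n2)\<^sup>2 = k * C" using dv(3) by (auto simp: dvd_def)
  obtain D where D: "2 * a0 * \<beta> * (n1 * n2) = k * D" using dv(4) by (auto simp: dvd_def)
  obtain E where E: "2 * a0 * \<alpha> * (n1 * n2) = k * E" using dv(5) by (auto simp: dvd_def)
  obtain G where G: "2 * (a0 * \<alpha> * \<beta> + a1 * c0 * n0) = k * G" using dv(6) by (auto simp: dvd_def)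
  have k: "k \<noteq> 0" using pos by simp
  define n where "n = n0 * n1 * n2"
  have kn: "k = 2 * n" using n_prod by (simp add: n_def)
  define F where "F = tern_form A B C D E G"
  have qF: "a0 * (\<alpha> * X + \<beta> * T + n1 * n2 * W)\<^sup>2 + a1 * (c0 * X + n0 * T)\<^sup>2 - a2 * X\<^sup>2 = k * F (X, T, W)" for X T W
  proof -
    have "k * F (X, T, W) = (k * A) * X\<^sup>2 + (k * B) * T\<^sup>2 + (k * C) * W\<^sup>2 + (k * D) * T * W + (k * E) * X * W + (k * G) * X * T"
      by (simp add: F_def tern_form_def algebra_simps)
    then show ?thesis unfolding A[symmetric] B[symmetric] C[symmetric] D[symmetric] E[symmetric] G[symmetric]
      by (simp add: power2_eq_square algebra_simps)
  qed
  \<comment> \<open>The diagonal form has half-discriminant -4 k and the basis has determinant n up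
    to sign, so the restricted form has -4 k n^2. Since k = 2 n, dividing the form by k leaves
    exactly -1.\<close>
  have "k ^ 3 * half_disc A B C D E G = half_disc (k * A) (k * B) (k * C) (k * D) (k * E) (k * G)"
    by (simp add: half_disc_def power2_eq_square power3_eq_cube algebra_simps)
  also have "\<dots> = - 4 * k * n\<^sup>2"
    unfolding A[symmetric] B[symmetric] C[symmetric] D[symmetric] E[symmetric] G[symmetric] n_def
    by (simp add: half_disc_def power2_eq_square algebra_simps)
  also have "\<dots> = k ^ 3 * (-1)" using kn by (simp add: power2_eq_square power3_eq_cube)
  finally have "half_disc A B C D E G = -1" using k by (simp only: mult_cancel_left) simp
  then obtain \<phi> where \<phi>: "sl3 \<phi>" "F \<circ> \<phi> = (\<lambda>(X, Y, Z). Y\<^sup>2 - X * Z)"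
    unfolding F_def by (rule unimodular_form_standard)
  obtain a b c d e f g h i where N: "det3 a b c d e f g h i = 1" "\<phi> = lin3 a b c d e f g h i"
    using \<phi>(1) unfolding sl3_def by blast
  note disc = sl3_row_disc[OF N(1) \<phi>(2)[unfolded N(2)]]
  \<comment> \<open>The plane x2 = 0 is spanned by the last two basis vectors.\<close>
  have "k\<^sup>2 * (b\<^sup>2 - 4 * a * c) = (k * D)\<^sup>2 - 4 * (k * B) * (k * C)"
  proof -
    have "b\<^sup>2 - 4 * a * c = D\<^sup>2 - 4 * B * C"
      using disc[OF refl refl refl, where ?p1.0=0 and ?p2.0=1 and ?p3.0=0 and ?q1.0=0 and ?q2.0=0 and ?q3.0=1] by (simp add: F_def tern_form_def)
    then show ?thesis by (simp only:) (simp add: power2_eq_square algebra_simps)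
  qed
  also have "\<dots> = - (4 * a0 * a1 * n\<^sup>2)"
    unfolding B[symmetric] C[symmetric] D[symmetric] n_def by (simp add: power2_eq_square algebra_simps)
  also have "\<dots> = k\<^sup>2 * (- (a0 * a1))" unfolding kn by (simp add: power2_eq_square algebra_simps)
  finally have disc2: "b\<^sup>2 - 4 * a * c = - (a0 * a1)" using k by (simp only: mult_cancel_left) simp
  \<comment> \<open>The plane x1 = 0, that is c0 X + n0 T = 0, is spanned by (n0, -c0, 0) and (0, 0,
    1).\<close>
  have "k\<^sup>2 * ((c0 * b + n0 * e)\<^sup>2 - 4 * (c0 * a + n0 * d) * (c0 * c + n0 * f)) =
    ((k * E) * n0 - (k * D) * c0)\<^sup>2 - 4 * ((k * A) * n0\<^sup>2 + (k * B) * c0\<^sup>2 - (k * G) * n0 * c0) * (k * C)"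
  proof -
    have "(c0 * b + n0 * e)\<^sup>2 - 4 * (c0 * a + n0 * d) * (c0 * c + n0 * f) =
      (E * n0 - D * c0)\<^sup>2 - 4 * (A * n0\<^sup>2 + B * c0\<^sup>2 - G * n0 * c0) * C"
      using disc[OF refl refl refl, where ?p1.0=n0 and ?p2.0="-c0" and ?p3.0=0 and ?q1.0=0 and ?q2.0=0 and ?q3.0=1] 
      by (simp add: F_def tern_form_def power2_eq_square algebra_simps)
    then show ?thesis by (simp only:) (simp add: power2_eq_square algebra_simps)
  qed
  also have "\<dots> = 4 * a0 * a2 * n\<^sup>2"
    unfolding A[symmetric] B[symmetric] C[symmetric] D[symmetric] E[symmetric] G[symmetric] n_def
    by (simp add: power2_eq_square algebra_simps)
  also have "\<dots> = k\<^sup>2 * (a0 * a2)" unfolding kn by (simp add: power2_eq_square algebra_simps)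
  finally have disc1: "(c0 * b + n0 * e)\<^sup>2 - 4 * (c0 * a + n0 * d) * (c0 * c + n0 * f) = a0 * a2"
    using k by (simp only: mult_cancel_left) simp
  have "a0 * (\<alpha> * X' + \<beta> * T' + n1 * n2 * W')\<^sup>2 + a1 * (c0 * X' + n0 * T')\<^sup>2 - a2 * X'\<^sup>2 = k * (Y\<^sup>2 - X * Z)"
    if "(X', T', W') = lin3 a b c d e f g h i (X, Y, Z)" for X Y Z X' T' W'
    unfolding qF that using fun_cong[OF \<phi>(2), of "(X, Y, Z)"] by (simp add: N(2))
  then show thesis using that[of a b c d e f g h i \<alpha> \<beta>] N(1) lat disc1 disc2 by blast
qed

end

context conic
begin

lemma prime_dvd_k_cases:
  assumes "prime p"
  shows "p dvd k \<longleftrightarrow> p dvd a0 * a1 \<or> p dvd a2"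
  using assms by (simp add: prime_dvd_mult_iff)

text \<open>The solutions in the lattice come from coprime (u, v), and x2 is a positive definite
  binary form in them. The coprimality required of a solution means that no prime of a0 a1 divides
  x2 and no prime of a2 divides x1; each of these forms degenerates at its primes, so every prime of
  k excludes one line. The 12 of the coprime count becomes 6 because (u, v) and (-u, -v) give the
  same solution.\<close>

lemma lattice_count:
  assumes c: "c0 \<in> C0" "c1 \<in> C1" "c2 \<in> C2"
  defines "S \<equiv> \<lambda>X::real. {x \<in> sols \<inter> lattice c0 c1 c2. real_of_int (snd (snd x)) \<le> X}"
  shows "finite (S X)"
    and "((\<lambda>X. real (card (S X)) / X) \<longlongrightarrow> 6 / (pi * sqrt (real_of_int (a0 * a1))) *
       (\<Prod>p\<in>prime_factors (nat k). inverse (1 + 1 / real p))) at_top"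
proof -
  obtain \<alpha> \<beta> a b c d e f g h i where
    N: "det3 a b c d e f g h i = 1" and
    lat: "\<And>X T W. (\<alpha> * X + \<beta> * T + n1 * n2 * W, c0 * X + n0 * T, X) \<in> lattice c0 c1 c2"
    "\<And>x. x \<in> lattice c0 c1 c2 \<Longrightarrow> \<exists>X T W. x = (\<alpha> * X + \<beta> * T + n1 * n2 * W, c0 * X + n0 * T, X)" and
    form: "\<And>X Y Z X' T' W'. (X', T', W') = lin3 a b c d e f g h i (X, Y, Z) \<Longrightarrow>
      a0 * (\<alpha> * X' + \<beta> * T' + n1 * n2 * W')\<^sup>2 + a1 * (c0 * X' + n0 * T')\<^sup>2 - a2 * X'\<^sup>2 = k * (Y\<^sup>2 - X * Z)" and
    disc2: "b\<^sup>2 - 4 * a * c = - (a0 * a1)" and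
    disc1: "(c0 * b + n0 * e)\<^sup>2 - 4 * (c0 * a + n0 * d) * (c0 * c + n0 * f) = a0 * a2"
    by (rule lattice_parametrization[OF c], rule that)
  define ra rb rc where "ra = c0 * a + n0 * d" "rb = c0 * b + n0 * e" "rc = c0 * c + n0 * f"
  note r_defs = ra_rb_rc_def
  have a01: "a0 * a1 > 0" and k: "k > 0" using pos by simp_all
  have "a \<noteq> 0"
  proof
    assume "a = 0"
    then have "b\<^sup>2 < 0" using disc2 a01 by simp
    then show False by simp
  qed
  \<comment> \<open>Primitive isotropic vectors are (u^2, u v, v^2) up to sign, and x2 > 0 forces
    the sign \<sigma> that makes G positive definite.\<close>
  define \<sigma> where "\<sigma> = sgn a"
  have \<sigma>: "\<sigma> * \<sigma> = 1" "\<sigma> * a > 0" "\<sigma> = 1 \<or> \<sigma> = -1" using \<open>a \<noteq> 0\<close> by (auto simp: \<sigma>_def sgn_if)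
  define G where "G u v = (\<sigma> * a) * u\<^sup>2 + (\<sigma> * b) * u * v + (\<sigma> * c) * v\<^sup>2" for u v
  have discG: "4 * (\<sigma> * a) * (\<sigma> * c) - (\<sigma> * b)\<^sup>2 = a0 * a1"
  proof -
    have "4 * (\<sigma> * a) * (\<sigma> * c) - (\<sigma> * b)\<^sup>2 = (\<sigma> * \<sigma>) * (4 * a * c - b\<^sup>2)"
      by (simp add: power2_eq_square algebra_simps)
    then show ?thesis using \<sigma>(1) disc2 by simp
  qed
  define H where "H u v = \<sigma> * (ra * u\<^sup>2 + rb * u * v + rc * v\<^sup>2)" for u v
  define A where "A = prime_factors (nat k)"
  have A_iff: "p \<in> A \<longleftrightarrow> prime p \<and> int p dvd k" for p
    using k by (simp add: A_def prime_factors_dvd) (metis int_dvd_int_iff int_nat_eq less_imp_le)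
  have finA: "finite A" by (simp add: A_def)
  have A2: "2 \<in> A"
  proof -
    have "2 dvd k" using n_prod by (metis dvd_triv_left mult.assoc)
    then show ?thesis by (simp add: A_iff)
  qed
  have col: "\<not> (int p dvd a \<and> int p dvd b \<and> int p dvd c)" if p: "prime p" for p
  proof
    assume *: "int p dvd a \<and> int p dvd b \<and> int p dvd c"
    have "det3 a b c d e f g h i = a * (e * i - f * h) - b * (d * i - f * g) + c * (d * h - e * g)"
      by (simp add: det3_def)
    moreover have "int p dvd \<dots>" using * by (intro dvd_add dvd_diff dvd_mult2) auto
    ultimately have "int p dvd 1" using N by simp
    then show False using p by (simp add: prime_nat_iff)
  qed
  \<comment> \<open>The form giving x1 combines the first two rows with coefficients c0 and n0. It
    is nonzero modulo p because the second row enters with a factor prime to p.\<close>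
  have colr: "\<not> (int p dvd ra \<and> int p dvd rb \<and> int p dvd rc)" if p: "prime p" "\<not> int p dvd n0" for p
  proof
    assume *: "int p dvd ra \<and> int p dvd rb \<and> int p dvd rc"
    have "n0 * det3 a b c d e f g h i = ra * (c * h - b * i) + rb * (a * i - c * g) + rc * (b * g - a * h)"
      unfolding r_defs by (simp add: det3_def algebra_simps)
    moreover have "int p dvd \<dots>" using * by (intro dvd_add dvd_mult2) auto
    ultimately show False using N p by simp
  qed
  \<comment> \<open>One linear form for each prime of k: from G, the form giving x2, if p divides a0
    a1, and otherwise from H, the form giving x1.\<close>
  have "\<exists>s t. \<not> (int p dvd s \<and> int p dvd t) \<and>
     (\<forall>u v. (if int p dvd a0 * a1 then int p dvd G u v else int p dvd H u v) \<longleftrightarrow> int p dvd s * u + t * v)"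
    if "p \<in> A" for p
  proof (cases "int p dvd a0 * a1")
    case True
    have p: "prime p" using that A_iff by simp
    have "int p dvd b\<^sup>2 - 4 * a * c" using True disc2 by simp
    from degenerate_form_mod_prime[OF p this col[OF p]] obtain s t where
      st: "\<not> (int p dvd s \<and> int p dvd t)" "\<And>u v. int p dvd a * u\<^sup>2 + b * u * v + c * v\<^sup>2 \<longleftrightarrow> int p dvd s * u + t * v" by blast
    have "G u v = \<sigma> * (a * u\<^sup>2 + b * u * v + c * v\<^sup>2)" for u v unfolding G_def by (simp add: algebra_simps)
    then have "int p dvd G u v \<longleftrightarrow> int p dvd a * u\<^sup>2 + b * u * v + c * v\<^sup>2" for u v using \<sigma>(3) by (auto simp del: minus_add_distrib)
    then show ?thesis using True st by auto
  next
    case False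
    have p: "prime p" "int p dvd a2" using that A_iff False prime_dvd_k_cases[of "int p"] by auto
    have "\<not> int p dvd n0" using False n_dvd(1) by (metis dvd_mult2 dvd_trans)
    have "int p dvd rb\<^sup>2 - 4 * ra * rc" using p(2) disc1 unfolding r_defs by simp
    from degenerate_form_mod_prime[OF p(1) this colr[OF p(1) \<open>\<not> int p dvd n0\<close>]] obtain s t where
      st: "\<not> (int p dvd s \<and> int p dvd t)" "\<And>u v. int p dvd ra * u\<^sup>2 + rb * u * v + rc * v\<^sup>2 \<longleftrightarrow> int p dvd s * u + t * v" by blast
    have "int p dvd H u v \<longleftrightarrow> int p dvd ra * u\<^sup>2 + rb * u * v + rc * v\<^sup>2" for u v
      using \<sigma>(3) unfolding H_def by (auto simp del: minus_add_distrib)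
    then show ?thesis using False st by auto
  qed
  then obtain s t where st: "\<And>p. p \<in> A \<Longrightarrow> \<not> (int p dvd s p \<and> int p dvd t p)"
    and av: "\<And>p u v. p \<in> A \<Longrightarrow> (if int p dvd a0 * a1 then int p dvd G u v else int p dvd H u v) \<longleftrightarrow> int p dvd s p * u + t p * v"
    by metis
  define P where "P X = {(u, v). coprime u v \<and> avoids A s t u v \<and> real_of_int (G u v) \<le> X}" for X :: real
  have "prime p" if "p \<in> A" for p using that A_iff by blast
  note count = coprime_lattice_count[OF \<sigma>(2) _ finA this A2 st, of "\<sigma> * c" "\<sigma> * b", unfolded discG, OF a01]
  have finP: "finite (P X)" for X
    using count(1)[of X] unfolding P_def G_def .
  have limP: "((\<lambda>X. real (card (P X)) / X) \<longlongrightarrow>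
      12 / (pi * sqrt (real_of_int (a0 * a1))) * (\<Prod>p\<in>A. inverse (1 + 1 / real p))) at_top"
    using count(2) unfolding P_def G_def .
  have avoid_iff: "avoids A s t u v \<longleftrightarrow> (\<forall>p. prime p \<longrightarrow> (int p dvd a0 * a1 \<longrightarrow> \<not> int p dvd G u v) \<and>
     (int p dvd a2 \<longrightarrow> \<not> int p dvd H u v))" for u v
  proof -
    have ex: "\<not> (int p dvd a0 * a1 \<and> int p dvd a2)" if "prime p" for p
      using cop that by (metis coprime_common_divisor coprime_mult_left_iff not_prime_unit prime_nat_int_transfer)
    show ?thesis unfolding avoids_def
    proof (intro iffI allI impI ballI)
      fix p :: nat assume 1: "\<forall>p\<in>A. \<not> int p dvd s p * u + t p * v" and p: "prime p"
      show "(int p dvd a0 * a1 \<longrightarrow> \<not> int p dvd G u v) \<and> (int p dvd a2 \<longrightarrow> \<not> int p dvd H u v)"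
        using 1 p av[of p u v] A_iff[of p] prime_dvd_k_cases[of "int p"] ex[OF p] by auto
    next
      fix p :: nat assume 1: "\<forall>p. prime p \<longrightarrow> (int p dvd a0 * a1 \<longrightarrow> \<not> int p dvd G u v) \<and> (int p dvd a2 \<longrightarrow> \<not> int p dvd H u v)"
        and p: "p \<in> A"
      then show "\<not> int p dvd s p * u + t p * v"
        using av[OF p, of u v] A_iff[of p] prime_dvd_k_cases[of "int p"] by (auto split: if_splits)
    qed
  qed
  define X' where "X' u v = \<sigma> * (a * u\<^sup>2 + b * (u * v) + c * v\<^sup>2)" for u v
  define T' where "T' u v = \<sigma> * (d * u\<^sup>2 + e * (u * v) + f * v\<^sup>2)" for u v
  define W' where "W' u v = \<sigma> * (g * u\<^sup>2 + h * (u * v) + i * v\<^sup>2)" for u v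
  define x0 where "x0 u v = \<alpha> * X' u v + \<beta> * T' u v + n1 * n2 * W' u v" for u v
  define \<psi> where "\<psi> = (\<lambda>(u, v). (x0 u v, H u v, G u v))"
  have GX: "G u v = X' u v" for u v unfolding G_def X'_def by (simp add: algebra_simps)
  have HT: "H u v = c0 * X' u v + n0 * T' u v" for u v unfolding H_def X'_def T'_def r_defs by (simp add: algebra_simps)
  have \<psi>_lat: "\<psi> (u, v) \<in> lattice c0 c1 c2" for u v
    unfolding \<psi>_def x0_def HT GX using lat(1) by simp
  have lin: "(X' u v, T' u v, W' u v) = lin3 a b c d e f g h i (\<sigma> * u\<^sup>2, \<sigma> * (u * v), \<sigma> * v\<^sup>2)" for u v
    unfolding X'_def T'_def W'_def lin3_def by (simp add: algebra_simps)
  have eqn: "a0 * (x0 u v)\<^sup>2 + a1 * (H u v)\<^sup>2 = a2 * (G u v)\<^sup>2" for u v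
    using form[OF lin[of u v]] unfolding x0_def HT GX by (simp add: power2_eq_square algebra_simps)
  have lin_cancel: "l = 0" if "n0 * l = 0" for l using that n_pos by simp
  \<comment> \<open>Away from k the lattice basis is invertible, and the parametrizing matrix is
    invertible everywhere, so a prime dividing all three coordinates would divide both u and
    v.\<close>
  have prim: "\<not> (p dvd x0 u v \<and> p dvd H u v \<and> p dvd G u v)" if p: "prime p" "\<not> p dvd k" and uv: "coprime u v" for p u v :: int
  proof
    assume *: "p dvd x0 u v \<and> p dvd H u v \<and> p dvd G u v"
    have pn: "\<not> p dvd n0" "\<not> p dvd n1" "\<not> p dvd n2" using p(2) n_dvd by (meson dvd_mult dvd_mult2 dvd_trans)+
    have X: "p dvd X' u v" using * GX by simp
    then have T: "p dvd T' u v" using * p(1) pn unfolding HT by (simp add: dvd_add_right_iff prime_dvd_mult_iff)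
    have "p dvd \<alpha> * X' u v + \<beta> * T' u v" using X T by simp
    then have "p dvd n1 * n2 * W' u v" using * unfolding x0_def by (simp add: dvd_add_right_iff)
    then have W: "p dvd W' u v" using p(1) pn by (simp add: prime_dvd_mult_iff)
    have "p dvd \<sigma> * u\<^sup>2" "p dvd \<sigma> * v\<^sup>2"
      using sl3_inj_dvd[OF N, of p "\<sigma> * u\<^sup>2" "\<sigma> * (u * v)" "\<sigma> * v\<^sup>2"] X T W lin[of u v] by (auto simp: lin3_def)
    then have "p dvd u" "p dvd v" using \<sigma>(3) p(1) by (auto simp: prime_dvd_power_iff)
    then show False using uv p(1) by (meson coprime_common_divisor not_prime_unit)
  qed
  have Gpos: "G u v > 0" if "avoids A s t u v" for u v
  proof -
    have nz: "G u v \<noteq> 0"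
    proof
      assume 0: "G u v = 0"
      have "4 * (\<sigma> * a) * G u v = (2 * (\<sigma> * a) * u + (\<sigma> * b) * v)\<^sup>2 + (4 * (\<sigma> * a) * (\<sigma> * c) - (\<sigma> * b)\<^sup>2) * v\<^sup>2"
        unfolding G_def by (simp add: power2_eq_square algebra_simps)
      then have 1: "(2 * (\<sigma> * a) * u + (\<sigma> * b) * v)\<^sup>2 + (a0 * a1) * v\<^sup>2 = 0" using 0 discG by simp
      then have "v = 0" using a01 by (smt (verit) mult_pos_pos zero_le_power2 zero_less_power2 power_eq_0_iff)
      then have "u = 0" using 1 \<sigma>(2) by auto
      then show False using \<open>v = 0\<close> that A2 by (auto simp: avoids_def)
    qed
    have "4 * (\<sigma> * a) * G u v = (2 * (\<sigma> * a) * u + (\<sigma> * b) * v)\<^sup>2 + (4 * (\<sigma> * a) * (\<sigma> * c) - (\<sigma> * b)\<^sup>2) * v\<^sup>2"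
      unfolding G_def by (simp add: power2_eq_square algebra_simps)
    then have "0 \<le> (4 * (\<sigma> * a)) * G u v" using discG a01 by simp
    then show ?thesis using nz \<sigma>(2) by (simp add: zero_le_mult_iff)
  qed
  have sols_iff: "\<psi> (u, v) \<in> sols \<longleftrightarrow> avoids A s t u v" if uv: "coprime u v" for u v
  proof
    assume "\<psi> (u, v) \<in> sols"
    note sc = sols_coprime[OF this[unfolded \<psi>_def prod.case]]
    show "avoids A s t u v" unfolding avoid_iff
    proof (intro allI impI conjI notI)
      fix p :: nat assume p: "prime p" "int p dvd a0 * a1" "int p dvd G u v"
      then show False using sc(1,2) by (metis coprime_common_divisor not_prime_unit prime_dvd_mult_iff prime_nat_int_transfer)
    next
      fix p :: nat assume p: "prime p" "int p dvd a2" "int p dvd H u v"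
      then show False using sc(3) by (metis coprime_common_divisor not_prime_unit prime_nat_int_transfer)
    qed
  next
    assume av: "avoids A s t u v"
    have no: "\<not> (p dvd a0 * a1 \<and> p dvd G u v) \<and> \<not> (p dvd a2 \<and> p dvd H u v)" if "prime p" for p :: int
    proof -
      define q where "q = nat p"
      have pq: "p = int q" using prime_ge_0_int[OF that] by (simp add: q_def)
      then have "prime q" using that by simp
      then show ?thesis using av unfolding avoid_iff pq by blast
    qed
    have "coprime (a0 * x0 u v) (a1 * H u v)"
    proof (rule ccontr)
      assume nc: "\<not> coprime (a0 * x0 u v) (a1 * H u v)"
      have "\<exists>p. prime p \<and> p dvd gcd (a0 * x0 u v) (a1 * H u v)"
      proof (cases "gcd (a0 * x0 u v) (a1 * H u v) = 0")
        case True
        then show ?thesis by (intro exI[of _ 2]) auto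
      next
        case False
        have "\<not> is_unit (gcd (a0 * x0 u v) (a1 * H u v))" using nc by (simp add: coprime_iff_gcd_eq_1)
        then show ?thesis using prime_divisor_exists False by blast
      qed
      then obtain p where p: "prime p" "p dvd a0 * x0 u v" "p dvd a1 * H u v" by auto
      have cd: "\<not> (p dvd x \<and> p dvd y)" if "coprime x y" for x y
        using that p(1) by (meson coprime_common_divisor not_prime_unit)
      have "p dvd a0 * x0 u v * x0 u v + a1 * H u v * H u v" using p by simp
      then have 2: "p dvd a2 * (G u v)\<^sup>2" using eqn[of u v] by (simp add: power2_eq_square algebra_simps)
      show False
      proof (cases "p dvd a0 * a1")
        case True
        then have "\<not> p dvd a2" using cop p(1) cd by (metis coprime_mult_left_iff)
        then have "p dvd G u v" using 2 p(1) by (simp add: prime_dvd_mult_iff prime_dvd_power_iff)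
        then show False using no[OF p(1)] True by simp
      next
        case False
        then have xH: "p dvd x0 u v" "p dvd H u v" using p by (auto simp: prime_dvd_mult_iff)
        then have na2: "\<not> p dvd a2" using no[OF p(1)] by simp
        then have "p dvd G u v" using 2 p(1) by (simp add: prime_dvd_mult_iff prime_dvd_power_iff)
        moreover have "\<not> p dvd k" using False na2 prime_dvd_k_cases[OF p(1)] by simp
        ultimately show False using prim[OF p(1) _ uv] xH by simp
      qed
    qed
    then show "\<psi> (u, v) \<in> sols" using eqn[of u v] Gpos[OF av] by (simp add: sols_def \<psi>_def)
  qed
  have image: "\<psi> ` P X = S X" for X
  proof (intro equalityI subsetI)
    fix x assume "x \<in> \<psi> ` P X"
    then obtain u v where uv: "x = \<psi> (u, v)" "(u, v) \<in> P X" by auto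
    then show "x \<in> S X" using sols_iff[of u v] \<psi>_lat[of u v] by (auto simp: S_def P_def \<psi>_def)
  next
    fix x assume x: "x \<in> S X"
    then obtain x1 y1 w1 where w: "x = (\<alpha> * x1 + \<beta> * y1 + n1 * n2 * w1, c0 * x1 + n0 * y1, x1)"
      using lat(2)[of x] by (auto simp: S_def)
    have xs: "(\<alpha> * x1 + \<beta> * y1 + n1 * n2 * w1, c0 * x1 + n0 * y1, x1) \<in> sols" and xX: "real_of_int x1 \<le> X"
      using x w by (auto simp: S_def)
    \<comment> \<open>the preimage under the unimodular matrix, by Cramer's rule\<close>
    define x' y' z' where "x' = (e * i - f * h) * x1 + (c * h - b * i) * y1 + (b * f - c * e) * w1"
      "y' = (f * g - d * i) * x1 + (a * i - c * g) * y1 + (c * d - a * f) * w1"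
      "z' = (d * h - e * g) * x1 + (b * g - a * h) * y1 + (a * e - b * d) * w1"
    note xyz = x'_y'_z'_def
    have "a * x' + b * y' + c * z' = det3 a b c d e f g h i * x1" "d * x' + e * y' + f * z' = det3 a b c d e f g h i * y1"
      "g * x' + h * y' + i * z' = det3 a b c d e f g h i * w1"
      unfolding xyz det3_def by (simp_all add: algebra_simps)
    then have lin': "(x1, y1, w1) = lin3 a b c d e f g h i (x', y', z')" using N by (simp add: lin3_def)
    have "k * (y'\<^sup>2 - x' * z') = 0" using form[OF lin'] xs by (simp add: sols_def)
    then have sq: "y'\<^sup>2 = x' * z'" using pos by simp
    have "\<not> (p dvd x' \<and> p dvd y' \<and> p dvd z')" if "prime p" for p
    proof
      assume "p dvd x' \<and> p dvd y' \<and> p dvd z'"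
      then have "p dvd x1" "p dvd y1" "p dvd w1" using lin' by (auto simp: lin3_def)
      then have "p dvd a0 * (\<alpha> * x1 + \<beta> * y1 + n1 * n2 * w1)" "p dvd a1 * (c0 * x1 + n0 * y1)" by auto
      moreover have "coprime (a0 * (\<alpha> * x1 + \<beta> * y1 + n1 * n2 * w1)) (a1 * (c0 * x1 + n0 * y1))"
        using xs by (simp add: sols_def)
      ultimately show False using that coprime_common_divisor not_prime_unit by blast
    qed
    then obtain u v \<tau> where uv: "\<tau> = 1 \<or> \<tau> = -1" "coprime u v" "x' = \<tau> * u\<^sup>2" "y' = \<tau> * (u * v)" "z' = \<tau> * v\<^sup>2"
      using primitive_square_product[OF sq] by metis
    have G1: "G u v = \<sigma> * \<tau> * x1"
    proof -
      have "x1 = \<tau> * (a * u\<^sup>2 + b * (u * v) + c * v\<^sup>2)" using lin' uv by (simp add: lin3_def algebra_simps)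
      then show ?thesis using uv(1) unfolding GX X'_def by auto
    qed
    have "x1 > 0" using xs by (simp add: sols_def)
    have "4 * (\<sigma> * a) * G u v = (2 * (\<sigma> * a) * u + (\<sigma> * b) * v)\<^sup>2 + (4 * (\<sigma> * a) * (\<sigma> * c) - (\<sigma> * b)\<^sup>2) * v\<^sup>2"
      unfolding G_def by (simp add: power2_eq_square algebra_simps)
    then have "0 \<le> (4 * (\<sigma> * a)) * G u v" using discG a01 by simp
    then have "G u v \<ge> 0" using \<sigma>(2) by (simp add: zero_le_mult_iff)
    then have "\<tau> = \<sigma>" using G1 \<open>x1 > 0\<close> uv(1) \<sigma>(3) by auto
    then have "(x1, y1, w1) = (X' u v, T' u v, W' u v)" unfolding lin using lin' uv by simp
    then have x\<psi>: "x = \<psi> (u, v)" unfolding w \<psi>_def by (simp add: x0_def HT GX)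
    have "avoids A s t u v" using sols_iff[OF uv(2)] xs w x\<psi> by simp
    moreover have "G u v = x1" using x\<psi> w by (simp add: \<psi>_def)
    ultimately have "(u, v) \<in> P X" using uv(2) xX by (simp add: P_def)
    then show "x \<in> \<psi> ` P X" using x\<psi> by blast
  qed
  then show finS: "finite (S X)" for X using finP by (metis finite_imageI)
  have fiber: "card {q \<in> P X. \<psi> q = y} = 2" if y: "y \<in> \<psi> ` P X" for y X
  proof -
    obtain u v where uv: "(u, v) \<in> P X" "y = \<psi> (u, v)" using y by (elim imageE) (metis prod.exhaust)
    have "{q \<in> P X. \<psi> q = y} = {(u, v), (-u, -v)}"
    proof (intro equalityI subsetI)
      fix q assume q: "q \<in> {q \<in> P X. \<psi> q = y}"
      obtain u' v' where q': "q = (u', v')" by fastforce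
      have e: "x0 u' v' = x0 u v" "H u' v' = H u v" "G u' v' = G u v" using q q' uv(2) by (auto simp: \<psi>_def)
      have X: "X' u' v' = X' u v" using e GX by simp
      have T: "T' u' v' = T' u v" using e(2) X n_pos unfolding HT by simp
      have W: "W' u' v' = W' u v" using e(1) X T n_pos unfolding x0_def by simp
      define Du Dm Dv where "Du = \<sigma> * u'\<^sup>2 - \<sigma> * u\<^sup>2" "Dm = \<sigma> * (u' * v') - \<sigma> * (u * v)" "Dv = \<sigma> * v'\<^sup>2 - \<sigma> * v\<^sup>2"
      have "a * Du + b * Dm + c * Dv = 0" "d * Du + e * Dm + f * Dv = 0" "g * Du + h * Dm + i * Dv = 0"
        using X T W unfolding X'_def T'_def W'_def Du_Dm_Dv_def by (simp_all add: algebra_simps)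
      \<comment> \<open>Divisibility by 0 is equality with 0, so integrality of the inverse yields
        injectivity.\<close>
      then have z: "0 dvd a * Du + b * Dm + c * Dv" "0 dvd d * Du + e * Dm + f * Dv" "0 dvd g * Du + h * Dm + i * Dv"
        by (simp_all only: dvd_refl)
      have "Du = 0" "Dm = 0" "Dv = 0" using sl3_inj_dvd[OF N z] by (simp_all only: dvd_0_left_iff)
      then have 2: "u'\<^sup>2 = u\<^sup>2" "u' * v' = u * v" "v'\<^sup>2 = v\<^sup>2" using \<sigma>(3) unfolding Du_Dm_Dv_def by auto
      then have "u' = u \<or> u' = -u" "v' = v \<or> v' = -v" by (simp_all add: power2_eq_iff)
      then show "q \<in> {(u, v), (-u, -v)}" using 2(2) unfolding q' by auto
    next
      fix q assume q: "q \<in> {(u, v), (-u, -v)}"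
      have "avoids A s t (-u) (-v) = avoids A s t u v"
      proof -
        have "s p * (-u) + t p * (-v) = - (s p * u + t p * v)" for p by simp
        then show ?thesis unfolding avoids_def by (simp only: dvd_minus_iff)
      qed
      moreover have "G (-u) (-v) = G u v" by (simp add: G_def)
      moreover have "\<psi> (-u, -v) = \<psi> (u, v)" by (simp add: \<psi>_def x0_def HT GX X'_def T'_def W'_def)
      ultimately have "(-u, -v) \<in> P X" "\<psi> (-u, -v) = y" using uv by (auto simp: P_def)
      then show "q \<in> {q \<in> P X. \<psi> q = y}" using q uv by auto
    qed
    moreover have "(u, v) \<noteq> (-u, -v)"
    proof
      assume "(u, v) = (-u, -v)"
      then have "u = 0" "v = 0" by auto
      then show False using uv A2 by (auto simp: P_def avoids_def)
    qed
    ultimately show ?thesis by simp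
  qed
  have "card (P X) = 2 * card (S X)" for X
  proof -
    have "card (P X) = (\<Sum>y\<in>\<psi> ` P X. \<Sum>q\<in>{q \<in> P X. \<psi> q = y}. 1)"
      using sum.image_gen[OF finP, of "\<lambda>_. 1::nat" X \<psi>] by simp
    also have "\<dots> = (\<Sum>y\<in>\<psi> ` P X. 2)" using fiber by (intro sum.cong) auto
    finally show ?thesis by (simp add: image)
  qed
  then have "real (card (S X)) / X = real (card (P X)) / X / 2" for X by simp
  then show "((\<lambda>X. real (card (S X)) / X) \<longlongrightarrow> 6 / (pi * sqrt (real_of_int (a0 * a1))) *
       (\<Prod>p\<in>prime_factors (nat k). inverse (1 + 1 / real p))) at_top"
    using tendsto_divide[OF limP tendsto_const[of 2]] by (simp add: A_def mult_ac)
qed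

end

section \<open>Counting all solutions of a conic\<close>

context conic
begin

text \<open>Every solution lies in exactly one of the lattices, and all lattices contribute the same
  density.\<close>

lemma sols_count:
  defines "S \<equiv> \<lambda>X::real. {x \<in> sols. real_of_int (snd (snd x)) \<le> X}"
  shows "finite (S X)"
    and "((\<lambda>X. real (card (S X)) / X) \<longlongrightarrow> real (card C0 * card C1 * card C2) *
      (6 / (pi * sqrt (real_of_int (a0 * a1))) * (\<Prod>p\<in>prime_factors (nat k). inverse (1 + 1 / real p)))) at_top"
proof -
  define I where "I = C0 \<times> C1 \<times> C2"
  define Sc where "Sc c X = {x \<in> sols \<inter> lattice (fst c) (fst (snd c)) (snd (snd c)). real_of_int (snd (snd x)) \<le> X}"
    for c and X :: real
  define L where "L = 6 / (pi * sqrt (real_of_int (a0 * a1))) * (\<Prod>p\<in>prime_factors (nat k). inverse (1 + 1 / real p))"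
  have finC: "finite C0" "finite C1" "finite C2"
    unfolding C0_def C1_def C2_def by (rule finite_subset[of _ "{0..<n0}"], auto)
      (rule finite_subset[of _ "{0..<n1}"], auto, rule finite_subset[of _ "{0..<n2}"], auto)
  have finI: "finite I" unfolding I_def using finC by auto
  have cnt: "finite (Sc c X)" "((\<lambda>X. real (card (Sc c X)) / X) \<longlongrightarrow> L) at_top" if "c \<in> I" for c X
    using that lattice_count[of "fst c" "fst (snd c)" "snd (snd c)"] unfolding Sc_def L_def I_def by auto
  have un: "S X = (\<Union>c\<in>I. Sc c X)" for X
  proof (intro equalityI subsetI)
    fix x assume x: "x \<in> S X"
    obtain x0 x1 x2 where xx: "x = (x0, x1, x2)" by (metis prod.exhaust)
    then have "(x0, x1, x2) \<in> sols" using x by (simp add: S_def)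
    from sols_lattice[OF this] obtain c0 c1 c2 where "(c0, c1, c2) \<in> C0 \<times> C1 \<times> C2" "(x0, x1, x2) \<in> lattice c0 c1 c2"
      by blast
    then show "x \<in> (\<Union>c\<in>I. Sc c X)" using x xx by (intro UN_I[of "(c0, c1, c2)"]) (auto simp: I_def Sc_def S_def)
  qed (auto simp: S_def Sc_def)
  then show "finite (S X)" for X using finI cnt(1) by auto
  have disj: "Sc c X \<inter> Sc c' X = {}" if "c \<in> I" "c' \<in> I" "c \<noteq> c'" for c c' X
  proof -
    have False if x: "x \<in> Sc c X" "x \<in> Sc c' X" for x
    proof -
      obtain x0 x1 x2 where xx: "x = (x0, x1, x2)" by (metis prod.exhaust)
      then have s: "(x0, x1, x2) \<in> sols" using x by (simp add: Sc_def)
      obtain d0 d1 d2 where d: "c = (d0, d1, d2)" by (metis prod.exhaust)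
      obtain e0 e1 e2 where e: "c' = (e0, e1, e2)" by (metis prod.exhaust)
      from sols_lattice[OF s] obtain z where
        "\<And>y. (case y of (c0, c1, c2) \<Rightarrow> (c0, c1, c2) \<in> C0 \<times> C1 \<times> C2 \<and> (x0, x1, x2) \<in> lattice c0 c1 c2) \<Longrightarrow> y = z"
        by (elim ex1E) blast
      from this[of c] this[of c'] have "c = c'" using x xx d e \<open>c \<in> I\<close> \<open>c' \<in> I\<close>
        by (auto simp: I_def Sc_def)
      then show False using \<open>c \<noteq> c'\<close> by simp
    qed
    then show ?thesis by blast
  qed
  have card_eq: "card (S X) = (\<Sum>c\<in>I. card (Sc c X))" for X
    unfolding un by (rule card_UN_disjoint) (use finI cnt disj in auto)
  have "((\<lambda>X. \<Sum>c\<in>I. real (card (Sc c X)) / X) \<longlongrightarrow> (\<Sum>c\<in>I. L)) at_top"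
    by (intro tendsto_sum cnt(2))
  moreover have "(\<Sum>c\<in>I. real (card (Sc c X)) / X) = real (card (S X)) / X" for X
    by (simp add: card_eq sum_divide_distrib)
  moreover have "(\<Sum>c\<in>I. L) = real (card C0 * card C1 * card C2) * L"
    by (simp add: I_def card_cartesian_product)
  ultimately show "((\<lambda>X. real (card (S X)) / X) \<longlongrightarrow> real (card C0 * card C1 * card C2) *
      (6 / (pi * sqrt (real_of_int (a0 * a1))) * (\<Prod>p\<in>prime_factors (nat k). inverse (1 + 1 / real p)))) at_top"
    unfolding L_def[symmetric] by (simp only:)
qed

definition sols_pos :: "real \<Rightarrow> (int \<times> int \<times> int) set" where
  "sols_pos B = {(x0, x1, x2) \<in> sols. x0 > 0 \<and> x1 > 0 \<and> real_of_int (a2 * x2\<^sup>2) \<le> B}"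

text \<open>Apart from boundedly many solutions with a zero coordinate, the signs of x0 and x1 make
  four solutions of each positive one. The bound a2 x2^2 \<le> B means x2 \<le> sqrt (B / a2), so 6
  / sqrt (a0 a1) turns into 6 / (4 sqrt k).\<close>

lemma sols_pos_count:
  shows "finite (sols_pos B)"
    and "((\<lambda>B. real (card (sols_pos B)) / sqrt B) \<longlongrightarrow> real (card C0 * card C1 * card C2) *
      (3 / (2 * pi * sqrt (real_of_int k)) * (\<Prod>p\<in>prime_factors (nat k). inverse (1 + 1 / real p)))) at_top"
proof -
  define S where "S X = {x \<in> sols. real_of_int (snd (snd x)) \<le> X}" for X :: real
  define r where "r = sqrt (real_of_int a2)"
  have r: "r > 0" using pos by (simp add: r_def)
  have finS: "finite (S X)" for X using sols_count(1) by (simp add: S_def)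
  have le_iff: "real_of_int (a2 * x2\<^sup>2) \<le> B \<longleftrightarrow> real_of_int x2 \<le> sqrt B / r" if "x2 > 0" for x2 B
  proof -
    have e: "real_of_int (a2 * x2\<^sup>2) = (r * real_of_int x2)\<^sup>2" using pos by (simp add: r_def power_mult_distrib)
    have "(r * real_of_int x2)\<^sup>2 \<le> B \<longleftrightarrow> r * real_of_int x2 \<le> sqrt B"
      using real_sqrt_le_iff[of "(r * real_of_int x2)\<^sup>2" B] r that by simp
    also have "r * real_of_int x2 \<le> sqrt B \<longleftrightarrow> real_of_int x2 \<le> sqrt B / r" using r by (simp add: field_simps)
    finally show ?thesis unfolding e .
  qed
  have posS: "sols_pos B = {(x0, x1, x2) \<in> S (sqrt B / r). x0 > 0 \<and> x1 > 0}" for B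
    unfolding sols_pos_def S_def using le_iff by (auto simp: sols_def)
  show finp: "finite (sols_pos B)" for B unfolding posS by (rule finite_subset[OF _ finS]) auto
  define E where "E B = {(x0, x1, x2) \<in> S (sqrt B / r). x0 = 0 \<or> x1 = 0}" for B
  \<comment> \<open>If x0 or x1 vanishes, coprimality makes the other one and its coefficient units,
    and then x2 is 1; at most nine triples remain.\<close>
  have Esub: "E B \<subseteq> {-1..1} \<times> {-1..1} \<times> {1}" for B
  proof
    fix x assume x: "x \<in> E B"
    obtain x0 x1 x2 where xx: "x = (x0, x1, x2)" by (metis prod.exhaust)
    have s: "a0 * x0\<^sup>2 + a1 * x1\<^sup>2 = a2 * x2\<^sup>2" "x2 > 0" "coprime (a0 * x0) (a1 * x1)" and z: "x0 = 0 \<or> x1 = 0"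
      using x xx by (auto simp: E_def S_def sols_def)
    have unit: "\<bar>t\<bar> = 1 \<and> a * t\<^sup>2 = 1" if "is_unit (a * t)" "a > 0" for a t :: int
    proof -
      have "is_unit a" "is_unit t" using that(1) unfolding is_unit_mult_iff by blast+
      then have a1: "\<bar>a\<bar> = 1" and t1: "\<bar>t\<bar> = 1" by (simp_all only: zdvd1_eq)
      have "t\<^sup>2 = 1" using t1 by (metis power2_abs one_power2)
      moreover have "a = 1" using a1 that(2) by linarith
      ultimately show ?thesis using t1 by simp
    qed
    have fin: "x2 = 1" if "a2 * x2\<^sup>2 = 1"
    proof -
      have "x2 dvd 1" using that by (metis dvd_mult dvd_triv_left power2_eq_square)
      then show ?thesis using s(2) by simp
    qed
    show "x \<in> {-1..1} \<times> {-1..1} \<times> {1}"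
    proof (cases "x0 = 0")
      case True
      then have "is_unit (a1 * x1)" using s(3) by (simp add: coprime_iff_gcd_eq_1 zdvd1_eq)
      from unit[OF this pos(2)] s(1) True have "\<bar>x1\<bar> = 1" "a2 * x2\<^sup>2 = 1" by auto
      then show ?thesis using True fin xx by auto
    next
      case False
      then have 0: "x1 = 0" using z by simp
      then have "is_unit (a0 * x0)" using s(3) by (simp add: coprime_iff_gcd_eq_1 zdvd1_eq)
      from unit[OF this pos(1)] s(1) 0 have "\<bar>x0\<bar> = 1" "a2 * x2\<^sup>2 = 1" by auto
      then show ?thesis using 0 fin xx by auto
    qed
  qed
  have cardE: "card (E B) \<le> 9" for B using card_mono[OF _ Esub] by (simp add: card_cartesian_product)
  have finE: "finite (E B)" for B using finite_subset[OF Esub] by simp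
  let ?sg = "\<lambda>(s, t, x0, x1, x2). (s * x0, t * x1, x2)"
  have decomp: "S (sqrt B / r) = E B \<union> ?sg ` ({1, -1} \<times> {1, -1} \<times> sols_pos B)" for B
  proof (intro equalityI subsetI)
    fix x assume x: "x \<in> S (sqrt B / r)"
    obtain x0 x1 x2 where xx: "x = (x0, x1, x2)" by (metis prod.exhaust)
    show "x \<in> E B \<union> ?sg ` ({1, -1} \<times> {1, -1} \<times> sols_pos B)"
    proof (cases "x0 = 0 \<or> x1 = 0")
      case True
      then show ?thesis using x xx by (simp add: E_def)
    next
      case False
      have "coprime (a0 * \<bar>x0\<bar>) (a1 * \<bar>x1\<bar>) = coprime (a0 * x0) (a1 * x1)"
        by simp
      then have "(\<bar>x0\<bar>, \<bar>x1\<bar>, x2) \<in> sols_pos B" using x xx False unfolding posS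
        by (auto simp: S_def sols_def)
      moreover have "x = ?sg (sgn x0, sgn x1, \<bar>x0\<bar>, \<bar>x1\<bar>, x2)" using xx by (simp add: sgn_mult_abs)
      moreover have "sgn x0 \<in> {1, -1}" "sgn x1 \<in> {1, -1}" using False by (auto simp: sgn_if)
      ultimately show ?thesis by blast
    qed
  next
    fix x assume "x \<in> E B \<union> ?sg ` ({1, -1} \<times> {1, -1} \<times> sols_pos B)"
    then show "x \<in> S (sqrt B / r)" unfolding posS E_def by (auto simp: S_def sols_def)
  qed
  have inj: "inj_on ?sg ({1, -1} \<times> {1, -1} \<times> sols_pos B)" for B
    by (auto simp: inj_on_def sols_pos_def)
  have disj: "E B \<inter> ?sg ` ({1, -1} \<times> {1, -1} \<times> sols_pos B) = {}" for B
    by (auto simp: E_def sols_pos_def)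
  have cardS: "card (S (sqrt B / r)) = card (E B) + 4 * card (sols_pos B)" for B
    unfolding decomp using finE finp disj
    by (subst card_Un_disjoint) (auto simp: card_image[OF inj] card_cartesian_product)
  then have eq: "real (card (sols_pos B)) / sqrt B =
      (real (card (S (sqrt B / r))) / (sqrt B / r) * (1 / r) - real (card (E B)) / sqrt B) / 4" for B
  proof -
    have "real (card (S (sqrt B / r))) / (sqrt B / r) * (1 / r) = real (card (S (sqrt B / r))) / sqrt B"
      using r by simp
    then show ?thesis using cardS[of B] by (simp add: add_divide_distrib)
  qed
  have lim1: "((\<lambda>B. real (card (S (sqrt B / r))) / (sqrt B / r)) \<longlongrightarrow> real (card C0 * card C1 * card C2) *
      (6 / (pi * sqrt (real_of_int (a0 * a1))) * (\<Prod>p\<in>prime_factors (nat k). inverse (1 + 1 / real p)))) at_top"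
  proof -
    have "filterlim (\<lambda>B. sqrt B / r) at_top at_top"
      using filterlim_tendsto_pos_mult_at_top[OF tendsto_const, of "1 / r" sqrt at_top] sqrt_at_top r
      by (simp add: field_simps)
    then show ?thesis
      by (rule filterlim_compose[OF sols_count(2)[folded S_def]])
  qed
  have lim2: "((\<lambda>B. real (card (E B)) / sqrt B) \<longlongrightarrow> 0) at_top"
  proof (rule Lim_null_comparison)
    show "eventually (\<lambda>B. norm (real (card (E B)) / sqrt B) \<le> 9 / sqrt B) at_top"
      using eventually_gt_at_top[of 0]
    proof eventually_elim
      case (elim B)
      have "real (card (E B)) \<le> 9" using cardE[of B] by linarith
      then show ?case using elim by (simp add: divide_right_mono)
    qed
    show "((\<lambda>B. 9 / sqrt B) \<longlongrightarrow> 0) at_top"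
      by (intro tendsto_divide_0[OF tendsto_const] filterlim_at_top_imp_at_infinity sqrt_at_top)
  qed
  have "((\<lambda>B. real (card (sols_pos B)) / sqrt B) \<longlongrightarrow> (real (card C0 * card C1 * card C2) *
      (6 / (pi * sqrt (real_of_int (a0 * a1))) * (\<Prod>p\<in>prime_factors (nat k). inverse (1 + 1 / real p))) * (1 / r) - 0) / 4) at_top"
    unfolding eq by (intro tendsto_divide tendsto_diff tendsto_mult lim1 lim2 tendsto_const) simp_all
  moreover have "sqrt (real_of_int k) = sqrt (real_of_int (a0 * a1)) * r" by (simp add: r_def real_sqrt_mult)
  ultimately show "((\<lambda>B. real (card (sols_pos B)) / sqrt B) \<longlongrightarrow> real (card C0 * card C1 * card C2) *
      (3 / (2 * pi * sqrt (real_of_int k)) * (\<Prod>p\<in>prime_factors (nat k). inverse (1 + 1 / real p)))) at_top"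
    by (simp add: field_simps)
qed

end

text \<open>If one coefficient is divisible by 4, the other two are odd by coprimality, so halving
  whatever is even halves exactly that one.\<close>

lemma conicI:
  fixes a0 a1 a2 :: int
  assumes pos: "a0 > 0" "a1 > 0" "a2 > 0" and cop: "coprime a0 a1" "coprime a0 a2" "coprime a1 a2"
    and four: "4 dvd a0 \<or> 4 dvd a1 \<or> 4 dvd a2"
  shows "conic a0 a1 a2 (if even a0 then a0 div 2 else a0) (if even a1 then a1 div 2 else a1) (if even a2 then a2 div 2 else a2)"
proof -
  have ev: "\<not> (even x \<and> even y)" if "coprime x y" for x y :: int using that by (meson coprime_common_divisor odd_one)
  have f: "4 dvd x \<or> odd x" if "even x \<Longrightarrow> 4 dvd x" for x :: int using that by blast
  have e: "even x" if "4 dvd x" for x :: int using that by (meson dvd_trans even_numeral)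
  have sing: "(if even x then x div 2 else x) > 0 \<and> (if even x then x div 2 else x) dvd x \<and>
      x dvd (if even x then x div 2 else x)\<^sup>2 \<and> x dvd 2 * (if even x then x div 2 else x)" if x: "x > 0" "4 dvd x \<or> odd x" for x :: int
  proof (cases "even x")
    case True
    then have "4 dvd x" using x(2) by blast
    then obtain z where "x = 4 * z" by (rule dvdE)
    then show ?thesis using True x(1) by (auto simp: power2_eq_square)
  next
    case False
    then show ?thesis using x by (auto simp: power2_eq_square)
  qed
  have "4 dvd a0 \<or> odd a0" "4 dvd a1 \<or> odd a1" "4 dvd a2 \<or> odd a2"
    using four e ev[OF cop(1)] ev[OF cop(2)] ev[OF cop(3)] by blast+
  note s = sing[OF pos(1) this(1)] sing[OF pos(2) this(2)] sing[OF pos(3) this(3)]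
  show ?thesis
  proof
    show "2 * (if even a0 then a0 div 2 else a0) * (if even a1 then a1 div 2 else a1) * (if even a2 then a2 div 2 else a2) = a0 * a1 * a2"
      using four e ev[OF cop(1)] ev[OF cop(2)] ev[OF cop(3)] by auto
  qed (use pos cop s in blast)+
qed

section \<open>Local densities\<close>

text \<open>The congruence is modulo m, but roots are counted modulo n, which is m or m/2 in
  accordance with the halved coefficient of a conic.\<close>

definition root_count :: "int \<Rightarrow> int \<Rightarrow> int \<Rightarrow> nat" where
  "root_count n m t = card {d \<in> {0..<n}. [d\<^sup>2 = t] (mod m)}"

text \<open>Multiplication by a turns a c^2 = b into (a c)^2 = t w^2, so c corresponds to the root d
  = a c / w of t.\<close>

lemma card_roots_scaled:
  fixes a b w t n m :: int
  assumes cop: "coprime a m" "coprime w m" and ab: "[a * b = t * w\<^sup>2] (mod m)"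
    and n: "n > 0" "n dvd m" "m dvd n\<^sup>2" "m dvd 2 * n"
  shows "card {c \<in> {0..<n}. [a * c\<^sup>2 = b] (mod m)} = root_count n m t"
proof -
  obtain a' where a': "[a * a' = 1] (mod m)" using cong_solve_coprime_int[OF cop(1)] by blast
  obtain w' where w': "[w * w' = 1] (mod m)" using cong_solve_coprime_int[OF cop(2)] by blast
  have a'n: "[a * a' = 1] (mod n)" and w'n: "[w * w' = 1] (mod n)" using a' w' n(2) cong_dvd_modulus by blast+
  define f where "f c = (a * w' * c) mod n" for c
  define g where "g d = (a' * w * d) mod n" for d
  have fc: "[f c = a * w' * c] (mod n)" for c unfolding f_def by simp
  have gc: "[g d = a' * w * d] (mod n)" for d unfolding g_def by simp
  have "bij_betw f {c \<in> {0..<n}. [a * c\<^sup>2 = b] (mod m)} {d \<in> {0..<n}. [d\<^sup>2 = t] (mod m)}"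
  proof (rule bij_betw_byWitness[where f' = g])
    have red: "[(a * a') * (w * w') * c = 1 * 1 * c] (mod n)" for c
      by (intro cong_mult a'n w'n cong_refl)
    show "\<forall>c\<in>{c \<in> {0..<n}. [a * c\<^sup>2 = b] (mod m)}. g (f c) = c"
    proof
      fix c assume c: "c \<in> {c \<in> {0..<n}. [a * c\<^sup>2 = b] (mod m)}"
      have "[g (f c) = a' * w * (a * w' * c)] (mod n)"
        using cong_trans[OF gc cong_mult[OF cong_refl fc]] .
      also have "a' * w * (a * w' * c) = (a * a') * (w * w') * c" by simp
      also note red
      finally have "[g (f c) = c] (mod n)" by simp
      then show "g (f c) = c" using c n(1) cong_less_imp_eq_int[of "g (f c)" n c] by (auto simp: g_def)
    qed
    show "\<forall>d\<in>{d \<in> {0..<n}. [d\<^sup>2 = t] (mod m)}. f (g d) = d"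
    proof
      fix d assume d: "d \<in> {d \<in> {0..<n}. [d\<^sup>2 = t] (mod m)}"
      have "[f (g d) = a * w' * (a' * w * d)] (mod n)"
        using cong_trans[OF fc cong_mult[OF cong_refl gc]] .
      also have "a * w' * (a' * w * d) = (a * a') * (w * w') * d" by simp
      also note red
      finally have "[f (g d) = d] (mod n)" by simp
      then show "f (g d) = d" using d n(1) cong_less_imp_eq_int[of "f (g d)" n d] by (auto simp: f_def)
    qed
    show "f ` {c \<in> {0..<n}. [a * c\<^sup>2 = b] (mod m)} \<subseteq> {d \<in> {0..<n}. [d\<^sup>2 = t] (mod m)}"
    proof (intro image_subsetI)
      fix c assume c: "c \<in> {c \<in> {0..<n}. [a * c\<^sup>2 = b] (mod m)}"
      have "[(f c)\<^sup>2 = (a * w' * c)\<^sup>2] (mod m)" using sq_cong[OF fc n(2-4)] .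
      also have "(a * w' * c)\<^sup>2 = a * (a * c\<^sup>2) * w'\<^sup>2" by (simp add: power2_eq_square)
      also have "[a * (a * c\<^sup>2) * w'\<^sup>2 = a * b * w'\<^sup>2] (mod m)" using c by (intro cong_mult cong_refl) auto
      also have "[a * b * w'\<^sup>2 = t * w\<^sup>2 * w'\<^sup>2] (mod m)" by (intro cong_mult cong_refl ab)
      also have "t * w\<^sup>2 * w'\<^sup>2 = t * (w * w')\<^sup>2" by (simp add: power2_eq_square)
      also have "[t * (w * w')\<^sup>2 = t * 1\<^sup>2] (mod m)" by (intro cong_mult cong_refl cong_pow w')
      finally show "f c \<in> {d \<in> {0..<n}. [d\<^sup>2 = t] (mod m)}" using n(1) by (simp add: f_def)
    qed
    show "g ` {d \<in> {0..<n}. [d\<^sup>2 = t] (mod m)} \<subseteq> {c \<in> {0..<n}. [a * c\<^sup>2 = b] (mod m)}"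
    proof (intro image_subsetI)
      fix d assume d: "d \<in> {d \<in> {0..<n}. [d\<^sup>2 = t] (mod m)}"
      have "[a * (g d)\<^sup>2 = a * (a' * w * d)\<^sup>2] (mod m)" by (intro cong_mult cong_refl sq_cong[OF gc n(2-4)])
      also have "a * (a' * w * d)\<^sup>2 = (a * a') * a' * w\<^sup>2 * d\<^sup>2" by (simp add: power2_eq_square)
      also have "[(a * a') * a' * w\<^sup>2 * d\<^sup>2 = 1 * a' * w\<^sup>2 * t] (mod m)" using d by (intro cong_mult cong_refl a') auto
      also have "1 * a' * w\<^sup>2 * t = a' * (t * w\<^sup>2)" by simp
      also have "[a' * (t * w\<^sup>2) = a' * (a * b)] (mod m)" by (intro cong_mult cong_refl cong_sym[OF ab])
      also have "a' * (a * b) = (a * a') * b" by simp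
      also have "[(a * a') * b = 1 * b] (mod m)" by (intro cong_mult cong_refl a')
      finally show "g d \<in> {c \<in> {0..<n}. [a * c\<^sup>2 = b] (mod m)}" using n(1) by (simp add: g_def)
    qed
  qed
  then show ?thesis unfolding root_count_def by (rule bij_betw_same_card)
qed

lemma root_count_mult:
  fixes n1 n2 m1 m2 t :: int
  assumes cop: "coprime m1 m2"
    and n1: "n1 > 0" "n1 dvd m1" "m1 dvd n1\<^sup>2" "m1 dvd 2 * n1"
    and n2: "n2 > 0" "n2 dvd m2" "m2 dvd n2\<^sup>2" "m2 dvd 2 * n2"
  shows "root_count (n1 * n2) (m1 * m2) t = root_count n1 m1 t * root_count n2 m2 t"
proof -
  have copn: "coprime n1 n2" using cop n1(2) n2(2) by (meson coprime_divisors)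
  let ?f = "\<lambda>d. (d mod n1, d mod n2)"
  have "bij_betw ?f {d \<in> {0..<n1 * n2}. [d\<^sup>2 = t] (mod m1 * m2)}
     ({d \<in> {0..<n1}. [d\<^sup>2 = t] (mod m1)} \<times> {d \<in> {0..<n2}. [d\<^sup>2 = t] (mod m2)})"
  proof (rule bij_betwI')
    fix x y assume xy: "x \<in> {d \<in> {0..<n1 * n2}. [d\<^sup>2 = t] (mod m1 * m2)}" "y \<in> {d \<in> {0..<n1 * n2}. [d\<^sup>2 = t] (mod m1 * m2)}"
    show "(?f x = ?f y) = (x = y)"
    proof
      assume "?f x = ?f y"
      then have "[x = y] (mod n1)" "[x = y] (mod n2)" by (auto simp: unique_euclidean_semiring_class.cong_def)
      then have "[x = y] (mod n1 * n2)" using copn by (intro coprime_cong_mult)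
      then show "x = y" using xy cong_less_imp_eq_int[of x "n1 * n2" y] by auto
    qed simp
  next
    fix x assume x: "x \<in> {d \<in> {0..<n1 * n2}. [d\<^sup>2 = t] (mod m1 * m2)}"
    then have "[x\<^sup>2 = t] (mod m1)" "[x\<^sup>2 = t] (mod m2)" using cong_dvd_modulus by force+
    moreover have "[(x mod n1)\<^sup>2 = x\<^sup>2] (mod m1)" "[(x mod n2)\<^sup>2 = x\<^sup>2] (mod m2)"
      using sq_cong[OF _ n1(2-4)] sq_cong[OF _ n2(2-4)] by simp_all
    ultimately show "?f x \<in> {d \<in> {0..<n1}. [d\<^sup>2 = t] (mod m1)} \<times> {d \<in> {0..<n2}. [d\<^sup>2 = t] (mod m2)}"
      using n1(1) n2(1) cong_trans by auto
  next
    fix z assume z: "z \<in> {d \<in> {0..<n1}. [d\<^sup>2 = t] (mod m1)} \<times> {d \<in> {0..<n2}. [d\<^sup>2 = t] (mod m2)}"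
    obtain u v where zz: "z = (u, v)" by fastforce
    obtain x' where x': "[x' = u] (mod n1)" "[x' = v] (mod n2)"
      using binary_chinese_remainder_int[OF copn] by blast
    define x where "x = x' mod (n1 * n2)"
    have x: "[x = u] (mod n1)" "[x = v] (mod n2)" using x' by (auto simp: x_def unique_euclidean_semiring_class.cong_def mod_mod_cancel)
    have "[x\<^sup>2 = u\<^sup>2] (mod m1)" "[x\<^sup>2 = v\<^sup>2] (mod m2)"
      using sq_cong[OF x(1) n1(2-4)] sq_cong[OF x(2) n2(2-4)] by simp_all
    then have "[x\<^sup>2 = t] (mod m1)" "[x\<^sup>2 = t] (mod m2)" using z zz cong_trans by auto
    then have "[x\<^sup>2 = t] (mod m1 * m2)" using cop by (intro coprime_cong_mult)
    moreover have "x \<in> {0..<n1 * n2}" using n1(1) n2(1) by (simp add: x_def)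
    moreover have "z = ?f x" using x z zz by (auto simp: unique_euclidean_semiring_class.cong_def)
    ultimately show "\<exists>x\<in>{d \<in> {0..<n1 * n2}. [d\<^sup>2 = t] (mod m1 * m2)}. z = ?f x" by blast
  qed
  from bij_betw_same_card[OF this] show ?thesis unfolding root_count_def by (simp add: card_cartesian_product)
qed

lemma hensel_square_root:
  fixes p :: int
  assumes p: "prime p" "odd p" and t: "\<not> p dvd t" and r: "[r\<^sup>2 = t] (mod p)" and e: "e \<ge> 1"
  shows "\<exists>s. [s\<^sup>2 = t] (mod p ^ e)"
  using e
proof (induction e rule: nat_induct_at_least)
  case base
  then show ?case using r by auto
next
  case (Suc e)
  then obtain s where s: "[s\<^sup>2 = t] (mod p ^ e)" by blast
  then obtain q where q: "t = s\<^sup>2 + p ^ e * q" by (metis cong_iff_lin mult.commute)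
  have "[s\<^sup>2 = t] (mod p)" using s Suc(1) cong_dvd_modulus[of "s\<^sup>2" t "p ^ e" p] by (simp add: dvd_power)
  then have "\<not> p dvd s\<^sup>2" using t cong_dvd_iff by blast
  then have "\<not> p dvd 2 * s" using p by (metis dvd_power_iff_le even_mult_iff prime_dvd_mult_iff dvd_mult power2_eq_square primes_dvd_imp_eq two_is_prime dvd_refl)
  then have "coprime (2 * s) p" using p prime_imp_coprime coprime_commute by blast
  then obtain z where z: "[2 * s * z = 1] (mod p)" using cong_solve_coprime_int by blast
  have "[2 * s * (z * q) = 1 * q] (mod p)" using z by (metis cong_scalar_right mult.assoc)
  then obtain h where h: "q = 2 * s * (z * q) + p * h" by (metis cong_iff_lin mult_1 mult.commute)
  \<comment> \<open>Newton correction: z inverts 2 s modulo p, so the error p^e q is cancelled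
    modulo p^(e+1).\<close>
  define s' where "s' = s + p ^ e * (z * q)"
  have "t - s'\<^sup>2 = p ^ e * (q - 2 * s * (z * q)) - (p ^ e)\<^sup>2 * (z * q)\<^sup>2"
    unfolding q s'_def by (simp add: power2_eq_square algebra_simps)
  also have "q - 2 * s * (z * q) = p * h" using h by simp
  finally have d: "t - s'\<^sup>2 = p ^ Suc e * h - (p ^ e)\<^sup>2 * (z * q)\<^sup>2" by simp
  have "p ^ Suc e dvd (p ^ e)\<^sup>2" using Suc(1) unfolding power_mult[symmetric] by (intro le_imp_power_dvd) simp
  then have "p ^ Suc e dvd t - s'\<^sup>2" unfolding d by (intro dvd_diff dvd_mult2) auto
  then show ?case by (metis cong_iff_dvd_diff cong_sym)
qed

text \<open>A root modulo p lifts to some s by Hensel's lemma. The factors d - s and d + s cannot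
  both be divisible by p, as p does not divide 2 s, so the full power of p divides one of them and
  the roots are s and -s.\<close>

lemma root_count_prime_power:
  fixes p :: nat
  assumes p: "prime p" "p > 2" and t: "\<not> int p dvd t" and e: "e \<ge> 1"
  shows "int (root_count (int p ^ e) (int p ^ e) t) = 1 + Legendre t (int p)"
proof (cases "QuadRes (int p) t")
  case False
  have "\<not> [d\<^sup>2 = t] (mod int p ^ e)" for d
  proof
    assume "[d\<^sup>2 = t] (mod int p ^ e)"
    then have "[d\<^sup>2 = t] (mod int p)" using e cong_dvd_modulus by (metis dvd_power less_le_trans zero_less_one)
    then show False using False unfolding QuadRes_def by blast
  qed
  then show ?thesis using False t by (simp add: root_count_def Legendre_def cong_0_iff)
next
  case True
  then obtain r where r: "[r\<^sup>2 = t] (mod int p)" unfolding QuadRes_def by blast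
  define P where "P = int p ^ e"
  have pp: "prime (int p)" "odd (int p)" using p prime_odd_nat by auto
  obtain s where s: "[s\<^sup>2 = t] (mod P)" using hensel_square_root[OF pp t r e] unfolding P_def by blast
  have P0: "P > 0" using p by (simp add: P_def)
  have pP: "int p dvd P" using e by (simp add: P_def dvd_power)
  have "[s\<^sup>2 = t] (mod int p)" using s pP cong_dvd_modulus by blast
  then have "\<not> int p dvd s\<^sup>2" using t cong_dvd_iff by blast
  then have ps: "\<not> int p dvd s" by (metis dvd_mult power2_eq_square)
  have p2: "\<not> int p dvd 2" using p by (auto dest: zdvd_imp_le)
  have p2s: "\<not> int p dvd 2 * s" using ps p2 pp(1) by (simp add: prime_dvd_mult_iff)
  have roots: "[d\<^sup>2 = t] (mod P) \<longleftrightarrow> [d = s] (mod P) \<or> [d = - s] (mod P)" for d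
  proof
    assume "[d\<^sup>2 = t] (mod P)"
    then have "[d\<^sup>2 = s\<^sup>2] (mod P)" using s cong_sym cong_trans by blast
    then have "P dvd (d - s) * (d + s)" by (simp add: cong_iff_dvd_diff power2_eq_square algebra_simps)
    moreover have "\<not> (int p dvd d - s \<and> int p dvd d + s)"
    proof
      assume "int p dvd d - s \<and> int p dvd d + s"
      then have "int p dvd (d + s) - (d - s)" using dvd_diff by blast
      then show False using p2s by simp
    qed
    ultimately have "P dvd d - s \<or> P dvd d + s"
    proof (cases "int p dvd d - s")
      case True
      then have "coprime P (d + s)" using \<open>\<not> (int p dvd d - s \<and> int p dvd d + s)\<close> prime_imp_coprime[OF pp(1)] 
        by (simp add: P_def)
      then show ?thesis using \<open>P dvd (d - s) * (d + s)\<close> by (simp add: coprime_dvd_mult_left_iff)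
    next
      case False
      then have "coprime P (d - s)" using prime_imp_coprime[OF pp(1)] by (simp add: P_def)
      then show ?thesis using \<open>P dvd (d - s) * (d + s)\<close> by (simp add: coprime_dvd_mult_right_iff)
    qed
    then show "[d = s] (mod P) \<or> [d = - s] (mod P)" by (simp add: cong_iff_dvd_diff)
  next
    assume "[d = s] (mod P) \<or> [d = - s] (mod P)"
    then have "[d\<^sup>2 = s\<^sup>2] (mod P)" using cong_pow[of d s P 2] cong_pow[of d "-s" P 2] by auto
    then show "[d\<^sup>2 = t] (mod P)" using s cong_trans by blast
  qed
  have "{d \<in> {0..<P}. [d\<^sup>2 = t] (mod P)} = {s mod P, (- s) mod P}"
    unfolding roots using P0 by (auto simp: unique_euclidean_semiring_class.cong_def)
  moreover have "s mod P \<noteq> (- s) mod P"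
  proof
    assume "s mod P = (- s) mod P"
    then have "P dvd 2 * s" by (metis mod_eq_dvd_iff diff_minus_eq_add mult_2)
    then show False using pP p2s dvd_trans by blast
  qed
  ultimately have "root_count P P t = 2" by (simp add: root_count_def)
  then show ?thesis using True t by (simp add: P_def Legendre_def cong_0_iff)
qed

lemma root_count_cube:
  fixes A :: "nat set"
  assumes "finite A" "\<And>p. p \<in> A \<Longrightarrow> prime p \<and> p > 2 \<and> \<not> int p dvd t"
  shows "int (root_count (int (\<Prod>A) ^ 3) (int (\<Prod>A) ^ 3) t) = (\<Prod>p\<in>A. 1 + Legendre t (int p))"
  using assms
proof (induction A rule: finite_induct)
  case empty
  have "{d. d = 0 \<and> [d\<^sup>2 = t] (mod 1)} = {0::int}" by auto
  moreover have "{d \<in> {0..<1}. [d\<^sup>2 = t] (mod 1)} = {0::int}" by auto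
  ultimately show ?case by (simp add: root_count_def)
next
  case (insert p A)
  have p: "prime p" "p > 2" "\<not> int p dvd t" using insert.prems by auto
  have "coprime p (\<Prod>A)"
    using insert p by (intro prod_coprime_right) (metis primes_coprime insertI2)
  then have "coprime (int p) (int (\<Prod>A))" by (simp only: coprime_int_iff)
  then have cop: "coprime (int p ^ 3) (int (\<Prod>A) ^ 3)" by simp
  have pos: "int p ^ 3 > 0" "int (\<Prod>A) ^ 3 > 0" using p insert.prems
    by (auto simp del: of_nat_prod intro!: zero_less_power prod_pos dest: prime_gt_0_nat)
  have sqd: "n dvd n\<^sup>2" for n :: int by (simp add: power2_eq_square)
  have "root_count (int p ^ 3 * int (\<Prod>A) ^ 3) (int p ^ 3 * int (\<Prod>A) ^ 3) t =
    root_count (int p ^ 3) (int p ^ 3) t * root_count (int (\<Prod>A) ^ 3) (int (\<Prod>A) ^ 3) t"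
    by (rule root_count_mult[OF cop pos(1) dvd_refl sqd dvd_triv_right pos(2) dvd_refl sqd dvd_triv_right])
  moreover have "int p ^ 3 * int (\<Prod>A) ^ 3 = int (\<Prod>(insert p A)) ^ 3"
    using insert.hyps by (simp add: power_mult_distrib)
  ultimately show ?case
    using insert root_count_prime_power[OF p, of 3] by simp
qed

text \<open>The contribution of 2 to a coefficient 4 y^3 with y odd.\<close>

lemma root_count_2_4: "odd t \<Longrightarrow> root_count 2 4 t = (if [t = 1] (mod 4) then 1 else 0)"
proof -
  assume t: "odd t"
  have "{d \<in> {0..<2}. [d\<^sup>2 = t] (mod 4)} = (if [t = 1] (mod 4) then {1} else {})"
  proof -
    have "{0..<2} = {0, 1::int}" by auto
    moreover have "\<not> [0 = t] (mod 4)"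
    proof
      assume "[0 = t] (mod 4)"
      then have "4 dvd t" by (metis cong_0_iff cong_sym)
      then show False using t by (meson dvd_trans even_numeral)
    qed
    ultimately show ?thesis by (auto simp: cong_sym_eq)
  qed
  then show ?thesis by (simp add: root_count_def)
qed

text \<open>The contribution of 2 to a coefficient y^3 with y twice an odd number; 1 and 3 modulo 4
  both have square 1 modulo 8.\<close>

lemma root_count_4_8: "odd t \<Longrightarrow> root_count 4 8 t = (if [t = 1] (mod 8) then 2 else 0)"
proof -
  assume t: "odd t"
  have r: "{0..<4} = {0, 1, 2, 3::int}" by auto
  have e: "\<not> [0 = t] (mod 8)" "\<not> [4 = t] (mod 8)"
  proof -
    have "odd (t mod 8)" using t by presburger
    then show "\<not> [0 = t] (mod 8)" "\<not> [4 = t] (mod 8)" by (auto simp: unique_euclidean_semiring_class.cong_def)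
  qed
  have "[9 = t] (mod 8) \<longleftrightarrow> [1 = t] (mod 8)" by (simp add: unique_euclidean_semiring_class.cong_def)
  then have "{d \<in> {0..<4}. [d\<^sup>2 = t] (mod 8)} = (if [t = 1] (mod 8) then {1, 3} else {})"
    unfolding r using e by (auto simp: cong_sym_eq[of t])
  then show ?thesis by (simp add: root_count_def)
qed

lemma odd_square_mod_8: "odd (a::int) \<Longrightarrow> [a\<^sup>2 = 1] (mod 8)"
proof -
  assume "odd a"
  then obtain b where b: "a = 2 * b + 1" by (rule oddE)
  have "a\<^sup>2 - 1 = 4 * (b * (b + 1))" unfolding b by (simp add: power2_eq_square algebra_simps)
  moreover have "2 dvd b * (b + 1)" by simp
  then have "4 * 2 dvd 4 * (b * (b + 1))" by (rule mult_dvd_mono[OF dvd_refl])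
  ultimately show ?thesis by (simp add: cong_iff_dvd_diff)
qed

lemma hensel_square_root_2:
  fixes t :: int
  assumes t: "[t = 1] (mod 8)"
  shows "\<exists>s. odd s \<and> [s\<^sup>2 = t] (mod 2 ^ (n + 3))"
proof (induction n)
  case 0
  then show ?case using t by (intro exI[of _ 1]) (simp add: cong_sym_eq)
next
  case (Suc n)
  then obtain s where s: "odd s" "[s\<^sup>2 = t] (mod 2 ^ (n + 3))" by blast
  then obtain q where q: "t = s\<^sup>2 + 2 ^ (n + 3) * q" by (metis cong_iff_lin mult.commute)
  \<comment> \<open>The correction has exponent n + 2 since the cross term 2 s gains a power of 2;
    what is left of the old error carries the even factor 1 - s.\<close>
  define s' where "s' = s + 2 ^ (n + 2) * q"
  have d: "t - s'\<^sup>2 = 2 ^ (n + 3) * (q * (1 - s)) - 2 ^ (2 * n + 4) * q\<^sup>2"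
  proof -
    have "t - s'\<^sup>2 = 2 * 2 ^ (n + 2) * (q * (1 - s)) - (2 ^ (n + 2))\<^sup>2 * q\<^sup>2"
      unfolding q s'_def by (simp add: power2_eq_square power_add algebra_simps)
    moreover have "(2::int) * 2 ^ (n + 2) = 2 ^ (n + 3)" by (simp add: power_add)
    moreover have "((2::int) ^ (n + 2))\<^sup>2 = 2 ^ ((n + 2) * 2)" by (simp only: power_mult)
    moreover have "(n + 2) * 2 = 2 * n + 4" by simp
    ultimately show ?thesis by (simp only:)
  qed
  have "(2::int) ^ (n + 3) * 2 dvd 2 ^ (n + 3) * (q * (1 - s))"
    using s(1) by (intro mult_dvd_mono) auto
  moreover have "(2::int) ^ (Suc n + 3) = 2 ^ (n + 3) * 2" by (simp add: power_add)
  ultimately have "(2::int) ^ (Suc n + 3) dvd 2 ^ (n + 3) * (q * (1 - s))" by (simp only:)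
  moreover have "(2::int) ^ (Suc n + 3) dvd 2 ^ (2 * n + 4) * q\<^sup>2" by (intro dvd_mult2 le_imp_power_dvd) simp
  ultimately have "2 ^ (Suc n + 3) dvd t - s'\<^sup>2" unfolding d by (rule dvd_diff)
  then have "[s'\<^sup>2 = t] (mod 2 ^ (Suc n + 3))" by (metis cong_iff_dvd_diff cong_sym)
  moreover have "odd s'" using s(1) by (simp add: s'_def)
  ultimately show ?case by blast
qed

text \<open>The roots are the residues congruent to s or -s modulo 2^(r-1), and each of these two
  classes has two members modulo 2^r.\<close>

lemma root_count_2_power:
  assumes t: "odd t" and r: "r \<ge> 3"
  shows "root_count (2 ^ r) (2 ^ r) t = (if [t = 1] (mod 8) then 4 else 0)"
proof (cases "[t = 1] (mod 8)")
  case False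
  have "\<not> [d\<^sup>2 = t] (mod 2 ^ r)" for d
  proof
    assume d: "[d\<^sup>2 = t] (mod 2 ^ r)"
    have "(2::int) ^ 3 dvd 2 ^ r" using r by (rule le_imp_power_dvd)
    then have d8: "[d\<^sup>2 = t] (mod 8)" using d cong_dvd_modulus[of _ _ "2 ^ r" 8] by simp
    have "even (d\<^sup>2 - t)" using d8 unfolding cong_iff_dvd_diff by (meson dvd_trans even_numeral)
    then have "odd d" using t by simp
    then have "[t = 1] (mod 8)" using d8 odd_square_mod_8 cong_sym cong_trans by blast
    then show False using False by simp
  qed
  then show ?thesis using False by (simp add: root_count_def)
next
  case True
  obtain n where n: "r = n + 3" using r by (metis add.commute le_Suc_ex)
  obtain s where s: "odd s" "[s\<^sup>2 = t] (mod 2 ^ r)" using hensel_square_root_2[OF True] n by blast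
  define h where "h = (2::int) ^ (n + 2)"
  define P where "P = (2::int) ^ r"
  have P: "P = 2 * h" "h = 4 * 2 ^ n" "P > 0" "h > 0" by (simp_all add: P_def h_def n power_add)
  have roots: "[d\<^sup>2 = t] (mod P) \<longleftrightarrow> [d = s] (mod h) \<or> [d = - s] (mod h)" for d
  proof
    assume "[d\<^sup>2 = t] (mod P)"
    then have "[d\<^sup>2 = s\<^sup>2] (mod P)" using s cong_sym cong_trans unfolding P_def by blast
    then have dv: "P dvd (d - s) * (d + s)" by (simp add: cong_iff_dvd_diff power2_eq_square algebra_simps)
    have "even ((d - s) * (d + s))" using dv P(1) by (meson dvd_trans dvd_triv_left)
    then have ev: "even (d - s)" "even (d + s)" by auto
    \<comment> \<open>With d - s = 2 u and d + s = 2 (u + s), exactly one of u and u + s is odd, so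
      the other one takes the whole power of 2.\<close>
    obtain u where u: "d - s = 2 * u" using ev(1) by (rule evenE)
    have u': "d + s = 2 * (u + s)" using u by simp
    have "(2 * u) * (2 * (u + s)) = 2 * (2 * (u * (u + s)))" by simp
    then have "2 * h dvd 2 * (2 * (u * (u + s)))" using dv unfolding u u' P(1) by (simp only:)
    then have hd: "h dvd 2 * (u * (u + s))" by (simp only: dvd_mult_cancel_left) simp
    then have "2 * (2 * 2 ^ n) dvd 2 * (u * (u + s))" using P(2) by simp
    then have hd: "2 * 2 ^ n dvd u * (u + s)" by (simp only: dvd_mult_cancel_left) simp
    then have h2: "2 ^ Suc n dvd u * (u + s)" by simp
    have "2 ^ Suc n dvd u \<or> 2 ^ Suc n dvd u + s"
    proof (cases "even u")
      case True
      then have "odd (u + s)" using s(1) by simp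
      then have "coprime (2 ^ Suc n) (u + s)" by simp
      then show ?thesis using h2 by (simp only: coprime_dvd_mult_left_iff) simp
    next
      case False
      then have "coprime (2 ^ Suc n) u" by simp
      then show ?thesis using h2 by (simp only: coprime_dvd_mult_right_iff) simp
    qed
    then have "2 * 2 ^ Suc n dvd 2 * u \<or> 2 * 2 ^ Suc n dvd 2 * (u + s)"
      using mult_dvd_mono[OF dvd_refl[of 2]] by blast
    then have "2 * 2 ^ Suc n dvd d - s \<or> 2 * 2 ^ Suc n dvd d + s" unfolding u u' .
    then show "[d = s] (mod h) \<or> [d = - s] (mod h)" using P(2) by (simp add: cong_iff_dvd_diff)
  next
    assume "[d = s] (mod h) \<or> [d = - s] (mod h)"
    then obtain v where v: "v = s \<or> v = -s" "[d = v] (mod h)" by blast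
    have "[d\<^sup>2 = v\<^sup>2] (mod P)"
    proof (rule sq_cong[of d v "h"])
      show "[d = v] (mod h)" by (rule v(2))
    qed (auto simp: P power2_eq_square)
    then show "[d\<^sup>2 = t] (mod P)" using s(2) v(1) cong_trans unfolding P_def by fastforce
  qed
  have ne: "\<not> [s = - s] (mod h)"
  proof
    assume "[s = - s] (mod h)"
    then have "h dvd 2 * s" by (simp add: cong_iff_dvd_diff)
    then have "2 * (2 * 2 ^ n) dvd 2 * s" using P(2) by simp
    then have "2 * 2 ^ n dvd s" by (simp only: dvd_mult_cancel_left) simp
    then show False using s(1) by (meson dvd_trans dvd_triv_left)
  qed
  have two: "card {d \<in> {0..<P}. [d = v] (mod h)} = 2" for v
  proof -
    have "{d \<in> {0..<P}. [d = v] (mod h)} = {v mod h, v mod h + h}"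
    proof (intro equalityI subsetI)
      fix d assume d: "d \<in> {d \<in> {0..<P}. [d = v] (mod h)}"
      then have dm: "d mod h = v mod h" by (simp add: unique_euclidean_semiring_class.cong_def)
      show "d \<in> {v mod h, v mod h + h}"
      proof (cases "d < h")
        case True
        then show ?thesis using d dm by simp
      next
        case False
        then have "(d - h) mod h = d - h" using d P by (intro mod_pos_pos_trivial) auto
        then show ?thesis using dm by simp
      qed
    next
      fix d assume "d \<in> {v mod h, v mod h + h}"
      then show "d \<in> {d \<in> {0..<P}. [d = v] (mod h)}" using P(1,4) pos_mod_bound[OF P(4), of v] pos_mod_sign[OF P(4), of v]
        by (auto simp: unique_euclidean_semiring_class.cong_def)
    qed
    then show ?thesis using P(4) by simp
  qed
  have un: "{d \<in> {0..<P}. [d\<^sup>2 = t] (mod P)} = {d \<in> {0..<P}. [d = s] (mod h)} \<union> {d \<in> {0..<P}. [d = - s] (mod h)}"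
    unfolding roots by blast
  have disj: "{d \<in> {0..<P}. [d = s] (mod h)} \<inter> {d \<in> {0..<P}. [d = - s] (mod h)} = {}"
    using ne cong_sym cong_trans by blast
  have fin: "finite {d \<in> {0..<P}. [d = v] (mod h)}" for v
    by (rule finite_subset[of _ "{0..<P}"]) auto
  have "root_count P P t = 2 + 2" unfolding root_count_def un by (simp only: card_Un_disjoint[OF fin fin disj] two)
  then show ?thesis using True by (simp add: P_def)
qed

section \<open>Counting modulo powers of 2: the factor \<open>sigma2\<close>\<close>

definition odds :: "nat \<Rightarrow> int set" where "odds r = {y \<in> {0..<2 ^ r}. odd y}"
definition evens :: "nat \<Rightarrow> int set" where "evens r = {y \<in> {0..<2 ^ r}. even y}"

lemma card_residue_class:
  assumes "r \<ge> j" "0 \<le> c" "c < 2 ^ j"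
  shows "card {x \<in> {0..<2 ^ r}. x mod 2 ^ j = (c::int)} = 2 ^ (r - j)"
proof -
  have r: "(2::int) ^ r = 2 ^ j * 2 ^ (r - j)" using assms(1) by (simp flip: power_add)
  have "{x \<in> {0..<2 ^ r}. x mod 2 ^ j = c} = (\<lambda>q. 2 ^ j * q + c) ` {0..<2 ^ (r - j)}"
  proof (intro equalityI subsetI)
    fix x assume x: "x \<in> {x \<in> {0..<2 ^ r}. x mod 2 ^ j = c}"
    then have e: "x = 2 ^ j * (x div 2 ^ j) + c" by (metis (mono_tags, lifting) mem_Collect_eq mult_div_mod_eq)
    have "0 \<le> x div 2 ^ j" using x by (simp add: pos_imp_zdiv_nonneg_iff)
    moreover have "x div 2 ^ j < 2 ^ (r - j)" 
    proof -
      have "2 ^ j * (x div 2 ^ j) < 2 ^ j * 2 ^ (r - j)" using e x assms(2) unfolding r[symmetric] by auto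
      then show ?thesis by (simp only: mult_less_cancel_left) auto
    qed
    ultimately show "x \<in> (\<lambda>q. 2 ^ j * q + c) ` {0..<2 ^ (r - j)}" using e by (intro image_eqI[of _ _ "x div 2 ^ j"]) auto
  next
    fix x assume "x \<in> (\<lambda>q. 2 ^ j * q + c) ` {0..<2 ^ (r - j)}"
    then obtain q where q: "0 \<le> q" "q + 1 \<le> 2 ^ (r - j)" "x = 2 ^ j * q + c" by auto
    have "2 ^ j * (q + 1) \<le> 2 ^ r" unfolding r using q(2) by (intro mult_left_mono) auto
    then have "x < 2 ^ r" using q(3) assms(3) by (simp add: algebra_simps)
    then show "x \<in> {x \<in> {0..<2 ^ r}. x mod 2 ^ j = c}" using q assms(2,3) by simp
  qed
  moreover have "inj_on (\<lambda>q. 2 ^ j * q + c) {0..<2 ^ (r - j)}" by (auto simp: inj_on_def)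
  ultimately show ?thesis by (simp add: card_image nat_power_eq)
qed

lemma card_odds: "r \<ge> 1 \<Longrightarrow> card (odds r) = 2 ^ (r - 1)"
  using card_residue_class[of 1 r 1] by (simp add: odds_def odd_iff_mod_2_eq_one)

text \<open>Fix x and an odd z. The equation for y is B y^2 = w with w odd, which has four roots or
  none according to a condition modulo 8; as odd squares are 1 modulo 8, this condition does not
  involve z.\<close>

lemma card_two_odd_solutions:
  fixes A B C :: int
  assumes r: "r \<ge> 3" and E: "finite E" "\<And>x. x \<in> E \<Longrightarrow> even (A * x)" and BC: "odd B" "odd C"
  shows "card {(x, y, z) \<in> E \<times> odds r \<times> odds r. [A * x\<^sup>2 + B * y\<^sup>2 + C * z\<^sup>2 = 0] (mod 2 ^ r)} =
    card {x \<in> E. [A * x\<^sup>2 + B + C = 0] (mod 8)} * 2 ^ (r - 1) * 4"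
proof -
  define Y where "Y x z = {y \<in> odds r. [A * x\<^sup>2 + B * y\<^sup>2 + C * z\<^sup>2 = 0] (mod 2 ^ r)}" for x z
  have fo: "finite (odds r)" unfolding odds_def by (rule finite_subset[of _ "{0..<2^r}"]) auto
  have cardY: "card (Y x z) = (if [A * x\<^sup>2 + B + C = 0] (mod 8) then 4 else 0)" if x: "x \<in> E" and z: "z \<in> odds r" for x z
  proof -
    define w where "w = - (A * x\<^sup>2 + C * z\<^sup>2)"
    have evA: "even (A * x\<^sup>2)" using E(2)[OF x] by (simp add: power2_eq_square)
    have oz: "odd z" using z by (simp add: odds_def)
    have ow: "odd w" using evA oz BC by (simp add: w_def)
    have iff: "[A * x\<^sup>2 + B * y\<^sup>2 + C * z\<^sup>2 = 0] (mod 2 ^ r) \<longleftrightarrow> [B * y\<^sup>2 = w] (mod 2 ^ r)" for y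
      by (simp add: cong_iff_dvd_diff w_def algebra_simps)
    have "odd y" if "[B * y\<^sup>2 = w] (mod 2 ^ r)" for y
    proof -
      have "2 dvd (2::int) ^ r" using r by simp
      then have "even (B * y\<^sup>2 - w)" using that unfolding cong_iff_dvd_diff by (meson dvd_trans)
      then show ?thesis using ow BC by simp
    qed
    then have "Y x z = {y \<in> {0..<2 ^ r}. [B * y\<^sup>2 = w] (mod 2 ^ r)}"
      unfolding Y_def iff odds_def by blast
    also have "card \<dots> = root_count (2 ^ r) (2 ^ r) (B * w)"
      by (rule card_roots_scaled[of _ _ 1]) (use BC in \<open>auto simp: power2_eq_square\<close>)
    also have "\<dots> = (if [B * w = 1] (mod 8) then 4 else 0)"
      using BC ow r by (intro root_count_2_power) auto
    also have "[B * w = 1] (mod 8) \<longleftrightarrow> [A * x\<^sup>2 + B + C = 0] (mod 8)"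
    proof -
      have z8: "[C * z\<^sup>2 = C * 1] (mod 8)" by (intro cong_mult cong_refl odd_square_mod_8 oz)
      have B8: "[B\<^sup>2 = 1] (mod 8)" by (rule odd_square_mod_8[OF BC(1)])
      have "coprime B (2 ^ 3)" using BC(1) by (simp only: coprime_power_right_iff coprime_right_2_iff_odd) simp
      then have cB: "coprime B 8" by simp
      have wB: "w - B = - (A * x\<^sup>2 + B + C * z\<^sup>2)" by (simp add: w_def)
      have "[B * w = 1] (mod 8) \<longleftrightarrow> [B * w = B * B] (mod 8)"
        using B8 unfolding power2_eq_square by (metis cong_sym cong_trans)
      also have "\<dots> \<longleftrightarrow> [w = B] (mod 8)" using cB by (rule cong_mult_lcancel)
      also have "\<dots> \<longleftrightarrow> [A * x\<^sup>2 + B + C * z\<^sup>2 = 0] (mod 8)"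
        unfolding cong_iff_dvd_diff wB by (simp only: dvd_minus_iff diff_0_right)
      also have "\<dots> \<longleftrightarrow> [A * x\<^sup>2 + B + C = 0] (mod 8)"
      proof -
        have "[A * x\<^sup>2 + B + C * z\<^sup>2 = A * x\<^sup>2 + B + C] (mod 8)" using z8 by (intro cong_add cong_refl) simp
        then show ?thesis using cong_sym cong_trans by blast
      qed
      finally show ?thesis .
    qed
    finally show ?thesis .
  qed
  have fY: "finite (Y x z)" for x z unfolding Y_def using fo by auto
  have "{(x, y, z) \<in> E \<times> odds r \<times> odds r. [A * x\<^sup>2 + B * y\<^sup>2 + C * z\<^sup>2 = 0] (mod 2 ^ r)} =
    (\<lambda>(x, z, y). (x, y, z)) ` (SIGMA x:E. SIGMA z:odds r. Y x z)"
    unfolding Y_def by force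
  also have "card \<dots> = card (SIGMA x:E. SIGMA z:odds r. Y x z)"
    by (rule card_image) (auto simp: inj_on_def)
  also have "\<dots> = (\<Sum>x\<in>E. \<Sum>z\<in>odds r. card (Y x z))"
    using E fo fY by (simp add: card_SigmaI)
  also have "\<dots> = (\<Sum>x\<in>E. \<Sum>z\<in>odds r. (if [A * x\<^sup>2 + B + C = 0] (mod 8) then 4 else 0))"
    using cardY by (intro sum.cong refl) auto
  also have "\<dots> = (\<Sum>x\<in>E. if [A * x\<^sup>2 + B + C = 0] (mod 8) then 2 ^ (r - 1) * 4 else 0)"
    using card_odds[of r] r by (intro sum.cong refl) auto
  also have "\<dots> = (\<Sum>x\<in>{x \<in> E. [A * x\<^sup>2 + B + C = 0] (mod 8)}. 2 ^ (r - 1) * 4)"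
    using E(1) by (intro sum.mono_neutral_cong_right) auto
  finally show ?thesis by simp
qed

text \<open>For even x the term A x^2 is 0 or 4 modulo 8 according to x modulo 4. So if 4 divides B
  + C, exactly one class of x modulo 4 is admissible, and 2^(r-2) times 2^(r-1) times 4 is half of
  2^(2 r); the factor 2 avoids a fraction.\<close>

lemma card_even_odd_odd:
  fixes A B C :: int
  assumes r: "r \<ge> 3" and ABC: "odd A" "odd B" "odd C"
  shows "2 * card {(x, y, z) \<in> evens r \<times> odds r \<times> odds r. [A * x\<^sup>2 + B * y\<^sup>2 + C * z\<^sup>2 = 0] (mod 2 ^ r)} =
    (if [B + C = 0] (mod 4) then 2 ^ (2 * r) else 0)"
proof -
  have fe: "finite (evens r)" unfolding evens_def by (rule finite_subset[of _ "{0..<2^r}"]) auto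
  define K where "K = {x \<in> evens r. [A * x\<^sup>2 + B + C = 0] (mod 8)}"
  have sq: "[A * x\<^sup>2 = (if x mod 4 = 0 then 0 else 4)] (mod 8)" if ex: "even x" for x
  proof -
    obtain u where u: "x = 2 * u" using ex by (rule evenE)
    show ?thesis
    proof (cases "even u")
      case True
      then obtain v where "u = 2 * v" by (rule evenE)
      then have "A * x\<^sup>2 = 8 * (2 * A * v\<^sup>2)" "x mod 4 = 0" using u by (auto simp: power2_eq_square)
      then show ?thesis by (metis cong_0_iff dvd_triv_left)
    next
      case False
      then have "x mod 4 \<noteq> 0" using u by presburger
      moreover have "8 dvd A * x\<^sup>2 - 4"
      proof -
        have "even (A * u\<^sup>2 - 1)" using False ABC by simp
        then have "4 * 2 dvd 4 * (A * u\<^sup>2 - 1)" by (rule mult_dvd_mono[OF dvd_refl])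
        then show ?thesis using u by (simp add: power2_eq_square algebra_simps)
      qed
      ultimately show ?thesis by (simp add: cong_iff_dvd_diff)
    qed
  qed
  have cond: "[A * x\<^sup>2 + B + C = 0] (mod 8) \<longleftrightarrow> [(if x mod 4 = 0 then 0 else 4) + (B + C) = 0] (mod 8)" if "even x" for x
  proof -
    have "[A * x\<^sup>2 + (B + C) = (if x mod 4 = 0 then 0 else 4) + (B + C)] (mod 8)"
      using sq[OF that] by (intro cong_add cong_refl)
    then show ?thesis using cong_sym cong_trans unfolding add.assoc by blast
  qed
  have s8: "(4 + s) mod 8 = 0 \<longleftrightarrow> s mod 8 = 4" for s :: int by presburger
  have K: "K = {x \<in> {0..<2 ^ r}. (x mod 4 = 0 \<and> (B + C) mod 8 = 0) \<or> (x mod 4 = 2 \<and> (B + C) mod 8 = 4)}"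
  proof -
    have m: "[0 + (B + C) = 0] (mod 8) \<longleftrightarrow> (B + C) mod 8 = 0" "[4 + (B + C) = 0] (mod 8) \<longleftrightarrow> (B + C) mod 8 = 4"
      unfolding unique_euclidean_semiring_class.cong_def using s8[of "B + C"] by simp_all
    show ?thesis
    proof (intro Set.set_eqI)
      fix x :: int
      have "even x \<longleftrightarrow> x mod 4 = 0 \<or> x mod 4 = 2" by presburger
      then consider "odd x" "x mod 4 \<noteq> 0" "x mod 4 \<noteq> 2" | "even x" "x mod 4 = 0" | "even x" "x mod 4 = 2" by metis
      then show "x \<in> K \<longleftrightarrow> x \<in> {x \<in> {0..<2 ^ r}. (x mod 4 = 0 \<and> (B + C) mod 8 = 0) \<or> (x mod 4 = 2 \<and> (B + C) mod 8 = 4)}"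
      proof cases
        case 1
        then show ?thesis by (simp add: K_def evens_def)
      next
        case 2
        then show ?thesis using cond[OF 2(1)] m(1) by (simp only: K_def evens_def mem_Collect_eq) simp
      next
        case 3
        then show ?thesis using cond[OF 3(1)] m(2) by (simp only: K_def evens_def mem_Collect_eq) simp
      qed
    qed
  qed
  have "s mod 8 = 0 \<or> s mod 8 = 4 \<longleftrightarrow> s mod 4 = 0" for s :: int by presburger
  from this[of "B + C"] have "(B + C) mod 8 = 0 \<or> (B + C) mod 8 = 4 \<longleftrightarrow> [B + C = 0] (mod 4)"
    by (simp add: unique_euclidean_semiring_class.cong_def)
  then have cK: "card K = (if [B + C = 0] (mod 4) then 2 ^ (r - 2) else 0)"
    unfolding K using card_residue_class[of 2 r 0] card_residue_class[of 2 r 2] r by auto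
  have p: "2 * ((2::nat) ^ (r - 2) * 2 ^ (r - 1) * 4) = 2 ^ (2 * r)"
  proof -
    obtain n where "r = n + 3" using r by (metis add.commute le_Suc_ex)
    moreover have "(2::nat) ^ (2 * r) = 2 ^ r * 2 ^ r" by (simp add: mult_2 power_add)
    ultimately show ?thesis by (simp add: power_add)
  qed
  have eq: "card {(x, y, z) \<in> evens r \<times> odds r \<times> odds r. [A * x\<^sup>2 + B * y\<^sup>2 + C * z\<^sup>2 = 0] (mod 2 ^ r)} =
      card K * 2 ^ (r - 1) * 4"
    unfolding K_def by (rule card_two_odd_solutions[OF r fe _ ABC(2,3)]) (auto simp: evens_def)
  show ?thesis unfolding eq cK using p by simp
qed

text \<open>Here A x^2 vanishes modulo 8 and x is free: compared with the preceding count, a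
  stronger condition on B + C and four times as many solutions.\<close>

lemma card_any_odd_odd:
  fixes A B C :: int
  assumes r: "r \<ge> 3" and ABC: "8 dvd A" "odd B" "odd C"
  shows "card {(x, y, z) \<in> {0..<2 ^ r} \<times> odds r \<times> odds r. [A * x\<^sup>2 + B * y\<^sup>2 + C * z\<^sup>2 = 0] (mod 2 ^ r)} =
    (if [B + C = 0] (mod 8) then 2 * 2 ^ (2 * r) else 0)"
proof -
  have eA: "even A" using ABC(1) by (meson dvd_trans even_numeral)
  have "[A * x\<^sup>2 + B + C = 0] (mod 8) \<longleftrightarrow> [B + C = 0] (mod 8)" for x
    unfolding cong_0_iff add.assoc using ABC(1) by (simp add: dvd_add_right_iff)
  then have "{x \<in> {0..<2 ^ r}. [A * x\<^sup>2 + B + C = 0] (mod 8)} = (if [B + C = 0] (mod 8) then {0..<2 ^ r} else {})"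
    by auto
  then have cK: "card {x \<in> {0..<2 ^ r}. [A * x\<^sup>2 + B + C = 0] (mod 8)} = (if [B + C = 0] (mod 8) then 2 ^ r else 0)"
    by (simp add: nat_power_eq)
  have p: "(2::nat) ^ r * 2 ^ (r - 1) * 4 = 2 * 2 ^ (2 * r)"
  proof -
    obtain n where "r = n + 3" using r by (metis add.commute le_Suc_ex)
    moreover have "(2::nat) ^ (2 * r) = 2 ^ r * 2 ^ r" by (simp add: mult_2 power_add)
    ultimately show ?thesis by (simp add: power_add)
  qed
  show ?thesis
    using card_two_odd_solutions[OF r, of "{0..<2 ^ r}" A B C] eA ABC p cK by auto
qed

text \<open>Odd squares are 1 modulo 8, so modulo m an odd number equals its cube and is its own
  inverse.\<close>

lemma cube_diff_cong_iff:
  fixes a b m :: int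
  assumes ab: "odd a" "odd b" and m: "m dvd 8"
  shows "[a ^ 3 - b ^ 3 = 0] (mod m) \<longleftrightarrow> [a * b = 1] (mod m)"
proof -
  have sq: "[c\<^sup>2 = 1] (mod m)" if "odd c" for c
    using odd_square_mod_8[OF that] m cong_dvd_modulus by blast
  have cube: "[c ^ 3 = c] (mod m)" if "odd c" for c
  proof -
    have "[c\<^sup>2 * c = 1 * c] (mod m)" by (intro cong_mult cong_refl sq that)
    then show ?thesis by (simp add: power3_eq_cube power2_eq_square)
  qed
  have "[a ^ 3 - b ^ 3 = a - b] (mod m)" by (intro cong_diff cube ab)
  then have 1: "[a ^ 3 - b ^ 3 = 0] (mod m) \<longleftrightarrow> [a = b] (mod m)"
    by (metis cong_diff_iff_cong_0 cong_sym cong_trans)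
  have "[a * b = b * b] (mod m)" if "[a = b] (mod m)" using that by (rule cong_scalar_right)
  moreover have b: "[b * b = 1] (mod m)" using sq[OF ab(2)] by (simp add: power2_eq_square)
  moreover have "[a = b] (mod m)" if "[a * b = 1] (mod m)"
  proof -
    have "[a * b * b = 1 * b] (mod m)" using that by (rule cong_scalar_right)
    moreover have "[a * (b * b) = a * 1] (mod m)" using b by (rule cong_scalar_left)
    ultimately show ?thesis by (simp add: mult.assoc) (metis cong_sym cong_trans)
  qed
  ultimately show ?thesis unfolding 1 using cong_trans by blast
qed

lemma nu2_eq_0_iff: "nu2 a = 0 \<longleftrightarrow> odd a"
  by (auto simp: nu2_def zero_enat_def multiplicity_eq_zero_iff not_dvd_imp_multiplicity_0)

text \<open>Over the integers the third coefficient carries its sign, so the counts above apply with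
  the coordinates in any order.\<close>

definition sigma2_set :: "nat \<Rightarrow> nat \<Rightarrow> nat \<Rightarrow> nat \<Rightarrow> (int \<times> int \<times> int) set" where
  "sigma2_set y0 y1 y2 r = {(x0, x1, x2). x0 \<in> {0..<2 ^ r} \<and> x1 \<in> {0..<2 ^ r} \<and> x2 \<in> {0..<2 ^ r} \<and>
     [int y0 ^ 3 * x0\<^sup>2 + int y1 ^ 3 * x1\<^sup>2 + (- (int y2 ^ 3)) * x2\<^sup>2 = 0] (mod 2 ^ r) \<and>
     (odd (x0 * int y0) \<or> odd (x1 * int y1) \<or> odd (x2 * int y2))}"

lemma sigma2_count_eq: "sigma2_count y0 y1 y2 r = card (sigma2_set y0 y1 y2 r)"
proof -
  let ?Z = "{(x0, x1, x2). x0 \<in> {..<2 ^ r} \<and> x1 \<in> {..<2 ^ r} \<and> x2 \<in> {..<2 ^ r} \<and>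
       [y0 ^ 3 * x0\<^sup>2 + y1 ^ 3 * x1\<^sup>2 = y2 ^ 3 * x2\<^sup>2] (mod 2 ^ r) \<and>
       min (nu2 (x0 * y0)) (min (nu2 (x1 * y1)) (nu2 (x2 * y2))) = 0}"
  let ?f = "\<lambda>(x0, x1, x2). (int x0, int x1, int x2)"
  have m0: "min a b = 0 \<longleftrightarrow> a = 0 \<or> b = 0" for a b :: enat by (auto simp: min_def)
  have iff: "(x0, x1, x2) \<in> ?Z \<longleftrightarrow> ?f (x0, x1, x2) \<in> sigma2_set y0 y1 y2 r" for x0 x1 x2
  proof -
    have "[y0 ^ 3 * x0\<^sup>2 + y1 ^ 3 * x1\<^sup>2 = y2 ^ 3 * x2\<^sup>2] (mod 2 ^ r) \<longleftrightarrow>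
      [int (y0 ^ 3 * x0\<^sup>2 + y1 ^ 3 * x1\<^sup>2) = int (y2 ^ 3 * x2\<^sup>2)] (mod int (2 ^ r))"
      by (simp only: cong_int_iff)
    also have "\<dots> \<longleftrightarrow> [int y0 ^ 3 * (int x0)\<^sup>2 + int y1 ^ 3 * (int x1)\<^sup>2 + (- (int y2 ^ 3)) * (int x2)\<^sup>2 = 0] (mod 2 ^ r)"
      by (simp add: cong_iff_dvd_diff algebra_simps)
    finally have c: "[y0 ^ 3 * x0\<^sup>2 + y1 ^ 3 * x1\<^sup>2 = y2 ^ 3 * x2\<^sup>2] (mod 2 ^ r) \<longleftrightarrow>
      [int y0 ^ 3 * (int x0)\<^sup>2 + int y1 ^ 3 * (int x1)\<^sup>2 + (- (int y2 ^ 3)) * (int x2)\<^sup>2 = 0] (mod 2 ^ r)" .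
    have l: "int x < 2 ^ r \<longleftrightarrow> x < 2 ^ r" for x by (metis of_nat_less_iff of_nat_numeral of_nat_power)
    show ?thesis unfolding sigma2_set_def by (simp add: c m0 nu2_eq_0_iff l)
  qed
  have "?f ` ?Z = sigma2_set y0 y1 y2 r"
  proof (intro equalityI subsetI)
    fix z assume z: "z \<in> sigma2_set y0 y1 y2 r"
    obtain x0 x1 x2 where zz: "z = (x0, x1, x2)" by (metis prod.exhaust)
    have "x0 \<ge> 0" "x1 \<ge> 0" "x2 \<ge> 0" using z zz by (auto simp: sigma2_set_def)
    then have f: "z = ?f (nat x0, nat x1, nat x2)" using zz by simp
    have "(nat x0, nat x1, nat x2) \<in> ?Z" unfolding iff using f z by metis
    then show "z \<in> ?f ` ?Z" using f by blast
  next
    fix z assume "z \<in> ?f ` ?Z"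
    then show "z \<in> sigma2_set y0 y1 y2 r" using iff by fastforce
  qed
  moreover have "inj_on ?f ?Z" by (auto simp: inj_on_def)
  ultimately show ?thesis unfolding sigma2_count_def using card_image[of ?f ?Z] by simp
qed

text \<open>The normalized counts are constant from r = 3 on in every case, because conditions
  modulo 8 decide everything; hence the limit exists.\<close>

lemma sigma2_eqI:
  assumes "\<And>r. r \<ge> 3 \<Longrightarrow> real (sigma2_count y0 y1 y2 r) = c * 2 ^ (2 * r)"
  shows "sigma2 y0 y1 y2 = c"
proof -
  have "(\<lambda>r. real (sigma2_count y0 y1 y2 r) / 2 ^ (2 * r)) \<longlonglongrightarrow> c"
  proof (rule tendsto_eventually)
    show "eventually (\<lambda>r. real (sigma2_count y0 y1 y2 r) / 2 ^ (2 * r) = c) sequentially"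
      using eventually_ge_at_top[of 3] by eventually_elim (simp add: assms)
  qed
  then show ?thesis unfolding sigma2_def by (rule limI)
qed

lemma parity_of_cong:
  fixes s :: int
  assumes "[s = 0] (mod 2 ^ r)" "r \<ge> 3"
  shows "even s"
proof -
  have "(2::int) dvd 2 ^ r" using assms(2) by simp
  then show ?thesis using assms(1) unfolding cong_0_iff by (rule dvd_trans)
qed

text \<open>The congruence makes x0 + x1 + x2 even, and not all three are even, so exactly one
  coordinate is. The three positions give the three summands.\<close>

lemma sigma2_odd:
  assumes y: "odd y0" "odd y1" "odd y2"
  shows "sigma2 y0 y1 y2 = (of_bool [int y1 * int y2 = 1] (mod 4) + of_bool [int y0 * int y2 = 1] (mod 4) +
      of_bool [- (int y0 * int y1) = 1] (mod 4)) / 2"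
proof (rule sigma2_eqI)
  fix r :: nat assume r: "r \<ge> 3"
  define Y0 Y1 Y2 where "Y0 = int y0 ^ 3" "Y1 = int y1 ^ 3" "Y2 = int y2 ^ 3"
  have odd: "odd Y0" "odd Y1" "odd Y2" "odd (- Y2)" using y by (auto simp: Y0_Y1_Y2_def)
  define T where "T A B C = {(x, y, z) \<in> evens r \<times> odds r \<times> odds r. [A * x\<^sup>2 + B * y\<^sup>2 + C * z\<^sup>2 = 0] (mod 2 ^ r)}" for A B C
  have finT: "finite (T A B C)" for A B C
    unfolding T_def evens_def odds_def by (rule finite_subset[of _ "{0..<2^r} \<times> {0..<2^r} \<times> {0..<2^r}"]) auto
  let ?s1 = "\<lambda>(x, y, z). (y, x, z) :: int \<times> int \<times> int" and ?s2 = "\<lambda>(x, y, z). (y, z, x) :: int \<times> int \<times> int"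
  have set: "sigma2_set y0 y1 y2 r = T Y0 Y1 (- Y2) \<union> (?s1 ` T Y1 Y0 (- Y2) \<union> ?s2 ` T (- Y2) Y0 Y1)"
  proof (intro equalityI subsetI)
    fix x assume x: "x \<in> sigma2_set y0 y1 y2 r"
    obtain x0 x1 x2 where xx: "x = (x0, x1, x2)" by (metis prod.exhaust)
    have c: "[Y0 * x0\<^sup>2 + Y1 * x1\<^sup>2 + (- Y2) * x2\<^sup>2 = 0] (mod 2 ^ r)" 
      using x xx by (simp add: sigma2_set_def Y0_Y1_Y2_def)
    have "even (Y0 * x0\<^sup>2 + Y1 * x1\<^sup>2 + (- Y2) * x2\<^sup>2)" using parity_of_cong[OF c r] .
    then have par: "even (x0 + x1 + x2)" using odd by simp
    have some: "odd x0 \<or> odd x1 \<or> odd x2" using x xx by (auto simp: sigma2_set_def)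
    then consider "even x0" "odd x1" "odd x2" | "odd x0" "even x1" "odd x2" | "odd x0" "odd x1" "even x2"
      using par by fastforce
    then show "x \<in> T Y0 Y1 (- Y2) \<union> (?s1 ` T Y1 Y0 (- Y2) \<union> ?s2 ` T (- Y2) Y0 Y1)"
    proof cases
      case 1
      then show ?thesis using x xx c by (simp add: T_def evens_def odds_def sigma2_set_def)
    next
      case 2
      then have "(x1, x0, x2) \<in> T Y1 Y0 (- Y2)" using x xx c by (simp add: T_def evens_def odds_def sigma2_set_def algebra_simps)
      then show ?thesis using xx by force
    next
      case 3
      then have "(x2, x0, x1) \<in> T (- Y2) Y0 Y1" using x xx c by (simp add: T_def evens_def odds_def sigma2_set_def algebra_simps)
      then show ?thesis using xx by force
    qed
  next
    fix x assume "x \<in> T Y0 Y1 (- Y2) \<union> (?s1 ` T Y1 Y0 (- Y2) \<union> ?s2 ` T (- Y2) Y0 Y1)"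
    then show "x \<in> sigma2_set y0 y1 y2 r"
      using y by (auto simp: T_def evens_def odds_def sigma2_set_def Y0_Y1_Y2_def algebra_simps)
  qed
  have d1: "T Y0 Y1 (- Y2) \<inter> (?s1 ` T Y1 Y0 (- Y2) \<union> ?s2 ` T (- Y2) Y0 Y1) = {}"
    and d2: "?s1 ` T Y1 Y0 (- Y2) \<inter> ?s2 ` T (- Y2) Y0 Y1 = {}"
    by (auto simp: T_def evens_def odds_def)
  have "card (sigma2_set y0 y1 y2 r) = card (T Y0 Y1 (- Y2)) + (card (?s1 ` T Y1 Y0 (- Y2)) + card (?s2 ` T (- Y2) Y0 Y1))"
    unfolding set
    by (simp only: card_Un_disjoint[OF finT _ d1] card_Un_disjoint[OF _ _ d2] finT finite_imageI finite_UnI)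
  also have "card (?s1 ` T Y1 Y0 (- Y2)) = card (T Y1 Y0 (- Y2))" by (rule card_image) (auto simp: inj_on_def)
  also have "card (?s2 ` T (- Y2) Y0 Y1) = card (T (- Y2) Y0 Y1)" by (rule card_image) (auto simp: inj_on_def)
  finally have "2 * card (sigma2_set y0 y1 y2 r) = 2 * card (T Y0 Y1 (- Y2)) + 2 * card (T Y1 Y0 (- Y2)) + 2 * card (T (- Y2) Y0 Y1)"
    by simp
  also have "2 * card (T Y0 Y1 (- Y2)) = of_bool [int y1 * int y2 = 1] (mod 4) * 2 ^ (2 * r)"
    unfolding T_def card_even_odd_odd[OF r odd(1,2,4)]
    using cube_diff_cong_iff[of "int y1" "int y2" 4] y by (simp add: Y0_Y1_Y2_def)
  also have "2 * card (T Y1 Y0 (- Y2)) = of_bool [int y0 * int y2 = 1] (mod 4) * 2 ^ (2 * r)"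
    unfolding T_def card_even_odd_odd[OF r odd(2,1,4)]
    using cube_diff_cong_iff[of "int y0" "int y2" 4] y by (simp add: Y0_Y1_Y2_def)
  also have "2 * card (T (- Y2) Y0 Y1) = of_bool [- (int y0 * int y1) = 1] (mod 4) * 2 ^ (2 * r)"
    unfolding T_def card_even_odd_odd[OF r odd(4,1,2)]
    using cube_diff_cong_iff[of "int y0" "- int y1" 4] y by (simp add: Y0_Y1_Y2_def)
  finally have "2 * card (sigma2_set y0 y1 y2 r) = (of_bool [int y1 * int y2 = 1] (mod 4) +
      of_bool [int y0 * int y2 = 1] (mod 4) + of_bool [- (int y0 * int y1) = 1] (mod 4)) * 2 ^ (2 * r)"
    by (simp only: distrib_right)
  then have "real (2 * card (sigma2_set y0 y1 y2 r)) = real ((of_bool [int y1 * int y2 = 1] (mod 4) +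
      of_bool [int y0 * int y2 = 1] (mod 4) + of_bool [- (int y0 * int y1) = 1] (mod 4)) * 2 ^ (2 * r))"
    by (simp only:)
  then show "real (sigma2_count y0 y1 y2 r) = (of_bool [int y1 * int y2 = 1] (mod 4) + of_bool [int y0 * int y2 = 1] (mod 4) +
      of_bool [- (int y0 * int y1) = 1] (mod 4)) / 2 * 2 ^ (2 * r)"
    unfolding sigma2_count_eq by (simp add: field_simps)
qed

text \<open>The coordinates at the two odd y have equal parity by the congruence and must therefore
  both be odd, while the coordinate at the even y is free. The even y may stand in any of the three
  places, and in the last one a sign changes.\<close>

lemma sigma2_even:
  assumes y: "even y0" "odd y1" "odd y2"
  shows "sigma2 y0 y1 y2 = 2 * of_bool [int y1 * int y2 = 1] (mod 8)"
    and "sigma2 y1 y0 y2 = 2 * of_bool [int y1 * int y2 = 1] (mod 8)"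
    and "sigma2 y1 y2 y0 = 2 * of_bool [- (int y1 * int y2) = 1] (mod 8)"
proof -
  define Y0 Y1 Y2 where "Y0 = int y0 ^ 3" "Y1 = int y1 ^ 3" "Y2 = int y2 ^ 3"
  have odd: "odd Y1" "odd Y2" "odd (- Y2)" using y by (auto simp: Y0_Y1_Y2_def)
  have "8 dvd Y0"
  proof -
    have "(2 * 2 * 2 :: int) dvd int y0 * int y0 * int y0" using y(1) by (intro mult_dvd_mono) auto
    then show ?thesis by (simp add: Y0_Y1_Y2_def power3_eq_cube)
  qed
  then have e8: "8 dvd Y0" "8 dvd - Y0" by simp_all
  then have ev: "even Y0" by (meson dvd_trans even_numeral)
  define T where "T r A B C = {(x, y, z) \<in> {0..<2 ^ r} \<times> odds r \<times> odds r. [A * x\<^sup>2 + B * y\<^sup>2 + C * z\<^sup>2 = 0] (mod 2 ^ r)}" for r A B C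
  have card8: "[int y1 ^ 3 - int y2 ^ 3 = 0] (mod 8) \<longleftrightarrow> [int y1 * int y2 = 1] (mod 8)"
    "[int y1 ^ 3 + int y2 ^ 3 = 0] (mod 8) \<longleftrightarrow> [- (int y1 * int y2) = 1] (mod 8)"
    using cube_diff_cong_iff[of "int y1" "int y2" 8] cube_diff_cong_iff[of "int y1" "- int y2" 8] y by simp_all
  show "sigma2 y0 y1 y2 = 2 * of_bool [int y1 * int y2 = 1] (mod 8)"
  proof (rule sigma2_eqI)
    fix r :: nat assume r: "r \<ge> 3"
    have "sigma2_set y0 y1 y2 r = T r Y0 Y1 (- Y2)"
    proof (intro equalityI subsetI)
      fix x assume x: "x \<in> sigma2_set y0 y1 y2 r"
      obtain x0 x1 x2 where xx: "x = (x0, x1, x2)" by (metis prod.exhaust)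
      have c: "[Y0 * x0\<^sup>2 + Y1 * x1\<^sup>2 + (- Y2) * x2\<^sup>2 = 0] (mod 2 ^ r)"
        using x xx by (simp add: sigma2_set_def Y0_Y1_Y2_def)
      have "even (Y0 * x0\<^sup>2 + Y1 * x1\<^sup>2 + (- Y2) * x2\<^sup>2)" using parity_of_cong[OF c r] .
      then have "even (x1 + x2)" using odd ev by simp
      moreover have "odd x1 \<or> odd x2" using x xx y by (auto simp: sigma2_set_def)
      ultimately have "odd x1" "odd x2" by auto
      then show "x \<in> T r Y0 Y1 (- Y2)" using x xx c by (simp add: T_def odds_def sigma2_set_def)
    qed (use y in \<open>auto simp: T_def odds_def sigma2_set_def Y0_Y1_Y2_def\<close>)
    then show "real (sigma2_count y0 y1 y2 r) = 2 * of_bool [int y1 * int y2 = 1] (mod 8) * 2 ^ (2 * r)"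
      unfolding sigma2_count_eq using card8 card_any_odd_odd[OF r e8(1) odd(1,3)] by (simp add: T_def Y0_Y1_Y2_def)
  qed
  show "sigma2 y1 y0 y2 = 2 * of_bool [int y1 * int y2 = 1] (mod 8)"
  proof (rule sigma2_eqI)
    fix r :: nat assume r: "r \<ge> 3"
    let ?s = "\<lambda>(x, y, z). (y, x, z) :: int \<times> int \<times> int"
    have "sigma2_set y1 y0 y2 r = ?s ` T r Y0 Y1 (- Y2)"
    proof (intro equalityI subsetI)
      fix x assume x: "x \<in> sigma2_set y1 y0 y2 r"
      obtain x0 x1 x2 where xx: "x = (x0, x1, x2)" by (metis prod.exhaust)
      have c: "[Y0 * x1\<^sup>2 + Y1 * x0\<^sup>2 + (- Y2) * x2\<^sup>2 = 0] (mod 2 ^ r)"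
        using x xx by (simp add: sigma2_set_def Y0_Y1_Y2_def algebra_simps)
      have "even (Y0 * x1\<^sup>2 + Y1 * x0\<^sup>2 + (- Y2) * x2\<^sup>2)" using parity_of_cong[OF c r] .
      then have "even (x0 + x2)" using odd ev by simp
      moreover have "odd x0 \<or> odd x2" using x xx y by (auto simp: sigma2_set_def)
      ultimately have "odd x0" "odd x2" by auto
      then have "(x1, x0, x2) \<in> T r Y0 Y1 (- Y2)" using x xx c by (simp add: T_def odds_def sigma2_set_def)
      then show "x \<in> ?s ` T r Y0 Y1 (- Y2)" using xx by force
    qed (use y in \<open>auto simp: T_def odds_def sigma2_set_def Y0_Y1_Y2_def algebra_simps\<close>)
    moreover have "card (?s ` T r Y0 Y1 (- Y2)) = card (T r Y0 Y1 (- Y2))" by (rule card_image) (auto simp: inj_on_def)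
    ultimately show "real (sigma2_count y1 y0 y2 r) = 2 * of_bool [int y1 * int y2 = 1] (mod 8) * 2 ^ (2 * r)"
      unfolding sigma2_count_eq using card8 card_any_odd_odd[OF r e8(1) odd(1,3)] by (simp add: T_def Y0_Y1_Y2_def)
  qed
  show "sigma2 y1 y2 y0 = 2 * of_bool [- (int y1 * int y2) = 1] (mod 8)"
  proof (rule sigma2_eqI)
    fix r :: nat assume r: "r \<ge> 3"
    let ?s = "\<lambda>(x, y, z). (y, z, x) :: int \<times> int \<times> int"
    have "sigma2_set y1 y2 y0 r = ?s ` T r (- Y0) Y1 Y2"
    proof (intro equalityI subsetI)
      fix x assume x: "x \<in> sigma2_set y1 y2 y0 r"
      obtain x0 x1 x2 where xx: "x = (x0, x1, x2)" by (metis prod.exhaust)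
      have c: "[(- Y0) * x2\<^sup>2 + Y1 * x0\<^sup>2 + Y2 * x1\<^sup>2 = 0] (mod 2 ^ r)"
        using x xx by (simp add: sigma2_set_def Y0_Y1_Y2_def algebra_simps)
      have "even ((- Y0) * x2\<^sup>2 + Y1 * x0\<^sup>2 + Y2 * x1\<^sup>2)" using parity_of_cong[OF c r] .
      then have "even (x0 + x1)" using odd ev by simp
      moreover have "odd x0 \<or> odd x1" using x xx y by (auto simp: sigma2_set_def)
      ultimately have "odd x0" "odd x1" by auto
      then have "(x2, x0, x1) \<in> T r (- Y0) Y1 Y2" using x xx c by (simp add: T_def odds_def sigma2_set_def)
      then show "x \<in> ?s ` T r (- Y0) Y1 Y2" using xx by force
    qed (use y in \<open>auto simp: T_def odds_def sigma2_set_def Y0_Y1_Y2_def algebra_simps\<close>)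
    moreover have "card (?s ` T r (- Y0) Y1 Y2) = card (T r (- Y0) Y1 Y2)" by (rule card_image) (auto simp: inj_on_def)
    ultimately show "real (sigma2_count y1 y2 y0 r) = 2 * of_bool [- (int y1 * int y2) = 1] (mod 8) * 2 ^ (2 * r)"
      unfolding sigma2_count_eq using card8 card_any_odd_odd[OF r e8(2) odd(1,2)] by (simp add: T_def Y0_Y1_Y2_def)
  qed
qed

section \<open>Conic densities as terms of the constant\<close>

definition odd_primes :: "nat \<Rightarrow> nat set" where "odd_primes d = {p. prime p \<and> p dvd d \<and> p > 2}"

lemma finite_odd_primes: "d > 0 \<Longrightarrow> finite (odd_primes d)"
  unfolding odd_primes_def by (rule finite_subset[OF _ finite_divisors_nat[of d]]) auto

lemma prime_factors_odd:
  assumes "d > 0" "odd d"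
  shows "prime_factors d = odd_primes d"
proof -
  have "p > 2" if "prime p" "p dvd d" for p
    using that assms(2) prime_ge_2_nat[of p] by (cases "p = 2") auto
  then show ?thesis using assms(1) by (auto simp: odd_primes_def prime_factors_dvd)
qed

lemma squarefree_eq_prod_odd_primes:
  assumes "squarefree d" "odd d"
  shows "d = \<Prod>(odd_primes d)"
proof -
  have d: "d > 0" using assms(2) by (simp add: odd_pos)
  have "d = (\<Prod>p\<in>prime_factors d. p ^ multiplicity p d)" by (rule prime_factorization_nat[OF d])
  also have "\<dots> = (\<Prod>p\<in>prime_factors d. p)"
  proof (rule prod.cong[OF refl])
    fix p assume p: "p \<in> prime_factors d"
    then have "multiplicity p d \<le> 1" using assms(1) d squarefree_factorial_semiring''[of d] by auto
    moreover have "multiplicity p d \<ge> 1" using p by (simp add: prime_factors_multiplicity)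
    ultimately have "multiplicity p d = 1" by simp
    then show "p ^ multiplicity p d = p" by simp
  qed
  finally show ?thesis using prime_factors_odd[OF d assms(2)] by simp
qed

text \<open>The odd primes give the Legendre factors of \<open>rho\<close>. The three statements are
  the three shapes of a coefficient, y^3 and 4 y^3 with y odd and y^3 with y even, the prime 2
  adding the conditions modulo 4 and 8 that occur in \<open>sigma2\<close>.\<close>

lemma root_count_component:
  fixes y :: nat and t :: int
  assumes y: "squarefree y" and t: "\<And>p. p \<in> odd_primes y \<Longrightarrow> \<not> int p dvd t"
  defines "R \<equiv> \<Prod>p\<in>odd_primes y. 1 + Legendre t (int p)"
  shows "odd y \<Longrightarrow> int (root_count (int y ^ 3) (int y ^ 3) t) = R"
    and "odd y \<Longrightarrow> odd t \<Longrightarrow> int (root_count (2 * int y ^ 3) (4 * int y ^ 3) t) = of_bool [t = 1] (mod 4) * R"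
    and "even y \<Longrightarrow> odd t \<Longrightarrow> int (root_count (int y ^ 3 div 2) (int y ^ 3) t) = 2 * of_bool [t = 1] (mod 8) * R"
proof -
  have cube: "int (root_count (int d ^ 3) (int d ^ 3) t) = (\<Prod>p\<in>odd_primes d. 1 + Legendre t (int p))"
    if d: "squarefree d" "odd d" "odd_primes d \<subseteq> odd_primes y" for d
  proof -
    have "d > 0" using d(2) by (simp add: odd_pos)
    then have "int (root_count (int (\<Prod>(odd_primes d)) ^ 3) (int (\<Prod>(odd_primes d)) ^ 3) t) =
        (\<Prod>p\<in>odd_primes d. 1 + Legendre t (int p))"
      using d(3) t by (intro root_count_cube finite_odd_primes) (auto simp: odd_primes_def)
    then show ?thesis using squarefree_eq_prod_odd_primes[OF d(1,2)] by simp
  qed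
  show 1: "int (root_count (int y ^ 3) (int y ^ 3) t) = R" if "odd y" using cube[OF y that] by (simp add: R_def)
  have sqd: "n dvd n\<^sup>2" for n :: int by (simp add: power2_eq_square)
  show "int (root_count (2 * int y ^ 3) (4 * int y ^ 3) t) = of_bool [t = 1] (mod 4) * R" if "odd y" "odd t"
  proof -
    have pos: "int y ^ 3 > 0" using \<open>odd y\<close> by (simp add: odd_pos)
    have "coprime (4::int) (int y ^ 3)"
    proof -
      have "coprime (2::int) (int y ^ 3)" using \<open>odd y\<close> by simp
      then have "coprime (2 * 2) (int y ^ 3)" by (simp only: coprime_mult_left_iff)
      then show ?thesis by simp
    qed
    then have "root_count (2 * int y ^ 3) (4 * int y ^ 3) t = root_count 2 4 t * root_count (int y ^ 3) (int y ^ 3) t"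
      by (rule root_count_mult[OF _ _ _ _ _ pos dvd_refl sqd dvd_triv_right]) auto
    then show ?thesis using 1[OF \<open>odd y\<close>] root_count_2_4[OF \<open>odd t\<close>] by simp
  qed
  show "int (root_count (int y ^ 3 div 2) (int y ^ 3) t) = 2 * of_bool [t = 1] (mod 8) * R" if "even y" "odd t"
  proof -
    obtain d where d: "y = 2 * d" using \<open>even y\<close> by (rule evenE)
    have sqd': "squarefree d" using y squarefree_mono[of d y] d by simp
    have od: "odd d"
    proof
      assume "even d"
      then have "2\<^sup>2 dvd y" using d by (auto simp: power2_eq_square)
      then have "(2::nat) dvd 1" using y squarefreeD by blast
      then show False by simp
    qed
    have op: "odd_primes d = odd_primes y"
    proof -
      have "p dvd 2 * d \<longleftrightarrow> p dvd d" if "prime p" "p > 2" for p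
        using that by (metis prime_dvd_mult_iff primes_dvd_imp_eq two_is_prime_nat less_irrefl)
      then show ?thesis unfolding odd_primes_def d by blast
    qed
    have pos: "int d ^ 3 > 0" using od by (simp add: odd_pos)
    have "coprime (8::int) (int d ^ 3)"
    proof -
      have "coprime (2::int) (int d ^ 3)" using od by simp
      then have "coprime (2 * 2 * 2) (int d ^ 3)" by (simp only: coprime_mult_left_iff)
      then show ?thesis by simp
    qed
    then have "root_count (4 * int d ^ 3) (8 * int d ^ 3) t = root_count 4 8 t * root_count (int d ^ 3) (int d ^ 3) t"
      by (rule root_count_mult[OF _ _ _ _ _ pos dvd_refl sqd dvd_triv_right]) auto
    moreover have "int y ^ 3 = 8 * int d ^ 3" "int y ^ 3 div 2 = 4 * int d ^ 3"
      by (simp_all add: d power_mult_distrib)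
    ultimately show ?thesis using cube[OF sqd' od] op root_count_4_8[OF \<open>odd t\<close>] by (simp add: R_def)
  qed
qed

definition half_if_even :: "int \<Rightarrow> int" where "half_if_even a = (if even a then a div 2 else a)"

text \<open>The three congruences for the ratios of coordinates reduce to square roots of y1 y2, y0
  y2 and -y0 y1, since the s_i and the cubes change these numbers only by squares of units.\<close>

lemma conic_density:
  fixes y0 y1 y2 :: nat and s0 s1 s2 :: int
  defines "a0 \<equiv> s0\<^sup>2 * int y0 ^ 3" and "a1 \<equiv> s1\<^sup>2 * int y1 ^ 3" and "a2 \<equiv> s2\<^sup>2 * int y2 ^ 3"
  assumes pos: "s0 > 0" "s1 > 0" "s2 > 0" "y0 > 0" "y1 > 0" "y2 > 0"
    and cop: "coprime a0 a1" "coprime a0 a2" "coprime a1 a2"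
    and four: "4 dvd a0 \<or> 4 dvd a1 \<or> 4 dvd a2"
  shows "((\<lambda>B. real (card (conic.sols_pos a0 a1 a2 B)) / sqrt B) \<longlongrightarrow>
      real (root_count (half_if_even a0) a0 (int y1 * int y2) * root_count (half_if_even a1) a1 (int y0 * int y2) *
        root_count (half_if_even a2) a2 (- (int y0 * int y1))) *
      (3 / (2 * pi * sqrt (real_of_int (a0 * a1 * a2))) * (\<Prod>p\<in>prime_factors (nat (a0 * a1 * a2)). inverse (1 + 1 / real p)))) at_top"
proof -
  have apos: "a0 > 0" "a1 > 0" "a2 > 0" using pos by (auto simp: a0_def a1_def a2_def)
  interpret conic a0 a1 a2 "half_if_even a0" "half_if_even a1" "half_if_even a2"
    using conicI[OF apos cop four] unfolding half_if_even_def .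
  have comp: "coprime (s1 * s2 * int y1 * int y2) a0" "coprime (s0 * s2 * int y0 * int y2) a1" "coprime (s0 * s1 * int y0 * int y1) a2"
  proof -
    have d: "s * int y dvd s\<^sup>2 * int y ^ 3" for s :: int and y :: nat
      by (intro mult_dvd_mono) (auto simp: power2_eq_square power3_eq_cube)
    have c: "coprime (s * int y * (s' * int y')) a" if "coprime (s\<^sup>2 * int y ^ 3) a" "coprime (s'\<^sup>2 * int y' ^ 3) a" for s s' a :: int and y y' :: nat
      using coprime_divisors[OF d[of s y] dvd_refl that(1)] coprime_divisors[OF d[of s' y'] dvd_refl that(2)] by simp
    show "coprime (s1 * s2 * int y1 * int y2) a0" "coprime (s0 * s2 * int y0 * int y2) a1" "coprime (s0 * s1 * int y0 * int y1) a2"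
      using c[of s1 y1 a0 s2 y2] c[of s0 y0 a1 s2 y2] c[of s0 y0 a2 s1 y1] cop
      unfolding a0_def[symmetric] a1_def[symmetric] a2_def[symmetric] by (simp_all add: coprime_commute mult_ac)
  qed
  have "card C0 = root_count (half_if_even a0) a0 (int y1 * int y2)"
    unfolding C0_def
  proof (rule card_roots_scaled[OF _ comp(1) _ n_pos(1) n_dvd(1) n_sq(1) n_dbl(1)])
    have "a1 * a2 = int y1 * int y2 * (s1 * s2 * int y1 * int y2)\<^sup>2"
      by (simp add: a1_def a2_def power2_eq_square power3_eq_cube)
    then show "[a1 * a2 = int y1 * int y2 * (s1 * s2 * int y1 * int y2)\<^sup>2] (mod a0)" by simp
  qed (use cop in \<open>simp add: coprime_commute\<close>)
  moreover have "card C1 = root_count (half_if_even a1) a1 (int y0 * int y2)"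
    unfolding C1_def
  proof (rule card_roots_scaled[OF _ comp(2) _ n_pos(2) n_dvd(2) n_sq(2) n_dbl(2)])
    have "a0 * a2 = int y0 * int y2 * (s0 * s2 * int y0 * int y2)\<^sup>2"
      by (simp add: a0_def a2_def power2_eq_square power3_eq_cube)
    then show "[a0 * a2 = int y0 * int y2 * (s0 * s2 * int y0 * int y2)\<^sup>2] (mod a1)" by simp
  qed (use cop in simp)
  moreover have "card C2 = root_count (half_if_even a2) a2 (- (int y0 * int y1))"
    unfolding C2_def
  proof (rule card_roots_scaled[OF _ comp(3) _ n_pos(3) n_dvd(3) n_sq(3) n_dbl(3)])
    have "a0 * - a1 = - (int y0 * int y1) * (s0 * s1 * int y0 * int y1)\<^sup>2"
      by (simp add: a0_def a1_def power2_eq_square power3_eq_cube)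
    then show "[a0 * - a1 = - (int y0 * int y1) * (s0 * s1 * int y0 * int y1)\<^sup>2] (mod a2)" by simp
  qed (use cop in simp)
  ultimately show ?thesis using sols_pos_count(2) by simp
qed

text \<open>The 2/3 is the factor 1 / (1 + 1/2) of the prime 2, over which \<open>gamma_fac\<close>
  does not run.\<close>

lemma gamma_product:
  assumes "d > 0" "even m" "m > 0" "\<And>p. prime p \<Longrightarrow> p > 2 \<Longrightarrow> p dvd m \<longleftrightarrow> p dvd d"
  shows "(\<Prod>p\<in>prime_factors m. inverse (1 + 1 / real p)) = 2 / 3 * gamma_fac d"
proof -
  have "prime_factors m = insert 2 (odd_primes d)"
  proof (intro Set.set_eqI)
    fix p
    have "p \<in> prime_factors m \<longleftrightarrow> prime p \<and> p dvd m" using assms(3) by (simp add: prime_factors_dvd)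
    moreover have "prime p \<Longrightarrow> p = 2 \<or> p > 2" using prime_ge_2_nat[of p] by linarith
    ultimately show "p \<in> prime_factors m \<longleftrightarrow> p \<in> insert 2 (odd_primes d)"
      using assms(2,4) by (auto simp: odd_primes_def)
  qed
  then show ?thesis using finite_odd_primes[OF assms(1)] by (simp add: odd_primes_def gamma_fac_def)
qed

definition conic_points :: "nat \<Rightarrow> nat \<Rightarrow> nat \<Rightarrow> real \<Rightarrow> (int \<times> int \<times> int) set" where
  "conic_points y0 y1 y2 B = {(x0, x1, x2). x0 > 0 \<and> x1 > 0 \<and> x2 > 0 \<and>
     int y0 ^ 3 * x0\<^sup>2 + int y1 ^ 3 * x1\<^sup>2 = int y2 ^ 3 * x2\<^sup>2 \<and>
     coprime (int y0 * x0) (int y1 * x1) \<and> real_of_int (int y2 ^ 3 * x2\<^sup>2) \<le> B}"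

text \<open>The term of \<open>c_BV\<close> at y including 1/pi, with \<mu>^2 = 1 because only
  squarefree products will occur.\<close>

definition conic_constant :: "nat \<Rightarrow> nat \<Rightarrow> nat \<Rightarrow> real" where
  "conic_constant y0 y1 y2 = 1 / pi * (gamma_fac (y0 * y1 * y2) / real (y0 * y1 * y2) powr (3 / 2) *
     sigma2 y0 y1 y2 * real_of_int (rho y0 y1 y2))"

text \<open>The conic with coefficients s_i^2 y_i^3 describes the solutions of the original conic
  whose i-th coordinate is divisible by s_i.\<close>

lemma sols_pos_iff:
  fixes y0 y1 y2 :: nat and s0 s1 s2 :: int
  defines "a0 \<equiv> s0\<^sup>2 * int y0 ^ 3" and "a1 \<equiv> s1\<^sup>2 * int y1 ^ 3" and "a2 \<equiv> s2\<^sup>2 * int y2 ^ 3"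
  assumes pos: "s0 > 0" "s1 > 0" "s2 > 0" "y0 > 0" "y1 > 0" "y2 > 0"
    and cop: "coprime a0 a1" "coprime a0 a2" "coprime a1 a2"
    and four: "4 dvd a0 \<or> 4 dvd a1 \<or> 4 dvd a2"
  shows "(x0, x1, x2) \<in> conic.sols_pos a0 a1 a2 B \<longleftrightarrow> (s0 * x0, s1 * x1, s2 * x2) \<in> conic_points y0 y1 y2 B"
    and "finite (conic.sols_pos a0 a1 a2 B)"
proof -
  have apos: "a0 > 0" "a1 > 0" "a2 > 0" using pos by (auto simp: a0_def a1_def a2_def)
  have p: "s0 * x0 > 0 \<longleftrightarrow> x0 > 0" "s1 * x1 > 0 \<longleftrightarrow> x1 > 0" "s2 * x2 > 0 \<longleftrightarrow> x2 > 0"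
    using pos by (simp_all add: zero_less_mult_iff)
  interpret conic a0 a1 a2 "half_if_even a0" "half_if_even a1" "half_if_even a2"
    using conicI[OF apos cop four] unfolding half_if_even_def .
  have c: "coprime (a0 * x0) (a1 * x1) \<longleftrightarrow> coprime (int y0 * (s0 * x0)) (int y1 * (s1 * x1))"
    unfolding a0_def a1_def by auto
  have e: "a0 * x0\<^sup>2 = int y0 ^ 3 * (s0 * x0)\<^sup>2" "a1 * x1\<^sup>2 = int y1 ^ 3 * (s1 * x1)\<^sup>2" "a2 * x2\<^sup>2 = int y2 ^ 3 * (s2 * x2)\<^sup>2"
    by (simp_all add: a0_def a1_def a2_def power_mult_distrib)
  show "(x0, x1, x2) \<in> conic.sols_pos a0 a1 a2 B \<longleftrightarrow> (s0 * x0, s1 * x1, s2 * x2) \<in> conic_points y0 y1 y2 B"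
    by (simp only: sols_pos_def sols_def conic_points_def mem_Collect_eq prod.case c e p) blast
  show "finite (conic.sols_pos a0 a1 a2 B)" by (rule sols_pos_count(1))
qed

lemma squarefree_mult_imp_coprime: "squarefree (a * b) \<Longrightarrow> coprime (a::nat) b"
proof (rule coprimeI)
  fix d assume "squarefree (a * b)" "d dvd a" "d dvd b"
  then show "is_unit d" using squarefreeD[of "a * b" d] mult_dvd_mono[of d a d b] by (simp add: power2_eq_square)
qed

lemma sqrt_cube: "x > 0 \<Longrightarrow> sqrt (x ^ 3) = x powr (3 / 2)"
  by (simp add: powr_half_sqrt[symmetric] powr_powr flip: powr_numeral)

lemma rho_eq:
  "rho y0 y1 y2 = (\<Prod>p\<in>odd_primes y0. 1 + Legendre (int y1 * int y2) (int p)) *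
     (\<Prod>p\<in>odd_primes y1. 1 + Legendre (int y0 * int y2) (int p)) *
     (\<Prod>p\<in>odd_primes y2. 1 + Legendre (- (int y0 * int y1)) (int p))"
  unfolding rho_def odd_primes_def ..

lemma odd_prime_not_dvd:
  assumes "coprime y a" "coprime y b" "p \<in> odd_primes y"
  shows "\<not> int p dvd int a * int b" "\<not> int p dvd - (int a * int b)"
proof -
  have p: "prime p" "p dvd y" using assms(3) by (auto simp: odd_primes_def)
  have "\<not> p dvd a" "\<not> p dvd b" using p assms(1,2) by (meson coprime_common_divisor not_prime_unit)+
  then have "\<not> int p dvd int a" "\<not> int p dvd int b" by simp_all
  then show "\<not> int p dvd int a * int b" "\<not> int p dvd - (int a * int b)"
    using p(1) by (auto simp: prime_dvd_mult_iff)
qed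

text \<open>If some y_i is even, 4 divides its cube and the conic can be treated as it stands. If
  all are odd, it is covered by three conics with one coefficient 4 y_i^3; the factor 2 in the
  square root of the coefficients then accounts for the 1/2 in \<open>sigma2_odd\<close>. In all
  cases the 3/2 of the count cancels the 2/3 of the prime 2.\<close>

lemma conic_points_density:
  assumes pos: "y0 > 0" "y1 > 0" "y2 > 0" and sf: "squarefree (y0 * y1 * y2)"
  shows "finite (conic_points y0 y1 y2 B)"
    and "((\<lambda>B. real (card (conic_points y0 y1 y2 B)) / sqrt B) \<longlongrightarrow> conic_constant y0 y1 y2) at_top"
proof -
  define d where "d = y0 * y1 * y2"
  have d0: "d > 0" using pos by (simp add: d_def)
  have copn: "coprime y0 y1" "coprime y0 y2" "coprime y1 y2"
  proof -
    have "squarefree (y0 * y1)" using squarefree_mono[OF _ sf, of "y0 * y1"] by simp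
    then show "coprime y0 y1" by (rule squarefree_mult_imp_coprime)
    show "coprime y0 y2" using squarefree_mult_imp_coprime[of "y0 * y1" y2] sf by simp
    show "coprime y1 y2" using squarefree_mult_imp_coprime[of "y0 * y1" y2] sf by simp
  qed
  have sfi: "squarefree y0" "squarefree y1" "squarefree y2"
    using sf squarefree_mono[of _ "y0 * y1 * y2"] by auto
  define t0 t1 t2 where "t0 = int y1 * int y2" "t1 = int y0 * int y2" "t2 = - (int y0 * int y1)"
  note t_defs = t0_t1_t2_def
  define R0 R1 R2 where "R0 = (\<Prod>p\<in>odd_primes y0. 1 + Legendre t0 (int p))"
    "R1 = (\<Prod>p\<in>odd_primes y1. 1 + Legendre t1 (int p))" "R2 = (\<Prod>p\<in>odd_primes y2. 1 + Legendre t2 (int p))"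
  note R_defs = R0_R1_R2_def
  have rho: "rho y0 y1 y2 = R0 * R1 * R2" unfolding rho_eq R_defs t_defs ..
  have rc0: "\<And>p. p \<in> odd_primes y0 \<Longrightarrow> \<not> int p dvd t0" and rc1: "\<And>p. p \<in> odd_primes y1 \<Longrightarrow> \<not> int p dvd t1"
    and rc2: "\<And>p. p \<in> odd_primes y2 \<Longrightarrow> \<not> int p dvd t2"
    unfolding t_defs using odd_prime_not_dvd copn by (auto simp: coprime_commute)
  note comp0 = root_count_component[OF sfi(1) rc0, folded R_defs]
    and comp1 = root_count_component[OF sfi(2) rc1, folded R_defs]
    and comp2 = root_count_component[OF sfi(3) rc2, folded R_defs]
  define yd where "yd = real d powr (3 / 2)"
  have yd: "yd = sqrt (real d ^ 3)" using d0 by (simp add: yd_def sqrt_cube)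
  have yd0: "yd > 0" using d0 by (simp add: yd_def)
  define N where "N s0 s1 s2 B = conic.sols_pos (s0\<^sup>2 * int y0 ^ 3) (s1\<^sup>2 * int y1 ^ 3) (s2\<^sup>2 * int y2 ^ 3) B" for s0 s1 s2 B
  \<comment> \<open>The scalings for which the coefficients s_i^2 y_i^3 satisfy the conditions of
    \<open>conicI\<close>.\<close>
  define adm where "adm s0 s1 s2 \<longleftrightarrow> s0 \<in> {1, 2} \<and> s1 \<in> {1, 2} \<and> s2 \<in> {1, 2} \<and>
     coprime (s0\<^sup>2 * int y0 ^ 3) (s1\<^sup>2 * int y1 ^ 3) \<and> coprime (s0\<^sup>2 * int y0 ^ 3) (s2\<^sup>2 * int y2 ^ 3) \<and>
     coprime (s1\<^sup>2 * int y1 ^ 3) (s2\<^sup>2 * int y2 ^ 3) \<and>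
     (4 dvd s0\<^sup>2 * int y0 ^ 3 \<or> 4 dvd s1\<^sup>2 * int y1 ^ 3 \<or> 4 dvd s2\<^sup>2 * int y2 ^ 3)" for s0 s1 s2 :: int
  have N_iff: "(x0, x1, x2) \<in> N s0 s1 s2 B \<longleftrightarrow> (s0 * x0, s1 * x1, s2 * x2) \<in> conic_points y0 y1 y2 B"
    and N_fin: "finite (N s0 s1 s2 B)" if "adm s0 s1 s2" for s0 s1 s2 B x0 x1 x2
  proof -
    have sp: "s0 > 0" "s1 > 0" "s2 > 0" using that by (auto simp: adm_def)
    show "(x0, x1, x2) \<in> N s0 s1 s2 B \<longleftrightarrow> (s0 * x0, s1 * x1, s2 * x2) \<in> conic_points y0 y1 y2 B"
      and "finite (N s0 s1 s2 B)"
      using sols_pos_iff[OF sp pos] that unfolding adm_def N_def by auto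
  qed
  have N_lim: "((\<lambda>B. real (card (N s0 s1 s2 B)) / sqrt B) \<longlongrightarrow>
      real_of_int c * (gamma_fac d / (pi * of_int (s0 * s1 * s2) * yd))) at_top"
    if a: "adm s0 s1 s2" and c: "c = int (root_count (half_if_even (s0\<^sup>2 * int y0 ^ 3)) (s0\<^sup>2 * int y0 ^ 3) t0) *
        int (root_count (half_if_even (s1\<^sup>2 * int y1 ^ 3)) (s1\<^sup>2 * int y1 ^ 3) t1) *
        int (root_count (half_if_even (s2\<^sup>2 * int y2 ^ 3)) (s2\<^sup>2 * int y2 ^ 3) t2)" for s0 s1 s2 c
  proof -
    have sp: "s0 > 0" "s1 > 0" "s2 > 0" using a by (auto simp: adm_def)
    define m where "m = s0\<^sup>2 * int y0 ^ 3 * (s1\<^sup>2 * int y1 ^ 3) * (s2\<^sup>2 * int y2 ^ 3)"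
    have m: "m = (s0 * s1 * s2)\<^sup>2 * int d ^ 3" by (simp add: m_def d_def power_mult_distrib mult_ac)
    have m0: "m > 0" unfolding m using sp d0 by simp
    have "real_of_int m = (real_of_int (s0 * s1 * s2))\<^sup>2 * real d ^ 3" unfolding m by simp
    then have sq: "sqrt (real_of_int m) = real_of_int (s0 * s1 * s2) * yd"
      using sp by (simp add: real_sqrt_mult yd)
    have e4: "even x" if "4 dvd x" for x :: int using that by (meson dvd_trans even_numeral)
    have "even (s0\<^sup>2 * int y0 ^ 3) \<or> even (s1\<^sup>2 * int y1 ^ 3) \<or> even (s2\<^sup>2 * int y2 ^ 3)"
      using a e4 unfolding adm_def by blast
    then have "even m" unfolding m_def by (elim disjE) (simp_all only: dvd_mult dvd_mult2)
    have g: "(\<Prod>p\<in>prime_factors (nat m). inverse (1 + 1 / real p)) = 2 / 3 * gamma_fac d"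
    proof (rule gamma_product[OF d0])
      show "even (nat m)" "nat m > 0" using \<open>even m\<close> m0 by (auto simp: even_nat_iff)
      show "p dvd nat m \<longleftrightarrow> p dvd d" if p: "prime p" "p > 2" for p
      proof -
        have pi: "prime (int p)" using p(1) by simp
        have "\<not> int p dvd s" if "s \<in> {1, 2}" for s
          using that p zdvd_imp_le[of "int p" s] by auto
        then have "\<not> int p dvd s0 * s1 * s2" using a pi unfolding adm_def by (simp add: prime_dvd_mult_iff)
        then have "int p dvd m \<longleftrightarrow> int p dvd int d"
          unfolding m using pi by (simp add: prime_dvd_mult_iff prime_dvd_power_iff)
        moreover have "int p dvd m \<longleftrightarrow> p dvd nat m" using m0 by (metis int_dvd_int_iff int_nat_eq less_imp_le)
        ultimately show ?thesis by simp
      qed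
    qed
    have "((\<lambda>B. real (card (N s0 s1 s2 B)) / sqrt B) \<longlongrightarrow>
      real_of_int c * (3 / (2 * pi * sqrt (real_of_int m)) * (\<Prod>p\<in>prime_factors (nat m). inverse (1 + 1 / real p)))) at_top"
      using conic_density[OF sp pos] a unfolding adm_def N_def m_def t_defs c by simp
    then show ?thesis unfolding g sq by (simp add: mult_ac)
  qed
  have const: "conic_constant y0 y1 y2 = sigma2 y0 y1 y2 * real_of_int (R0 * R1 * R2) * gamma_fac d / (pi * yd)"
    unfolding conic_constant_def rho yd_def d_def by (simp add: mult_ac)
  have h: "half_if_even (s\<^sup>2 * int y ^ 3) = int y ^ 3" if "s = 1" "odd y" for s and y :: nat
    using that by (simp add: half_if_even_def)
  have h2: "half_if_even (s\<^sup>2 * int y ^ 3) = 2 * int y ^ 3" if "s = 2" for s and y :: nat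
    using that by (simp add: half_if_even_def)
  have h3: "half_if_even (s\<^sup>2 * int y ^ 3) = int y ^ 3 div 2" if "s = 1" "even y" for s and y :: nat
    using that by (simp add: half_if_even_def)
  have ev: "4 dvd int y ^ 3" if "even y" for y
  proof -
    have "(2 * 2 :: int) dvd int y * int y" using that by (intro mult_dvd_mono) auto
    then show ?thesis by (simp add: power3_eq_cube)
  qed
  have notboth: "\<not> (even y \<and> even z)" if "coprime y z" for y z :: nat
    using that by (meson coprime_common_divisor_nat numeral_eq_one_iff semiring_norm(85) prime_nat_iff two_is_prime_nat)
  have cop3: "coprime (int y0 ^ 3) (int y1 ^ 3)" "coprime (int y0 ^ 3) (int y2 ^ 3)" "coprime (int y1 ^ 3) (int y2 ^ 3)"
    using copn by simp_all
  have c4: "coprime (4 * int y ^ 3) (int z ^ 3)" "coprime (int z ^ 3) (4 * int y ^ 3)"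
    if "coprime y z" "odd z" for y z :: nat
  proof -
    have "coprime (2::int) (int z ^ 3)" using that(2) by simp
    then have "coprime (2 * 2 * int y ^ 3) (int z ^ 3)" using that(1) by (simp only: coprime_mult_left_iff) simp
    then show "coprime (4 * int y ^ 3) (int z ^ 3)" "coprime (int z ^ 3) (4 * int y ^ 3)" by (simp_all add: coprime_commute)
  qed
  consider (odd) "odd y0" "odd y1" "odd y2" | (e0) "even y0" "odd y1" "odd y2"
    | (e1) "odd y0" "even y1" "odd y2" | (e2) "odd y0" "odd y1" "even y2"
    using notboth copn by blast
  then have "(\<forall>B. finite (conic_points y0 y1 y2 B)) \<and>
    ((\<lambda>B. real (card (conic_points y0 y1 y2 B)) / sqrt B) \<longlongrightarrow> conic_constant y0 y1 y2) at_top"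
  proof cases
    case odd
    have to: "odd t0" "odd t1" "odd t2" using odd by (simp_all add: t_defs)
    have adm: "adm 2 1 1" "adm 1 2 1" "adm 1 1 2"
      unfolding adm_def using cop3 c4 odd copn by (simp_all add: coprime_commute)
    define T0 T1 T2 where "T0 B = (\<lambda>(x0, x1, x2). (2 * x0, x1, x2)) ` N 2 1 1 B"
      "T1 B = (\<lambda>(x0, x1, x2). (x0, 2 * x1, x2)) ` N 1 2 1 B"
      "T2 B = (\<lambda>(x0, x1, x2). (x0, x1, 2 * x2)) ` N 1 1 2 B" for B
    note T_defs = T0_T1_T2_def
    have T_eq: "T0 B = {(x0, x1, x2) \<in> conic_points y0 y1 y2 B. even x0}"
      "T1 B = {(x0, x1, x2) \<in> conic_points y0 y1 y2 B. even x1}"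
      "T2 B = {(x0, x1, x2) \<in> conic_points y0 y1 y2 B. even x2}" for B
      unfolding T_defs using N_iff[OF adm(1), of _ _ _ B] N_iff[OF adm(2), of _ _ _ B] N_iff[OF adm(3), of _ _ _ B]
      by (auto simp: image_iff elim!: evenE) (metis case_prod_conv)+
    \<comment> \<open>An even pair x0, x1 would contradict coprimality, so with an even sum exactly
      one of the three coordinates is even.\<close>
    have par: "even (x0 + x1 + x2) \<and> \<not> (even x0 \<and> even x1)" if x: "(x0, x1, x2) \<in> conic_points y0 y1 y2 B" for x0 x1 x2 B
    proof -
      have "even (int y0 ^ 3 * x0\<^sup>2 + int y1 ^ 3 * x1\<^sup>2) \<longleftrightarrow> even (int y2 ^ 3 * x2\<^sup>2)" using x by (simp add: conic_points_def)
      then have 1: "even (x0 + x1 + x2)" using odd by auto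
      have "coprime (int y0 * x0) (int y1 * x1)" using x by (simp add: conic_points_def)
      then have "\<not> (even (int y0 * x0) \<and> even (int y1 * x1))" by (meson coprime_common_divisor odd_one)
      then show ?thesis using 1 odd by auto
    qed
    have un: "conic_points y0 y1 y2 B = T0 B \<union> (T1 B \<union> T2 B)" for B
      unfolding T_eq using par[of _ _ _ B] by fastforce
    have finT: "finite (T0 B)" "finite (T1 B)" "finite (T2 B)" for B unfolding T_defs using N_fin adm by auto
    have disj1: "T0 B \<inter> (T1 B \<union> T2 B) = {}" and disj2: "T1 B \<inter> T2 B = {}" for B
      unfolding T_eq using par[of _ _ _ B] by fastforce+
    have "card (conic_points y0 y1 y2 B) = card (T0 B) + (card (T1 B) + card (T2 B))" for B
      unfolding un by (simp only: card_Un_disjoint[OF finT(1) _ disj1] card_Un_disjoint[OF finT(2,3) disj2] finT finite_UnI)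
    moreover have "card (T0 B) = card (N 2 1 1 B)" "card (T1 B) = card (N 1 2 1 B)" "card (T2 B) = card (N 1 1 2 B)" for B
      unfolding T_defs by (rule card_image, force simp: inj_on_def)+
    ultimately have eq: "real (card (conic_points y0 y1 y2 B)) / sqrt B =
       real (card (N 2 1 1 B)) / sqrt B + (real (card (N 1 2 1 B)) / sqrt B + real (card (N 1 1 2 B)) / sqrt B)" for B
      by (simp add: add_divide_distrib)
    have l0: "((\<lambda>B. real (card (N 2 1 1 B)) / sqrt B) \<longlongrightarrow>
        real_of_int (of_bool [t0 = 1] (mod 4) * R0 * R1 * R2) * (gamma_fac d / (pi * of_int (2 * 1 * 1) * yd))) at_top"
      by (rule N_lim[OF adm(1)]) (use comp0(2) comp1(1) comp2(1) odd to h h2 in simp)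
    have l1: "((\<lambda>B. real (card (N 1 2 1 B)) / sqrt B) \<longlongrightarrow>
        real_of_int (R0 * (of_bool [t1 = 1] (mod 4) * R1) * R2) * (gamma_fac d / (pi * of_int (1 * 2 * 1) * yd))) at_top"
      by (rule N_lim[OF adm(2)]) (use comp0(1) comp1(2) comp2(1) odd to h h2 in simp)
    have l2: "((\<lambda>B. real (card (N 1 1 2 B)) / sqrt B) \<longlongrightarrow>
        real_of_int (R0 * R1 * (of_bool [t2 = 1] (mod 4) * R2)) * (gamma_fac d / (pi * of_int (1 * 1 * 2) * yd))) at_top"
      by (rule N_lim[OF adm(3)]) (use comp0(1) comp1(1) comp2(2) odd to h h2 in simp)
    have "conic_constant y0 y1 y2 =
        real_of_int (of_bool [t0 = 1] (mod 4) * R0 * R1 * R2) * (gamma_fac d / (pi * of_int (2 * 1 * 1) * yd)) +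
        (real_of_int (R0 * (of_bool [t1 = 1] (mod 4) * R1) * R2) * (gamma_fac d / (pi * of_int (1 * 2 * 1) * yd)) +
         real_of_int (R0 * R1 * (of_bool [t2 = 1] (mod 4) * R2)) * (gamma_fac d / (pi * of_int (1 * 1 * 2) * yd)))"
      unfolding const sigma2_odd[OF odd] t_defs using yd0 by (simp add: field_simps)
    then show ?thesis using tendsto_add[OF l0 tendsto_add[OF l1 l2]] finT unfolding eq by (simp add: un)
  next
    case e0
    have to: "odd t0" using e0 by (simp add: t_defs)
    have adm: "adm 1 1 1" unfolding adm_def using cop3 ev e0 by simp
    have Neq: "N 1 1 1 B = conic_points y0 y1 y2 B" for B using N_iff[OF adm, of _ _ _ B] by auto
    have l: "((\<lambda>B. real (card (N 1 1 1 B)) / sqrt B) \<longlongrightarrow>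
        real_of_int (2 * of_bool [t0 = 1] (mod 8) * R0 * R1 * R2) * (gamma_fac d / (pi * of_int (1 * 1 * 1) * yd))) at_top"
      by (rule N_lim[OF adm]) (use comp0(3) comp1(1) comp2(1) e0 to h h3 in simp)
    have "conic_constant y0 y1 y2 = real_of_int (2 * of_bool [t0 = 1] (mod 8) * R0 * R1 * R2) * (gamma_fac d / (pi * of_int (1 * 1 * 1) * yd))"
      unfolding const sigma2_even(1)[OF e0] t_defs by simp
    then show ?thesis using l N_fin[OF adm] unfolding Neq by simp
  next
    case e1
    have to: "odd t1" using e1 by (simp add: t_defs)
    have adm: "adm 1 1 1" unfolding adm_def using cop3 ev e1 by simp
    have Neq: "N 1 1 1 B = conic_points y0 y1 y2 B" for B using N_iff[OF adm, of _ _ _ B] by auto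
    have l: "((\<lambda>B. real (card (N 1 1 1 B)) / sqrt B) \<longlongrightarrow>
        real_of_int (R0 * (2 * of_bool [t1 = 1] (mod 8) * R1) * R2) * (gamma_fac d / (pi * of_int (1 * 1 * 1) * yd))) at_top"
      by (rule N_lim[OF adm]) (use comp0(1) comp1(3) comp2(1) e1 to h h3 in simp)
    have "conic_constant y0 y1 y2 = real_of_int (R0 * (2 * of_bool [t1 = 1] (mod 8) * R1) * R2) * (gamma_fac d / (pi * of_int (1 * 1 * 1) * yd))"
      unfolding const sigma2_even(2)[OF e1(2,1,3)] t_defs by simp
    then show ?thesis using l N_fin[OF adm] unfolding Neq by simp
  next
    case e2
    have to: "odd t2" using e2 by (simp add: t_defs)
    have adm: "adm 1 1 1" unfolding adm_def using cop3 ev e2 by simp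
    have Neq: "N 1 1 1 B = conic_points y0 y1 y2 B" for B using N_iff[OF adm, of _ _ _ B] by auto
    have l: "((\<lambda>B. real (card (N 1 1 1 B)) / sqrt B) \<longlongrightarrow>
        real_of_int (R0 * R1 * (2 * of_bool [t2 = 1] (mod 8) * R2)) * (gamma_fac d / (pi * of_int (1 * 1 * 1) * yd))) at_top"
      by (rule N_lim[OF adm]) (use comp0(1) comp1(1) comp2(3) e2 to h h3 in simp)
    have "conic_constant y0 y1 y2 = real_of_int (R0 * R1 * (2 * of_bool [t2 = 1] (mod 8) * R2)) * (gamma_fac d / (pi * of_int (1 * 1 * 1) * yd))"
      unfolding const sigma2_even(3)[OF e2(3,1,2)] t_defs by simp
    then show ?thesis using l N_fin[OF adm] unfolding Neq by simp
  qed
  then show "finite (conic_points y0 y1 y2 B)"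
    and "((\<lambda>B. real (card (conic_points y0 y1 y2 B)) / sqrt B) \<longlongrightarrow> conic_constant y0 y1 y2) at_top"
    by blast+
qed

section \<open>The squaring morphism of the projective line\<close>

definition bimon :: "nat \<Rightarrow> nat \<Rightarrow> (nat \<Rightarrow>\<^sub>0 nat)" where
  "bimon i j = Poly_Mapping.single 0 i + Poly_Mapping.single 1 j"

lemma lookup_bimon: "Poly_Mapping.lookup (bimon i j) k = (if k = 0 then i else if k = 1 then j else 0)"
  by (simp add: bimon_def lookup_add lookup_single when_def)

lemma bimon_eq_iff [simp]: "bimon i j = bimon i' j' \<longleftrightarrow> i = i' \<and> j = j'"
  by (metis lookup_bimon zero_neq_one)

lemma bimon_0 [simp]: "bimon 0 0 = 0"
  by (simp add: bimon_def)

lemma keys_bimon: "Poly_Mapping.keys (bimon i j) = (if i = 0 then {} else {0}) \<union> (if j = 0 then {} else {1})"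
  by (auto simp: in_keys_iff lookup_bimon split: if_splits)

lemma bimon_add: "bimon i j + bimon i' j' = bimon (i + i') (j + j')"
  by (rule poly_mapping_eqI) (simp add: lookup_bimon lookup_add)

lemma eq_bimon:
  assumes "Poly_Mapping.keys m \<subseteq> {..1}"
  shows "m = bimon (Poly_Mapping.lookup m 0) (Poly_Mapping.lookup m 1)"
proof (rule poly_mapping_eqI)
  fix k
  show "Poly_Mapping.lookup m k = Poly_Mapping.lookup (bimon (Poly_Mapping.lookup m 0) (Poly_Mapping.lookup m 1)) k"
  proof (cases "k \<le> 1")
    case True
    then have "k = 0 \<or> k = 1" by linarith
    then show ?thesis by (auto simp: lookup_bimon)
  next
    case False
    then have "k \<notin> Poly_Mapping.keys m" using assms by auto
    then show ?thesis using False by (simp add: in_keys_iff lookup_bimon)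
  qed
qed

lemma degree_bimon: "(\<Sum>k\<in>Poly_Mapping.keys (bimon i j). Poly_Mapping.lookup (bimon i j) k) = i + j"
proof -
  have "(\<Sum>k\<in>Poly_Mapping.keys (bimon i j). Poly_Mapping.lookup (bimon i j) k) =
      (\<Sum>k\<in>{0, 1}. Poly_Mapping.lookup (bimon i j) k)"
    by (rule sum.mono_neutral_left) (auto simp: keys_bimon lookup_bimon split: if_splits)
  then show ?thesis by (simp add: lookup_bimon)
qed

lemma Var_power: "Var 0 ^ i = Poly_Mapping.single (bimon i 0) 1" "Var (Suc 0) ^ j = Poly_Mapping.single (bimon 0 j) 1"
proof -
  have V: "Var 0 = Poly_Mapping.single (bimon 1 0) 1" "Var (Suc 0) = Poly_Mapping.single (bimon 0 1) 1"
    by (simp_all add: Var_def bimon_def)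
  show "Var 0 ^ i = Poly_Mapping.single (bimon i 0) 1"
  proof (induction i)
    case 0
    then show ?case by simp
  next
    case (Suc i)
    then show ?case by (simp only: power_Suc V(1) mult_single bimon_add) simp
  qed
  show "Var (Suc 0) ^ j = Poly_Mapping.single (bimon 0 j) 1"
  proof (induction j)
    case 0
    then show ?case by simp
  next
    case (Suc j)
    then show ?case by (simp only: power_Suc V(2) mult_single bimon_add) simp
  qed
qed

lemma Const_Var_power: "Const c * Var 0 ^ i * Var (Suc 0) ^ j = Poly_Mapping.single (bimon i j) c"
  by (simp only: Var_power Const_def mult_single) (simp add: bimon_add)

lemma Const_simps: "Const 0 = 0" "Const 1 = 1" "Const (a + b) = Const a + Const b" "Const (a * b) = Const a * Const b"
  by (simp_all add: Const_def single_add mult_single)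

text \<open>Homogenization of p to degree N at (x, y), coefficients beyond N being dropped. The
  arguments are general because the coordinates, the swapped coordinates and the squares of the
  coordinates are all inserted.\<close>

definition homog :: "rat mpoly \<Rightarrow> rat mpoly \<Rightarrow> nat \<Rightarrow> rat poly \<Rightarrow> rat mpoly" where
  "homog x y N p = (\<Sum>i\<le>N. Const (coeff p i) * x ^ i * y ^ (N - i))"

lemma homog_0 [simp]: "homog x y N 0 = 0"
  by (simp add: homog_def Const_simps)

lemma homog_add: "homog x y N (p + q) = homog x y N p + homog x y N q"
  by (simp add: homog_def Const_simps algebra_simps sum.distrib)

lemma homog_smult: "homog x y N (smult c p) = Const c * homog x y N p"
  by (simp add: homog_def Const_simps sum_distrib_left mult.assoc)

lemma homog_const: "homog x y N [:c:] = Const c * y ^ N"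
proof -
  have "homog x y N [:c:] = (\<Sum>i\<le>N. if i = 0 then Const c * y ^ N else 0)"
    unfolding homog_def by (intro sum.cong refl) (auto simp: coeff_pCons Const_simps split: nat.splits)
  then show ?thesis by (simp add: sum.delta)
qed

lemma homog_shift: "degree p \<le> N \<Longrightarrow> homog x y (N + k) p = y ^ k * homog x y N p"
proof -
  assume p: "degree p \<le> N"
  have "homog x y (N + k) p = (\<Sum>i\<le>N. Const (coeff p i) * x ^ i * y ^ (N + k - i))"
    unfolding homog_def using p by (intro sum.mono_neutral_right) (auto simp: Const_simps coeff_eq_0)
  also have "\<dots> = (\<Sum>i\<le>N. y ^ k * (Const (coeff p i) * x ^ i * y ^ (N - i)))"
  proof (intro sum.cong refl)
    fix i assume "i \<in> {..N}"
    then have "N + k - i = k + (N - i)" by simp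
    then show "Const (coeff p i) * x ^ i * y ^ (N + k - i) = y ^ k * (Const (coeff p i) * x ^ i * y ^ (N - i))"
      by (simp add: power_add mult_ac)
  qed
  finally show ?thesis by (simp add: homog_def sum_distrib_left)
qed

lemma homog_pCons: "homog x y (Suc N) (pCons c p) = Const c * y ^ Suc N + x * homog x y N p"
  unfolding homog_def by (simp only: sum.atMost_Suc_shift) (simp add: sum_distrib_left mult_ac)

lemma homog_mult:
  assumes "degree p \<le> N" "degree q \<le> M"
  shows "homog x y (N + M) (p * q) = homog x y N p * homog x y M q"
  using assms(1)
proof (induction p arbitrary: N)
  case 0
  then show ?case by simp
next
  case (pCons c p)
  have sm: "homog x y (N + M) (smult c q) = Const c * y ^ N * homog x y M q" for N
    using homog_shift[OF assms(2), of x y N] by (simp add: homog_smult add.commute mult.assoc)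
  show ?case
  proof (cases "p = 0")
    case True
    then show ?thesis using sm by (simp add: homog_const)
  next
    case False
    then obtain N' where N': "N = Suc N'" "degree p \<le> N'" using pCons.prems by (cases N) auto
    have "homog x y (N + M) (pCons c p * q) = homog x y (N + M) (smult c q) + homog x y (Suc (N' + M)) (pCons 0 (p * q))"
      using N' by (simp add: homog_add)
    also have "homog x y (Suc (N' + M)) (pCons 0 (p * q)) = x * (homog x y N' p * homog x y M q)"
      by (simp only: homog_pCons pCons.IH[OF N'(2)] Const_simps) simp
    finally show ?thesis unfolding sm using N'(1) by (simp add: homog_pCons algebra_simps)
  qed
qed

abbreviation hom2 :: "nat \<Rightarrow> rat poly \<Rightarrow> rat mpoly" where "hom2 \<equiv> homog (Var 0) (Var (Suc 0))"

lemma hom2_eq: "hom2 N p = (\<Sum>i\<le>N. Poly_Mapping.single (bimon i (N - i)) (coeff p i))"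
  unfolding homog_def by (intro sum.cong refl) (rule Const_Var_power)

lemma lookup_hom2: "Poly_Mapping.lookup (hom2 N p) (bimon i j) = (if i + j = N then coeff p i else 0)"
proof -
  have "Poly_Mapping.lookup (hom2 N p) (bimon i j) = (\<Sum>k\<le>N. if k = i \<and> N - k = j then coeff p k else 0)"
    unfolding hom2_eq lookup_sum by (intro sum.cong refl) (auto simp: lookup_single when_def)
  also have "\<dots> = (\<Sum>k\<le>N. if k = i then (if i + j = N then coeff p i else 0) else 0)"
    by (intro sum.cong refl) auto
  also have "\<dots> = (if i + j = N then coeff p i else 0)" by (simp add: sum.delta)
  finally show ?thesis .
qed

lemma keys_hom2: "m \<in> Poly_Mapping.keys (hom2 N p) \<Longrightarrow> \<exists>i\<le>N. m = bimon i (N - i)"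
  unfolding hom2_eq using keys_sum[of "\<lambda>i. Poly_Mapping.single (bimon i (N - i)) (coeff p i)" "{..N}"]
  by (fastforce split: if_splits)

lemma hom2_eq_0_iff: "degree p \<le> N \<Longrightarrow> hom2 N p = 0 \<longleftrightarrow> p = 0"
proof
  assume p: "degree p \<le> N" and 0: "hom2 N p = 0"
  have "coeff p i = 0" for i
    using lookup_hom2[of N p i "N - i"] 0 p by (cases "i \<le> N") (auto simp: coeff_eq_0)
  then show "p = 0" by (simp add: poly_eq_iff)
qed simp

lemma homogeneous_hom2: "homogeneous 1 N (hom2 N p)"
proof -
  have k: "Poly_Mapping.keys (bimon i j) \<subseteq> {..1}" for i j by (auto simp: keys_bimon)
  have "Poly_Mapping.keys m \<subseteq> {..1} \<and> (\<Sum>i\<in>Poly_Mapping.keys m. Poly_Mapping.lookup m i) = N"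
    if m: "m \<in> Poly_Mapping.keys (hom2 N p)" for m
  proof -
    obtain i where "i \<le> N" "m = bimon i (N - i)" using keys_hom2[OF m] by blast
    then show ?thesis using k degree_bimon[of i "N - i"] by simp
  qed
  then show ?thesis unfolding homogeneous_def coord_ring_def by simp
qed

lemma coeff_sum_monom: "coeff (\<Sum>i\<le>d. monom (a i) i) j = (if j \<le> d then a j else 0)"
proof -
  have "coeff (\<Sum>i\<le>d. monom (a i) i) j = (\<Sum>i\<le>d. if i = j then a j else 0)"
    unfolding coeff_sum by (intro sum.cong refl) simp
  then show ?thesis by (simp add: sum.delta)
qed

lemma homogeneous_imp_hom2:
  assumes "homogeneous 1 d F"
  obtains p where "degree p \<le> d" "F = hom2 d p"
proof -
  define p where "p = (\<Sum>i\<le>d. monom (Poly_Mapping.lookup F (bimon i (d - i))) i)"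
  have cp: "coeff p i = (if i \<le> d then Poly_Mapping.lookup F (bimon i (d - i)) else 0)" for i
    unfolding p_def by (rule coeff_sum_monom)
  have "F = hom2 d p"
  proof (rule poly_mapping_eqI)
    fix m
    show "Poly_Mapping.lookup F m = Poly_Mapping.lookup (hom2 d p) m"
    proof (cases "\<exists>i j. m = bimon i j")
      case True
      then obtain i j where m: "m = bimon i j" by blast
      show ?thesis
      proof (cases "i + j = d")
        case True
        then have "i \<le> d" "d - i = j" by auto
        then show ?thesis using True by (simp add: m lookup_hom2 cp)
      next
        case False
        then have "m \<notin> Poly_Mapping.keys F" using assms degree_bimon[of i j] m unfolding homogeneous_def by auto
        then show ?thesis using False by (simp add: m lookup_hom2 in_keys_iff)
      qed
    next
      case False
      have "m \<notin> Poly_Mapping.keys F"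
      proof
        assume "m \<in> Poly_Mapping.keys F"
        then have "Poly_Mapping.keys m \<subseteq> {..1}" using assms unfolding homogeneous_def coord_ring_def by auto
        then show False using eq_bimon False by blast
      qed
      moreover have "m \<notin> Poly_Mapping.keys (hom2 d p)" using keys_hom2 False by blast
      ultimately show ?thesis by (simp add: in_keys_iff)
    qed
  qed
  moreover have "degree p \<le> d" by (rule degree_le) (simp add: cp)
  ultimately show thesis using that by blast
qed

text \<open>Dehomogenization at the first coordinate, for prime ideals that may contain the
  second.\<close>

lemma homogeneous_imp_homog_swapped:
  assumes "homogeneous 1 d F"
  obtains p where "degree p \<le> d" "F = homog (Var (Suc 0)) (Var 0) d p"
proof -
  obtain q where q: "degree q \<le> d" "F = hom2 d q" using homogeneous_imp_hom2[OF assms] .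
  define p where "p = (\<Sum>i\<le>d. monom (coeff q (d - i)) i)"
  have cp: "coeff p i = (if i \<le> d then coeff q (d - i) else 0)" for i
    unfolding p_def by (rule coeff_sum_monom)
  have "F = (\<Sum>i\<le>d. Const (coeff q (d - i)) * Var 0 ^ (d - i) * Var (Suc 0) ^ (d - (d - i)))"
    unfolding q(2) homog_def by (rule sum.reindex_bij_witness[of _ "\<lambda>i. d - i" "\<lambda>i. d - i"]) auto
  also have "\<dots> = homog (Var (Suc 0)) (Var 0) d p"
    unfolding homog_def by (intro sum.cong refl) (simp add: cp mult_ac)
  finally have "F = homog (Var (Suc 0)) (Var 0) d p" .
  moreover have "degree p \<le> d" by (rule degree_le) (simp add: cp)
  ultimately show thesis using that by blast
qed

section \<open>Homogeneous primes and the dimension of the line\<close>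

lemma coord_ring_sel [simp]:
  "mult (coord_ring n) = (*)" "one (coord_ring n) = 1" "zero (coord_ring n) = 0" "add (coord_ring n) = (+)"
  by (simp_all add: coord_ring_def)

lemma in_coord_ring: "f \<in> carrier (coord_ring n) \<longleftrightarrow> (\<forall>m\<in>Poly_Mapping.keys f. Poly_Mapping.keys m \<subseteq> {..n})"
  by (simp add: coord_ring_def)

lemma coord_ring_closed:
  assumes "f \<in> carrier (coord_ring n)" "g \<in> carrier (coord_ring n)"
  shows "f + g \<in> carrier (coord_ring n)" "f * g \<in> carrier (coord_ring n)" "- f \<in> carrier (coord_ring n)"
proof -
  show "f + g \<in> carrier (coord_ring n)"
    unfolding in_coord_ring
  proof
    fix m assume "m \<in> Poly_Mapping.keys (f + g)"
    then have "m \<in> Poly_Mapping.keys f \<or> m \<in> Poly_Mapping.keys g" using keys_add[of f g] by blast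
    then show "Poly_Mapping.keys m \<subseteq> {..n}" using assms by (auto simp: in_coord_ring)
  qed
  show "f * g \<in> carrier (coord_ring n)"
    unfolding in_coord_ring
  proof
    fix m assume "m \<in> Poly_Mapping.keys (f * g)"
    then obtain a b where ab: "m = a + b" "a \<in> Poly_Mapping.keys f" "b \<in> Poly_Mapping.keys g" using keys_mult[of f g] by blast
    then have "Poly_Mapping.keys m \<subseteq> Poly_Mapping.keys a \<union> Poly_Mapping.keys b" using keys_add[of a b] by simp
    then show "Poly_Mapping.keys m \<subseteq> {..n}" using assms ab by (auto simp: in_coord_ring)
  qed
  have "Poly_Mapping.keys (- f) = Poly_Mapping.keys f" by (auto simp: in_keys_iff)
  then show "- f \<in> carrier (coord_ring n)" using assms by (simp add: in_coord_ring)
qed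

lemma coord_ring_0: "0 \<in> carrier (coord_ring n)" and coord_ring_1: "1 \<in> carrier (coord_ring n)"
  and coord_ring_Const: "Const c \<in> carrier (coord_ring n)"
  by (auto simp: in_coord_ring Const_def)

lemma coord_ring_Var: "i \<le> n \<Longrightarrow> Var i \<in> carrier (coord_ring n)"
  by (auto simp: in_coord_ring Var_def)

lemma cring_coord_ring: "cring (coord_ring n)"
proof (rule cringI)
  show "abelian_group (coord_ring n)"
  proof (rule abelian_groupI)
    show "\<exists>y\<in>carrier (coord_ring n). y \<oplus>\<^bsub>coord_ring n\<^esub> x = \<zero>\<^bsub>coord_ring n\<^esub>" if "x \<in> carrier (coord_ring n)" for x
      using coord_ring_closed(3)[OF that that] by (intro bexI[of _ "- x"]) auto
  qed (auto simp: coord_ring_closed coord_ring_0 algebra_simps)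
  show "comm_monoid (coord_ring n)"
    by (rule comm_monoidI) (auto simp: coord_ring_closed coord_ring_1 algebra_simps)
qed (auto simp: algebra_simps)

lemma homog_in_coord_ring:
  assumes "x \<in> carrier (coord_ring n)" "y \<in> carrier (coord_ring n)"
  shows "homog x y N p \<in> carrier (coord_ring n)"
proof -
  have pw: "z ^ i \<in> carrier (coord_ring n)" if "z \<in> carrier (coord_ring n)" for z i
    using that by (induction i) (auto simp: coord_ring_1 coord_ring_closed)
  have sm: "sum f A \<in> carrier (coord_ring n)" if "\<And>i. f i \<in> carrier (coord_ring n)" for f and A :: "nat set"
    by (induction A rule: infinite_finite_induct) (auto simp: coord_ring_0 coord_ring_closed that)
  show ?thesis unfolding homog_def
    by (intro sm coord_ring_closed coord_ring_Const pw assms)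
qed

lemma integral_subvarietyD:
  assumes "integral_subvariety n P"
  shows "P \<subseteq> carrier (coord_ring n)" "0 \<in> P" "\<And>f g. f \<in> P \<Longrightarrow> g \<in> P \<Longrightarrow> f + g \<in> P"
    "\<And>f g. f \<in> P \<Longrightarrow> g \<in> carrier (coord_ring n) \<Longrightarrow> f * g \<in> P"
    "\<And>f g. f \<in> carrier (coord_ring n) \<Longrightarrow> g \<in> carrier (coord_ring n) \<Longrightarrow> f * g \<in> P \<Longrightarrow> f \<in> P \<or> g \<in> P"
    "1 \<notin> P" "\<not> Var ` {..n} \<subseteq> P"
    "P = Idl\<^bsub>coord_ring n\<^esub> {f \<in> P. \<exists>d. homogeneous n d f}"
proof -
  have "primeideal P (coord_ring n)" using assms by (simp add: integral_subvariety_def)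
  then interpret primeideal P "coord_ring n" .
  show "P \<subseteq> carrier (coord_ring n)" by (rule a_subset)
  show "0 \<in> P" using additive_subgroup.zero_closed[OF is_additive_subgroup] by simp
  show "f + g \<in> P" if "f \<in> P" "g \<in> P" for f g using additive_subgroup.a_closed[OF is_additive_subgroup that] by simp
  show "f * g \<in> P" if "f \<in> P" "g \<in> carrier (coord_ring n)" for f g using I_r_closed[OF that] by simp
  show "f \<in> P \<or> g \<in> P" if "f \<in> carrier (coord_ring n)" "g \<in> carrier (coord_ring n)" "f * g \<in> P" for f g
    using I_prime[OF that(1,2)] that(3) by simp
  show "1 \<notin> P" using one_imp_carrier I_notcarr by auto
  show "\<not> Var ` {..n} \<subseteq> P" using assms by (simp add: integral_subvariety_def)
  show "P = Idl\<^bsub>coord_ring n\<^esub> {f \<in> P. \<exists>d. homogeneous n d f}"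
    using assms by (simp add: integral_subvariety_def homogeneous_ideal_def)
qed

text \<open>Dehomogenizing at a coordinate outside \<open>Q\<close> turns \<open>P\<close> into a nonzero prime ideal of the principal
  ideal domain of univariate polynomials, which is maximal.\<close>

lemma nonzero_prime_not_below:
  assumes P: "integral_subvariety 1 P" and Q: "integral_subvariety 1 Q" and PQ: "P \<subset> Q" and P0: "P \<noteq> {0}"
    and xy: "x \<in> carrier (coord_ring 1)" "y \<in> carrier (coord_ring 1)" "y \<notin> Q"
    and forms: "\<And>d F. homogeneous 1 d F \<Longrightarrow> \<exists>p. degree p \<le> d \<and> F = homog x y d p"
  shows False
proof -
  let ?R = "carrier (coord_ring 1)"
  let ?H = "homog x y"
  note PD = integral_subvarietyD[OF P] and QD = integral_subvarietyD[OF Q]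
  interpret R: cring "coord_ring 1" by (rule cring_coord_ring)
  have HR: "?H N p \<in> ?R" for N p using homog_in_coord_ring xy(1,2) by blast
  have pwR: "y ^ k \<in> ?R" for k using xy(2) by (induction k) (auto simp: coord_ring_1 coord_ring_closed)
  have ypow: "y ^ k \<notin> Q" for k
  proof (induction k)
    case (Suc k)
    then show ?case using QD(5)[OF xy(2) pwR] xy(3) by auto
  qed (use QD(6) in simp)
  \<comment> \<open>Powers of y lie outside Q and hence outside the prime P, so they can be
    cancelled: membership in P does not depend on the degree of homogenization.\<close>
  have cancel: "?H N p \<in> P" if "degree p \<le> N" "?H (N + k) p \<in> P" for N k p
    using that PD(5)[OF pwR HR, of k N p] ypow[of k] PQ by (auto simp: homog_shift)
  have "\<exists>f \<in> P. f \<noteq> 0 \<and> (\<exists>d. homogeneous 1 d f)"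
  proof (rule ccontr)
    assume "\<not> ?thesis"
    then have "{f \<in> P. \<exists>d. homogeneous 1 d f} \<subseteq> {0}" by blast
    then have "Idl\<^bsub>coord_ring 1\<^esub> {f \<in> P. \<exists>d. homogeneous 1 d f} \<subseteq> {\<zero>\<^bsub>coord_ring 1\<^esub>}"
      by (intro R.genideal_minimal R.zeroideal) (simp only: coord_ring_sel)
    then have "P \<subseteq> {0}" using PD(8) by (simp only: coord_ring_sel)
    then show False using P0 PD(2) by auto
  qed
  then obtain F d0 where F: "F \<in> P" "F \<noteq> 0" "homogeneous 1 d0 F" by blast
  \<comment> \<open>The nonzero elements of the dehomogenized P; an element f of least degree plays
    the part of the generator.\<close>
  define S where "S = {p. p \<noteq> 0 \<and> ?H (degree p) p \<in> P}"
  have S_I: "p \<in> S" if "p \<noteq> 0" "degree p \<le> N" "?H N p \<in> P" for p N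
    using that cancel[of p "degree p" "N - degree p"] by (simp add: S_def)
  obtain p0 where p0: "degree p0 \<le> d0" "F = ?H d0 p0" using forms[OF F(3)] by blast
  have "p0 \<noteq> 0" using F(2) p0(2) by auto
  then have "p0 \<in> S" using S_I[OF _ p0(1)] F(1) p0(2) by simp
  then obtain f where f: "f \<in> S" "\<And>p. p \<in> S \<Longrightarrow> degree f \<le> degree p"
    using ex_has_least_nat[of "\<lambda>p. p \<in> S" p0 degree] by blast
  \<comment> \<open>A homogeneous ideal is generated by its forms, so a form witnesses that Q is
    larger than P.\<close>
  have "\<exists>G. G \<in> Q \<and> G \<notin> P \<and> (\<exists>d. homogeneous 1 d G)"
  proof (rule ccontr)
    assume "\<not> ?thesis"
    then have "{f \<in> Q. \<exists>d. homogeneous 1 d f} \<subseteq> P" by blast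
    moreover have "ideal P (coord_ring 1)" using P by (simp add: integral_subvariety_def homogeneous_ideal_def)
    ultimately have "Q \<subseteq> P" using QD(8) R.genideal_minimal by blast
    then show False using PQ by blast
  qed
  then obtain G e where G: "G \<in> Q" "G \<notin> P" "homogeneous 1 e G" by blast
  obtain g where g: "degree g \<le> e" "G = ?H e g" using forms[OF G(3)] by blast
  define c where "c = gcd f g"
  have f0: "f \<noteq> 0" and fP: "?H (degree f) f \<in> P" using f(1) by (auto simp: S_def)
  have c0: "c \<noteq> 0" using f0 by (simp add: c_def)
  obtain k where k: "f = c * k" using gcd_dvd1[of f g] unfolding c_def by (elim dvdE)
  have k0: "k \<noteq> 0" using f0 k by auto
  have dk: "degree f = degree c + degree k" using k c0 k0 by (simp add: degree_mult_eq)
  \<comment> \<open>By primality the gcd c of f and g or its cofactor k belongs to the dehomogenized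
    P. If c does, so does its multiple g. If k does, minimality of f makes c constant, and Bezout's
    identity puts a power of y into Q.\<close>
  have "?H (degree c) c * ?H (degree k) k \<in> P" using fP unfolding k dk[unfolded k] by (simp add: homog_mult)
  then have "?H (degree c) c \<in> P \<or> ?H (degree k) k \<in> P" using PD(5)[OF HR HR] by blast
  then show False
  proof
    assume "?H (degree c) c \<in> P"
    then have cS: "c \<in> S" using c0 by (simp add: S_def)
    obtain w where w: "g = c * w" using gcd_dvd2[of f g] unfolding c_def by (elim dvdE)
    define N where "N = e + degree w"
    have "?H (degree c + N) (c * w) = ?H (degree c) c * ?H N w" by (rule homog_mult) (auto simp: N_def)
    then have "?H (degree c + N) g \<in> P" using w PD(4)[OF \<open>?H (degree c) c \<in> P\<close> HR] by simp
    then have "?H (e + (degree c + degree w)) g \<in> P" by (simp add: N_def add_ac)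
    then have "G \<in> P" using cancel[OF g(1)] g(2) by simp
    then show False using G(2) by simp
  next
    assume "?H (degree k) k \<in> P"
    then have "k \<in> S" using k0 by (simp add: S_def)
    then have "degree c = 0" using f(2)[of k] dk by simp
    then obtain c1 where c1: "c = [:c1:]" "c1 \<noteq> 0" using c0 by (metis degree_eq_zeroE pCons_0_0)
    obtain u v where uv: "u * f + v * g = c" unfolding c_def using bezout_coefficients_fst_snd by blast
    define N where "N = degree f + e + degree u + degree v"
    have "?H (degree f + (e + degree u + degree v)) (f * u) = ?H (degree f) f * ?H (e + degree u + degree v) u"
      by (rule homog_mult) auto
    moreover have "degree f + (e + degree u + degree v) = N" by (simp add: N_def)
    ultimately have 1: "?H N (u * f) \<in> P" using PD(4)[OF fP HR] by (simp only: mult.commute[of u f])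
    have "?H (e + (degree f + degree u + degree v)) (g * v) = ?H e g * ?H (degree f + degree u + degree v) v"
      by (rule homog_mult) (use g in auto)
    moreover have "e + (degree f + degree u + degree v) = N" by (simp add: N_def)
    ultimately have 2: "?H N (v * g) \<in> Q" using QD(4)[OF G(1) HR] g(2) by (simp only: mult.commute[of v g])
    have "?H N c \<in> Q" unfolding uv[symmetric] homog_add using 1 2 PQ QD(3) by blast
    then have "Const c1 * y ^ N * Const (1 / c1) \<in> Q" using QD(4) coord_ring_Const unfolding c1 homog_const by blast
    moreover have "Const c1 * y ^ N * Const (1 / c1) = y ^ N"
      using c1(2) Const_simps(4)[of c1 "1 / c1"] by (simp add: Const_simps mult_ac)
    ultimately show False using ypow by simp
  qed
qed

text \<open>Since Q does not contain the irrelevant ideal, one of the two coordinates lies outside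
  Q, and one dehomogenizes there.\<close>

lemma no_chain:
  assumes "integral_subvariety 1 P" "integral_subvariety 1 Q" "P \<subset> Q" "P \<noteq> {0}"
  shows False
proof -
  have V: "Var 0 \<in> carrier (coord_ring 1)" "Var (Suc 0) \<in> carrier (coord_ring 1)" by (auto intro: coord_ring_Var)
  have "Var 0 \<notin> Q \<or> Var (Suc 0) \<notin> Q"
    using integral_subvarietyD(7)[OF assms(2)] by (auto simp: le_Suc_eq)
  then show False
    using nonzero_prime_not_below[OF assms V] nonzero_prime_not_below[OF assms V(2,1)] homogeneous_imp_hom2 homogeneous_imp_homog_swapped by metis
qed

lemma Var_nonzero: "Var i \<noteq> 0"
proof -
  have "Poly_Mapping.keys (Var i) = {Poly_Mapping.single i 1}" by (simp add: Var_def)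
  then show ?thesis by fastforce
qed

lemma zero_integral_subvariety: "integral_subvariety 1 {0}"
proof -
  interpret R: cring "coord_ring 1" by (rule cring_coord_ring)
  have "ideal {0} (coord_ring 1)" using R.zeroideal by simp
  moreover have "{f \<in> {0::rat mpoly}. \<exists>d. homogeneous 1 d f} = {\<zero>\<^bsub>coord_ring 1\<^esub>}"
    by (auto simp: homogeneous_def in_coord_ring)
  then have "Idl\<^bsub>coord_ring 1\<^esub> {f \<in> {0}. \<exists>d. homogeneous 1 d f} = {0}" using R.genideal_zero by (simp only: coord_ring_sel)
  moreover have "primeideal {0} (coord_ring 1)"
  proof (rule primeidealI[OF \<open>ideal {0} (coord_ring 1)\<close> cring_coord_ring])
    show "carrier (coord_ring 1) \<noteq> {0}" using coord_ring_1[of 1] by (metis singletonD zero_neq_one)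
  qed auto
  moreover have "\<not> Var ` {..1} \<subseteq> {0}" using Var_nonzero[of 0] by auto
  ultimately show ?thesis unfolding integral_subvariety_def homogeneous_ideal_def by simp
qed

definition restrict_keys :: "rat mpoly \<Rightarrow> (nat \<Rightarrow>\<^sub>0 nat) set \<Rightarrow> rat mpoly" where
  "restrict_keys f S = (\<Sum>m\<in>Poly_Mapping.keys f \<inter> S. Poly_Mapping.single m (Poly_Mapping.lookup f m))"

lemma lookup_restrict_keys: "Poly_Mapping.lookup (restrict_keys f S) m = (if m \<in> S then Poly_Mapping.lookup f m else 0)"
proof -
  have "Poly_Mapping.lookup (restrict_keys f S) m =
      (\<Sum>k\<in>Poly_Mapping.keys f \<inter> S. if k = m then Poly_Mapping.lookup f m else 0)"
    unfolding restrict_keys_def lookup_sum by (intro sum.cong refl) (auto simp: lookup_single when_def)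
  also have "\<dots> = (if m \<in> Poly_Mapping.keys f \<inter> S then Poly_Mapping.lookup f m else 0)"
    by (rule sum.delta) simp
  also have "\<dots> = (if m \<in> S then Poly_Mapping.lookup f m else 0)" by (auto simp: in_keys_iff)
  finally show ?thesis .
qed

lemma restrict_keys_decomp: "f = restrict_keys f S + restrict_keys f (- S)"
  by (rule poly_mapping_eqI) (simp add: lookup_add lookup_restrict_keys)

lemma keys_restrict_keys: "Poly_Mapping.keys (restrict_keys f S) = Poly_Mapping.keys f \<inter> S"
  by (auto simp: in_keys_iff lookup_restrict_keys split: if_splits)

text \<open>The prime of the point [0 : 1], generated by \<open>Var 0\<close>. Stating it through
  monomials makes primality easy to check.\<close>

definition X_ideal :: "rat mpoly set" where
  "X_ideal = {f \<in> carrier (coord_ring 1). \<forall>m\<in>Poly_Mapping.keys f. Poly_Mapping.lookup m 0 > 0}"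

lemma X_ideal_eq: "X_ideal = PIdl\<^bsub>coord_ring 1\<^esub> (Var 0)"
proof (intro equalityI subsetI)
  fix f assume "f \<in> PIdl\<^bsub>coord_ring 1\<^esub> (Var 0)"
  then obtain g where g: "g \<in> carrier (coord_ring 1)" "f = g * Var 0" by (auto simp: cgenideal_def)
  have "Poly_Mapping.lookup m 0 > 0" if "m \<in> Poly_Mapping.keys f" for m
    using that keys_mult[of g "Var 0"] unfolding g(2) by (auto simp: Var_def lookup_add)
  then show "f \<in> X_ideal" using g coord_ring_closed(2)[OF g(1) coord_ring_Var[of 0 1]] by (simp add: X_ideal_def)
next
  fix f assume f: "f \<in> X_ideal"
  interpret R: cring "coord_ring 1" by (rule cring_coord_ring)
  have V: "Var 0 \<in> carrier (coord_ring 1)" by (simp add: coord_ring_Var)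
  interpret I: ideal "PIdl\<^bsub>coord_ring 1\<^esub> (Var 0)" "coord_ring 1" by (rule R.cgenideal_ideal[OF V])
  have single: "Poly_Mapping.single m c \<in> PIdl\<^bsub>coord_ring 1\<^esub> (Var 0)"
    if m: "Poly_Mapping.keys m \<subseteq> {..1}" "Poly_Mapping.lookup m 0 > 0" for m and c :: rat
  proof -
    obtain i where i: "Poly_Mapping.lookup m 0 = Suc i" using m(2) by (metis gr0_implies_Suc)
    define m' where "m' = bimon i (Poly_Mapping.lookup m 1)"
    have "m = m' + bimon 1 0" using eq_bimon[OF m(1)] i by (simp add: m'_def bimon_add)
    then have "Poly_Mapping.single m c = Poly_Mapping.single m' c * Var 0"
      by (simp add: Var_def mult_single bimon_def)
    moreover have "Poly_Mapping.single m' c \<in> carrier (coord_ring 1)"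
      by (auto simp: in_coord_ring m'_def keys_bimon split: if_splits)
    ultimately show ?thesis by (auto simp: cgenideal_def)
  qed
  have "sum g A \<in> PIdl\<^bsub>coord_ring 1\<^esub> (Var 0)" if "\<And>m. m \<in> A \<Longrightarrow> g m \<in> PIdl\<^bsub>coord_ring 1\<^esub> (Var 0)"
    for g and A :: "(nat \<Rightarrow>\<^sub>0 nat) set"
    using that
  proof (induction A rule: infinite_finite_induct)
    case (insert m A)
    then show ?case using additive_subgroup.a_closed[OF I.is_additive_subgroup, of "g m" "sum g A"] by simp
  qed (use additive_subgroup.zero_closed[OF I.is_additive_subgroup] in auto)
  then have "restrict_keys f UNIV \<in> PIdl\<^bsub>coord_ring 1\<^esub> (Var 0)"
    unfolding restrict_keys_def using f single by (auto simp: X_ideal_def in_coord_ring)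
  moreover have "restrict_keys f UNIV = f" by (rule poly_mapping_eqI) (simp add: lookup_restrict_keys)
  ultimately show "f \<in> PIdl\<^bsub>coord_ring 1\<^esub> (Var 0)" by simp
qed

lemma X_ideal_integral: "integral_subvariety 1 X_ideal"
proof -
  interpret R: cring "coord_ring 1" by (rule cring_coord_ring)
  have V: "Var 0 \<in> carrier (coord_ring 1)" by (simp add: coord_ring_Var)
  have id: "ideal X_ideal (coord_ring 1)" unfolding X_ideal_eq by (rule R.cgenideal_ideal[OF V])
  interpret I: ideal X_ideal "coord_ring 1" by (rule id)
  have VX: "Var 0 \<in> X_ideal" unfolding X_ideal_eq by (rule R.cgenideal_self[OF V])
  have Vh: "homogeneous 1 1 (Var 0)" using V by (simp add: homogeneous_def Var_def)
  have gen: "X_ideal = Idl\<^bsub>coord_ring 1\<^esub> {f \<in> X_ideal. \<exists>d. homogeneous 1 d f}"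
  proof
    have "X_ideal = Idl\<^bsub>coord_ring 1\<^esub> {Var 0}" unfolding X_ideal_eq by (rule R.cgenideal_eq_genideal[OF V])
    also have "\<dots> \<subseteq> Idl\<^bsub>coord_ring 1\<^esub> {f \<in> X_ideal. \<exists>d. homogeneous 1 d f}"
    proof (rule R.genideal_minimal)
      have sub: "{f \<in> X_ideal. \<exists>d. homogeneous 1 d f} \<subseteq> carrier (coord_ring 1)" by (auto simp: X_ideal_def)
      show "ideal (Idl\<^bsub>coord_ring 1\<^esub> {f \<in> X_ideal. \<exists>d. homogeneous 1 d f}) (coord_ring 1)"
        by (rule R.genideal_ideal[OF sub])
      show "{Var 0} \<subseteq> Idl\<^bsub>coord_ring 1\<^esub> {f \<in> X_ideal. \<exists>d. homogeneous 1 d f}"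
        using R.genideal_self[OF sub] VX Vh by blast
    qed
    finally show "X_ideal \<subseteq> Idl\<^bsub>coord_ring 1\<^esub> {f \<in> X_ideal. \<exists>d. homogeneous 1 d f}" .
    show "Idl\<^bsub>coord_ring 1\<^esub> {f \<in> X_ideal. \<exists>d. homogeneous 1 d f} \<subseteq> X_ideal"
      by (rule R.genideal_minimal[OF id]) blast
  qed
  \<comment> \<open>Modulo the ideal a polynomial is represented by its monomials free of
    \<open>Var 0\<close>. These are closed under multiplication, so a product of representatives
    lies in the ideal only if it is 0.\<close>
  define S where "S = {m :: nat \<Rightarrow>\<^sub>0 nat. Poly_Mapping.lookup m 0 = 0}"
  have prime: "f \<in> X_ideal \<or> g \<in> X_ideal"
    if fg: "f \<in> carrier (coord_ring 1)" "g \<in> carrier (coord_ring 1)" "f * g \<in> X_ideal" for f g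
  proof -
    have car: "restrict_keys h T \<in> carrier (coord_ring 1)" if "h \<in> carrier (coord_ring 1)" for h T
      using that by (auto simp: in_coord_ring keys_restrict_keys)
    have neg: "restrict_keys h (- S) \<in> X_ideal" if "h \<in> carrier (coord_ring 1)" for h
      using car[OF that] by (auto simp: X_ideal_def keys_restrict_keys S_def)
    let ?f0 = "restrict_keys f S" and ?g0 = "restrict_keys g S"
    have "?f0 * ?g0 = f * g + (- (restrict_keys f (- S) * g) + - (?f0 * restrict_keys g (- S)))"
    proof -
      have "f * g = (?f0 + restrict_keys f (- S)) * g" by (subst restrict_keys_decomp[of f S]) simp
      moreover have "?f0 * g = ?f0 * (?g0 + restrict_keys g (- S))" by (subst restrict_keys_decomp[of g S]) simp
      ultimately show ?thesis by (simp add: algebra_simps)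
    qed
    moreover have "restrict_keys f (- S) * g \<in> X_ideal" using I.I_r_closed[OF neg[OF fg(1)] fg(2)] by simp
    moreover have "?f0 * restrict_keys g (- S) \<in> X_ideal" using I.I_l_closed[OF neg[OF fg(2)] car[OF fg(1)]] by simp
    moreover have "- h \<in> X_ideal" if "h \<in> X_ideal" for h
    proof -
      have "Poly_Mapping.keys (- h) = Poly_Mapping.keys h" by (auto simp: in_keys_iff)
      then show ?thesis using that coord_ring_closed(3) by (auto simp: X_ideal_def)
    qed
    moreover have add: "h + h' \<in> X_ideal" if "h \<in> X_ideal" "h' \<in> X_ideal" for h h'
      using additive_subgroup.a_closed[OF I.is_additive_subgroup that] by simp
    ultimately have in0: "?f0 * ?g0 \<in> X_ideal" using fg(3) by metis
    have "Poly_Mapping.keys (?f0 * ?g0) \<subseteq> S"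
      using keys_mult[of ?f0 ?g0] by (fastforce simp: keys_restrict_keys S_def lookup_add)
    moreover have "m \<notin> S" if "m \<in> Poly_Mapping.keys (?f0 * ?g0)" for m
    proof -
      have "Poly_Mapping.lookup m 0 > 0" using in0 that unfolding X_ideal_def by blast
      then show ?thesis by (simp add: S_def)
    qed
    ultimately have "Poly_Mapping.keys (?f0 * ?g0) = {}" by blast
    then have "?f0 * ?g0 = 0" by simp
    then have "?f0 = 0 \<or> ?g0 = 0" by simp
    then show ?thesis
      using neg[OF fg(1)] neg[OF fg(2)] restrict_keys_decomp[of f S] restrict_keys_decomp[of g S] by auto
  qed
  have nV: "Var 1 \<notin> X_ideal" by (simp add: X_ideal_def Var_def lookup_single)
  have "primeideal X_ideal (coord_ring 1)"
  proof (rule primeidealI[OF id cring_coord_ring])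
    show "carrier (coord_ring 1) \<noteq> X_ideal" using nV coord_ring_Var[of 1 1] by auto
  qed (use prime in simp)
  then show ?thesis unfolding integral_subvariety_def homogeneous_ideal_def
    using id gen nV by auto
qed

text \<open>The zero ideal below the ideal of a point gives a chain of length 1; in a longer chain
  the second member would be a nonzero prime strictly below another.\<close>

lemma projective_line_curve: "integral_projective_curve 1 {0}"
proof -
  let ?S = "{Ps. Ps \<noteq> [] \<and> sorted_wrt (\<subset>) Ps \<and> set Ps \<subseteq> scheme_points 1 {0}}"
  have "variety_dim 1 {0} = 1" unfolding variety_dim_def
  proof (rule antisym)
    show "(SUP Ps\<in>?S. enat (length Ps - 1)) \<le> 1"
    proof (rule SUP_least)
      fix Ps assume Ps: "Ps \<in> ?S"
      have "length Ps \<le> 2"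
      proof (rule ccontr)
        assume "\<not> length Ps \<le> 2"
        then have len: "2 < length Ps" by simp
        have s: "sorted_wrt (\<subset>) Ps" using Ps by simp
        have "Ps ! 0 \<subset> Ps ! 1" "Ps ! 1 \<subset> Ps ! 2"
          using sorted_wrt_nth_less[OF s, of 0 1] sorted_wrt_nth_less[OF s, of 1 2] len by auto
        moreover have "Ps ! 0 \<in> scheme_points 1 {0}" "Ps ! 1 \<in> scheme_points 1 {0}" "Ps ! 2 \<in> scheme_points 1 {0}"
          using Ps len nth_mem[of _ Ps] by (auto dest: less_trans[rotated])
        moreover have "{0} \<subseteq> Ps ! 0" using \<open>Ps ! 0 \<in> scheme_points 1 {0}\<close> by (simp add: scheme_points_def)
        ultimately have "integral_subvariety 1 (Ps ! 1)" "integral_subvariety 1 (Ps ! 2)" "Ps ! 1 \<subset> Ps ! 2" "Ps ! 1 \<noteq> {0}"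
          unfolding scheme_points_def by blast+
        then show False by (rule no_chain)
      qed
      then show "enat (length Ps - 1) \<le> 1" by (simp add: one_enat_def)
    qed
    have "{0} \<subset> X_ideal"
    proof -
      have "0 \<in> X_ideal" by (auto simp: X_ideal_def in_coord_ring)
      moreover have "Var 0 \<in> X_ideal" "Var 0 \<noteq> 0" using coord_ring_Var[of 0 1] Var_nonzero[of 0] by (auto simp: X_ideal_def Var_def)
      ultimately show ?thesis by blast
    qed
    then have "[{0}, X_ideal] \<in> ?S"
      using zero_integral_subvariety X_ideal_integral by (auto simp: scheme_points_def)
    from SUP_upper[OF this, of "\<lambda>Ps. enat (length Ps - 1)"]
    show "1 \<le> (SUP Ps\<in>?S. enat (length Ps - 1))" by (simp add: one_enat_def)
  qed
  then show ?thesis unfolding integral_projective_curve_def using zero_integral_subvariety by simp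
qed

section \<open>The function field of the projective line\<close>

definition valid :: "nat \<Rightarrow> rat poly \<Rightarrow> rat poly \<Rightarrow> bool" where
  "valid d p q \<longleftrightarrow> degree p \<le> d \<and> degree q \<le> d \<and> q \<noteq> 0"

text \<open>The rational function p/q in the variable \<open>Var 0\<close> over
  \<open>Var 1\<close>, homogenized in degree d. This turns identities in the function field into
  identities of univariate polynomials.\<close>

definition cl :: "nat \<Rightarrow> rat poly \<Rightarrow> rat poly \<Rightarrow> (rat mpoly \<times> rat mpoly) set" where
  "cl d p q = frac_class 1 {0} (hom2 d p) (hom2 d q)"

abbreviation FF where "FF \<equiv> function_field 1 {0}"

lemma degree_mult_le': "degree p \<le> d \<Longrightarrow> degree q \<le> e \<Longrightarrow> degree (p * q) \<le> d + e"
  using degree_mult_le[of p q] by linarith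

lemma valid_mult: "valid d p q \<Longrightarrow> valid e p' q' \<Longrightarrow> valid (d + e) (p * p') (q * q')"
  unfolding valid_def by (simp add: degree_mult_le')

lemma valid_add: "valid d p q \<Longrightarrow> valid e p' q' \<Longrightarrow> valid (d + e) (p * q' + p' * q) (q * q')"
  unfolding valid_def
  using degree_mult_le'[of p' e q d] by (simp add: degree_mult_le' degree_add_le add.commute)

lemma form_fracs_iff: "x \<in> form_fracs 1 {0} \<longleftrightarrow> (\<exists>d p q. valid d p q \<and> x = (hom2 d p, hom2 d q))"
proof
  assume x: "x \<in> form_fracs 1 {0}"
  obtain F G where FG: "x = (F, G)" by fastforce
  then obtain d where d: "homogeneous 1 d F" "homogeneous 1 d G" "G \<noteq> 0" using x by (auto simp: form_fracs_def)
  obtain p where p: "degree p \<le> d" "F = hom2 d p" using homogeneous_imp_hom2[OF d(1)] .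
  obtain q where q: "degree q \<le> d" "G = hom2 d q" using homogeneous_imp_hom2[OF d(2)] .
  have "valid d p q" using p q d(3) by (auto simp: valid_def)
  then show "\<exists>d p q. valid d p q \<and> x = (hom2 d p, hom2 d q)" using FG p q by blast
next
  assume "\<exists>d p q. valid d p q \<and> x = (hom2 d p, hom2 d q)"
  then obtain d p q where v: "valid d p q" "x = (hom2 d p, hom2 d q)" by blast
  have "\<exists>e. homogeneous 1 e (hom2 d p) \<and> homogeneous 1 e (hom2 d q)" using homogeneous_hom2 by blast
  moreover have "hom2 d q \<noteq> 0" using v(1) hom2_eq_0_iff[of q d] by (simp add: valid_def)
  ultimately show "x \<in> form_fracs 1 {0}" by (simp add: form_fracs_def v(2))
qed

lemma cross_iff:
  assumes "valid d p q" "valid e r s"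
  shows "hom2 d p * hom2 e s - hom2 e r * hom2 d q \<in> {0} \<longleftrightarrow> p * s = r * q"
proof -
  have deg: "degree (p * s) \<le> d + e" "degree (r * q) \<le> d + e" "degree (p * s - r * q) \<le> d + e"
  proof -
    show 1: "degree (p * s) \<le> d + e" using assms degree_mult_le[of p s] by (simp add: valid_def)
    show 2: "degree (r * q) \<le> d + e" using assms degree_mult_le[of r q] by (simp add: valid_def)
    show "degree (p * s - r * q) \<le> d + e" using 1 2 by (rule degree_diff_le)
  qed
  have "hom2 d p * hom2 e s = hom2 (d + e) (p * s)" using assms by (intro homog_mult[symmetric]) (auto simp: valid_def)
  moreover have "hom2 e r * hom2 d q = hom2 (d + e) (r * q)"
    using assms homog_mult[of r e q d "Var 0" "Var (Suc 0)"] by (simp add: valid_def add.commute)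
  moreover have "hom2 (d + e) (p * s - r * q) + hom2 (d + e) (r * q) = hom2 (d + e) (p * s)"
    by (simp flip: homog_add)
  ultimately have "hom2 d p * hom2 e s - hom2 e r * hom2 d q = hom2 (d + e) (p * s - r * q)"
    by (metis add_diff_cancel_right')
  then show ?thesis using hom2_eq_0_iff[OF deg(3)] by simp
qed

lemma cl_eq: 
  assumes "valid d p q"
  shows "cl d p q = {(hom2 e r, hom2 e s) |e r s. valid e r s \<and> p * s = r * q}"
proof -
  have "x \<in> cl d p q \<longleftrightarrow> (\<exists>e r s. x = (hom2 e r, hom2 e s) \<and> valid e r s \<and> p * s = r * q)" for x
  proof -
    obtain F G where x: "x = (F, G)" by fastforce
    have "x \<in> cl d p q \<longleftrightarrow> (hom2 d p, hom2 d q) \<in> form_fracs 1 {0} \<and> (F, G) \<in> form_fracs 1 {0} \<and> hom2 d p * G - F * hom2 d q \<in> {0}"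
      unfolding cl_def frac_class_def frac_rel_def x by simp
    also have "\<dots> \<longleftrightarrow> (\<exists>e r s. valid e r s \<and> (F, G) = (hom2 e r, hom2 e s) \<and> hom2 d p * G - F * hom2 d q \<in> {0})"
      unfolding form_fracs_iff using assms by blast
    also have "\<dots> \<longleftrightarrow> (\<exists>e r s. (F, G) = (hom2 e r, hom2 e s) \<and> valid e r s \<and> p * s = r * q)"
      using cross_iff[OF assms] by (metis Pair_inject)
    finally show ?thesis unfolding x .
  qed
  then show ?thesis by blast
qed

lemma cl_self: "valid d p q \<Longrightarrow> (hom2 d p, hom2 d q) \<in> cl d p q"
  unfolding cl_eq by blast

lemma cl_eq_iff:
  assumes "valid d p q" "valid e p' q'"
  shows "cl d p q = cl e p' q' \<longleftrightarrow> p * q' = p' * q"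
proof
  assume "cl d p q = cl e p' q'"
  then have "(hom2 e p', hom2 e q') \<in> cl d p q" using cl_self[OF assms(2)] by simp
  then have "hom2 d p * hom2 e q' - hom2 e p' * hom2 d q \<in> {0}" unfolding cl_def frac_class_def frac_rel_def by simp
  then show "p * q' = p' * q" using cross_iff[OF assms] by simp
next
  assume eq: "p * q' = p' * q"
  have "p * s = r * q \<longleftrightarrow> p' * s = r * q'" for r s
  proof -
    have q0: "q \<noteq> 0" "q' \<noteq> 0" using assms by (auto simp: valid_def)
    have "p * s = r * q \<longleftrightarrow> (p * s) * q' = (r * q) * q'" using q0 by simp
    also have "\<dots> \<longleftrightarrow> (p * q') * s = (r * q') * q" by (simp add: mult_ac)
    also have "\<dots> \<longleftrightarrow> (p' * s) * q = (r * q') * q" unfolding eq by (simp add: mult_ac)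
    also have "\<dots> \<longleftrightarrow> p' * s = r * q'" using q0 by simp
    finally show ?thesis .
  qed
  then show "cl d p q = cl e p' q'" unfolding cl_eq[OF assms(1)] cl_eq[OF assms(2)] by simp
qed

lemma carrier_FF: "A \<in> carrier FF \<longleftrightarrow> (\<exists>d p q. valid d p q \<and> A = cl d p q)"
proof -
  have "A \<in> carrier FF \<longleftrightarrow> (\<exists>x\<in>form_fracs 1 {0}. A = frac_rel 1 {0} `` {x})"
    by (auto simp: function_field_def quotient_def)
  also have "\<dots> \<longleftrightarrow> (\<exists>d p q. valid d p q \<and> A = frac_rel 1 {0} `` {(hom2 d p, hom2 d q)})"
    unfolding Bex_def form_fracs_iff by blast
  finally show ?thesis unfolding cl_def frac_class_def .
qed

text \<open>All choices of representatives give the same class, so the unions in the definition of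
  the product are unions of copies of one set.\<close>

lemma mult_FF:
  assumes v: "valid d p q" "valid e p' q'"
  shows "cl d p q \<otimes>\<^bsub>FF\<^esub> cl e p' q' = cl (d + e) (p * p') (q * q')"
proof -
  have "frac_class 1 {0} (F * F') (G * G') = cl (d + e) (p * p') (q * q')"
    if FG: "(F, G) \<in> cl d p q" "(F', G') \<in> cl e p' q'" for F G F' G'
  proof -
    obtain i r s where 1: "F = hom2 i r" "G = hom2 i s" "valid i r s" "p * s = r * q" using FG(1) unfolding cl_eq[OF v(1)] by auto
    obtain j r' s' where 2: "F' = hom2 j r'" "G' = hom2 j s'" "valid j r' s'" "p' * s' = r' * q'" using FG(2) unfolding cl_eq[OF v(2)] by auto
    have "F * F' = hom2 (i + j) (r * r')" "G * G' = hom2 (i + j) (s * s')"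
      using 1 2 by (simp_all add: homog_mult valid_def)
    then have "frac_class 1 {0} (F * F') (G * G') = cl (i + j) (r * r') (s * s')" by (simp add: cl_def)
    also have "\<dots> = cl (d + e) (p * p') (q * q')"
    proof (subst cl_eq_iff[OF valid_mult[OF 1(3) 2(3)] valid_mult[OF v]])
      have "(p * s) * (p' * s') = (r * q) * (r' * q')" using 1(4) 2(4) by simp
      then show "r * r' * (q * q') = p * p' * (s * s')" by (simp add: mult_ac)
    qed
    finally show ?thesis .
  qed
  then have "(\<lambda>(F, G). \<Union>(F', G')\<in>cl e p' q'. frac_class 1 {0} (F * F') (G * G')) x = cl (d + e) (p * p') (q * q')"
    if "x \<in> cl d p q" for x
    using that cl_self[OF v(2)] by (cases x) (auto 0 3)
  then show ?thesis using cl_self[OF v(1)] by (simp add: function_field_def) blast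
qed

lemma add_FF:
  assumes v: "valid d p q" "valid e p' q'"
  shows "cl d p q \<oplus>\<^bsub>FF\<^esub> cl e p' q' = cl (d + e) (p * q' + p' * q) (q * q')"
proof -
  have "frac_class 1 {0} (F * G' + F' * G) (G * G') = cl (d + e) (p * q' + p' * q) (q * q')"
    if FG: "(F, G) \<in> cl d p q" "(F', G') \<in> cl e p' q'" for F G F' G'
  proof -
    obtain i r s where 1: "F = hom2 i r" "G = hom2 i s" "valid i r s" "p * s = r * q" using FG(1) unfolding cl_eq[OF v(1)] by auto
    obtain j r' s' where 2: "F' = hom2 j r'" "G' = hom2 j s'" "valid j r' s'" "p' * s' = r' * q'" using FG(2) unfolding cl_eq[OF v(2)] by auto
    have "F * G' = hom2 (i + j) (r * s')" "F' * G = hom2 (i + j) (r' * s)" "G * G' = hom2 (i + j) (s * s')"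
      using 1 2 homog_mult[of r i s' j "Var 0" "Var (Suc 0)"] homog_mult[of r' j s i "Var 0" "Var (Suc 0)"]
        homog_mult[of s i s' j "Var 0" "Var (Suc 0)"] by (simp_all add: valid_def add.commute)
    then have "frac_class 1 {0} (F * G' + F' * G) (G * G') = cl (i + j) (r * s' + r' * s) (s * s')" by (simp add: cl_def homog_add)
    also have "\<dots> = cl (d + e) (p * q' + p' * q) (q * q')"
    proof (subst cl_eq_iff[OF valid_add[OF 1(3) 2(3)] valid_add[OF v]])
      have "(r * s' + r' * s) * (q * q') = (r * q) * (s' * q') + (r' * q') * (s * q)" by (simp add: algebra_simps)
      also have "\<dots> = (p * s) * (s' * q') + (p' * s') * (s * q)" using 1(4) 2(4) by simp
      also have "\<dots> = (p * q' + p' * q) * (s * s')" by (simp add: algebra_simps)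
      finally show "(r * s' + r' * s) * (q * q') = (p * q' + p' * q) * (s * s')" .
    qed
    finally show ?thesis .
  qed
  then have "(\<lambda>(F, G). \<Union>(F', G')\<in>cl e p' q'. frac_class 1 {0} (F * G' + F' * G) (G * G')) x = cl (d + e) (p * q' + p' * q) (q * q')"
    if "x \<in> cl d p q" for x
    using that cl_self[OF v(2)] by (cases x) (auto 0 3)
  then show ?thesis using cl_self[OF v(1)] by (simp add: function_field_def) blast
qed

lemma one_FF: "\<one>\<^bsub>FF\<^esub> = cl 0 1 1" and zero_FF: "\<zero>\<^bsub>FF\<^esub> = cl 0 0 1"
proof -
  have "hom2 0 1 = 1" using homog_const[of "Var 0" "Var (Suc 0)" 0 1] by (simp add: Const_simps flip: one_pCons)
  then show "\<one>\<^bsub>FF\<^esub> = cl 0 1 1" "\<zero>\<^bsub>FF\<^esub> = cl 0 0 1" by (simp_all add: function_field_def cl_def)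
qed

lemma valid_0_1: "valid 0 1 1" "valid 0 0 1" by (auto simp: valid_def)

lemma cring_FF: "cring FF"
proof (rule cringI)
  note v = valid_mult valid_add valid_0_1
  show "abelian_group FF"
  proof (rule abelian_groupI)
    fix x y assume "x \<in> carrier FF" "y \<in> carrier FF"
    then obtain d p q e r s where xy: "valid d p q" "x = cl d p q" "valid e r s" "y = cl e r s" unfolding carrier_FF by blast
    show "x \<oplus>\<^bsub>FF\<^esub> y \<in> carrier FF" unfolding carrier_FF xy(2,4) using add_FF[OF xy(1,3)] v(2)[OF xy(1,3)] by blast
    show "x \<oplus>\<^bsub>FF\<^esub> y = y \<oplus>\<^bsub>FF\<^esub> x"
      unfolding xy(2,4) add_FF[OF xy(1,3)] add_FF[OF xy(3,1)] by (simp add: add.commute mult.commute)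
  next
    show "\<zero>\<^bsub>FF\<^esub> \<in> carrier FF" unfolding carrier_FF zero_FF using valid_0_1 by blast
  next
    fix x y z assume "x \<in> carrier FF" "y \<in> carrier FF" "z \<in> carrier FF"
    then obtain d p q e r s f t u where xyz: "valid d p q" "x = cl d p q" "valid e r s" "y = cl e r s" "valid f t u" "z = cl f t u"
      unfolding carrier_FF by blast
    show "(x \<oplus>\<^bsub>FF\<^esub> y) \<oplus>\<^bsub>FF\<^esub> z = x \<oplus>\<^bsub>FF\<^esub> (y \<oplus>\<^bsub>FF\<^esub> z)"
      unfolding xyz(2,4,6) add_FF[OF xyz(1,3)] add_FF[OF xyz(3,5)] add_FF[OF v(2)[OF xyz(1,3)] xyz(5)] add_FF[OF xyz(1) v(2)[OF xyz(3,5)]]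
      by (simp add: algebra_simps)
  next
    fix x assume "x \<in> carrier FF"
    then obtain d p q where x: "valid d p q" "x = cl d p q" unfolding carrier_FF by blast
    show "\<zero>\<^bsub>FF\<^esub> \<oplus>\<^bsub>FF\<^esub> x = x" unfolding x(2) zero_FF add_FF[OF valid_0_1(2) x(1)] by simp
    have m: "valid d (- p) q" using x(1) by (simp add: valid_def)
    have "cl d (- p) q \<oplus>\<^bsub>FF\<^esub> x = \<zero>\<^bsub>FF\<^esub>"
      unfolding x(2) zero_FF add_FF[OF m x(1)] by (subst cl_eq_iff[OF v(2)[OF m x(1)] valid_0_1(2)]) simp
    then show "\<exists>y\<in>carrier FF. y \<oplus>\<^bsub>FF\<^esub> x = \<zero>\<^bsub>FF\<^esub>" using m carrier_FF by blast
  qed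
  show "comm_monoid FF"
  proof (rule comm_monoidI)
    fix x y assume "x \<in> carrier FF" "y \<in> carrier FF"
    then obtain d p q e r s where xy: "valid d p q" "x = cl d p q" "valid e r s" "y = cl e r s" unfolding carrier_FF by blast
    show "x \<otimes>\<^bsub>FF\<^esub> y \<in> carrier FF" unfolding carrier_FF xy(2,4) using mult_FF[OF xy(1,3)] v(1)[OF xy(1,3)] by blast
    show "x \<otimes>\<^bsub>FF\<^esub> y = y \<otimes>\<^bsub>FF\<^esub> x"
      unfolding xy(2,4) mult_FF[OF xy(1,3)] mult_FF[OF xy(3,1)] by (simp add: add.commute mult.commute)
  next
    show "\<one>\<^bsub>FF\<^esub> \<in> carrier FF" unfolding carrier_FF one_FF using valid_0_1 by blast
  next
    fix x y z assume "x \<in> carrier FF" "y \<in> carrier FF" "z \<in> carrier FF"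
    then obtain d p q e r s f t u where xyz: "valid d p q" "x = cl d p q" "valid e r s" "y = cl e r s" "valid f t u" "z = cl f t u"
      unfolding carrier_FF by blast
    show "(x \<otimes>\<^bsub>FF\<^esub> y) \<otimes>\<^bsub>FF\<^esub> z = x \<otimes>\<^bsub>FF\<^esub> (y \<otimes>\<^bsub>FF\<^esub> z)"
      unfolding xyz(2,4,6) mult_FF[OF xyz(1,3)] mult_FF[OF xyz(3,5)] mult_FF[OF v(1)[OF xyz(1,3)] xyz(5)] mult_FF[OF xyz(1) v(1)[OF xyz(3,5)]]
      by (simp add: algebra_simps)
  next
    fix x assume "x \<in> carrier FF"
    then obtain d p q where x: "valid d p q" "x = cl d p q" unfolding carrier_FF by blast
    show "\<one>\<^bsub>FF\<^esub> \<otimes>\<^bsub>FF\<^esub> x = x" unfolding x(2) one_FF mult_FF[OF valid_0_1(1) x(1)] by simp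
  qed
next
  fix x y z assume "x \<in> carrier FF" "y \<in> carrier FF" "z \<in> carrier FF"
  then obtain d p q e r s f t u where xyz: "valid d p q" "x = cl d p q" "valid e r s" "y = cl e r s" "valid f t u" "z = cl f t u"
    unfolding carrier_FF by blast
  note v1 = valid_mult[OF valid_add[OF xyz(1,3)] xyz(5)] and v2 = valid_add[OF valid_mult[OF xyz(1,5)] valid_mult[OF xyz(3,5)]]
  show "(x \<oplus>\<^bsub>FF\<^esub> y) \<otimes>\<^bsub>FF\<^esub> z = x \<otimes>\<^bsub>FF\<^esub> z \<oplus>\<^bsub>FF\<^esub> y \<otimes>\<^bsub>FF\<^esub> z"
    unfolding xyz(2,4,6) add_FF[OF xyz(1,3)] mult_FF[OF xyz(1,5)] mult_FF[OF xyz(3,5)]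
      mult_FF[OF valid_add[OF xyz(1,3)] xyz(5)] add_FF[OF valid_mult[OF xyz(1,5)] valid_mult[OF xyz(3,5)]]
    by (subst cl_eq_iff[OF v1 v2]) (simp add: algebra_simps)
qed

section \<open>The degree of the squaring morphism\<close>

definition sq_arg :: "rat poly \<Rightarrow> rat poly" where "sq_arg s = pcompose s [:0, 0, 1:]"

lemma sq_arg_pCons: "sq_arg (pCons c s) = pCons c (pCons 0 (sq_arg s))"
  by (simp add: sq_arg_def pcompose_pCons)

lemma sq_arg_0: "sq_arg 0 = 0" by (simp add: sq_arg_def)

lemma sq_arg_add: "sq_arg (s + t) = sq_arg s + sq_arg t" and sq_arg_mult: "sq_arg (s * t) = sq_arg s * sq_arg t"
  and sq_arg_diff: "sq_arg (s - t) = sq_arg s - sq_arg t"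
  by (simp_all add: sq_arg_def pcompose_add pcompose_mult pcompose_diff)

lemma degree_sq_arg: "degree (sq_arg s) = 2 * degree s"
  by (simp add: sq_arg_def degree_pcompose)

text \<open>A nonzero even polynomial has even degree, and x times a nonzero even polynomial has odd
  degree.\<close>

lemma sq_arg_parity: "sq_arg s = pCons 0 (sq_arg t) \<Longrightarrow> s = 0 \<and> t = 0"
proof -
  assume eq: "sq_arg s = pCons 0 (sq_arg t)"
  have inj: "u = 0" if "sq_arg u = 0" for u
    using that by (induction u) (auto simp: sq_arg_pCons)
  have "t = 0"
  proof (rule ccontr)
    assume "t \<noteq> 0"
    then have "degree (pCons 0 (sq_arg t)) = Suc (2 * degree t)" using inj by (auto simp: degree_sq_arg)
    then have "2 * degree s = Suc (2 * degree t)" using eq degree_sq_arg by metis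
    then show False by presburger
  qed
  then show ?thesis using eq inj by (simp add: sq_arg_0)
qed

lemma even_odd_decomp: "\<exists>s t. p = sq_arg s + pCons 0 (sq_arg t)"
proof (induction p)
  case 0
  show ?case by (rule exI[of _ 0], rule exI[of _ 0]) (simp add: sq_arg_0)
next
  case (pCons c p)
  then obtain s t where "p = sq_arg s + pCons 0 (sq_arg t)" by blast
  then have "pCons c p = sq_arg (pCons c t) + pCons 0 (sq_arg s)" by (simp add: sq_arg_pCons)
  then show ?case by blast
qed

lemma homog_sq_arg: "degree p \<le> N \<Longrightarrow> homog x y (2 * N) (sq_arg p) = homog (x\<^sup>2) (y\<^sup>2) N p"
proof (induction p arbitrary: N)
  case 0
  then show ?case by (simp add: sq_arg_0)
next
  case (pCons c p)
  show ?case
  proof (cases "p = 0")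
    case True
    then show ?thesis by (simp add: sq_arg_pCons sq_arg_0 homog_const power_mult)
  next
    case False
    then obtain N' where N': "N = Suc N'" "degree p \<le> N'" using pCons.prems by (cases N) auto
    have "2 * N = Suc (Suc (2 * N'))" using N' by simp
    then have "homog x y (2 * N) (sq_arg (pCons c p)) = Const c * y ^ (2 * N) + x * (x * homog (x\<^sup>2) (y\<^sup>2) N' p)"
      by (simp add: sq_arg_pCons homog_pCons Const_simps pCons.IH[OF N'(2)])
    then show ?thesis by (simp only: N'(1) homog_pCons power_mult power2_eq_square mult.assoc)
  qed
qed

lemma eval_with_hom2:
  assumes c0: "c 0 = 0"
  shows "eval_with c v (hom2 d p) = (\<Sum>i\<le>d. c (coeff p i) * v 0 ^ i * v 1 ^ (d - i))"
proof -
  let ?t = "\<lambda>m. c (Poly_Mapping.lookup (hom2 d p) m) * (\<Prod>k\<in>Poly_Mapping.keys m. v k ^ Poly_Mapping.lookup m k)"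
  let ?b = "\<lambda>i. bimon i (d - i)"
  have sub: "Poly_Mapping.keys (hom2 d p) \<subseteq> ?b ` {..d}" using keys_hom2 by blast
  have "eval_with c v (hom2 d p) = sum ?t (?b ` {..d})"
    unfolding eval_with_def by (rule sum.mono_neutral_left[OF _ sub]) (use c0 in \<open>auto simp: in_keys_iff\<close>)
  also have "\<dots> = (\<Sum>i\<le>d. ?t (?b i))" by (subst sum.reindex) (auto simp: inj_on_def)
  also have "\<dots> = (\<Sum>i\<le>d. c (coeff p i) * v 0 ^ i * v 1 ^ (d - i))"
  proof (intro sum.cong refl)
    fix i assume i: "i \<in> {..d}"
    have "(\<Prod>k\<in>Poly_Mapping.keys (?b i). v k ^ Poly_Mapping.lookup (?b i) k) = (\<Prod>k\<in>{0, 1}. v k ^ Poly_Mapping.lookup (?b i) k)"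
      by (rule prod.mono_neutral_left) (auto simp: keys_bimon lookup_bimon split: if_splits)
    then show "?t (?b i) = c (coeff p i) * v 0 ^ i * v 1 ^ (d - i)"
      using i by (simp add: lookup_hom2 lookup_bimon mult.assoc)
  qed
  finally show ?thesis .
qed

text \<open>The morphism [x : y] to [a x^2 : b y^2], written through \<open>hom2\<close> so that
  evaluation and homogeneity are those of homogenized polynomials.\<close>

definition square_forms :: "rat \<Rightarrow> rat \<Rightarrow> rat mpoly \<times> rat mpoly" where
  "square_forms a b = (hom2 2 (monom a 2), hom2 2 [:b:])"

lemma square_forms_eq: "square_forms a b = (Const a * (Var 0)\<^sup>2, Const b * (Var (Suc 0))\<^sup>2)"
proof -
  have "{..2::nat} = {0, 1, 2}" by auto
  then have "hom2 2 (monom a 2) = Const a * (Var 0)\<^sup>2" by (simp add: homog_def Const_simps)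
  then show ?thesis by (simp add: square_forms_def homog_const)
qed

text \<open>The substitution of (a x, b y) into a form of degree d, read on its
  dehomogenization.\<close>

definition twist :: "rat \<Rightarrow> rat \<Rightarrow> nat \<Rightarrow> rat poly \<Rightarrow> rat poly" where
  "twist a b d h = (\<Sum>i\<le>d. monom (coeff h i * a ^ i * b ^ (d - i)) i)"

lemma coeff_twist: "coeff (twist a b d h) i = (if i \<le> d then coeff h i * a ^ i * b ^ (d - i) else 0)"
  unfolding twist_def by (rule coeff_sum_monom)

lemma degree_twist: "degree (twist a b d h) \<le> d"
  by (rule degree_le) (simp add: coeff_twist)

lemma subst2_square_forms:
  "subst2 (hom2 d h) (fst (square_forms a b)) (snd (square_forms a b)) = hom2 (2 * d) (sq_arg (twist a b d h))"
proof -
  have cp: "Const (a ^ i) = Const a ^ i" for a i by (induction i) (simp_all add: Const_simps)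
  have "subst2 (hom2 d h) (fst (square_forms a b)) (snd (square_forms a b)) =
      (\<Sum>i\<le>d. Const (coeff h i) * (Const a * (Var 0)\<^sup>2) ^ i * (Const b * (Var (Suc 0))\<^sup>2) ^ (d - i))"
    unfolding subst2_def square_forms_eq by (subst eval_with_hom2) (simp_all add: Const_simps)
  also have "\<dots> = homog ((Var 0)\<^sup>2) ((Var (Suc 0))\<^sup>2) d (twist a b d h)"
    unfolding homog_def by (intro sum.cong refl) (simp add: coeff_twist Const_simps cp power_mult_distrib mult_ac)
  also have "\<dots> = hom2 (2 * d) (sq_arg (twist a b d h))" by (rule homog_sq_arg[symmetric, OF degree_twist])
  finally show ?thesis .
qed

lemma twist_surj:
  assumes "a \<noteq> 0" "b \<noteq> 0" "degree s \<le> d"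
  obtains h where "degree h \<le> d" "twist a b d h = s"
proof
  let ?h = "twist (1 / a) (1 / b) d s"
  show "degree ?h \<le> d" by (rule degree_twist)
  show "twist a b d ?h = s"
    by (rule poly_eqI) (use assms in \<open>auto simp: coeff_twist power_divide coeff_eq_0\<close>)
qed

lemma sq_arg_eq_0_iff: "sq_arg s = 0 \<longleftrightarrow> s = 0"
  using sq_arg_parity[of s 0] by (auto simp: sq_arg_0)

lemma valid_sq_arg: "degree s \<le> D \<Longrightarrow> degree r \<le> D \<Longrightarrow> r \<noteq> 0 \<Longrightarrow> valid (2 * D) (sq_arg s) (sq_arg r)"
  by (simp add: valid_def degree_sq_arg sq_arg_eq_0_iff)

text \<open>The pullbacks are the rational functions of x^2: for nonzero a and b the scaling of the
  coordinates can be undone and leaves this field unchanged.\<close>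

lemma pullback_field_square_forms:
  assumes ab: "a \<noteq> 0" "b \<noteq> 0"
  shows "A \<in> pullback_field 1 {0} {square_forms a b} \<longleftrightarrow>
    (\<exists>D s r. degree s \<le> D \<and> degree r \<le> D \<and> r \<noteq> 0 \<and> A = cl (2 * D) (sq_arg s) (sq_arg r))"
proof
  assume "A \<in> pullback_field 1 {0} {square_forms a b}"
  then obtain h k d F G where A: "A = frac_class 1 {0} (subst2 h F G) (subst2 k F G)" "homogeneous 1 d h" "homogeneous 1 d k"
    "(F, G) = square_forms a b" "subst2 k F G \<noteq> 0" by (auto simp: pullback_field_def)
  obtain h' where h: "degree h' \<le> d" "h = hom2 d h'" using homogeneous_imp_hom2[OF A(2)] .
  obtain k' where k: "degree k' \<le> d" "k = hom2 d k'" using homogeneous_imp_hom2[OF A(3)] .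
  have FG: "F = fst (square_forms a b)" "G = snd (square_forms a b)" using A(4) by (simp_all flip: A(4))
  have "A = cl (2 * d) (sq_arg (twist a b d h')) (sq_arg (twist a b d k'))"
    unfolding A(1) h(2) k(2) FG subst2_square_forms cl_def ..
  moreover have "twist a b d k' \<noteq> 0" using A(5) unfolding k(2) FG subst2_square_forms by (auto simp: sq_arg_0)
  ultimately show "\<exists>D s r. degree s \<le> D \<and> degree r \<le> D \<and> r \<noteq> 0 \<and> A = cl (2 * D) (sq_arg s) (sq_arg r)"
    using degree_twist by blast
next
  assume "\<exists>D s r. degree s \<le> D \<and> degree r \<le> D \<and> r \<noteq> 0 \<and> A = cl (2 * D) (sq_arg s) (sq_arg r)"
  then obtain D s r where A: "degree s \<le> D" "degree r \<le> D" "r \<noteq> 0" "A = cl (2 * D) (sq_arg s) (sq_arg r)" by blast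
  obtain h where h: "degree h \<le> D" "twist a b D h = s" using twist_surj[OF ab A(1)] .
  obtain k where k: "degree k \<le> D" "twist a b D k = r" using twist_surj[OF ab A(2)] .
  let ?F = "fst (square_forms a b)" and ?G = "snd (square_forms a b)"
  have s: "subst2 (hom2 D h) ?F ?G = hom2 (2 * D) (sq_arg s)" "subst2 (hom2 D k) ?F ?G = hom2 (2 * D) (sq_arg r)"
    unfolding subst2_square_forms h k by (rule refl)+
  have "hom2 (2 * D) (sq_arg r) \<noteq> 0" using A(2,3) by (simp add: hom2_eq_0_iff degree_sq_arg sq_arg_eq_0_iff)
  then have "A = frac_class 1 {0} (subst2 (hom2 D h) ?F ?G) (subst2 (hom2 D k) ?F ?G) \<and>
      homogeneous 1 D (hom2 D h) \<and> homogeneous 1 D (hom2 D k) \<and> (?F, ?G) \<in> {square_forms a b} \<and> subst2 (hom2 D k) ?F ?G \<notin> {0}"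
    unfolding s using A(4) homogeneous_hom2 by (simp add: cl_def)
  then show "A \<in> pullback_field 1 {0} {square_forms a b}" unfolding pullback_field_def by blast
qed

text \<open>The function field is Q(x) and the pullback field is Q(x^2), over which 1 and x form a
  basis.\<close>

lemma square_forms_degree:
  assumes ab: "a \<noteq> 0" "b \<noteq> 0"
  shows "has_degree 1 {0} {square_forms a b} 2"
proof -
  interpret R: cring FF by (rule cring_FF)
  define K where "K = pullback_field 1 {0} {square_forms a b}"
  note K_iff = pullback_field_square_forms[OF ab, folded K_def]
  define v where "v = cl 1 [:0, 1:] 1"
  have vv: "valid 1 [:0, 1:] 1" by (simp add: valid_def)
  have vc: "v \<in> carrier FF" unfolding carrier_FF v_def using vv by blast
  \<comment> \<open>The span of 1 over K, which is K itself; x is added to it afterwards.\<close>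
  define E where "E = R.line_extension K \<one>\<^bsub>FF\<^esub> {\<zero>\<^bsub>FF\<^esub>}"
  have Kc: "K \<subseteq> carrier FF" unfolding carrier_FF subset_iff K_iff using valid_sq_arg by blast
  have E_K: "E = K"
  proof -
    have "k \<otimes>\<^bsub>FF\<^esub> \<one>\<^bsub>FF\<^esub> \<oplus>\<^bsub>FF\<^esub> \<zero>\<^bsub>FF\<^esub> = k" if "k \<in> K" for k
    proof -
      have kc: "k \<in> carrier FF" using that Kc by blast
      show ?thesis by (simp only: R.r_one[OF kc] R.r_zero[OF kc])
    qed
    then have "u \<in> E \<longleftrightarrow> u \<in> K" for u unfolding E_def R.line_extension_mem_iff by (metis singletonD singletonI)
    then show ?thesis by blast
  qed
  have one: "\<one>\<^bsub>FF\<^esub> \<notin> {\<zero>\<^bsub>FF\<^esub>}" using cl_eq_iff[OF valid_0_1] unfolding one_FF zero_FF by simp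
  have "R.dimension (Suc 0) K E" unfolding E_def
    by (rule R.Suc_dim[OF R.one_closed one R.zero_dim])
  \<comment> \<open>If x were a quotient of even polynomials, an even polynomial would equal x times
    an even one.\<close>
  moreover have "v \<notin> E"
  proof
    assume "v \<in> E"
    then obtain D s r where s: "degree s \<le> D" "degree r \<le> D" "r \<noteq> 0" "v = cl (2 * D) (sq_arg s) (sq_arg r)"
      unfolding E_K K_iff by blast
    then have "[:0, 1:] * sq_arg r = sq_arg s * 1"
      using cl_eq_iff[OF vv valid_sq_arg[OF s(1-3)]] unfolding v_def by simp
    then have "sq_arg s = pCons 0 (sq_arg r)" by simp
    then show False using sq_arg_parity s(3) by blast
  qed
  ultimately have dim: "R.dimension (Suc (Suc 0)) K (R.line_extension K v E)"
    by (rule R.Suc_dim[OF vc, rotated])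
  have "R.line_extension K v E = carrier FF"
  proof (intro equalityI subsetI)
    fix A assume "A \<in> R.line_extension K v E"
    then obtain k e where ke: "k \<in> K" "e \<in> K" "A = k \<otimes>\<^bsub>FF\<^esub> v \<oplus>\<^bsub>FF\<^esub> e"
      unfolding R.line_extension_mem_iff E_K by blast
    show "A \<in> carrier FF" unfolding ke(3)
      by (intro R.add.m_closed R.m_closed subsetD[OF Kc] ke(1,2) vc)
  next
    fix A assume "A \<in> carrier FF"
    then obtain d p q where A: "valid d p q" "A = cl d p q" unfolding carrier_FF by blast
    \<comment> \<open>multiplying by the conjugate \<open>q(-x)\<close> makes the denominator even\<close>
    obtain s t where q: "q = sq_arg s + pCons 0 (sq_arg t)" using even_odd_decomp by blast
    define q' where "q' = sq_arg s - pCons 0 (sq_arg t)"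
    define r where "r = s * s - pCons 0 (t * t)"
    have x: "pCons 0 z = [:0, 1:] * z" for z :: "rat poly" by simp
    have "sq_arg (pCons 0 z) = [:0, 1:] * ([:0, 1:] * sq_arg z)" for z by (simp add: sq_arg_pCons)
    then have r: "q * q' = sq_arg r"
      unfolding q q'_def r_def sq_arg_diff sq_arg_mult x[of "sq_arg t"] by (simp only: sq_arg_mult) (simp add: algebra_simps)
    have "q' \<noteq> 0"
    proof
      assume "q' = 0"
      then have "s = 0 \<and> t = 0" using sq_arg_parity unfolding q'_def by simp
      then show False using A(1) q by (simp add: valid_def sq_arg_0)
    qed
    then have r0: "r \<noteq> 0" using r A(1) by (auto simp: valid_def sq_arg_0)
    obtain u w where uw: "p * q' = sq_arg u + pCons 0 (sq_arg w)" using even_odd_decomp by blast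
    define D where "D = max (degree r) (max (degree u) (degree w))"
    have va: "valid (2 * D) (sq_arg w) (sq_arg r)" "valid (2 * D) (sq_arg u) (sq_arg r)"
      using r0 by (auto intro!: valid_sq_arg simp: D_def)
    have inK: "cl (2 * D) (sq_arg w) (sq_arg r) \<in> K" "cl (2 * D) (sq_arg u) (sq_arg r) \<in> K"
    proof -
      have deg: "degree r \<le> D" "degree u \<le> D" "degree w \<le> D" by (simp_all add: D_def)
      show "cl (2 * D) (sq_arg w) (sq_arg r) \<in> K" "cl (2 * D) (sq_arg u) (sq_arg r) \<in> K"
        unfolding K_iff using deg r0 by blast+
    qed
    have "cl (2 * D) (sq_arg w) (sq_arg r) \<otimes>\<^bsub>FF\<^esub> v \<oplus>\<^bsub>FF\<^esub> cl (2 * D) (sq_arg u) (sq_arg r) = A"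
      unfolding v_def A(2) mult_FF[OF va(1) vv] add_FF[OF valid_mult[OF va(1) vv] va(2)]
    proof (subst cl_eq_iff[OF valid_add[OF valid_mult[OF va(1) vv] va(2)] A(1)])
      have "(sq_arg w * [:0, 1:] * sq_arg r + sq_arg u * (sq_arg r * 1)) * q = (sq_arg u + pCons 0 (sq_arg w)) * sq_arg r * q"
        unfolding x[of "sq_arg w"] by (simp add: algebra_simps)
      also have "\<dots> = p * (sq_arg r * 1 * sq_arg r)" unfolding uw[symmetric] r[symmetric] by (simp add: algebra_simps)
      finally show "(sq_arg w * [:0, 1:] * sq_arg r + sq_arg u * (sq_arg r * 1)) * q = p * (sq_arg r * 1 * sq_arg r)" .
    qed
    then show "A \<in> R.line_extension K v E" unfolding R.line_extension_mem_iff E_K using inK by metis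
  qed
  then show ?thesis using dim unfolding has_degree_def K_def by (simp add: numeral_2_eq_2)
qed

text \<open>The set A is the image of the rational points under the squaring morphism. The condition
  on s makes [s : t] a point and keeps the first form nonzero there.\<close>

lemma basic_thin_squares:
  assumes ab: "a \<noteq> 0" "b \<noteq> 0"
  obtains A where "basic_thin A" "\<And>s t. s \<noteq> 0 \<Longrightarrow> P1_point (a * s\<^sup>2) (b * t\<^sup>2) \<in> A"
proof -
  let ?\<Phi> = "{square_forms a b}"
  have hom: "homogeneous 1 2 (fst (square_forms a b))" "homogeneous 1 2 (snd (square_forms a b))"
    unfolding square_forms_def using homogeneous_hom2 by simp_all
  have "morphism_to_P1 1 {0} ?\<Phi>" unfolding morphism_to_P1_def
  proof (intro conjI)
    show "\<forall>(F, G)\<in>?\<Phi>. \<exists>d. homogeneous 1 d F \<and> homogeneous 1 d G" using hom by (auto split: prod.splits)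
    show "\<forall>(F, G)\<in>?\<Phi>. \<forall>(F', G')\<in>?\<Phi>. F * G' - F' * G \<in> {0}" by auto
    show "\<forall>P\<in>scheme_points 1 {0}. \<exists>(F, G)\<in>?\<Phi>. F \<notin> P \<or> G \<notin> P"
    proof
      fix P assume "P \<in> scheme_points 1 {0}"
      then have P: "integral_subvariety 1 P" by (simp add: scheme_points_def)
      note PD = integral_subvarietyD[OF P]
      have V: "Var i \<in> P" if "Const c * (Var i)\<^sup>2 \<in> P" "c \<noteq> 0" "i \<le> 1" for c i
      proof -
        have "Const c * (Var i)\<^sup>2 * Const (1 / c) \<in> P" using PD(4)[OF that(1) coord_ring_Const] .
        moreover have "Const c * (Var i)\<^sup>2 * Const (1 / c) = Var i * Var i"
          using that(2) Const_simps(4)[of c "1 / c"] by (simp add: Const_simps power2_eq_square mult_ac)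
        ultimately show ?thesis using PD(5)[OF coord_ring_Var[OF that(3)] coord_ring_Var[OF that(3)]] by auto
      qed
      have "{..1::nat} = {0, Suc 0}" by auto
      then have "\<not> (Var 0 \<in> P \<and> Var (Suc 0) \<in> P)" using PD(7) by auto
      then show "\<exists>(F, G)\<in>?\<Phi>. F \<notin> P \<or> G \<notin> P"
        unfolding square_forms_eq using V[of a 0] V[of b "Suc 0"] ab by auto
    qed
  qed
  moreover have "dominant {0} ?\<Phi>" unfolding dominant_def
  proof (intro allI impI)
    fix h d assume h: "homogeneous 1 d h \<and> h \<noteq> 0"
    then obtain p where p: "degree p \<le> d" "h = hom2 d p" using homogeneous_imp_hom2 by blast
    have "p \<noteq> 0" using h p by auto
    have "twist a b d p \<noteq> 0"
    proof
      assume "twist a b d p = 0"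
      then have "coeff p i = 0" for i
        using coeff_twist[of a b d p i] ab p(1) by (cases "i \<le> d") (auto simp: coeff_eq_0)
      then show False using \<open>p \<noteq> 0\<close> by (simp add: poly_eq_iff)
    qed
    then have "subst2 h (fst (square_forms a b)) (snd (square_forms a b)) \<notin> {0}"
      unfolding p(2) subst2_square_forms using degree_twist[of a b d p]
      by (simp add: hom2_eq_0_iff degree_sq_arg sq_arg_eq_0_iff)
    then show "\<exists>(F, G)\<in>?\<Phi>. subst2 h F G \<notin> {0}" by (auto split: prod.splits)
  qed
  ultimately have "basic_thin (image_rational_points 1 {0} ?\<Phi>)"
    unfolding basic_thin_def using projective_line_curve square_forms_degree[OF ab] by blast
  moreover have "P1_point (a * s\<^sup>2) (b * t\<^sup>2) \<in> image_rational_points 1 {0} ?\<Phi>" if s: "s \<noteq> 0" for s t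
  proof -
    define \<alpha> :: "nat \<Rightarrow> rat" where "\<alpha> = (\<lambda>i. if i = 0 then s else if i = 1 then t else 0)"
    have "\<alpha> \<in> rational_zeros 1 {0}"
      unfolding rational_zeros_def coord_vectors_def \<alpha>_def using s by (auto simp: eval_at_def eval_with_def)
    moreover have "eval_at \<alpha> (fst (square_forms a b)) = a * s\<^sup>2" "eval_at \<alpha> (snd (square_forms a b)) = b * t\<^sup>2"
    proof -
      have 2: "{..2::nat} = {0, 1, 2}" by auto
      show "eval_at \<alpha> (fst (square_forms a b)) = a * s\<^sup>2" "eval_at \<alpha> (snd (square_forms a b)) = b * t\<^sup>2"
        unfolding eval_at_def square_forms_def by (simp_all add: eval_with_hom2 2 \<alpha>_def coeff_pCons)
    qed
    moreover have "a * s\<^sup>2 \<noteq> 0" using ab s by simp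
    ultimately show ?thesis unfolding image_rational_points_def
      by (intro CollectI exI[of _ \<alpha>] exI[of _ "fst (square_forms a b)"] exI[of _ "snd (square_forms a b)"]) simp
  qed
  ultimately show thesis using that by blast
qed

section \<open>Removing a thin set of prescribed density\<close>

definition int_point :: "int \<Rightarrow> int \<Rightarrow> (nat \<Rightarrow> rat) set" where
  "int_point z0 z1 = P1_point (of_int z0) (of_int z1)"

text \<open>Proportional primitive vectors divide each other coordinate by coordinate, so they agree
  up to signs, and the vanishing cross product makes the two signs equal.\<close>

lemma int_point_eq_iff:
  assumes "coprime z0 z1" "coprime w0 w1"
  shows "int_point z0 z1 = int_point w0 w1 \<longleftrightarrow> (z0 = w0 \<and> z1 = w1) \<or> (z0 = - w0 \<and> z1 = - w1)"
proof
  let ?v = "\<lambda>a b. (\<lambda>i::nat. if i = 0 then of_int a else if i = 1 then of_int b else 0) :: nat \<Rightarrow> rat"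
  assume eq: "int_point z0 z1 = int_point w0 w1"
  have "?v z0 z1 \<in> int_point z0 z1"
    unfolding int_point_def P1_point_def proj_class_def by (intro CollectI exI[of _ 1]) auto
  then have "?v z0 z1 \<in> int_point w0 w1" using eq by simp
  then obtain c where "c \<noteq> 0" "?v z0 z1 = (\<lambda>i. c * ?v w0 w1 i)"
    unfolding int_point_def P1_point_def proj_class_def by blast
  then have c: "of_int z0 = c * of_int w0" "of_int z1 = c * of_int w1"
    using fun_cong[of "?v z0 z1" _ 0] fun_cong[of "?v z0 z1" _ 1] by simp_all
  then have "(of_int (z0 * w1) :: rat) = of_int (z1 * w0)" by simp
  then have cross: "z0 * w1 = z1 * w0" by (simp only: of_int_eq_iff)
  have "z0 dvd w0" using dvd_triv_left[of z0 w1] unfolding cross coprime_dvd_mult_right_iff[OF assms(1)] .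
  moreover have "w0 dvd z0" using dvd_triv_right[of w0 z1] unfolding cross[symmetric] coprime_dvd_mult_left_iff[OF assms(2)] .
  ultimately have 0: "\<bar>z0\<bar> = \<bar>w0\<bar>" by (rule zdvd_antisym_abs)
  have "z1 dvd w1" using dvd_triv_left[of z1 w0] unfolding cross[symmetric]
    using assms(1) by (simp add: coprime_dvd_mult_right_iff coprime_commute)
  moreover have "w1 dvd z1" using dvd_triv_right[of w1 z0] unfolding cross
    using assms(2) by (simp add: coprime_dvd_mult_left_iff coprime_commute)
  ultimately have 1: "\<bar>z1\<bar> = \<bar>w1\<bar>" by (rule zdvd_antisym_abs)
  show "(z0 = w0 \<and> z1 = w1) \<or> (z0 = - w0 \<and> z1 = - w1)"
  proof (cases "w0 = 0 \<or> w1 = 0")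
    case True
    then show ?thesis using 0 1 by (auto simp: abs_eq_iff)
  next
    case False
    have "z0 = w0 \<or> z0 = - w0" "z1 = w1 \<or> z1 = - w1" using 0 1 by (auto simp: abs_eq_iff)
    moreover have "\<not> (w0 * w1 = - (w0 * w1))" using False by simp
    ultimately show ?thesis using cross by (auto simp: mult.commute)
  qed
next
  have neg: "int_point (- w0) (- w1) \<subseteq> int_point w0 w1" for w0 w1
  proof
    fix v assume "v \<in> int_point (- w0) (- w1)"
    then obtain c where c: "c \<noteq> 0" "v = (\<lambda>i. c * (if i = 0 then of_int (- w0) else if i = 1 then of_int (- w1) else 0))"
      unfolding int_point_def P1_point_def proj_class_def by blast
    then have "v = (\<lambda>i. (- c) * (if i = 0 then of_int w0 else if i = 1 then of_int w1 else 0))" by (auto simp: fun_eq_iff)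
    then show "v \<in> int_point w0 w1" using c(1) unfolding int_point_def P1_point_def proj_class_def by fastforce
  qed
  assume "(z0 = w0 \<and> z1 = w1) \<or> (z0 = - w0 \<and> z1 = - w1)"
  then show "int_point z0 z1 = int_point w0 w1" using neg[of w0 w1] neg[of "- w0" "- w1"] by auto
qed

lemma height_int_point:
  assumes "coprime z0 z1"
  shows "height (int_point z0 z1) = max \<bar>z0\<bar> (max \<bar>z1\<bar> \<bar>z0 + z1\<bar>)"
  unfolding height_def
proof (rule the_equality)
  show "\<exists>w0 w1. coprime w0 w1 \<and> int_point z0 z1 = P1_point (of_int w0) (of_int w1) \<and>
      max \<bar>z0\<bar> (max \<bar>z1\<bar> \<bar>z0 + z1\<bar>) = max \<bar>w0\<bar> (max \<bar>w1\<bar> \<bar>w0 + w1\<bar>)"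
    using assms unfolding int_point_def by blast
next
  fix h assume "\<exists>w0 w1. coprime w0 w1 \<and> int_point z0 z1 = P1_point (of_int w0) (of_int w1) \<and> h = max \<bar>w0\<bar> (max \<bar>w1\<bar> \<bar>w0 + w1\<bar>)"
  then obtain w0 w1 where w: "coprime w0 w1" "int_point z0 z1 = int_point w0 w1" "h = max \<bar>w0\<bar> (max \<bar>w1\<bar> \<bar>w0 + w1\<bar>)"
    unfolding int_point_def by blast
  have "(z0 = w0 \<and> z1 = w1) \<or> (z0 = - w0 \<and> z1 = - w1)" using w(2) int_point_eq_iff[OF assms w(1)] by simp
  moreover have "\<bar>- w0 + - w1\<bar> = \<bar>w0 + w1\<bar>" by linarith
  ultimately show "h = max \<bar>z0\<bar> (max \<bar>z1\<bar> \<bar>z0 + z1\<bar>)"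
    unfolding w(3) by (elim disjE conjE) (simp_all only: abs_minus_cancel)
qed

lemma finite_campana_height: "finite {z \<in> campana_points. real_of_int (height z) \<le> B}"
proof (rule finite_subset)
  show "{z \<in> campana_points. real_of_int (height z) \<le> B} \<subseteq> (\<lambda>(z0, z1). int_point z0 z1) ` ({-\<lceil>B\<rceil>..\<lceil>B\<rceil>} \<times> {-\<lceil>B\<rceil>..\<lceil>B\<rceil>})"
  proof
    fix z assume "z \<in> {z \<in> campana_points. real_of_int (height z) \<le> B}"
    then obtain z0 z1 where z: "coprime z0 z1" "z = int_point z0 z1" "real_of_int (height z) \<le> B"
      unfolding campana_points_def int_point_def by blast
    have "height z \<le> \<lceil>B\<rceil>" using z(3) by linarith
    then have "\<bar>z0\<bar> \<le> \<lceil>B\<rceil>" "\<bar>z1\<bar> \<le> \<lceil>B\<rceil>" unfolding z(2) height_int_point[OF z(1)] by auto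
    then show "z \<in> (\<lambda>(z0, z1). int_point z0 z1) ` ({-\<lceil>B\<rceil>..\<lceil>B\<rceil>} \<times> {-\<lceil>B\<rceil>..\<lceil>B\<rceil>})"
      unfolding z(2) by (intro image_eqI[of _ _ "(z0, z1)"]) (simp_all add: abs_le_iff)
  qed
qed auto

lemma squareful_cube_square:
  assumes "y > 0" "x > 0"
  shows "squareful (int y ^ 3 * x\<^sup>2)" "squareful (- (int y ^ 3 * x\<^sup>2))"
proof -
  have "p\<^sup>2 dvd int y ^ 3 * x\<^sup>2" if p: "prime p" "p dvd int y ^ 3 * x\<^sup>2" for p
  proof -
    have "p dvd int y \<or> p dvd x" using p by (auto simp: prime_dvd_mult_iff prime_dvd_power_iff)
    then show ?thesis
    proof
      assume "p dvd int y"
      then have "p\<^sup>2 dvd int y ^ 2" by (rule dvd_power_same)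
      moreover have "int y ^ 3 * x\<^sup>2 = int y ^ 2 * (int y * x\<^sup>2)" by (simp add: power3_eq_cube power2_eq_square)
      ultimately show ?thesis by (metis dvd_mult2)
    next
      assume "p dvd x"
      then have "p\<^sup>2 dvd x\<^sup>2" by (rule dvd_power_same)
      then show ?thesis by simp
    qed
  qed
  then show "squareful (int y ^ 3 * x\<^sup>2)" "squareful (- (int y ^ 3 * x\<^sup>2))"
    using assms by (auto simp: squareful_def)
qed

text \<open>The number is y (y x)^2, so the parities of its valuations recover the squarefree
  y.\<close>

lemma cube_square_unique:
  fixes y y' :: nat and x x' :: int
  assumes "squarefree y" "squarefree y'" "x > 0" "x' > 0" and eq: "int y ^ 3 * x\<^sup>2 = int y' ^ 3 * x'\<^sup>2"
  shows "y = y'" "x = x'"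
proof -
  have y: "y > 0" "y' > 0" using assms(1,2) by (auto intro: Nat.gr0I)
  define a b where "a = y * nat x" "b = y' * nat x'"
  have ab: "a > 0" "b > 0" using y assms(3,4) by (auto simp: a_b_def)
  have "int (y * a\<^sup>2) = int (y' * b\<^sup>2)"
    using assms(3,4) eq by (simp add: a_b_def power_mult_distrib power3_eq_cube power2_eq_square mult_ac)
  then have e: "y * a\<^sup>2 = y' * b\<^sup>2" by (simp only: of_nat_eq_iff)
  show yy: "y = y'"
  proof (rule multiplicity_eq_nat[OF y])
    fix p :: nat assume p: "prime p"
    have m: "multiplicity p (z * c\<^sup>2) = multiplicity p z + 2 * multiplicity p c" if "z > 0" "c > 0" for z c
      using p that by (simp add: prime_elem_multiplicity_mult_distrib prime_elem_multiplicity_power_distrib)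
    have "multiplicity p y + 2 * multiplicity p a = multiplicity p y' + 2 * multiplicity p b"
      using e m[OF y(1) ab(1)] m[OF y(2) ab(2)] by simp
    moreover have "multiplicity p y \<le> 1" "multiplicity p y' \<le> 1"
      using assms(1,2) y p squarefree_factorial_semiring''[of y] squarefree_factorial_semiring''[of y'] by auto
    ultimately show "multiplicity p y = multiplicity p y'" by presburger
  qed
  have "x\<^sup>2 = x'\<^sup>2" using eq y unfolding yy by simp
  then show "x = x'" using assms(3,4) by (simp add: power2_eq_iff)
qed

text \<open>Keeping \<open>\<lfloor>\<theta> N(n)\<rfloor>\<close> of the first \<open>N(n)\<close> points, level by level.\<close>

lemma thinning:
  fixes U :: "'a set" and h :: "'a \<Rightarrow> int" and \<theta> :: real
  assumes fin: "\<And>n. finite {z \<in> U. h z \<le> int n}" and nonneg: "\<And>z. z \<in> U \<Longrightarrow> h z \<ge> 0"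
    and \<theta>: "0 \<le> \<theta>" "\<theta> \<le> 1"
  obtains T where "T \<subseteq> U" "\<And>n. int (card {z \<in> T. h z \<le> int n}) = \<lfloor>\<theta> * real (card {z \<in> U. h z \<le> int n})\<rfloor>"
proof -
  define N where "N n = card {z \<in> U. h z \<le> int n}" for n
  define f where "f n = nat \<lfloor>\<theta> * real (N n)\<rfloor>" for n
  define L where "L n = {z \<in> U. h z = int n}" for n
  \<comment> \<open>How many points to keep at height exactly n; as \<theta> \<le> 1, never more
    than there are.\<close>
  define t where "t n = (case n of 0 \<Rightarrow> f 0 | Suc m \<Rightarrow> f (Suc m) - f m)" for n
  have finL: "finite (L n)" for n unfolding L_def by (rule finite_subset[OF _ fin[of n]]) auto
  have NS: "N (Suc n) = N n + card (L (Suc n))" for n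
  proof -
    have "{z \<in> U. h z \<le> int (Suc n)} = {z \<in> U. h z \<le> int n} \<union> L (Suc n)" by (auto simp: L_def)
    moreover have "{z \<in> U. h z \<le> int n} \<inter> L (Suc n) = {}" by (auto simp: L_def)
    ultimately show ?thesis unfolding N_def by (simp only: card_Un_disjoint[OF fin finL])
  qed
  have N0: "N 0 = card (L 0)" unfolding N_def L_def using nonneg by (intro arg_cong[of _ _ card] Collect_cong) (auto intro: antisym)
  have fmono: "f n \<le> f (Suc n)" for n
    unfolding f_def using \<theta> NS[of n] by (intro nat_mono floor_mono mult_left_mono) auto
  have "t n \<le> card (L n)" for n
  proof (cases n)
    case 0
    have "\<theta> * real (N 0) \<le> real (N 0)" using \<theta> by (simp add: mult_left_le_one_le)
    then show ?thesis unfolding t_def f_def 0 using N0 by (simp add: floor_le_iff nat_le_iff)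
  next
    case (Suc m)
    have "\<theta> * real (N (Suc m)) \<le> \<theta> * real (N m) + real (card (L (Suc m)))"
      unfolding NS using \<theta> by (simp add: distrib_left mult_left_le_one_le)
    then have "\<lfloor>\<theta> * real (N (Suc m))\<rfloor> \<le> \<lfloor>\<theta> * real (N m)\<rfloor> + int (card (L (Suc m)))" by linarith
    then show ?thesis unfolding t_def f_def Suc by simp
  qed
  then have "\<exists>S. S \<subseteq> L n \<and> card S = t n" for n by (metis obtain_subset_with_card_n)
  then obtain S where S: "\<And>n. S n \<subseteq> L n" "\<And>n. card (S n) = t n" by metis
  define T where "T = (\<Union>n. S n)"
  have TU: "T \<subseteq> U" unfolding T_def using S(1) by (auto simp: L_def)
  have lev: "{z \<in> T. h z = int n} = S n" for n
  proof (intro Set.set_eqI iffI)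
    fix z assume "z \<in> {z \<in> T. h z = int n}"
    then obtain m where "z \<in> S m" "h z = int n" unfolding T_def by blast
    moreover from this have "h z = int m" using S(1)[of m] by (auto simp: L_def)
    ultimately show "z \<in> S n" by simp
  next
    fix z assume "z \<in> S n"
    then show "z \<in> {z \<in> T. h z = int n}" using S(1)[of n] by (auto simp: L_def T_def)
  qed
  have "card {z \<in> T. h z \<le> int n} = f n" for n
  proof (induction n)
    case 0
    have "h z \<le> int 0 \<longleftrightarrow> h z = int 0" if "z \<in> T" for z using nonneg[of z] TU that by auto
    then have "{z \<in> T. h z \<le> int 0} = S 0" unfolding lev[symmetric] by blast
    then show ?case using S(2)[of 0] by (simp add: t_def)
  next
    case (Suc n)
    have "{z \<in> T. h z \<le> int (Suc n)} = {z \<in> T. h z \<le> int n} \<union> S (Suc n)" unfolding lev[symmetric] by auto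
    moreover have "{z \<in> T. h z \<le> int n} \<inter> S (Suc n) = {}" unfolding lev[symmetric] by auto
    moreover have "finite {z \<in> T. h z \<le> int n}" by (rule finite_subset[OF _ fin[of n]]) (use TU in auto)
    moreover have "finite (S (Suc n))" using S(1) finL finite_subset by blast
    ultimately have "card {z \<in> T. h z \<le> int (Suc n)} = f n + t (Suc n)" using Suc S(2) by (simp add: card_Un_disjoint)
    then show ?case using fmono[of n] by (simp add: t_def)
  qed
  then have "int (card {z \<in> T. h z \<le> int n}) = \<lfloor>\<theta> * real (card {z \<in> U. h z \<le> int n})\<rfloor>" for n
    using \<theta> by (simp add: f_def N_def)
  then show thesis using that TU by blast
qed

text \<open>From positive z0 and z1, the three points, up to sign, whose coordinates and their sum
  have absolute values z0, z1 and z0 + z1 in some order prescribed by j: the largest is the sum for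
  j = 0, the first coordinate for j = 1 and the second for j = 2. This is the origin of the factor
  3.\<close>

definition orient :: "nat \<Rightarrow> int \<Rightarrow> int \<Rightarrow> int \<times> int" where
  "orient j z0 z1 = (if j = 0 then (z0, z1) else if j = 1 then (z0 + z1, - z1) else (- z0, z0 + z1))"

lemma orient_props:
  assumes "z0 > 0" "z1 > 0" "coprime z0 z1" "j < 3"
  shows "coprime (fst (orient j z0 z1)) (snd (orient j z0 z1))"
    and "height (int_point (fst (orient j z0 z1)) (snd (orient j z0 z1))) = z0 + z1"
proof -
  have "coprime (z0 + z1) z1" "coprime z0 (z0 + z1)"
    using assms(3) unfolding coprime_iff_gcd_eq_1 by (simp_all only: gcd_add1 gcd_add2)
  then show c: "coprime (fst (orient j z0 z1)) (snd (orient j z0 z1))"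
    using assms(3) by (auto simp: orient_def)
  show "height (int_point (fst (orient j z0 z1)) (snd (orient j z0 z1))) = z0 + z1"
    unfolding height_int_point[OF c] using assms(1,2) by (auto simp: orient_def)
qed

lemma orient_inj:
  assumes z: "z0 > 0" "z1 > 0" "coprime z0 z1" "j < 3" and w: "w0 > 0" "w1 > 0" "coprime w0 w1" "i < 3"
    and eq: "int_point (fst (orient j z0 z1)) (snd (orient j z0 z1)) = int_point (fst (orient i w0 w1)) (snd (orient i w0 w1))"
  shows "j = i \<and> z0 = w0 \<and> z1 = w1"
proof -
  have "j = 0 \<or> j = 1 \<or> j = 2" "i = 0 \<or> i = 1 \<or> i = 2" using z(4) w(4) by auto
  then show ?thesis
    using eq z(1,2) w(1,2) unfolding int_point_eq_iff[OF orient_props(1)[OF z] orient_props(1)[OF w]]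
    by (auto simp: orient_def)
qed

section \<open>Families of Campana points on conics\<close>

definition conic_sols :: "nat \<times> nat \<times> nat \<Rightarrow> (int \<times> int \<times> int) set" where
  "conic_sols = (\<lambda>(y0, y1, y2). {(x0, x1, x2). x0 > 0 \<and> x1 > 0 \<and> x2 > 0 \<and>
     int y0 ^ 3 * x0\<^sup>2 + int y1 ^ 3 * x1\<^sup>2 = int y2 ^ 3 * x2\<^sup>2 \<and> coprime (int y0 * x0) (int y1 * x1)})"

definition campana_point_of :: "nat \<Rightarrow> nat \<times> nat \<times> nat \<Rightarrow> int \<times> int \<times> int \<Rightarrow> (nat \<Rightarrow> rat) set" where
  "campana_point_of j = (\<lambda>(y0, y1, y2) (x0, x1, x2).
     int_point (fst (orient j (int y0 ^ 3 * x0\<^sup>2) (int y1 ^ 3 * x1\<^sup>2)))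
       (snd (orient j (int y0 ^ 3 * x0\<^sup>2) (int y1 ^ 3 * x1\<^sup>2))))"

definition good_triple :: "nat \<times> nat \<times> nat \<Rightarrow> bool" where
  "good_triple = (\<lambda>(y0, y1, y2). y0 > 0 \<and> y1 > 0 \<and> y2 > 0 \<and> squarefree (y0 * y1 * y2))"

lemma coprime_cube_square:
  "coprime (int y0 * x0) (int y1 * x1) \<Longrightarrow> coprime (int y0 ^ 3 * x0\<^sup>2) (int y1 ^ 3 * x1\<^sup>2)"
  by simp

lemma campana_point_of_props:
  assumes "good_triple (y0, y1, y2)" "(x0, x1, x2) \<in> conic_sols (y0, y1, y2)" "j < 3"
  shows "campana_point_of j (y0, y1, y2) (x0, x1, x2) \<in> campana_points"
    and "height (campana_point_of j (y0, y1, y2) (x0, x1, x2)) = int y2 ^ 3 * x2\<^sup>2"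
proof -
  define z0 z1 where "z0 = int y0 ^ 3 * x0\<^sup>2" and "z1 = int y1 ^ 3 * x1\<^sup>2"
  have y: "y0 > 0" "y1 > 0" "y2 > 0" using assms(1) by (simp_all add: good_triple_def)
  have x: "x0 > 0" "x1 > 0" "x2 > 0" and z2: "z0 + z1 = int y2 ^ 3 * x2\<^sup>2" and "coprime (int y0 * x0) (int y1 * x1)"
    using assms(2) by (simp_all add: conic_sols_def z0_def z1_def)
  then have cop: "coprime z0 z1" unfolding z0_def z1_def by (intro coprime_cube_square)
  have pos: "z0 > 0" "z1 > 0" unfolding z0_def z1_def using x y by simp_all
  have sq: "squareful z0" "squareful (- z0)" "squareful z1" "squareful (- z1)" "squareful (z0 + z1)"
    unfolding z2 unfolding z0_def z1_def using squareful_cube_square[OF y(1) x(1)] squareful_cube_square[OF y(2) x(2)]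
      squareful_cube_square[OF y(3) x(3)] by blast+
  define p where "p = orient j z0 z1"
  have "p = (z0, z1) \<or> p = (z0 + z1, - z1) \<or> p = (- z0, z0 + z1)" by (simp add: p_def orient_def)
  then have "squareful (fst p) \<and> squareful (snd p) \<and> squareful (fst p + snd p)"
    using sq by (elim disjE) simp_all
  moreover have "coprime (fst p) (snd p)" unfolding p_def by (rule orient_props(1)[OF pos cop assms(3)])
  ultimately show "campana_point_of j (y0, y1, y2) (x0, x1, x2) \<in> campana_points"
    unfolding campana_points_def campana_point_of_def int_point_def prod.case z0_def[symmetric] z1_def[symmetric] p_def by blast
  show "height (campana_point_of j (y0, y1, y2) (x0, x1, x2)) = int y2 ^ 3 * x2\<^sup>2"
    unfolding z2[symmetric] campana_point_of_def using orient_props(2)[OF pos cop assms(3)] by (simp add: z0_def z1_def)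
qed

text \<open>The point determines j and the positive numbers y_i^3 x_i^2, and each of these
  determines its squarefree y_i and then x_i.\<close>

lemma campana_point_of_inject:
  assumes y: "good_triple y" and x: "x \<in> conic_sols y" and j: "j < 3"
    and y': "good_triple y'" and x': "x' \<in> conic_sols y'" and j': "j' < 3"
    and eq: "campana_point_of j y x = campana_point_of j' y' x'"
  shows "j = j' \<and> y = y' \<and> x = x'"
proof -
  obtain y0 y1 y2 x0 x1 x2 y0' y1' y2' x0' x1' x2'
    where t: "y = (y0, y1, y2)" "x = (x0, x1, x2)" "y' = (y0', y1', y2')" "x' = (x0', x1', x2')"
    by (metis prod_cases3)
  have sf: "squarefree y0 \<and> squarefree y1 \<and> squarefree y2" if "good_triple (y0, y1, y2)" for y0 y1 y2
  proof -
    have s: "squarefree (y0 * y1 * y2)" using that by (simp add: good_triple_def)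
    show ?thesis by (intro conjI squarefree_mono[OF _ s]) simp_all
  qed
  have fc: "z0 > 0 \<and> z1 > 0 \<and> z2 > 0 \<and> int a0 ^ 3 * z0\<^sup>2 > 0 \<and> int a1 ^ 3 * z1\<^sup>2 > 0 \<and>
      coprime (int a0 ^ 3 * z0\<^sup>2) (int a1 ^ 3 * z1\<^sup>2) \<and> int a0 ^ 3 * z0\<^sup>2 + int a1 ^ 3 * z1\<^sup>2 = int a2 ^ 3 * z2\<^sup>2"
    if "good_triple (a0, a1, a2)" "(z0, z1, z2) \<in> conic_sols (a0, a1, a2)" for a0 a1 a2 z0 z1 z2
    using that unfolding good_triple_def conic_sols_def by simp
  note f = fc[OF y[unfolded t] x[unfolded t]]
  note f' = fc[OF y'[unfolded t] x'[unfolded t]]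
  have e: "j = j' \<and> int y0 ^ 3 * x0\<^sup>2 = int y0' ^ 3 * x0'\<^sup>2 \<and> int y1 ^ 3 * x1\<^sup>2 = int y1' ^ 3 * x1'\<^sup>2"
    using f f' j j' eq unfolding t campana_point_of_def prod.case by (intro orient_inj) blast+
  have "int y2 ^ 3 * x2\<^sup>2 = int y2' ^ 3 * x2'\<^sup>2" using e f f' by linarith
  then show ?thesis
    using e f f' sf[OF y[unfolded t]] sf[OF y'[unfolded t]]
      cube_square_unique[of y0 y0' x0 x0'] cube_square_unique[of y1 y1' x1 x1'] cube_square_unique[of y2 y2' x2 x2']
    unfolding t by simp
qed

definition conic_family :: "(nat \<times> nat \<times> nat) set \<Rightarrow> (nat \<Rightarrow> rat) set set" where
  "conic_family Y = {campana_point_of j y x |j y x. j < 3 \<and> y \<in> Y \<and> x \<in> conic_sols y}"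

lemma conic_family_campana:
  assumes "\<And>y. y \<in> Y \<Longrightarrow> good_triple y"
  shows "conic_family Y \<subseteq> campana_points"
proof
  fix z assume "z \<in> conic_family Y"
  then obtain j y x where z: "j < 3" "y \<in> Y" "x \<in> conic_sols y" "z = campana_point_of j y x" unfolding conic_family_def by blast
  obtain y0 y1 y2 x0 x1 x2 where t: "y = (y0, y1, y2)" "x = (x0, x1, x2)" by (metis prod_cases3)
  show "z \<in> campana_points"
    using campana_point_of_props(1)[OF assms[OF z(2), unfolded t] z(3)[unfolded t] z(1)] z(4) by (simp add: t)
qed

text \<open>The triples (j, y, x) parametrize the family without repetition, and the height is y2^3
  x2^2 for all three values of j.\<close>

lemma conic_family_count:
  assumes Y: "finite Y" "\<And>y. y \<in> Y \<Longrightarrow> good_triple y"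
  shows "count_height (conic_family Y) B = 3 * (\<Sum>(y0, y1, y2)\<in>Y. card (conic_points y0 y1 y2 B))"
proof -
  define P where "P = (\<lambda>(y0, y1, y2). conic_points y0 y1 y2 B)"
  have P: "x \<in> P y \<longleftrightarrow> x \<in> conic_sols y \<and> real_of_int (height (campana_point_of j y x)) \<le> B" if "y \<in> Y" "j < 3" for j y x
  proof -
    obtain y0 y1 y2 x0 x1 x2 where t: "y = (y0, y1, y2)" "x = (x0, x1, x2)" by (metis prod_cases3)
    have g: "good_triple (y0, y1, y2)" using Y(2)[OF that(1)] by (simp add: t)
    have "x \<in> P y \<longleftrightarrow> x \<in> conic_sols y \<and> real_of_int (int y2 ^ 3 * x2\<^sup>2) \<le> B"
      unfolding P_def t conic_points_def conic_sols_def by auto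
    then show ?thesis using campana_point_of_props(2)[OF g _ that(2)] unfolding t by metis
  qed
  have fin: "finite (P y)" if "y \<in> Y" for y
    using conic_points_density(1) Y(2)[OF that] unfolding P_def good_triple_def by (auto split: prod.splits)
  let ?e = "\<lambda>(j, y, x). campana_point_of j y x"
  let ?I = "{..<3::nat} \<times> (SIGMA y:Y. P y)"
  have eq: "{z \<in> conic_family Y. real_of_int (height z) \<le> B} = ?e ` ?I"
  proof (intro Set.set_eqI iffI)
    fix z assume "z \<in> {z \<in> conic_family Y. real_of_int (height z) \<le> B}"
    then obtain j y x where z: "j < 3" "y \<in> Y" "x \<in> conic_sols y" "z = campana_point_of j y x" "real_of_int (height z) \<le> B"
      unfolding conic_family_def by blast
    then have "(j, y, x) \<in> ?I" using P by simp
    then show "z \<in> ?e ` ?I" using z(4) by (intro image_eqI[of _ _ "(j, y, x)"]) simp_all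
  next
    fix z assume "z \<in> ?e ` ?I"
    then obtain j y x where z: "j < 3" "y \<in> Y" "x \<in> P y" "z = campana_point_of j y x" by auto
    then show "z \<in> {z \<in> conic_family Y. real_of_int (height z) \<le> B}" using P[OF z(2,1)] unfolding conic_family_def by blast
  qed
  have inj: "inj_on ?e ?I"
  proof (rule inj_onI)
    fix a b assume "a \<in> ?I" "b \<in> ?I" and e: "?e a = ?e b"
    then obtain j y x j' y' x' where ab: "a = (j, y, x)" "b = (j', y', x')" "j < 3" "j' < 3" "y \<in> Y" "y' \<in> Y" "x \<in> P y" "x' \<in> P y'"
      by auto
    have "x \<in> conic_sols y" "x' \<in> conic_sols y'" using ab P by blast+
    then show "a = b" using campana_point_of_inject[OF Y(2)[OF ab(5)] _ ab(3) Y(2)[OF ab(6)] _ ab(4)] e unfolding ab(1,2) by simp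
  qed
  have "count_height (conic_family Y) B = card ?I" unfolding count_height_def eq by (rule card_image[OF inj])
  also have "\<dots> = 3 * (\<Sum>y\<in>Y. card (P y))" using Y(1) fin by (simp add: card_cartesian_product card_SigmaI)
  also have "(\<Sum>y\<in>Y. card (P y)) = (\<Sum>(y0, y1, y2)\<in>Y. card (conic_points y0 y1 y2 B))"
    unfolding P_def by (intro sum.cong) auto
  finally show ?thesis .
qed

lemma conic_family_density:
  assumes Y: "finite Y" "\<And>y. y \<in> Y \<Longrightarrow> good_triple y"
  shows "((\<lambda>B. real (count_height (conic_family Y) B) / sqrt B) \<longlongrightarrow> 3 * (\<Sum>(y0, y1, y2)\<in>Y. conic_constant y0 y1 y2)) at_top"
proof -
  have "((\<lambda>B. (\<Sum>(y0, y1, y2)\<in>Y. real (card (conic_points y0 y1 y2 B)) / sqrt B)) \<longlongrightarrow> (\<Sum>(y0, y1, y2)\<in>Y. conic_constant y0 y1 y2)) at_top"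
  proof (rule tendsto_sum)
    fix y assume y: "y \<in> Y"
    obtain y0 y1 y2 where t: "y = (y0, y1, y2)" by (metis prod_cases3)
    have "((\<lambda>B. real (card (conic_points y0 y1 y2 B)) / sqrt B) \<longlongrightarrow> conic_constant y0 y1 y2) at_top"
      by (rule conic_points_density(2)) (use Y(2)[OF y] in \<open>simp_all add: t good_triple_def\<close>)
    then show "((\<lambda>B. case y of (y0, y1, y2) \<Rightarrow> real (card (conic_points y0 y1 y2 B)) / sqrt B) \<longlongrightarrow>
        (case y of (y0, y1, y2) \<Rightarrow> conic_constant y0 y1 y2)) at_top" unfolding t by simp
  qed
  then have "((\<lambda>B. 3 * (\<Sum>(y0, y1, y2)\<in>Y. real (card (conic_points y0 y1 y2 B)) / sqrt B)) \<longlongrightarrow> 3 * (\<Sum>(y0, y1, y2)\<in>Y. conic_constant y0 y1 y2)) at_top"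
    by (intro tendsto_mult_left)
  moreover have "3 * (\<Sum>(y0, y1, y2)\<in>Y. real (card (conic_points y0 y1 y2 B)) / sqrt B) = real (count_height (conic_family Y) B) / sqrt B" for B
  proof -
    have "real (count_height (conic_family Y) B) = 3 * (\<Sum>(y0, y1, y2)\<in>Y. real (card (conic_points y0 y1 y2 B)))"
      using conic_family_count[OF Y, of B] by (simp add: case_prod_unfold)
    then show ?thesis by (simp add: sum_divide_distrib[symmetric] case_prod_unfold)
  qed
  ultimately show ?thesis by simp
qed

lemma campana_points_proj_space: "campana_points \<subseteq> proj_space 1"
proof
  fix z assume "z \<in> campana_points"
  then obtain z0 z1 where z: "z = P1_point (of_int z0) (of_int z1)" "squareful z0" unfolding campana_points_def by blast
  have "(\<lambda>i. if i = 0 then of_int z0 else if i = 1 then of_int z1 else 0) \<in> coord_vectors 1"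
    using z(2) unfolding coord_vectors_def squareful_def by (auto intro!: exI[of _ 0])
  then show "z \<in> proj_space 1" unfolding z(1) P1_point_def proj_space_def by (rule imageI)
qed

text \<open>Since y^3 x^2 = y (y x)^2, both coordinates of the point are constants times squares.
  For each orientation one squaring morphism, with coefficients read off from y, covers the whole
  conic.\<close>

lemma conic_family_basic_thin:
  assumes "good_triple y" "j < 3"
  obtains A where "basic_thin A" "\<And>x. x \<in> conic_sols y \<Longrightarrow> campana_point_of j y x \<in> A"
proof -
  note result = that
  obtain y0 y1 y2 where t: "y = (y0, y1, y2)" by (metis prod_cases3)
  have y: "y0 > 0" "y1 > 0" "y2 > 0" using assms(1) by (simp_all add: good_triple_def t)
  have cube: "(of_int (int n ^ 3 * x\<^sup>2) :: rat) = of_nat n * (of_nat n * of_int x)\<^sup>2" for n x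
    by (simp add: power3_eq_cube power2_eq_square mult_ac)
  have by_squares: thesis if ab: "a \<noteq> 0" "b \<noteq> 0" and sr: "\<And>x0 x1 x2. (x0, x1, x2) \<in> conic_sols y \<Longrightarrow> s x0 x1 x2 \<noteq> 0 \<and>
      of_int (fst (orient j (int y0 ^ 3 * x0\<^sup>2) (int y1 ^ 3 * x1\<^sup>2))) = a * (s x0 x1 x2)\<^sup>2 \<and>
      of_int (snd (orient j (int y0 ^ 3 * x0\<^sup>2) (int y1 ^ 3 * x1\<^sup>2))) = b * (r x0 x1 x2)\<^sup>2"
    for a b :: rat and s r :: "int \<Rightarrow> int \<Rightarrow> int \<Rightarrow> rat"
  proof -
    obtain A where A: "basic_thin A" "\<And>s t. s \<noteq> 0 \<Longrightarrow> P1_point (a * s\<^sup>2) (b * t\<^sup>2) \<in> A"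
      using basic_thin_squares[OF ab] by blast
    have "campana_point_of j y x \<in> A" if x: "x \<in> conic_sols y" for x
    proof -
      obtain x0 x1 x2 where tx: "x = (x0, x1, x2)" by (metis prod_cases3)
      note p = sr[OF x[unfolded tx]]
      show ?thesis unfolding t tx campana_point_of_def int_point_def prod.case
        using A(2)[of "s x0 x1 x2" "r x0 x1 x2"] p by metis
    qed
    then show thesis using result A(1) by blast
  qed
  have pos: "x0 > 0 \<and> x2 > 0 \<and> int y0 ^ 3 * x0\<^sup>2 + int y1 ^ 3 * x1\<^sup>2 = int y2 ^ 3 * x2\<^sup>2"
    if "(x0, x1, x2) \<in> conic_sols y" for x0 x1 x2 using that by (simp add: t conic_sols_def)
  consider "j = 0" | "j = 1" | "j = 2" using assms(2) by linarith
  then show thesis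
  proof cases
    case 1
    have o: "orient j z0 z1 = (z0, z1)" for z0 z1 by (simp add: 1 orient_def)
    show thesis
      by (rule by_squares[of "of_nat y0" "of_nat y1" "\<lambda>x0 x1 x2. of_nat y0 * of_int x0" "\<lambda>x0 x1 x2. of_nat y1 * of_int x1"],
          unfold o fst_conv snd_conv cube) (use y pos in fastforce)+
  next
    case 2
    have o: "orient j z0 z1 = (z0 + z1, - z1)" for z0 z1 by (simp add: 2 orient_def)
    show thesis
    proof (rule by_squares[of "of_nat y2" "- of_nat y1" "\<lambda>x0 x1 x2. of_nat y2 * of_int x2" "\<lambda>x0 x1 x2. of_nat y1 * of_int x1"])
      fix x0 x1 x2 assume "(x0, x1, x2) \<in> conic_sols y"
      note p = pos[OF this]
      have e: "int y0 ^ 3 * x0\<^sup>2 + int y1 ^ 3 * x1\<^sup>2 = int y2 ^ 3 * x2\<^sup>2" using p by simp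
      have "(of_nat y2 * of_int x2 :: rat) \<noteq> 0" using y p by simp
      then show "of_nat y2 * of_int x2 \<noteq> (0 :: rat) \<and>
          of_int (fst (orient j (int y0 ^ 3 * x0\<^sup>2) (int y1 ^ 3 * x1\<^sup>2))) = of_nat y2 * (of_nat y2 * of_int x2 :: rat)\<^sup>2 \<and>
          of_int (snd (orient j (int y0 ^ 3 * x0\<^sup>2) (int y1 ^ 3 * x1\<^sup>2))) = - of_nat y1 * (of_nat y1 * of_int x1 :: rat)\<^sup>2"
        unfolding o fst_conv snd_conv e of_int_minus cube mult_minus_left by blast
    qed (use y in simp_all)
  next
    case 3
    have o: "orient j z0 z1 = (- z0, z0 + z1)" for z0 z1 by (simp add: 3 orient_def)
    show thesis
    proof (rule by_squares[of "- of_nat y0" "of_nat y2" "\<lambda>x0 x1 x2. of_nat y0 * of_int x0" "\<lambda>x0 x1 x2. of_nat y2 * of_int x2"])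
      fix x0 x1 x2 assume "(x0, x1, x2) \<in> conic_sols y"
      note p = pos[OF this]
      have e: "int y0 ^ 3 * x0\<^sup>2 + int y1 ^ 3 * x1\<^sup>2 = int y2 ^ 3 * x2\<^sup>2" using p by simp
      have "(of_nat y0 * of_int x0 :: rat) \<noteq> 0" using y p by simp
      then show "of_nat y0 * of_int x0 \<noteq> (0 :: rat) \<and>
          of_int (fst (orient j (int y0 ^ 3 * x0\<^sup>2) (int y1 ^ 3 * x1\<^sup>2))) = - of_nat y0 * (of_nat y0 * of_int x0 :: rat)\<^sup>2 \<and>
          of_int (snd (orient j (int y0 ^ 3 * x0\<^sup>2) (int y1 ^ 3 * x1\<^sup>2))) = of_nat y2 * (of_nat y2 * of_int x2 :: rat)\<^sup>2"
        unfolding o fst_conv snd_conv e of_int_minus cube mult_minus_left by blast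
    qed (use y in simp_all)
  qed
qed

text \<open>One double cover for each conic and orientation, finitely many in all; thinness passes
  to subsets.\<close>

lemma subset_conic_family_campana_thin:
  assumes Y: "finite Y" "\<And>y. y \<in> Y \<Longrightarrow> good_triple y" and T: "T \<subseteq> conic_family Y"
  shows "campana_thin T"
proof -
  have "\<forall>y\<in>Y. \<forall>j<3. \<exists>A. basic_thin A \<and> (\<forall>x\<in>conic_sols y. campana_point_of j y x \<in> A)"
    using conic_family_basic_thin Y(2) by metis
  then obtain A where A: "\<And>y j. y \<in> Y \<Longrightarrow> j < (3::nat) \<Longrightarrow> basic_thin (A y j) \<and> (\<forall>x\<in>conic_sols y. campana_point_of j y x \<in> A y j)"
    by metis
  have TC: "T \<subseteq> campana_points" using T conic_family_campana[OF Y(2)] by blast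
  have "thin T" unfolding thin_def
  proof (intro conjI exI)
    show "T \<subseteq> proj_space 1" using TC campana_points_proj_space by blast
    show "finite ((\<lambda>(y, j). A y j) ` (Y \<times> {..<3}))" using Y(1) by simp
    show "\<forall>B\<in>(\<lambda>(y, j). A y j) ` (Y \<times> {..<3}). basic_thin B" using A by auto
    show "T \<subseteq> \<Union>((\<lambda>(y, j). A y j) ` (Y \<times> {..<3}))"
    proof
      fix z assume "z \<in> T"
      then obtain j y x where "j < 3" "y \<in> Y" "x \<in> conic_sols y" "z = campana_point_of j y x"
        using T unfolding conic_family_def by blast
      then show "z \<in> \<Union>((\<lambda>(y, j). A y j) ` (Y \<times> {..<3}))" using A by (intro UnionI[of "A y j"]) auto
    qed
  qed
  then show ?thesis unfolding campana_thin_def using TC by blast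
qed

section \<open>Choice of the removed set\<close>

lemma c_BV_approx:
  assumes c: "c_BV > 0" and e: "e > 0"
  obtains Y where "finite Y" "\<And>y. y \<in> Y \<Longrightarrow> good_triple y" "(\<Sum>(y0, y1, y2)\<in>Y. conic_constant y0 y1 y2) > c_BV - e"
proof -
  define f where "f = (\<lambda>(y0, y1, y2). real_of_int ((Defs.moebius (y0 * y1 * y2))\<^sup>2) * gamma_fac (y0 * y1 * y2) /
       real (y0 * y1 * y2) powr (3 / 2) * sigma2 y0 y1 y2 * real_of_int (rho y0 y1 y2))"
  let ?S = "{1..} \<times> {1..} \<times> {1..} :: (nat \<times> nat \<times> nat) set"
  have cf: "c_BV = 1 / pi * infsum f ?S" unfolding c_BV_def f_def ..
  \<comment> \<open>On a family that is not summable \<open>infsum\<close> is 0 by default, which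
    c_BV > 0 excludes.\<close>
  have "f summable_on ?S"
  proof (rule ccontr)
    assume "\<not> f summable_on ?S"
    then show False using c unfolding cf by (simp add: infsum_not_exists)
  qed
  then have "(sum f \<longlongrightarrow> infsum f ?S) (finite_subsets_at_top ?S)"
    using has_sum_infsum unfolding has_sum_def by blast
  moreover have "infsum f ?S - pi * e < infsum f ?S" using e by simp
  ultimately have "eventually (\<lambda>F. infsum f ?S - pi * e < sum f F) (finite_subsets_at_top ?S)"
    by (rule order_tendstoD(1))
  then obtain F where F: "finite F" "F \<subseteq> ?S" "infsum f ?S - pi * e < sum f F"
    unfolding eventually_finite_subsets_at_top by blast
  \<comment> \<open>The remaining triples of F contribute 0, because \<mu> vanishes on their
    products.\<close>
  define Y where "Y = {y \<in> F. good_triple y}"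
  have "sum f F = (\<Sum>y\<in>Y. pi * (case y of (y0, y1, y2) \<Rightarrow> conic_constant y0 y1 y2))"
  proof (rule sum.mono_neutral_cong_right[OF F(1)])
    show "Y \<subseteq> F" by (auto simp: Y_def)
    show "\<forall>y\<in>F - Y. f y = 0"
    proof
      fix y assume y: "y \<in> F - Y"
      obtain y0 y1 y2 where t: "y = (y0, y1, y2)" by (metis prod_cases3)
      have "y0 > 0" "y1 > 0" "y2 > 0" using y F(2) unfolding t by auto
      then have "Defs.moebius (y0 * y1 * y2) = 0" using y unfolding t Y_def good_triple_def Defs.moebius_def by simp
      then show "f y = 0" by (simp add: f_def t)
    qed
    fix y assume "y \<in> Y"
    then have g: "good_triple y" by (simp add: Y_def)
    obtain y0 y1 y2 where t: "y = (y0, y1, y2)" by (metis prod_cases3)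
    have m: "(Defs.moebius (y0 * y1 * y2))\<^sup>2 = 1"
      using g by (simp add: t good_triple_def Defs.moebius_def power_mult[symmetric] mult.commute[of _ 2] power_mult)
    then show "f y = pi * (case y of (y0, y1, y2) \<Rightarrow> conic_constant y0 y1 y2)" unfolding t f_def conic_constant_def prod.case m by simp
  qed
  then have "sum f F = pi * (\<Sum>(y0, y1, y2)\<in>Y. conic_constant y0 y1 y2)" by (simp only: sum_distrib_left)
  moreover have "pi * (c_BV - e) = infsum f ?S - pi * e" unfolding cf right_diff_distrib by simp
  ultimately have "pi * (c_BV - e) < pi * (\<Sum>(y0, y1, y2)\<in>Y. conic_constant y0 y1 y2)" using F(3) by (simp only:)
  then have "(\<Sum>(y0, y1, y2)\<in>Y. conic_constant y0 y1 y2) > c_BV - e"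
    unfolding mult_less_cancel_left_pos[OF pi_gt_zero] .
  moreover have "finite Y" "\<And>y. y \<in> Y \<Longrightarrow> good_triple y" using F(1) by (simp_all add: Y_def)
  ultimately show thesis using that by blast
qed

lemma height_campana_nonneg: "z \<in> campana_points \<Longrightarrow> height z \<ge> 0"
  unfolding campana_points_def by (auto simp: height_int_point[unfolded int_point_def])

text \<open>Heights are integers, so the counts at B are those at the integer part of B. There the
  count of T is a floor, an error below 1 that is negligible against sqrt B.\<close>

lemma thinning_density:
  assumes U: "U \<subseteq> campana_points" and lim: "((\<lambda>B. real (count_height U B) / sqrt B) \<longlongrightarrow> d) at_top"
    and \<theta>: "0 \<le> \<theta>" "\<theta> \<le> 1"
  obtains T where "T \<subseteq> U" "((\<lambda>B. real (count_height T B) / sqrt B) \<longlongrightarrow> \<theta> * d) at_top"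
proof -
  have fin: "finite {z \<in> U. height z \<le> int n}" for n
    by (rule finite_subset[OF _ finite_campana_height[of "real n"]]) (use U in auto)
  obtain T where T: "T \<subseteq> U" "\<And>n. int (card {z \<in> T. height z \<le> int n}) = \<lfloor>\<theta> * real (card {z \<in> U. height z \<le> int n})\<rfloor>"
    using thinning[OF fin _ \<theta>] height_campana_nonneg U by blast
  have lev: "count_height S B = card {z \<in> S. height z \<le> int (nat \<lfloor>B\<rfloor>)}" if "B \<ge> 0" for S B
    unfolding count_height_def using that by (simp add: le_floor_iff)
  have fl: "real (count_height T B) = real_of_int \<lfloor>\<theta> * real (count_height U B)\<rfloor>" if "B \<ge> 0" for B
    using T(2)[of "nat \<lfloor>B\<rfloor>"] unfolding lev[OF that] by linarith
  have up: "((\<lambda>B. \<theta> * (real (count_height U B) / sqrt B)) \<longlongrightarrow> \<theta> * d) at_top"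
    by (intro tendsto_mult_left lim)
  have "((\<lambda>B. 1 / sqrt B) \<longlongrightarrow> 0) at_top" 
    by (intro tendsto_divide_0[OF tendsto_const] filterlim_at_top_imp_at_infinity sqrt_at_top)
  then have lo: "((\<lambda>B. \<theta> * (real (count_height U B) / sqrt B) - 1 / sqrt B) \<longlongrightarrow> \<theta> * d) at_top"
    using tendsto_diff[OF up] by fastforce
  have "((\<lambda>B. real (count_height T B) / sqrt B) \<longlongrightarrow> \<theta> * d) at_top"
  proof (rule tendsto_sandwich[OF _ _ lo up])
    show "eventually (\<lambda>B. \<theta> * (real (count_height U B) / sqrt B) - 1 / sqrt B \<le> real (count_height T B) / sqrt B) at_top"
      using eventually_gt_at_top[of 0]
    proof eventually_elim
      case (elim B)
      have "\<theta> * real (count_height U B) - 1 \<le> real (count_height T B)" using fl[of B] elim by linarith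
      then have "(\<theta> * real (count_height U B) - 1) / sqrt B \<le> real (count_height T B) / sqrt B"
        using elim by (intro divide_right_mono) simp_all
      then show ?case by (simp add: diff_divide_distrib)
    qed
    show "eventually (\<lambda>B. real (count_height T B) / sqrt B \<le> \<theta> * (real (count_height U B) / sqrt B)) at_top"
      using eventually_gt_at_top[of 0]
    proof eventually_elim
      case (elim B)
      have "real (count_height T B) \<le> \<theta> * real (count_height U B)" using fl[of B] elim by linarith
      then have "real (count_height T B) / sqrt B \<le> \<theta> * real (count_height U B) / sqrt B"
        using elim by (intro divide_right_mono) simp_all
      then show ?case by simp
    qed
  qed
  then show thesis using that T(1) by blast
qed

theorem theorem1p3:
  fixes l :: real
  assumes count_asymp: "(\<lambda>B::real. real (count_height campana_points B))
      \<sim>[at_top] (\<lambda>B. 3 * c_BV * B powr (1 / 2))"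
    and l: "l \<in> {0<..3 * c_BV}"
  shows "\<exists>T \<subseteq> campana_points. campana_thin T \<and>
    (\<lambda>B::real. real (count_height (campana_points - T) B))
      \<sim>[at_top] (\<lambda>B. l * B powr (1 / 2))"
proof -
  have l0: "l > 0" "l \<le> 3 * c_BV" using l by simp_all
  then have c0: "c_BV > 0" by simp
  \<comment> \<open>With the tolerance l / 3, three times the partial sum exceeds 3 c_BV -
    l.\<close>
  obtain Y where Y: "finite Y" "\<And>y. y \<in> Y \<Longrightarrow> good_triple y" "(\<Sum>(y0, y1, y2)\<in>Y. conic_constant y0 y1 y2) > c_BV - l / 3"
    using c_BV_approx[OF c0, of "l / 3"] l0 by auto
  define d where "d = 3 * (\<Sum>(y0, y1, y2)\<in>Y. conic_constant y0 y1 y2)"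
  have d: "d > 3 * c_BV - l" "d > 0" using Y(3) l0 unfolding d_def by linarith+
  \<comment> \<open>The share (3 c_BV - l) / d of the family is to be removed; it lies in [0, 1]
    because d > 3 c_BV - l \<ge> 0.\<close>
  obtain T where T: "T \<subseteq> conic_family Y"
      "((\<lambda>B. real (count_height T B) / sqrt B) \<longlongrightarrow> (3 * c_BV - l) / d * d) at_top"
    by (rule thinning_density[OF conic_family_campana[OF Y(2)] conic_family_density[OF Y(1,2), folded d_def],
        of "(3 * c_BV - l) / d"]) (use d l0 in auto)
  have TC: "T \<subseteq> campana_points" using T(1) conic_family_campana[OF Y(2)] by blast
  have "((\<lambda>B. real (count_height campana_points B) / (3 * c_BV * B powr (1 / 2))) \<longlongrightarrow> 1) at_top"
  proof (rule asymp_equivD_strong[OF count_asymp])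
    show "eventually (\<lambda>B. real (count_height campana_points B) \<noteq> 0 \<or> 3 * c_BV * B powr (1 / 2) \<noteq> 0) at_top"
      using eventually_gt_at_top[of 0] by eventually_elim (use c0 in simp)
  qed
  from tendsto_mult_right[OF this, of "3 * c_BV"]
  have "((\<lambda>B. real (count_height campana_points B) / (3 * c_BV * B powr (1 / 2)) * (3 * c_BV)) \<longlongrightarrow> 3 * c_BV) at_top"
    by simp
  then have C: "((\<lambda>B. real (count_height campana_points B) / sqrt B) \<longlongrightarrow> 3 * c_BV) at_top"
  proof (rule Lim_transform_eventually)
    show "eventually (\<lambda>B. real (count_height campana_points B) / (3 * c_BV * B powr (1 / 2)) * (3 * c_BV) =
        real (count_height campana_points B) / sqrt B) at_top"
      using eventually_gt_at_top[of 0] by eventually_elim (use c0 in \<open>simp add: powr_half_sqrt\<close>)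
  qed
  have diff: "real (count_height (campana_points - T) B) = real (count_height campana_points B) - real (count_height T B)" for B
  proof -
    have sub: "{z \<in> T. real_of_int (height z) \<le> B} \<subseteq> {z \<in> campana_points. real_of_int (height z) \<le> B}" using TC by blast
    have "{z \<in> campana_points - T. real_of_int (height z) \<le> B} =
        {z \<in> campana_points. real_of_int (height z) \<le> B} - {z \<in> T. real_of_int (height z) \<le> B}" by blast
    then show ?thesis unfolding count_height_def
      using card_Diff_subset[OF finite_subset[OF sub finite_campana_height] sub] card_mono[OF finite_campana_height sub]
      by (simp add: of_nat_diff)
  qed
  have "((\<lambda>B. real (count_height campana_points B) / sqrt B - real (count_height T B) / sqrt B) \<longlongrightarrow> 3 * c_BV - (3 * c_BV - l) / d * d) at_top"
    by (rule tendsto_diff[OF C T(2)])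
  moreover have "3 * c_BV - (3 * c_BV - l) / d * d = l" using d(2) nonzero_divide_eq_eq[of d] by simp
  ultimately have "((\<lambda>B. real (count_height (campana_points - T) B) / sqrt B) \<longlongrightarrow> l) at_top"
    by (simp only: diff diff_divide_distrib)
  then have "((\<lambda>B. real (count_height (campana_points - T) B) / sqrt B / l) \<longlongrightarrow> l / l) at_top"
    by (intro tendsto_divide) (use l0 in auto)
  then have "((\<lambda>B. real (count_height (campana_points - T) B) / sqrt B / l) \<longlongrightarrow> 1) at_top"
    using l0 by simp
  then have "((\<lambda>B. real (count_height (campana_points - T) B) / (l * B powr (1 / 2))) \<longlongrightarrow> 1) at_top"
  proof (rule Lim_transform_eventually)
    show "eventually (\<lambda>B. real (count_height (campana_points - T) B) / sqrt B / l =
        real (count_height (campana_points - T) B) / (l * B powr (1 / 2))) at_top"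
      using eventually_gt_at_top[of 0] by eventually_elim (simp add: powr_half_sqrt mult.commute)
  qed
  then have "(\<lambda>B. real (count_height (campana_points - T) B)) \<sim>[at_top] (\<lambda>B. l * B powr (1 / 2))"
    by (rule asymp_equivI')
  then show ?thesis using TC subset_conic_family_campana_thin[OF Y(1,2) T(1)] by blast
qed

end
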